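(* There exists $\nu^\star>0$ independent of $h$ such that, for all $0<h<h_{\mathcal A}$ and all $u\in H^{1/2}(\Gamma)$, $$J_h''(u)v_h^2\ge\nu^\star\Vert v_h\Vert^2_{H^{1/2}(\Gamma)}\qquad\forall v_h\in U_h .$$
   Context: Geometry and spaces. $\Omega\subset\mathbb R^2$ is a bounded domain with polygonal boundary $\Gamma$ having $m$ sides and vertices $S_1,\dots,S_m$; $S=\{S_1,\dots,S_m\}$, $r_j=|x-S_j|$. $(\cdot,\cdot)_\Omega$, $(\cdot,\cdot)_\Gamma$ are $L^2$ inner products. $H^{1/2}(\Gamma)$ has the norm $\Vert u\Vert_{H^{1/2}(\Gamma)}=\inf\{\Vert z\Vert_{H^1(\Omega)}: z\in H^1(\Omega),\ z=u\text{ on }\Gamma\}$. Coefficients. $A:\bar\Omega\to\mathbb R^{2\times2}$, $b:\bar\Omega\to\mathbb R^2$, $a_0:\bar\Omega\to\mathbb R$ are infinitely differentiable on $\bar\Omega\setminus S$, and there is $\delta>0$ such that near each vertex $S_j$ and for every multi-index $\alpha$: $|D^\alpha(A(x)-A(S_j))|\le c_\alpha r_j^{\delta-|\alpha|}$, $|D^\alpha b(x)|\le c_\alpha r_j^{\delta-1-|\alpha|}$, $|D^\alpha a_0(x)|\le c_\alpha r_j^{\delta-2-|\alpha|}$. Moreover $A=A^T$, there is $\Lambda>0$ with $\xi\cdot A(x)\xi\ge\Lambda|\xi|^2$ for all $\xi\in\mathbb R^2$ and a.a. $x\in\Omega$, and $a_0\ge0$ a.e. The bilinear form is $\mathfrak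 a(y,z)=\int_\Omega (A\nabla y)\cdot\nabla z\,dx+\int_\Omega(b\cdot\nabla y)z\,dx+\int_\Omega a_0yz\,dx$ for $y,z\in H^1(\Omega)$; no coercivity of $\mathfrak a$ is assumed. Discretization. $\{\mathcal K_h\}$ is a family of conforming, shape-regular triangulations of $\Omega$ with mesh size parameter $h$, graded with parameters $\mu_j\in(0,1]$, $j=1,\dots,m$: there are radii $0<R_j\le 1$ such that, with $h_T$ the diameter of $T\in\mathcal K_h$ and $r_{T,j}$ the distance from $T$ to $S_j$, one has (with constants independent of $h$) $h_T\sim h^{1/\mu_j}$ if $r_{T,j}=0$, $h_T\sim h\,r_{T,j}^{1-\mu_j}$ if $0<r_{T,j}\le R_j$, and $h_T\sim h$ if $r_{T,j}>R_j$ for all $j$. $Y_h\subset H^1(\Omega)\cap C(\bar\Omega)$ is the space of continuous piecewise linear functions on $\mathcal K_h$, $Y_{0,h}=Y_h\cap H^1_0(\Omega)$, $U_h$ is the space of traces of $Y_h$ on $\Gamma$. The harmonic extension $\mathcal Hu\in H^1(\Omega)$ of $u\in H^{1/2}(\Gamma)$ satisfies $(\nabla\mathcal Hu,\nabla\zeta)_\Omega=0$ for all $\zeta\in H^1_0(\Omega)$, $\mathcal Hu=u$ on $\Gamma$. $\mathcal Q_h:H^{1/2}(\Gamma)\to U_h$ is the projection defined by $\mathfrak p(\mathcal Q_hu,v_h)=\mathfrak p(u,v_h)$ for all $v_h\in U_h$, where $\mathfrak p(u,v)=(u,v)_\Gamma+(\nabla\mathcal Hu,\nabla\mathcal Hv)_\Omega$.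 The discrete harmonic extension $\mathcal H_hu\in Y_h$ satisfies $(\nabla\mathcal H_hu,\nabla\zeta_h)_\Omega=0$ for all $\zeta_h\in Y_{0,h}$, $\mathcal H_hu=\mathcal Q_hu$ on $\Gamma$. $h_{\mathcal A}>0$ is a threshold (whose existence is known) such that for all $0<h<h_{\mathcal A}$ and every $f\in H^{-1}(\Omega)$ there is a unique $\eta_h\in Y_{0,h}$ with $\mathfrak a(\eta_h,\zeta_h)=\langle f,\zeta_h\rangle$ for all $\zeta_h\in Y_{0,h}$, and $\Vert\eta_h\Vert_{H^1_0(\Omega)}\le c_{\mathcal A}\Vert f\Vert_{H^{-1}(\Omega)}$ with $c_{\mathcal A}$ independent of $h$. For $0<h<h_{\mathcal A}$ and $u\in H^{1/2}(\Gamma)$, $y_h(u)\in Y_h$ is the unique solution of $\mathfrak a(y_h(u),\zeta_h)=0$ for all $\zeta_h\in Y_{0,h}$, $y_h(u)=\mathcal Q_hu$ on $\Gamma$. Functional. For fixed $y_d\in L^2(\Omega)$, $u_d\in H^{1/2}(\Gamma)$, $\kappa>0$, $J_h:H^{1/2}(\Gamma)\to\mathbb R$ is $J_h(u)=\frac12\Vert y_h(u)-y_d\Vert^2_{L^2(\Omega)}+\frac\kappa2\Vert\nabla\mathcal H_h(u-u_d)\Vert^2_{L^2(\Omega)}$. $J_h''(u)v^2$ denotes the second derivative of $J_h$ at $u$ applied to $(v,v)$. *)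

theory Defs
  imports "HOL-Analysis.Analysis"
begin

type_synonym pt = "real^2"
type_synonym scal = "real^2 \<Rightarrow> real"
type_synonym vec2 = "real^2 \<Rightarrow> real^2"

section \<open>Polygonal domains\<close>

text \<open>
  The vertices are S_1, ..., S_m; the side with initial vertex S_j ends at S_(nxt j). The cycles of
  nxt are the connected components of the boundary, so that multiply connected polygons are
  included (a single cycle gives a simple closed polygon).
\<close>

record polygon =
  nvert :: nat
  vertex :: "nat \<Rightarrow> pt"
  nxt :: "nat \<Rightarrow> nat"

definition vertices :: "polygon \<Rightarrow> pt set" where
  "vertices P = vertex P ` {1..nvert P}"

definition side :: "polygon \<Rightarrow> nat \<Rightarrow> pt set" where
  "side P j = closed_segment (vertex P j) (vertex P (nxt P j))"

definition bdry :: "polygon \<Rightarrow> pt set" where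
  "bdry P = (\<Union>j\<in>{1..nvert P}. side P j)"

definition polygonal_domain :: "pt set \<Rightarrow> polygon \<Rightarrow> bool" where
  "polygonal_domain \<Omega> P \<longleftrightarrow>
     open \<Omega> \<and> connected \<Omega> \<and> bounded \<Omega> \<and> \<Omega> \<noteq> {} \<and>
     inj_on (vertex P) {1..nvert P} \<and>
     bij_betw (nxt P) {1..nvert P} {1..nvert P} \<and>
     (\<forall>j\<in>{1..nvert P}. nxt P j \<noteq> j) \<and>
     (\<forall>j\<in>{1..nvert P}. \<forall>k\<in>{1..nvert P}. j \<noteq> k \<longrightarrow>
        side P j \<inter> side P k =
          {vertex P j, vertex P (nxt P j)} \<inter> {vertex P k, vertex P (nxt P k)}) \<and>
     frontier \<Omega> = bdry P"

text \<open>Arc length on the boundary: the image, under affine parametrisation of the sides over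
  [0,1], of Lebesgue measure weighted with the side lengths.\<close>

definition arclength :: "polygon \<Rightarrow> pt measure" where
  "arclength P =
     distr
       (density (count_space {1..nvert P} \<Otimes>\<^sub>M restrict_space lborel {0..1})
          (\<lambda>(j, t). ennreal (dist (vertex P j) (vertex P (nxt P j)))))
       (restrict_space borel (bdry P))
       (\<lambda>(j, t). vertex P j + t *\<^sub>R (vertex P (nxt P j) - vertex P j))"

section \<open>Sobolev spaces\<close>

text \<open>
  Elements of function spaces are represented by functions on the whole plane; only the
  almost-everywhere class on the domain (or on the boundary) matters.
\<close>

definition L2 :: "pt measure \<Rightarrow> scal set" where
  "L2 M = {f. f \<in> borel_measurable M \<and> integrable M (\<lambda>x. (f x)\<^sup>2)}"

definition L2_inner :: "pt measure \<Rightarrow> scal \<Rightarrow> scal \<Rightarrow> real" where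
  "L2_inner M f g = (LINT x|M. f x * g x)"

definition L2_nrm :: "pt measure \<Rightarrow> scal \<Rightarrow> real" where
  "L2_nrm M f = sqrt (L2_inner M f f)"

definition L2v_inner :: "pt measure \<Rightarrow> vec2 \<Rightarrow> vec2 \<Rightarrow> real" where
  "L2v_inner M f g = (LINT x|M. f x \<bullet> g x)"

definition L2v_nrm :: "pt measure \<Rightarrow> vec2 \<Rightarrow> real" where
  "L2v_nrm M f = sqrt (L2v_inner M f f)"

text \<open>D i j plays the role of the partial derivative of order i in the first and j in the second
  variable of D 0 0. As the condition is imposed for all i and j, it says that D 0 0 is infinitely
  differentiable on the open set U.\<close>

definition deriv_family :: "pt set \<Rightarrow> (nat \<Rightarrow> nat \<Rightarrow> scal) \<Rightarrow> bool" where
  "deriv_family U D \<longleftrightarrow>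
     (\<forall>i j. \<forall>x\<in>U. (D i j has_derivative
        (\<lambda>v. D (Suc i) j x * v $ 1 + D i (Suc j) x * v $ 2)) (at x))"

definition test_family :: "pt set \<Rightarrow> (nat \<Rightarrow> nat \<Rightarrow> scal) \<Rightarrow> bool" where
  "test_family \<Omega> D \<longleftrightarrow>
     deriv_family UNIV D \<and> compact (closure {x. D 0 0 x \<noteq> 0}) \<and> closure {x. D 0 0 x \<noteq> 0} \<subseteq> \<Omega>"

definition has_weak_grad :: "pt set \<Rightarrow> scal \<Rightarrow> vec2 \<Rightarrow> bool" where
  "has_weak_grad \<Omega> z g \<longleftrightarrow>
     (\<forall>i. (\<lambda>x. g x $ i) \<in> L2 (lebesgue_on \<Omega>)) \<and>
     (\<forall>D. test_family \<Omega> D \<longrightarrow>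
        (LINT x|lebesgue_on \<Omega>. z x * D 1 0 x) = - (LINT x|lebesgue_on \<Omega>. g x $ 1 * D 0 0 x) \<and>
        (LINT x|lebesgue_on \<Omega>. z x * D 0 1 x) = - (LINT x|lebesgue_on \<Omega>. g x $ 2 * D 0 0 x))"

definition H1 :: "pt set \<Rightarrow> scal set" where
  "H1 \<Omega> = {z \<in> L2 (lebesgue_on \<Omega>). \<exists>g. has_weak_grad \<Omega> z g}"

definition grad :: "pt set \<Rightarrow> scal \<Rightarrow> vec2" where
  "grad \<Omega> z = (SOME g. has_weak_grad \<Omega> z g)"

definition H1_nrm :: "pt set \<Rightarrow> scal \<Rightarrow> real" where
  "H1_nrm \<Omega> z =
     sqrt ((L2_nrm (lebesgue_on \<Omega>) z)\<^sup>2 + (L2v_nrm (lebesgue_on \<Omega>) (grad \<Omega> z))\<^sup>2)"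

text \<open>The trace operator is the continuous extension, from H1 to L2 of the boundary, of the
  restriction map on the H1 functions that are continuous up to the boundary.\<close>

definition has_trace :: "pt set \<Rightarrow> polygon \<Rightarrow> scal \<Rightarrow> scal \<Rightarrow> bool" where
  "has_trace \<Omega> P z u \<longleftrightarrow>
     z \<in> H1 \<Omega> \<and> u \<in> L2 (arclength P) \<and>
     (\<exists>\<phi>. (\<forall>n. \<phi> n \<in> H1 \<Omega> \<and> continuous_on (closure \<Omega>) (\<phi> n)) \<and>
          (\<lambda>n. H1_nrm \<Omega> (\<lambda>x. \<phi> n x - z x)) \<longlonglongrightarrow> 0 \<and>
          (\<lambda>n::nat. L2_nrm (arclength P) (\<lambda>x. \<phi> n x - u x)) \<longlonglongrightarrow> 0)"

text \<open>H10 is the kernel of the trace operator; it carries the H1 norm.\<close>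

definition H10 :: "pt set \<Rightarrow> polygon \<Rightarrow> scal set" where
  "H10 \<Omega> P = {z \<in> H1 \<Omega>. has_trace \<Omega> P z (\<lambda>_. 0)}"

definition Hhalf :: "pt set \<Rightarrow> polygon \<Rightarrow> scal set" where
  "Hhalf \<Omega> P = {u. \<exists>z\<in>H1 \<Omega>. has_trace \<Omega> P z u}"

definition Hhalf_nrm :: "pt set \<Rightarrow> polygon \<Rightarrow> scal \<Rightarrow> real" where
  "Hhalf_nrm \<Omega> P u = Inf {H1_nrm \<Omega> z | z. z \<in> H1 \<Omega> \<and> has_trace \<Omega> P z u}"

text \<open>Bounded linear functionals on a space V of functions with a (semi)norm N.\<close>

definition dual :: "scal set \<Rightarrow> (scal \<Rightarrow> real) \<Rightarrow> (scal \<Rightarrow> real) set" where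
  "dual V N = {f.
     (\<forall>v\<in>V. \<forall>w\<in>V. f (\<lambda>x. v x + w x) = f v + f w) \<and>
     (\<forall>c. \<forall>v\<in>V. f (\<lambda>x. c * v x) = c * f v) \<and>
     (\<exists>C. \<forall>v\<in>V. \<bar>f v\<bar> \<le> C * N v)}"

definition dual_nrm :: "scal set \<Rightarrow> (scal \<Rightarrow> real) \<Rightarrow> (scal \<Rightarrow> real) \<Rightarrow> real" where
  "dual_nrm V N f = Sup {\<bar>f v\<bar> | v. v \<in> V \<and> N v \<le> 1}"

definition Hm1 :: "pt set \<Rightarrow> polygon \<Rightarrow> (scal \<Rightarrow> real) set" where
  "Hm1 \<Omega> P = dual (H10 \<Omega> P) (H1_nrm \<Omega>)"

definition Hm1_nrm :: "pt set \<Rightarrow> polygon \<Rightarrow> (scal \<Rightarrow> real) \<Rightarrow> real" where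
  "Hm1_nrm \<Omega> P = dual_nrm (H10 \<Omega> P) (H1_nrm \<Omega>)"

section \<open>Coefficients and bilinear form\<close>

text \<open>D is the family of partial derivatives of f, each of them extended continuously up to the
  boundary except at the vertices.\<close>

definition smooth_off_vertices ::
  "pt set \<Rightarrow> polygon \<Rightarrow> scal \<Rightarrow> (nat \<Rightarrow> nat \<Rightarrow> scal) \<Rightarrow> bool" where
  "smooth_off_vertices \<Omega> P f D \<longleftrightarrow>
     deriv_family \<Omega> D \<and>
     (\<forall>i j. continuous_on (closure \<Omega> - vertices P) (D i j)) \<and>
     (\<forall>x\<in>closure \<Omega> - vertices P. D 0 0 x = f x)"

definition vertex_bound :: "pt set \<Rightarrow> polygon \<Rightarrow> nat \<Rightarrow> real \<Rightarrow> scal \<Rightarrow> bool" where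
  "vertex_bound \<Omega> P k s f \<longleftrightarrow>
     (\<exists>D. smooth_off_vertices \<Omega> P f D \<and>
        (\<exists>\<rho>>0. \<forall>i j. \<exists>c. \<forall>x\<in>closure \<Omega> - vertices P. dist x (vertex P k) < \<rho> \<longrightarrow>
           \<bar>D i j x\<bar> \<le> c * dist x (vertex P k) powr (s - real (i + j))))"

definition admissible_coefficients ::
  "pt set \<Rightarrow> polygon \<Rightarrow> (pt \<Rightarrow> real^2^2) \<Rightarrow> vec2 \<Rightarrow> scal \<Rightarrow> bool" where
  "admissible_coefficients \<Omega> P A b a0 \<longleftrightarrow>
     (\<forall>p q. \<exists>D. smooth_off_vertices \<Omega> P (\<lambda>x. A x $ p $ q) D) \<and>
     (\<forall>p. \<exists>D. smooth_off_vertices \<Omega> P (\<lambda>x. b x $ p) D) \<and>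
     (\<exists>D. smooth_off_vertices \<Omega> P a0 D) \<and>
     (\<exists>\<delta>>0. \<forall>k\<in>{1..nvert P}.
        (\<forall>p q. vertex_bound \<Omega> P k \<delta> (\<lambda>x. A x $ p $ q - A (vertex P k) $ p $ q)) \<and>
        (\<forall>p. vertex_bound \<Omega> P k (\<delta> - 1) (\<lambda>x. b x $ p)) \<and>
        vertex_bound \<Omega> P k (\<delta> - 2) a0) \<and>
     (\<forall>x\<in>closure \<Omega>. transpose (A x) = A x) \<and>
     (\<exists>\<Lambda>>0. AE x in lebesgue_on \<Omega>. \<forall>\<xi>. \<xi> \<bullet> (A x *v \<xi>) \<ge> \<Lambda> * (norm \<xi>)\<^sup>2) \<and>
     (AE x in lebesgue_on \<Omega>. a0 x \<ge> 0)"

definition aform ::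
  "pt set \<Rightarrow> (pt \<Rightarrow> real^2^2) \<Rightarrow> vec2 \<Rightarrow> scal \<Rightarrow> scal \<Rightarrow> scal \<Rightarrow> real" where
  "aform \<Omega> A b a0 y z =
     (LINT x|lebesgue_on \<Omega>. (A x *v grad \<Omega> y x) \<bullet> grad \<Omega> z x) +
     (LINT x|lebesgue_on \<Omega>. (b x \<bullet> grad \<Omega> y x) * z x) +
     (LINT x|lebesgue_on \<Omega>. a0 x * y x * z x)"

section \<open>Triangulations and finite elements\<close>

definition triangulates :: "pt set \<Rightarrow> pt set set \<Rightarrow> bool" where
  "triangulates \<Omega> K \<longleftrightarrow> triangulation K \<and> (\<forall>T\<in>K. 2 simplex T) \<and> \<Union>K = closure \<Omega>"

text \<open>A family of meshes is indexed by a set of positive mesh size parameters.\<close>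

definition shape_regular :: "real set \<Rightarrow> (real \<Rightarrow> pt set set) \<Rightarrow> bool" where
  "shape_regular Hs K \<longleftrightarrow>
     (\<exists>c>0. \<forall>h\<in>Hs. \<forall>T\<in>K h. \<exists>x. cball x (c * diameter T) \<subseteq> T)"

definition graded ::
  "polygon \<Rightarrow> (nat \<Rightarrow> real) \<Rightarrow> real set \<Rightarrow> (real \<Rightarrow> pt set set) \<Rightarrow> bool" where
  "graded P \<mu> Hs K \<longleftrightarrow>
     (\<exists>R. (\<forall>j\<in>{1..nvert P}. 0 < R j \<and> R j \<le> 1) \<and>
       (\<exists>c1>0. \<exists>c2>0. \<forall>h\<in>Hs. \<forall>T\<in>K h.
          (\<forall>j\<in>{1..nvert P}. infdist (vertex P j) T = 0 \<longrightarrow>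
             c1 * h powr (1 / \<mu> j) \<le> diameter T \<and> diameter T \<le> c2 * h powr (1 / \<mu> j)) \<and>
          (\<forall>j\<in>{1..nvert P}. 0 < infdist (vertex P j) T \<and> infdist (vertex P j) T \<le> R j \<longrightarrow>
             c1 * (h * infdist (vertex P j) T powr (1 - \<mu> j)) \<le> diameter T \<and>
             diameter T \<le> c2 * (h * infdist (vertex P j) T powr (1 - \<mu> j))) \<and>
          ((\<forall>j\<in>{1..nvert P}. infdist (vertex P j) T > R j) \<longrightarrow>
             c1 * h \<le> diameter T \<and> diameter T \<le> c2 * h)))"

definition graded_mesh_family ::
  "pt set \<Rightarrow> polygon \<Rightarrow> (nat \<Rightarrow> real) \<Rightarrow> real set \<Rightarrow> (real \<Rightarrow> pt set set) \<Rightarrow> bool" where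
  "graded_mesh_family \<Omega> P \<mu> Hs K \<longleftrightarrow>
     Hs \<subseteq> {0<..} \<and> (\<forall>h\<in>Hs. triangulates \<Omega> (K h)) \<and> shape_regular Hs K \<and>
     (\<forall>j\<in>{1..nvert P}. 0 < \<mu> j \<and> \<mu> j \<le> 1) \<and> graded P \<mu> Hs K"

definition Yh :: "pt set \<Rightarrow> pt set set \<Rightarrow> scal set" where
  "Yh \<Omega> K = {y \<in> H1 \<Omega>. continuous_on (closure \<Omega>) y \<and>
     (\<forall>T\<in>K. \<exists>g c. \<forall>x\<in>T. y x = g \<bullet> x + c)}"

definition Y0h :: "pt set \<Rightarrow> polygon \<Rightarrow> pt set set \<Rightarrow> scal set" where
  "Y0h \<Omega> P K = Yh \<Omega> K \<inter> H10 \<Omega> P"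

definition Uh :: "pt set \<Rightarrow> polygon \<Rightarrow> pt set set \<Rightarrow> scal set" where
  "Uh \<Omega> P K = {u. \<exists>y\<in>Yh \<Omega> K. has_trace \<Omega> P y u}"

text \<open>The objects chosen by SOME below are unique up to almost-everywhere equality, and all later
  definitions depend on them only through integrals and traces.\<close>

definition harm_ext :: "pt set \<Rightarrow> polygon \<Rightarrow> scal \<Rightarrow> scal" where
  "harm_ext \<Omega> P u = (SOME z. z \<in> H1 \<Omega> \<and>
     (\<forall>\<zeta>\<in>H10 \<Omega> P. L2v_inner (lebesgue_on \<Omega>) (grad \<Omega> z) (grad \<Omega> \<zeta>) = 0) \<and>
     has_trace \<Omega> P z u)"

definition pform :: "pt set \<Rightarrow> polygon \<Rightarrow> scal \<Rightarrow> scal \<Rightarrow> real" where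
  "pform \<Omega> P u v = L2_inner (arclength P) u v +
     L2v_inner (lebesgue_on \<Omega>) (grad \<Omega> (harm_ext \<Omega> P u)) (grad \<Omega> (harm_ext \<Omega> P v))"

definition Qh :: "pt set \<Rightarrow> polygon \<Rightarrow> pt set set \<Rightarrow> scal \<Rightarrow> scal" where
  "Qh \<Omega> P K u = (SOME q. q \<in> Uh \<Omega> P K \<and> (\<forall>v\<in>Uh \<Omega> P K. pform \<Omega> P q v = pform \<Omega> P u v))"

definition disc_harm_ext :: "pt set \<Rightarrow> polygon \<Rightarrow> pt set set \<Rightarrow> scal \<Rightarrow> scal" where
  "disc_harm_ext \<Omega> P K u = (SOME y. y \<in> Yh \<Omega> K \<and>
     (\<forall>\<zeta>\<in>Y0h \<Omega> P K. L2v_inner (lebesgue_on \<Omega>) (grad \<Omega> y) (grad \<Omega> \<zeta>) = 0) \<and>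
     has_trace \<Omega> P y (Qh \<Omega> P K u))"

definition disc_state ::
  "pt set \<Rightarrow> polygon \<Rightarrow> (pt \<Rightarrow> real^2^2) \<Rightarrow> vec2 \<Rightarrow> scal \<Rightarrow> pt set set \<Rightarrow> scal \<Rightarrow> scal" where
  "disc_state \<Omega> P A b a0 K u = (SOME y. y \<in> Yh \<Omega> K \<and>
     (\<forall>\<zeta>\<in>Y0h \<Omega> P K. aform \<Omega> A b a0 y \<zeta> = 0) \<and>
     has_trace \<Omega> P y (Qh \<Omega> P K u))"

text \<open>Unique solvability and stability of the discrete homogeneous Dirichlet problems, uniformly
  below the threshold hA. Uniqueness is uniqueness on the closed domain, since values elsewhere
  carry no meaning.\<close>

definition discrete_solvability ::
  "pt set \<Rightarrow> polygon \<Rightarrow> (pt \<Rightarrow> real^2^2) \<Rightarrow> vec2 \<Rightarrow> scal \<Rightarrow>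
   real set \<Rightarrow> (real \<Rightarrow> pt set set) \<Rightarrow> real \<Rightarrow> real \<Rightarrow> bool" where
  "discrete_solvability \<Omega> P A b a0 Hs K hA cA \<longleftrightarrow>
     (\<forall>h\<in>Hs. 0 < h \<and> h < hA \<longrightarrow> (\<forall>f\<in>Hm1 \<Omega> P.
        \<exists>\<eta>\<in>Y0h \<Omega> P (K h).
          (\<forall>\<zeta>\<in>Y0h \<Omega> P (K h). aform \<Omega> A b a0 \<eta> \<zeta> = f \<zeta>) \<and>
          (\<forall>\<eta>'\<in>Y0h \<Omega> P (K h). (\<forall>\<zeta>\<in>Y0h \<Omega> P (K h). aform \<Omega> A b a0 \<eta>' \<zeta> = f \<zeta>) \<longrightarrow>
             (\<forall>x\<in>closure \<Omega>. \<eta>' x = \<eta> x)) \<and>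
          H1_nrm \<Omega> \<eta> \<le> cA * Hm1_nrm \<Omega> P f))"

section \<open>The discrete functional and its second derivative\<close>

definition Jh ::
  "pt set \<Rightarrow> polygon \<Rightarrow> (pt \<Rightarrow> real^2^2) \<Rightarrow> vec2 \<Rightarrow> scal \<Rightarrow> scal \<Rightarrow> scal \<Rightarrow> real \<Rightarrow>
   pt set set \<Rightarrow> scal \<Rightarrow> real" where
  "Jh \<Omega> P A b a0 yd ud \<kappa> K u =
     1 / 2 * (L2_nrm (lebesgue_on \<Omega>) (\<lambda>x. disc_state \<Omega> P A b a0 K u x - yd x))\<^sup>2 +
     \<kappa> / 2 * (L2v_nrm (lebesgue_on \<Omega>)
        (grad \<Omega> (disc_harm_ext \<Omega> P K (\<lambda>x. u x - ud x))))\<^sup>2"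

text \<open>Frechet derivatives of a real function J on a space V of functions with (semi)norm N:
  L is the derivative at u; B, with B v w being the value on the pair (v, w), is the second
  derivative at u, that is, the derivative at u of the map u \<mapsto> J'(u) into the dual space.\<close>

definition frechet_deriv ::
  "scal set \<Rightarrow> (scal \<Rightarrow> real) \<Rightarrow> (scal \<Rightarrow> real) \<Rightarrow> scal \<Rightarrow> (scal \<Rightarrow> real) \<Rightarrow> bool" where
  "frechet_deriv V N J u L \<longleftrightarrow>
     L \<in> dual V N \<and>
     (\<forall>\<epsilon>>0. \<exists>d>0. \<forall>w\<in>V. N w < d \<longrightarrow> \<bar>J (\<lambda>x. u x + w x) - J u - L w\<bar> \<le> \<epsilon> * N w)"

definition second_frechet_deriv ::
  "scal set \<Rightarrow> (scal \<Rightarrow> real) \<Rightarrow> (scal \<Rightarrow> real) \<Rightarrow> scal \<Rightarrow> (scal \<Rightarrow> scal \<Rightarrow> real) \<Rightarrow> bool" where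
  "second_frechet_deriv V N J u B \<longleftrightarrow>
     (\<forall>v\<in>V. (\<lambda>w. B v w) \<in> dual V N) \<and> (\<forall>w\<in>V. (\<lambda>v. B v w) \<in> dual V N) \<and>
     (\<exists>C. \<forall>v\<in>V. \<forall>w\<in>V. \<bar>B v w\<bar> \<le> C * N v * N w) \<and>
     (\<exists>J'. (\<forall>v\<in>V. frechet_deriv V N J v (J' v)) \<and>
        (\<forall>\<epsilon>>0. \<exists>d>0. \<forall>w\<in>V. N w < d \<longrightarrow>
           dual_nrm V N (\<lambda>v. J' (\<lambda>x. u x + w x) v - J' u v - B w v) \<le> \<epsilon> * N w))"

end

theory Submission
  imports Defs
begin

text \<open>The functional is quadratic, so its second derivative at any point is
  (y(v), y(w)) + \<kappa> (grad H v, grad H w), where y and H are the discrete state and the discrete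
  harmonic extension. Put Y = H v, y = y(v) and let M be the H1-norm of Y, which dominates the
  H1/2-norm of the trace v. Stability of the discrete Dirichlet problem bounds the H1-norm of y
  by c M. For small \<theta> > 0 the scaled trace inequality bounds the squared boundary norm of v by
  C (|y|^2 / \<theta> + \<theta> c^2 M^2), and the Friedrichs inequality
  bounds M^2 by C times the sum of that squared norm and |grad Y|^2. Choosing \<theta> small absorbs M^2. No
  compactness is used, so the constant does not depend on the mesh. The coefficients b and a0,
  which are singular at the vertices, are controlled by a Hardy inequality on sectors.\<close>

section \<open>Semi-inner products on spaces of functions\<close>

text \<open>Functions live on the whole plane and count only up to null sets; gradients, extensions
  and discrete solutions are picked by \<open>SOME\<close>. Every form in play is therefore merely
  semidefinite on a set of raw functions: \<open>semi_inner\<close> collects what survives without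
  definiteness. The trace is defined through H1 functions continuous up to the boundary, so the
  boundary inequalities are proved for such functions by integrating along segments and then passed
  to the limit; discrete functions are continuous themselves, hence the bilinear form is studied on
  continuous functions. Two kinds of constants are kept apart. For a fixed mesh, differentiability
  may use a bound that depends on the mesh and comes from finite dimension. Coercivity may not: its
  constant is built from \<open>Cf\<close> and \<open>Ct\<close> (domain only), \<open>Ca\<close>
  (domain and coefficients), \<open>cA\<close> and \<open>\<kappa>\<close>. The functional sees only
  the L2 norm of the state; its gradient is reachable only through the extension, which is why the
  gradient term of the trace inequality must carry a small factor.\<close>

locale semi_inner =
  fixes V :: "('a \<Rightarrow> real) set" and p :: "('a \<Rightarrow> real) \<Rightarrow> ('a \<Rightarrow> real) \<Rightarrow> real"
  assumes zero_mem: "(\<lambda>x. 0) \<in> V"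
    and add_mem: "v \<in> V \<Longrightarrow> w \<in> V \<Longrightarrow> (\<lambda>x. v x + w x) \<in> V"
    and scale_mem: "v \<in> V \<Longrightarrow> (\<lambda>x. c * v x) \<in> V"
    and sym: "v \<in> V \<Longrightarrow> w \<in> V \<Longrightarrow> p v w = p w v"
    and add_left: "v \<in> V \<Longrightarrow> w \<in> V \<Longrightarrow> z \<in> V \<Longrightarrow> p (\<lambda>x. v x + w x) z = p v z + p w z"
    and scale_left: "v \<in> V \<Longrightarrow> z \<in> V \<Longrightarrow> p (\<lambda>x. c * v x) z = c * p v z"
    and nonneg: "v \<in> V \<Longrightarrow> 0 \<le> p v v"
begin

lemma diff_mem: "v \<in> V \<Longrightarrow> w \<in> V \<Longrightarrow> (\<lambda>x. v x - w x) \<in> V"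
  using add_mem[OF _ scale_mem[of w "-1"], of v] by simp

lemma diff_left: "v \<in> V \<Longrightarrow> w \<in> V \<Longrightarrow> z \<in> V \<Longrightarrow> p (\<lambda>x. v x - w x) z = p v z - p w z"
  using add_left[OF _ scale_mem[of w "-1"], of v z] scale_left[of w z "-1"] by simp

lemma add_right: "v \<in> V \<Longrightarrow> w \<in> V \<Longrightarrow> z \<in> V \<Longrightarrow> p z (\<lambda>x. v x + w x) = p z v + p z w"
  using add_left[of v w z] sym[of z] add_mem[of v w] by simp

lemma diff_right: "v \<in> V \<Longrightarrow> w \<in> V \<Longrightarrow> z \<in> V \<Longrightarrow> p z (\<lambda>x. v x - w x) = p z v - p z w"
  using diff_left[of v w z] sym[of z] diff_mem[of v w] by simp

lemma scale_right: "v \<in> V \<Longrightarrow> z \<in> V \<Longrightarrow> p z (\<lambda>x. c * v x) = c * p z v"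
  using scale_left[of v z c] sym[of z] scale_mem[of v c] by simp

lemmas bilin = add_left diff_left scale_left add_right diff_right scale_right
  add_mem diff_mem scale_mem zero_mem

lemma zero_left: "v \<in> V \<Longrightarrow> p (\<lambda>x. 0) v = 0"
  using scale_left[of v v 0] by simp

lemma expand_scaled: "v \<in> V \<Longrightarrow> w \<in> V \<Longrightarrow>
    p (\<lambda>x. v x + t * w x) (\<lambda>x. v x + t * w x) = p v v + 2 * t * p v w + t\<^sup>2 * p w w"
  by (simp add: bilin sym[of w v] power2_eq_square algebra_simps)

lemma expand_add: "v \<in> V \<Longrightarrow> w \<in> V \<Longrightarrow>
    p (\<lambda>x. v x + w x) (\<lambda>x. v x + w x) = p v v + 2 * p v w + p w w"
  using expand_scaled[of v w 1] by simp

lemma expand_diff: "v \<in> V \<Longrightarrow> w \<in> V \<Longrightarrow>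
    p (\<lambda>x. v x - w x) (\<lambda>x. v x - w x) = p v v - 2 * p v w + p w w"
  using expand_scaled[of v w "-1"] by simp

text \<open>The quadratic in t of \<open>expand_scaled\<close> is nonnegative. If
  \<open>p w w = 0\<close> it is affine, and a nonzero slope would make it negative somewhere;
  otherwise its value at the minimiser gives the claim.\<close>

lemma Cauchy_Schwarz: "v \<in> V \<Longrightarrow> w \<in> V \<Longrightarrow> (p v w)\<^sup>2 \<le> p v v * p w w"
proof -
  assume vw: "v \<in> V" "w \<in> V"
  have q: "0 \<le> p v v + 2 * t * p v w + t\<^sup>2 * p w w" for t
    using nonneg[OF add_mem[OF vw(1) scale_mem[OF vw(2), of t]]] expand_scaled[OF vw, of t] by simp
  show ?thesis
  proof (cases "p w w = 0")
    case True
    have "p v w = 0"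
    proof (rule ccontr)
      assume "p v w \<noteq> 0"
      \<comment> \<open>With this value of t the affine expression equals -1.\<close>
      then have "2 * (- (p v v + 1) / (2 * p v w)) * p v w = - (p v v + 1)" by simp
      then show False using q[of "- (p v v + 1) / (2 * p v w)"] True by simp
    qed
    then show ?thesis using True by simp
  next
    case False
    then have pos: "p w w > 0" using nonneg[OF vw(2)] by simp
    then have "0 \<le> p w w * (p v v + 2 * (- p v w / p w w) * p v w + (- p v w / p w w)\<^sup>2 * p w w)"
      using q[of "- p v w / p w w"] by simp
    also have "\<dots> = p v v * p w w - (p v w)\<^sup>2"
      using pos by (simp add: field_simps power2_eq_square)
    finally show ?thesis by simp
  qed
qed

definition nrm :: "('a \<Rightarrow> real) \<Rightarrow> real" where
  "nrm v = sqrt (p v v)"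

lemma nrm_nonneg: "v \<in> V \<Longrightarrow> 0 \<le> nrm v"
  by (simp add: nrm_def nonneg)

lemma nrm_sq: "v \<in> V \<Longrightarrow> (nrm v)\<^sup>2 = p v v"
  by (simp add: nrm_def nonneg)

lemma abs_le_nrm: "v \<in> V \<Longrightarrow> w \<in> V \<Longrightarrow> \<bar>p v w\<bar> \<le> nrm v * nrm w"
  using Cauchy_Schwarz[of v w] by (simp add: nrm_def flip: real_sqrt_mult real_sqrt_abs)

lemma nrm_add: "v \<in> V \<Longrightarrow> w \<in> V \<Longrightarrow> nrm (\<lambda>x. v x + w x) \<le> nrm v + nrm w"
proof -
  assume vw: "v \<in> V" "w \<in> V"
  have "(nrm (\<lambda>x. v x + w x))\<^sup>2 \<le> (nrm v + nrm w)\<^sup>2"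
    using abs_le_nrm[OF vw] by (simp add: nrm_sq add_mem vw expand_add power2_sum)
  then show ?thesis using nrm_nonneg vw by (meson add_nonneg_nonneg power2_le_imp_le)
qed

lemma nrm_scale: "v \<in> V \<Longrightarrow> nrm (\<lambda>x. c * v x) = \<bar>c\<bar> * nrm v"
  by (simp add: nrm_def bilin real_sqrt_mult flip: mult.assoc)

lemma nrm_swap: "v \<in> V \<Longrightarrow> w \<in> V \<Longrightarrow> nrm (\<lambda>x. v x - w x) = nrm (\<lambda>x. w x - v x)"
  using nrm_scale[OF diff_mem[of w v], of "-1"] by simp

lemma nrm_triangle: "u \<in> V \<Longrightarrow> v \<in> V \<Longrightarrow> w \<in> V \<Longrightarrow>
    nrm (\<lambda>x. u x - w x) \<le> nrm (\<lambda>x. u x - v x) + nrm (\<lambda>x. v x - w x)"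
  using nrm_add[OF diff_mem[of u v] diff_mem[of v w]] by simp

lemma nrm_reverse: "v \<in> V \<Longrightarrow> w \<in> V \<Longrightarrow> \<bar>nrm v - nrm w\<bar> \<le> nrm (\<lambda>x. v x - w x)"
proof -
  assume vw: "v \<in> V" "w \<in> V"
  have "nrm v \<le> nrm w + nrm (\<lambda>x. v x - w x)" "nrm w \<le> nrm v + nrm (\<lambda>x. w x - v x)"
    using nrm_add[OF vw(2) diff_mem[OF vw]] nrm_add[OF vw(1) diff_mem[OF vw(2,1)]] by simp_all
  then show ?thesis using nrm_swap[OF vw] by simp
qed

lemma tendsto_nrm:
  assumes "\<And>n. f n \<in> V" "v \<in> V" "(\<lambda>n::nat. nrm (\<lambda>x. f n x - v x)) \<longlonglongrightarrow> 0"
  shows "(\<lambda>n. nrm (f n)) \<longlonglongrightarrow> nrm v"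
proof -
  have "(\<lambda>n. nrm (f n) - nrm v) \<longlonglongrightarrow> 0"
    by (rule Lim_null_comparison[OF _ assms(3)]) (use nrm_reverse assms in auto)
  then show ?thesis by (simp add: LIM_zero_iff)
qed

lemma tendsto_form:
  assumes "\<And>n. f n \<in> V" "v \<in> V" "(\<lambda>n::nat. nrm (\<lambda>x. f n x - v x)) \<longlonglongrightarrow> 0"
  shows "(\<lambda>n. p (f n) (f n)) \<longlonglongrightarrow> p v v"
proof -
  have "(\<lambda>n. (nrm (f n))\<^sup>2) \<longlonglongrightarrow> (nrm v)\<^sup>2" by (intro tendsto_intros tendsto_nrm assms)
  then show ?thesis by (simp add: nrm_sq assms)
qed

lemma null_left: "v \<in> V \<Longrightarrow> w \<in> V \<Longrightarrow> p v v = 0 \<Longrightarrow> p v w = 0"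
  using Cauchy_Schwarz[of v w] by simp

lemma null_right: "v \<in> V \<Longrightarrow> w \<in> V \<Longrightarrow> p v v = 0 \<Longrightarrow> p w v = 0"
  using null_left[of v w] sym[of v w] by simp

lemma null_diff: "v \<in> V \<Longrightarrow> w \<in> V \<Longrightarrow> z \<in> V \<Longrightarrow> p (\<lambda>x. v x - w x) (\<lambda>x. v x - w x) = 0 \<Longrightarrow> p v z = p w z"
  using null_left[OF diff_mem[of v w], of z] by (simp add: bilin)

lemma subspace:
  assumes "W \<subseteq> V" "(\<lambda>x. 0) \<in> W" "\<And>v w. v \<in> W \<Longrightarrow> w \<in> W \<Longrightarrow> (\<lambda>x. v x + w x) \<in> W"
    "\<And>c v. v \<in> W \<Longrightarrow> (\<lambda>x. c * v x) \<in> W"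
  shows "semi_inner W p"
  using assms by unfold_locales (auto intro: sym add_left scale_left nonneg dest: subsetD)

text \<open>Riesz representation by the direct method: a minimising sequence of
  \<open>p v v - 2 * l v\<close> is Cauchy by the parallelogram law, and at the minimiser the first
  variation vanishes. Completeness is a hypothesis on sequences, since \<open>nrm\<close> is only a
  seminorm.\<close>

lemma representation_complete:
  fixes l :: "('a \<Rightarrow> real) \<Rightarrow> real"
  assumes complete: "\<And>f. (\<And>n. f n \<in> V) \<Longrightarrow>
      (\<forall>e>0. \<exists>N. \<forall>m\<ge>N. \<forall>n\<ge>N. nrm (\<lambda>x. f m x - f n x) < e) \<Longrightarrow>
      \<exists>v\<in>V. (\<lambda>n::nat. nrm (\<lambda>x. f n x - v x)) \<longlonglongrightarrow> 0"
    and ladd: "\<And>v w. v \<in> V \<Longrightarrow> w \<in> V \<Longrightarrow> l (\<lambda>x. v x + w x) = l v + l w"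
    and lscale: "\<And>c v. v \<in> V \<Longrightarrow> l (\<lambda>x. c * v x) = c * l v"
    and bound: "\<And>v. v \<in> V \<Longrightarrow> \<bar>l v\<bar> \<le> C * nrm v"
  shows "\<exists>w\<in>V. \<forall>v\<in>V. p w v = l v"
proof -
  define F where "F v = p v v - 2 * l v" for v
  \<comment> \<open>Young's inequality; it bounds \<open>F\<close> below by -C^2 on all of
    \<open>V\<close>.\<close>
  have C: "l v \<le> C\<^sup>2 / 2 + p v v / 2" if "v \<in> V" for v
  proof -
    have "0 \<le> (C - nrm v)\<^sup>2" by simp
    then have "2 * (C * nrm v) \<le> C\<^sup>2 + (nrm v)\<^sup>2" by (simp add: power2_diff)
    then show ?thesis using bound[OF that] by (simp add: nrm_sq that)
  qed
  have Flow: "F v \<ge> - C\<^sup>2" if "v \<in> V" for v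
    using C[OF that] by (simp add: F_def)
  define m where "m = Inf (F ` V)"
  have bdd: "bdd_below (F ` V)" using Flow by (intro bdd_belowI2)
  have mle: "m \<le> F v" if "v \<in> V" for v
    unfolding m_def using bdd that by (auto intro: cInf_lower)
  have "\<exists>v\<in>V. F v < m + e" if "e > 0" for e
  proof -
    have "Inf (F ` V) < m + e" using that m_def by simp
    then show ?thesis using zero_mem bdd by (subst (asm) cInf_less_iff) auto
  qed
  then have "\<forall>n::nat. \<exists>v\<in>V. F v < m + inverse (Suc n)" by simp
  then obtain f where f: "\<And>n. f n \<in> V" "\<And>n::nat. F (f n) < m + inverse (Suc n)" by metis
  have ldiff: "l (\<lambda>x. v x - w x) = l v - l w" if "v \<in> V" "w \<in> V" for v w
    using ladd[OF that(1) scale_mem[OF that(2), of "-1"]] lscale[OF that(2), of "-1"] by simp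
  \<comment> \<open>The midpoint of v and w lies in \<open>V\<close>, so its value is at least m;
    the parallelogram identity turns this into a bound on the distance of v and w.\<close>
  have par: "p (\<lambda>x. v x - w x) (\<lambda>x. v x - w x) \<le> 2 * (F v - m) + 2 * (F w - m)" if vw: "v \<in> V" "w \<in> V" for v w
  proof -
    have "m \<le> F (\<lambda>x. (1/2) * (v x + w x))" by (intro mle bilin vw)
    also have "\<dots> = (1/4) * (p v v + 2 * p v w + p w w) - l v - l w"
      unfolding F_def by (simp only: bilin vw lscale ladd) (simp add: sym[of w v] vw field_simps)
    finally show ?thesis
      by (simp add: F_def expand_diff vw field_simps)
  qed
  have "\<exists>v\<in>V. (\<lambda>n. nrm (\<lambda>x. f n x - v x)) \<longlonglongrightarrow> 0"
  proof (rule complete[OF f(1)], intro allI impI)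
    fix e :: real assume "e > 0"
    then obtain N :: nat where N: "inverse (Suc N) < e\<^sup>2 / 4"
      using reals_Archimedean[of "e\<^sup>2/4"] by auto
    have "nrm (\<lambda>x. f i x - f j x) < e" if "i \<ge> N" "j \<ge> N" for i j
    proof -
      have gen: "P < E" if "P \<le> 2 * (a - m) + 2 * (b - m)" "a < m + x" "b < m + y" "x \<le> z" "y \<le> z" "z < E / 4"
        for P a b x y z E :: real using that by (simp add: field_simps)
      have inv: "inverse (real (Suc i)) \<le> inverse (Suc N)" "inverse (real (Suc j)) \<le> inverse (Suc N)"
        using that by (auto intro!: le_imp_inverse_le)
      have "p (\<lambda>x. f i x - f j x) (\<lambda>x. f i x - f j x) < e\<^sup>2"
        by (rule gen[OF par[OF f(1)[of i] f(1)[of j]] f(2)[of i] f(2)[of j] inv N])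
      then have "(nrm (\<lambda>x. f i x - f j x))\<^sup>2 < e\<^sup>2" by (simp add: nrm_sq diff_mem f)
      then show ?thesis using \<open>e > 0\<close> by (meson less_imp_le power_less_imp_less_base)
    qed
    then show "\<exists>N. \<forall>m\<ge>N. \<forall>n\<ge>N. nrm (\<lambda>x. f m x - f n x) < e" by blast
  qed
  then obtain w where w: "w \<in> V" "(\<lambda>n. nrm (\<lambda>x. f n x - w x)) \<longlonglongrightarrow> 0" by blast
  have "(\<lambda>n. l (f n) - l w) \<longlonglongrightarrow> 0"
  proof (rule Lim_null_comparison)
    show "\<forall>\<^sub>F n in sequentially. norm (l (f n) - l w) \<le> C * nrm (\<lambda>x. f n x - w x)"
      using bound[OF diff_mem] f w ldiff by (auto intro!: always_eventually)
    show "(\<lambda>n. C * nrm (\<lambda>x. f n x - w x)) \<longlonglongrightarrow> 0" using tendsto_mult_right_zero[OF w(2)] by simp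
  qed
  then have "(\<lambda>n. F (f n)) \<longlonglongrightarrow> F w"
    unfolding F_def using tendsto_form[OF f(1) w] by (auto intro!: tendsto_intros simp: LIM_zero_iff)
  moreover have "(\<lambda>n. m + inverse (real (Suc n))) \<longlonglongrightarrow> m + 0"
    by (intro tendsto_intros LIMSEQ_inverse_real_of_nat)
  ultimately have Fw: "F w \<le> m"
    using f(2) by (intro LIMSEQ_le[of "\<lambda>n. F (f n)" _ "\<lambda>n. m + inverse (real (Suc n))"]) (auto intro: less_imp_le)
  show ?thesis
  proof (intro bexI ballI)
    show "w \<in> V" by fact
    fix v assume v: "v \<in> V"
    have q: "0 \<le> 2 * t * (p w v - l v) + t\<^sup>2 * p v v" for t
    proof -
      have "F w \<le> F (\<lambda>x. w x + t * v x)" using Fw mle[OF add_mem[OF w(1) scale_mem[OF v, of t]]] by simp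
      also have "\<dots> = F w + 2 * t * (p w v - l v) + t\<^sup>2 * p v v"
        unfolding F_def by (simp add: expand_scaled w v ladd lscale bilin algebra_simps)
      finally show ?thesis by simp
    qed
    show "p w v = l v"
    proof (rule ccontr)
      assume ne: "p w v \<noteq> l v"
      define d where "d = p w v - l v"
      \<comment> \<open>At t = -s the quadratic equals -s^2 (p v v + 2), which is negative. The
        summand 1 keeps the denominator positive when v is a null vector.\<close>
      define s where "s = d / (p v v + 1)"
      have pos: "p v v + 1 > 0" using nonneg[OF v] by simp
      then have d: "d = s * (p v v + 1)" by (simp add: s_def)
      then have "s \<noteq> 0" using ne d_def by auto
      then have "0 < s\<^sup>2 * (p v v + 2)" using nonneg[OF v] by simp
      moreover have "2 * (- s) * d + (- s)\<^sup>2 * p v v = - (s\<^sup>2 * (p v v + 2))"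
        unfolding d by (simp add: power2_eq_square algebra_simps)
      ultimately show False using q[of "- s"] unfolding d_def by linarith
    qed
  qed
qed

end

text \<open>A finite set X on which the values of a function determine it (up to null functions) is the
  only form of finite dimension that is needed; the induction removes one point of X at a time and
  splits V orthogonally.\<close>

lemma finite_dim_split:
  assumes V: "semi_inner V p" and e: "e \<in> V" "e x0 = 1"
    and rep: "\<exists>w\<in>{v\<in>V. v x0 = 0}. \<forall>v\<in>{v\<in>V. v x0 = 0}. p w v = p e v"
  obtains d where "d \<in> V" "d x0 = 1" "\<And>v. v \<in> V \<Longrightarrow> v x0 = 0 \<Longrightarrow> p d v = 0"
proof -
  obtain w where w: "w \<in> V" "w x0 = 0" "\<And>v. v \<in> V \<Longrightarrow> v x0 = 0 \<Longrightarrow> p w v = p e v"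
    using rep by auto
  show ?thesis
    by (rule that[of "\<lambda>x. e x - w x"])
      (use e w semi_inner.diff_mem[OF V] semi_inner.diff_left[OF V] in auto)
qed

lemma semi_inner_vanishing: "semi_inner V p \<Longrightarrow> semi_inner {v \<in> V. v x0 = 0} p"
  by (rule semi_inner.subspace) (auto simp: semi_inner.bilin)

lemma semi_inner_normalize:
  assumes "semi_inner V p" "\<exists>e\<in>V. e x0 \<noteq> 0"
  shows "\<exists>e\<in>V. e x0 = 1"
proof -
  obtain e where "e \<in> V" "e x0 \<noteq> 0" using assms(2) by blast
  then show ?thesis
    using semi_inner.scale_mem[OF assms(1), of e "1 / e x0"] by (intro bexI[of _ "\<lambda>x. 1 / e x0 * e x"]) auto
qed

lemma semi_inner_decompose:
  assumes "semi_inner V p" "v \<in> V" "d \<in> V" "d x0 = 1"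
  shows "(\<lambda>x. v x - v x0 * d x) \<in> {v \<in> V. v x0 = 0}"
  using assms semi_inner.diff_mem[OF assms(1,2) semi_inner.scale_mem[OF assms(1,3), of "v x0"]] by simp

text \<open>Boundedness of l is replaced by l = 0 on null vectors, which suffices in finite
  dimension. On the vectors vanishing at x0 the induction hypothesis represents l by some w; the
  vector d, orthogonal to all of them, accounts for the missing direction and supplies the
  correction c d.\<close>

lemma representation_finite:
  fixes l :: "('a \<Rightarrow> real) \<Rightarrow> real"
  assumes "finite X" and "semi_inner V p"
    and "\<And>v. v \<in> V \<Longrightarrow> \<forall>x\<in>X. v x = 0 \<Longrightarrow> p v v = 0"
    and "\<And>v w. v \<in> V \<Longrightarrow> w \<in> V \<Longrightarrow> l (\<lambda>x. v x + w x) = l v + l w"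
    and "\<And>c v. v \<in> V \<Longrightarrow> l (\<lambda>x. c * v x) = c * l v"
    and "\<And>v. v \<in> V \<Longrightarrow> p v v = 0 \<Longrightarrow> l v = 0"
  shows "\<exists>w\<in>V. \<forall>v\<in>V. p w v = l v"
  using assms
proof (induction X arbitrary: V l rule: finite_induct)
  case empty
  then show ?case
    by (intro bexI[of _ "\<lambda>x. 0"]) (auto simp: semi_inner.zero_left semi_inner.zero_mem)
next
  case (insert x0 X V l)
  note V = insert.prems(1)
  interpret semi_inner V p by (fact V)
  let ?V = "{v \<in> V. v x0 = 0}"
  have IH: "\<exists>w\<in>?V. \<forall>v\<in>?V. p w v = k v"
    if "\<And>v w. v \<in> ?V \<Longrightarrow> w \<in> ?V \<Longrightarrow> k (\<lambda>x. v x + w x) = k v + k w"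
      "\<And>c v. v \<in> ?V \<Longrightarrow> k (\<lambda>x. c * v x) = c * k v" "\<And>v. v \<in> ?V \<Longrightarrow> p v v = 0 \<Longrightarrow> k v = 0" for k
    by (rule insert.IH[OF semi_inner_vanishing[OF V]]) (use insert.prems(2) that in auto)
  show ?case
  proof (cases "\<exists>e\<in>V. e x0 \<noteq> 0")
    case False
    then have "?V = V" by auto
    then show ?thesis using IH[of l] insert.prems(3-5) by simp
  next
    case True
    then obtain e where e: "e \<in> V" "e x0 = 1"
      using semi_inner_normalize[OF V] by blast
    obtain d where d: "d \<in> V" "d x0 = 1" "\<And>v. v \<in> V \<Longrightarrow> v x0 = 0 \<Longrightarrow> p d v = 0"
      by (rule finite_dim_split[OF V e IH])
        (use e(1) in \<open>auto simp: bilin null_right\<close>)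
    obtain w where w: "w \<in> ?V" "\<forall>v\<in>?V. p w v = l v"
      using IH[of l] insert.prems(3-5) by auto
    \<comment> \<open>If d is a null vector then l d = 0 and division by zero gives c = 0, so
      \<open>c * p d d = l d\<close> holds in either case.\<close>
    define c where "c = l d / p d d"
    have c: "c * p d d = l d" using insert.prems(5)[OF d(1)] by (cases "p d d = 0") (auto simp: c_def)
    show ?thesis
    proof (intro bexI ballI)
      show "(\<lambda>x. w x + c * d x) \<in> V" using w d by (auto intro: bilin)
      fix v assume v: "v \<in> V"
      let ?v = "\<lambda>x. v x - v x0 * d x"
      have v': "?v \<in> ?V" by (rule semi_inner_decompose[OF V v d(1,2)])
      have wd: "p w d = 0" using w d(3) sym[of w d] d(1) by auto
      have pd: "p d v = v x0 * p d d"
        using d(3)[of ?v] v' v d(1) by (simp add: bilin)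
      have "p w v = p w ?v + v x0 * p w d" using w(1) v d(1) by (simp add: bilin)
      then have "p w v = l ?v" using w(2) v' wd by auto
      moreover have "l v = l ?v + v x0 * l d"
      proof -
        have "l (\<lambda>x. ?v x + v x0 * d x) = l ?v + l (\<lambda>x. v x0 * d x)"
          by (rule insert.prems(3)) (use v' d(1) in \<open>auto intro: bilin\<close>)
        then show ?thesis by (simp add: insert.prems(4)[OF d(1)])
      qed
      ultimately show "p (\<lambda>x. w x + c * d x) v = l v"
        using w(1) v d(1) pd c by (simp add: bilin)
    qed
  qed
qed

text \<open>Comparison of seminorms in finite dimension: v splits p-orthogonally into a part
  vanishing at x0, handled by induction, and a multiple of d, while q of a sum is at most twice the
  sum of the q-values. The constant depends on the space, so this may serve only where the mesh is
  fixed.\<close>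

lemma form_bound_finite:
  assumes "finite X" and "semi_inner V p" and "semi_inner V q"
    and "\<And>v. v \<in> V \<Longrightarrow> \<forall>x\<in>X. v x = 0 \<Longrightarrow> p v v = 0"
    and "\<And>v. v \<in> V \<Longrightarrow> p v v = 0 \<Longrightarrow> q v v = 0"
  shows "\<exists>C\<ge>0. \<forall>v\<in>V. q v v \<le> C * p v v"
  using assms
proof (induction X arbitrary: V rule: finite_induct)
  case empty
  then show ?case by (intro exI[of _ 0]) auto
next
  case (insert x0 X V)
  note V = insert.prems(1)
  interpret semi_inner V p by (fact V)
  interpret q: semi_inner V q by (fact insert.prems(2))
  let ?V = "{v \<in> V. v x0 = 0}"
  have "\<exists>C\<ge>0. \<forall>v\<in>?V. q v v \<le> C * p v v"
    by (rule insert.IH[OF semi_inner_vanishing[OF V] semi_inner_vanishing[OF insert.prems(2)]])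
      (use insert.prems(3,4) in auto)
  then obtain C where C: "C \<ge> 0" "\<And>v. v \<in> ?V \<Longrightarrow> q v v \<le> C * p v v" by auto
  show ?case
  proof (cases "\<exists>e\<in>V. e x0 \<noteq> 0")
    case False
    then have "?V = V" by auto
    then show ?thesis using C by auto
  next
    case True
    then obtain e where e: "e \<in> V" "e x0 = 1"
      using semi_inner_normalize[OF V] by blast
    have rep: "\<exists>w\<in>?V. \<forall>v\<in>?V. p w v = p e v"
      by (rule representation_finite[OF insert.hyps(1) semi_inner_vanishing[OF V]])
        (use e(1) insert.prems(3) in \<open>auto simp: bilin null_right\<close>)
    obtain d where d: "d \<in> V" "d x0 = 1" "\<And>v. v \<in> V \<Longrightarrow> v x0 = 0 \<Longrightarrow> p d v = 0"
      by (rule finite_dim_split[OF V e rep]) auto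
    \<comment> \<open>The quotient is 0 when d is a null vector of p, in which case
      \<open>q d d\<close> is 0 as well.\<close>
    define D where "D = q d d / p d d"
    have D: "D * p d d = q d d" "D \<ge> 0"
      using insert.prems(4)[OF d(1)] nonneg[OF d(1)] q.nonneg[OF d(1)]
      by (cases "p d d = 0"; auto simp: D_def)+
    show ?thesis
    proof (intro exI conjI ballI)
      show "0 \<le> 2 * (C + D)" using C D by simp
      fix v assume v: "v \<in> V"
      define v1 d1 where "v1 = (\<lambda>x. v x - v x0 * d x)" and "d1 = (\<lambda>x. v x0 * d x)"
      have v1: "v1 \<in> ?V" unfolding v1_def by (rule semi_inner_decompose[OF V v d(1,2)])
      have d1: "d1 \<in> V" unfolding d1_def using d(1) by (rule scale_mem)
      have split: "v = (\<lambda>x. v1 x + d1 x)" by (simp add: v1_def d1_def)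
      have pd1: "q d1 d1 = D * p d1 d1"
        using D(1) d(1) by (simp add: d1_def bilin q.bilin)
      have orth: "p v1 d1 = 0"
        using d(3)[of v1] sym[of v1 d] v1 d(1) by (simp add: d1_def scale_right)
      have "q v1 d1 \<le> (q v1 v1 + q d1 d1) / 2"
        using q.nonneg[OF q.diff_mem[OF _ d1], of v1] v1 d1 by (simp add: q.expand_diff)
      then have "q v v \<le> 2 * q v1 v1 + 2 * q d1 d1"
        using q.expand_add[of v1 d1] v1 d1 unfolding split by simp
      also have "\<dots> \<le> 2 * C * p v1 v1 + 2 * D * p d1 d1"
        using C(2)[OF v1] pd1 by simp
      also have "\<dots> \<le> 2 * (C + D) * (p v1 v1 + p d1 d1)"
        using C(1) D(2) nonneg[of v1] nonneg[OF d1] v1 by (simp add: algebra_simps)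
      also have "p v1 v1 + p d1 d1 = p v v"
        using expand_add[of v1 d1] v1 d1 orth unfolding split by simp
      finally show "q v v \<le> 2 * (C + D) * p v v" .
    qed
  qed
qed

section \<open>Smooth bumps\<close>

text \<open>The standard function exp(-1/t), flat at 0. The additional factor t^(-k) makes the
  family closed under differentiation up to linear combinations.\<close>

definition flat :: "nat \<Rightarrow> real \<Rightarrow> real" where
  "flat k t = (if t > 0 then exp (- inverse t) * inverse t ^ k else 0)"

lemma flat_tendsto_0: "(flat k \<longlongrightarrow> 0) (at_right 0)"
proof -
  have "((\<lambda>u. u ^ k / exp u) \<longlongrightarrow> (0::real)) at_top" by (rule tendsto_power_div_exp_0)
  then have "((\<lambda>t. inverse t ^ k / exp (inverse t)) \<longlongrightarrow> (0::real)) (at_right 0)"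
    using filterlim_inverse_at_top_right by (rule filterlim_compose)
  then show ?thesis
    by (rule Lim_transform_eventually)
      (auto simp: flat_def exp_minus field_simps eventually_at_filter)
qed

text \<open>Only t = 0 needs an argument: from the right the difference quotient of
  \<open>flat k\<close> is \<open>flat (Suc k)\<close>, which tends to 0 because exponential decay
  beats powers; from the left it is 0.\<close>

lemma flat_has_derivative:
  "(flat k has_real_derivative flat (k + 2) t - real k * flat (Suc k) t) (at t)"
proof -
  consider "t > 0" | "t < 0" | "t = 0" by linarith
  then show ?thesis
  proof cases
    case 1
    have "((\<lambda>t. exp (- inverse t) * inverse t ^ k) has_real_derivative
        exp (- inverse t) * (inverse t)\<^sup>2 * inverse t ^ k - exp (- inverse t) * (real k * inverse t ^ (k - 1) * (inverse t)\<^sup>2)) (at t)"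
      using 1 by (auto intro!: derivative_eq_intros simp: power2_eq_square)
    moreover have "exp (- inverse t) * (inverse t)\<^sup>2 * inverse t ^ k - exp (- inverse t) * (real k * inverse t ^ (k - 1) * (inverse t)\<^sup>2)
        = flat (k + 2) t - real k * flat (Suc k) t"
      using 1 by (cases k) (simp_all add: flat_def power2_eq_square algebra_simps)
    ultimately have "((\<lambda>t. exp (- inverse t) * inverse t ^ k) has_real_derivative
        flat (k + 2) t - real k * flat (Suc k) t) (at t)"
      by simp
    then show ?thesis
      by (rule DERIV_cong_ev[THEN iffD1, rotated -1])
        (use 1 in \<open>auto simp: flat_def eventually_nhds intro!: exI[of _ "{0<..}"]\<close>)
  next
    case 2
    have "((\<lambda>t. 0) has_real_derivative flat (k + 2) t - real k * flat (Suc k) t) (at t)"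
      using 2 by (simp add: flat_def)
    then show ?thesis
      by (rule DERIV_cong_ev[THEN iffD1, rotated -1])
        (use 2 in \<open>auto simp: flat_def eventually_nhds intro!: exI[of _ "{..<0}"]\<close>)
  next
    case 3
    have "((\<lambda>s. flat k s / s) \<longlongrightarrow> 0) (at 0)"
    proof (rule filterlim_split_at)
      show "((\<lambda>s. flat k s / s) \<longlongrightarrow> 0) (at_left 0)"
        by (rule tendsto_eventually) (auto simp: flat_def eventually_at_filter)
      show "((\<lambda>s. flat k s / s) \<longlongrightarrow> 0) (at_right 0)"
        by (rule Lim_transform_eventually[OF flat_tendsto_0[of "Suc k"]])
          (auto simp: flat_def eventually_at_filter field_simps)
    qed
    then show ?thesis using 3 by (simp add: has_field_derivative_iff flat_def)
  qed
qed

text \<open>Closure under differentiation reduces smoothness of these functions to continuity.\<close>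

inductive_set bumps :: "(real \<Rightarrow> real) set" where
  flat: "(\<lambda>t. flat k (c * t + d)) \<in> bumps"
| const: "(\<lambda>t. c) \<in> bumps"
| add: "f \<in> bumps \<Longrightarrow> g \<in> bumps \<Longrightarrow> (\<lambda>t. f t + g t) \<in> bumps"
| mult: "f \<in> bumps \<Longrightarrow> g \<in> bumps \<Longrightarrow> (\<lambda>t. f t * g t) \<in> bumps"

lemma bumps_has_derivative:
  "f \<in> bumps \<Longrightarrow> \<exists>g\<in>bumps. \<forall>t. (f has_real_derivative g t) (at t)"
proof (induction rule: bumps.induct)
  case (flat k c d)
  have "((\<lambda>t. flat k (c * t + d)) has_real_derivative
      (flat (k + 2) (c * t + d) - real k * flat (Suc k) (c * t + d)) * c) (at t)" for t
    by (rule DERIV_chain'[OF _ flat_has_derivative]) (auto intro!: derivative_eq_intros)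
  moreover have "(\<lambda>t. (flat (k + 2) (c * t + d) + (- real k) * flat (Suc k) (c * t + d)) * c) \<in> bumps"
    by (intro bumps.intros)
  ultimately show ?case by (intro bexI[of _ "\<lambda>t. (flat (k + 2) (c * t + d) + (- real k) * flat (Suc k) (c * t + d)) * c"]) auto
next
  case (const c)
  then show ?case by (intro bexI[of _ "\<lambda>t. 0"] bumps.const) auto
next
  case (add f g)
  then obtain f' g' where "f' \<in> bumps" "g' \<in> bumps"
    "\<forall>t. (f has_real_derivative f' t) (at t)" "\<forall>t. (g has_real_derivative g' t) (at t)" by blast
  then show ?case by (intro bexI[of _ "\<lambda>t. f' t + g' t"] bumps.add) (auto intro: DERIV_add)
next
  case (mult f g)
  then obtain f' g' where *: "f' \<in> bumps" "g' \<in> bumps"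
    "\<forall>t. (f has_real_derivative f' t) (at t)" "\<forall>t. (g has_real_derivative g' t) (at t)" by blast
  then have "(\<lambda>t. f' t * g t + g' t * f t) \<in> bumps"
    using mult by (intro bumps.intros)
  then show ?case using * by (intro bexI[of _ "\<lambda>t. f' t * g t + g' t * f t"]) (auto intro: DERIV_mult)
qed

text \<open>A derivative inside \<open>bumps\<close> is chosen and iterated, because test families
  ask for the derivatives of all orders at once.\<close>

lemma bumps_family:
  assumes "f \<in> bumps"
  obtains d :: "nat \<Rightarrow> real \<Rightarrow> real"
  where "d 0 = f" "\<And>i t. (d i has_real_derivative d (Suc i) t) (at t)" "\<And>i. d i \<in> bumps"
proof -
  obtain D where D: "\<And>g. g \<in> bumps \<Longrightarrow> D g \<in> bumps" "\<And>g t. g \<in> bumps \<Longrightarrow> (g has_real_derivative D g t) (at t)"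
    using bumps_has_derivative by metis
  define d where "d = rec_nat f (\<lambda>_. D)"
  have "d i \<in> bumps" for i by (induction i) (auto simp: d_def assms D)
  then show ?thesis by (intro that[of d]) (auto simp: d_def D)
qed

text \<open>The parameter n steepens the flanks: values stay in [0,1] and tend to the indicator of
  the open interval. Large n approximates boxes by test functions; n = 1 on a symmetric interval
  yields the mollifier kernel.\<close>

definition bump :: "nat \<Rightarrow> real \<Rightarrow> real \<Rightarrow> real \<Rightarrow> real" where
  "bump n a b t = flat 0 (real n * (t - a)) * flat 0 (real n * (b - t))"

lemma bump_mem: "bump n a b \<in> bumps"
proof -
  have "(\<lambda>t. flat 0 (real n * t + - (n * a)) * flat 0 ((- real n) * t + n * b)) \<in> bumps"
    by (intro bumps.intros)
  moreover have "(\<lambda>t. flat 0 (real n * t + - (n * a)) * flat 0 ((- real n) * t + n * b)) = bump n a b"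
    by (auto simp: bump_def algebra_simps)
  ultimately show ?thesis by simp
qed

lemma flat_0_bounds: "0 \<le> flat 0 t" "flat 0 t \<le> 1"
  by (auto simp: flat_def)

lemma bump_nonneg: "0 \<le> bump n a b t"
  by (simp add: bump_def flat_0_bounds)

lemma bump_le_1: "bump n a b t \<le> 1"
  by (simp add: bump_def flat_0_bounds mult_le_one)

lemma bump_eq_0: "t \<notin> {a<..<b} \<Longrightarrow> bump n a b t = 0"
  by (auto simp: bump_def flat_def zero_less_mult_iff)

lemma bump_pos: "a < t \<Longrightarrow> t < b \<Longrightarrow> n > 0 \<Longrightarrow> bump n a b t > 0"
  by (auto simp: bump_def flat_def)

lemma continuous_on_bumps: "f \<in> bumps \<Longrightarrow> continuous_on A f"
  using bumps_has_derivative
  by (metis DERIV_continuous_on has_field_derivative_at_within)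

lemma flat_scaled_tendsto_1:
  assumes "t > 0"
  shows "(\<lambda>n. flat 0 (real n * t)) \<longlonglongrightarrow> 1"
proof -
  have "(\<lambda>n. inverse (real n) * inverse t) \<longlonglongrightarrow> 0 * inverse t"
    by (intro tendsto_intros lim_inverse_n)
  from tendsto_exp[OF tendsto_minus[OF this]]
  have "(\<lambda>n. exp (- (inverse (real n) * inverse t))) \<longlonglongrightarrow> exp (- (0 * inverse t))" .
  then have "(\<lambda>n. exp (- (inverse (real n) * inverse t))) \<longlonglongrightarrow> 1" by simp
  moreover have "\<forall>\<^sub>F n in sequentially. exp (- (inverse (real n) * inverse t)) = flat 0 (real n * t)"
    using assms by (auto simp: flat_def inverse_mult_distrib intro!: eventually_sequentiallyI[of 1])
  ultimately show ?thesis by (rule Lim_transform_eventually)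
qed

lemma bump_tendsto: "(\<lambda>n. bump n a b t) \<longlonglongrightarrow> indicator {a<..<b} t"
proof (cases "t \<in> {a<..<b}")
  case True
  then have "(\<lambda>n. bump n a b t) \<longlonglongrightarrow> 1 * 1"
    unfolding bump_def by (intro tendsto_mult flat_scaled_tendsto_1) auto
  then show ?thesis using True by simp
qed (simp add: bump_eq_0)

lemma has_derivative_nth: "((\<lambda>x. x $ i) has_derivative (\<lambda>v. v $ i)) (at x)" for x :: pt
  by (auto intro!: derivative_intros bounded_linear_imp_has_derivative bounded_linear_vec_nth)

text \<open>Separated variables suffice for all test functions used: a mixed derivative of the
  product is a product of derivatives in one variable.\<close>

lemma deriv_family_product:
  assumes "\<And>i t. (d i has_real_derivative d (Suc i) t) (at t)"
    and "\<And>i t. (e i has_real_derivative e (Suc i) t) (at t)"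
  shows "deriv_family UNIV (\<lambda>i j x. d i (x $ 1) * e j (x $ 2))"
  unfolding deriv_family_def
proof (intro allI ballI)
  fix i j and x :: pt
  have 1: "((\<lambda>x::pt. d i (x $ 1)) has_derivative (\<lambda>v. d (Suc i) (x $ 1) * v $ 1)) (at x)"
    using has_derivative_compose[OF has_derivative_nth[of 1 x] assms(1)[unfolded has_field_derivative_def]] by simp
  have 2: "((\<lambda>x::pt. e j (x $ 2)) has_derivative (\<lambda>v. e (Suc j) (x $ 2) * v $ 2)) (at x)"
    using has_derivative_compose[OF has_derivative_nth[of 2 x] assms(2)[unfolded has_field_derivative_def]] by simp
  show "((\<lambda>x. d i (x $ 1) * e j (x $ 2)) has_derivative
      (\<lambda>v. d (Suc i) (x $ 1) * e j (x $ 2) * v $ 1 + d i (x $ 1) * e (Suc j) (x $ 2) * v $ 2)) (at x)"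
    using has_derivative_mult[OF 1 2] by (simp add: algebra_simps)
qed

lemma mem_box_pt: "x \<in> box a b \<longleftrightarrow> a $ 1 < x $ 1 \<and> x $ 1 < b $ 1 \<and> a $ 2 < x $ 2 \<and> x $ 2 < b $ 2" for x :: pt
  by (auto simp: mem_box_cart forall_2)

lemma mem_cbox_pt: "x \<in> cbox a b \<longleftrightarrow> a $ 1 \<le> x $ 1 \<and> x $ 1 \<le> b $ 1 \<and> a $ 2 \<le> x $ 2 \<and> x $ 2 \<le> b $ 2" for x :: pt
  by (auto simp: mem_box_cart forall_2)

lemma test_family_product:
  assumes "\<And>i t. (d i has_real_derivative d (Suc i) t) (at t)"
    and "\<And>i t. (e i has_real_derivative e (Suc i) t) (at t)"
    and "\<And>x::pt. x \<notin> cbox a b \<Longrightarrow> d 0 (x $ 1) * e 0 (x $ 2) = 0" "cbox a b \<subseteq> \<Omega>"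
  shows "test_family \<Omega> (\<lambda>i j x. d i (x $ 1) * e j (x $ 2))"
proof -
  have "closure {x::pt. d 0 (x $ 1) * e 0 (x $ 2) \<noteq> 0} \<subseteq> cbox a b"
    using assms(3) by (intro closure_minimal) auto
  moreover from this have "compact (closure {x::pt. d 0 (x $ 1) * e 0 (x $ 2) \<noteq> 0})"
    by (meson bounded_cbox bounded_subset closed_closure compact_eq_bounded_closed)
  ultimately show ?thesis
    unfolding test_family_def using deriv_family_product[of d e, OF assms(1,2)] assms(4) by auto
qed

lemma test_family_bump:
  assumes "cbox a b \<subseteq> \<Omega>"
  obtains D where "test_family \<Omega> D" "D 0 0 = (\<lambda>x. bump n (a $ 1) (b $ 1) (x $ 1) * bump n (a $ 2) (b $ 2) (x $ 2))"
proof -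
  obtain d where d: "d 0 = bump n (a $ 1) (b $ 1)" "\<And>i t. (d i has_real_derivative d (Suc i) t) (at t)"
    using bumps_family[OF bump_mem] by metis
  obtain e where e: "e 0 = bump n (a $ 2) (b $ 2)" "\<And>i t. (e i has_real_derivative e (Suc i) t) (at t)"
    using bumps_family[OF bump_mem] by metis
  have "d 0 (x $ 1) * e 0 (x $ 2) = 0" if "x \<notin> cbox a b" for x :: pt
    using that bump_eq_0 by (auto simp: d e mem_cbox_pt)
  then have "test_family \<Omega> (\<lambda>i j x. d i (x $ 1) * e j (x $ 2))"
    using test_family_product[of d e a b \<Omega>] d e assms by blast
  then show ?thesis using that d e by auto
qed

section \<open>Iterated integration in the plane\<close>

definition mkpt :: "real \<Rightarrow> real \<Rightarrow> pt" where
  "mkpt s t = (\<chi> i. if i = 1 then s else t)"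

lemma mkpt_nth [simp]: "mkpt s t $ 1 = s" "mkpt s t $ 2 = t"
  by (auto simp: mkpt_def)

lemma mkpt_eta [simp]: "mkpt (x $ 1) (x $ 2) = x"
  by (auto simp: vec_eq_iff forall_2)

lemma mkpt_eqI: "x $ 1 = y $ 1 \<Longrightarrow> x $ 2 = y $ 2 \<Longrightarrow> x = y" for x y :: pt
  by (auto simp: vec_eq_iff forall_2)

lemma continuous_mkpt: "continuous_on A f \<Longrightarrow> continuous_on A g \<Longrightarrow> continuous_on A (\<lambda>x. mkpt (f x) (g x))"
  unfolding mkpt_def by (rule continuous_on_vec_lambda, rename_tac i, case_tac "i = 1") auto

lemma measurable_mkpt [measurable (raw)]:
  assumes "f \<in> borel_measurable M" "g \<in> borel_measurable M"
  shows "(\<lambda>x. mkpt (f x) (g x)) \<in> borel_measurable M"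
proof -
  have "(\<lambda>p. mkpt (fst p) (snd p)) \<in> borel_measurable (borel :: (real \<times> real) measure)"
    by (intro borel_measurable_continuous_onI continuous_mkpt continuous_intros)
  from measurable_compose[OF borel_measurable_Pair[OF assms] this] show ?thesis by simp
qed

lemma measurable_nth [measurable (raw)]:
  "f \<in> borel_measurable M \<Longrightarrow> (\<lambda>x. (f x :: pt) $ i) \<in> borel_measurable M"
  by (erule measurable_compose) (intro borel_measurable_continuous_onI continuous_intros)

text \<open>Boxes determine Lebesgue measure, so only volumes have to be compared. This carries
  Fubini's theorem from pairs of reals to vectors, on which all integration along families of
  segments rests.\<close>

lemma lborel_pt: "(lborel :: pt measure) = distr (lborel \<Otimes>\<^sub>M lborel) borel (\<lambda>(s, t). mkpt s t)"
proof (rule lborel_eqI)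
  fix l u :: pt assume lu: "\<And>b. b \<in> Basis \<Longrightarrow> l \<bullet> b \<le> u \<bullet> b"
  have le: "l $ i \<le> u $ i" for i
    using lu[of "axis i 1"] by (simp add: inner_axis axis_in_Basis_iff)
  have "emeasure (distr (lborel \<Otimes>\<^sub>M lborel) borel (\<lambda>(s, t). mkpt s t)) (box l u)
      = emeasure (lborel \<Otimes>\<^sub>M lborel) ({l $ 1<..<u $ 1} \<times> {l $ 2<..<u $ 2})"
    by (subst emeasure_distr) (auto simp: mem_box_pt space_pair_measure split_beta
        intro!: arg_cong2[where f=emeasure])
  also have "\<dots> = ennreal (u $ 1 - l $ 1) * ennreal (u $ 2 - l $ 2)"
    by (subst lborel.emeasure_pair_measure_Times) (use le in auto)
  also have "\<dots> = ennreal (\<Prod>i\<in>UNIV. (u - l) $ i)"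
    using le by (simp add: UNIV_2 ennreal_mult)
  also have "(\<Prod>i\<in>UNIV. (u - l) $ i) = (\<Prod>b\<in>Basis. (u - l) \<bullet> b)"
  proof -
    have B: "(Basis :: pt set) = (\<lambda>i. axis i 1) ` UNIV" by (auto simp: Basis_vec_def)
    have inj: "inj (\<lambda>i::2. axis i (1::real))" by (auto simp: inj_on_def axis_eq_axis)
    show ?thesis unfolding B by (subst prod.reindex[OF inj]) (simp add: inner_axis)
  qed
  finally show "emeasure (distr (lborel \<Otimes>\<^sub>M lborel) borel (\<lambda>(s, t). mkpt s t)) (box l u) = ennreal (\<Prod>b\<in>Basis. (u - l) \<bullet> b)" .
qed simp

lemma nn_integral_pt:
  assumes [measurable]: "f \<in> borel_measurable borel"
  shows "(\<integral>\<^sup>+x. f x \<partial>(lborel :: pt measure)) = (\<integral>\<^sup>+s. \<integral>\<^sup>+t. f (mkpt s t) \<partial>lborel \<partial>lborel)"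
proof -
  have "(\<integral>\<^sup>+x. f x \<partial>(lborel :: pt measure)) = (\<integral>\<^sup>+p. f (case p of (s, t) \<Rightarrow> mkpt s t) \<partial>(lborel \<Otimes>\<^sub>M lborel))"
    by (subst lborel_pt, subst nn_integral_distr) (auto simp: split_beta)
  also have "\<dots> = (\<integral>\<^sup>+s. \<integral>\<^sup>+t. f (mkpt s t) \<partial>lborel \<partial>lborel)"
    by (subst lborel.nn_integral_fst[symmetric]) (auto simp: split_beta)
  finally show ?thesis .
qed

lemma nn_integral_pt_swap:
  assumes [measurable]: "f \<in> borel_measurable borel"
  shows "(\<integral>\<^sup>+x. f x \<partial>(lborel :: pt measure)) = (\<integral>\<^sup>+t. \<integral>\<^sup>+s. f (mkpt s t) \<partial>lborel \<partial>lborel)"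
  unfolding nn_integral_pt[OF assms]
  by (rule lborel_pair.Fubini') (simp add: split_beta)

lemma nn_integral_affine_real:
  assumes [measurable]: "f \<in> borel_measurable borel" and "c \<noteq> 0"
  shows "(\<integral>\<^sup>+t. f (a + c * t) \<partial>lborel) = ennreal (1 / \<bar>c\<bar>) * (\<integral>\<^sup>+t. f t \<partial>lborel)"
proof -
  have "ennreal (1 / \<bar>c\<bar>) * (\<integral>\<^sup>+t. f t \<partial>lborel) = ennreal (1 / \<bar>c\<bar>) * (ennreal \<bar>c\<bar> * (\<integral>\<^sup>+t. f (a + c * t) \<partial>lborel))"
    using nn_integral_real_affine[of f c a] assms by simp
  also have "\<dots> = (\<integral>\<^sup>+t. f (a + c * t) \<partial>lborel)"
    using assms(2) by (simp add: mult.assoc[symmetric] ennreal_mult[symmetric])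
  finally show ?thesis by simp
qed

lemma nn_integral_scale_pt:
  fixes f :: "pt \<Rightarrow> ennreal"
  assumes [measurable]: "f \<in> borel_measurable borel" and "c > 0"
  shows "(\<integral>\<^sup>+x. f (a + c *\<^sub>R x) \<partial>lborel) = ennreal (1 / c\<^sup>2) * (\<integral>\<^sup>+x. f x \<partial>lborel)"
proof -
  have v: "a + c *\<^sub>R mkpt s t = mkpt (a $ 1 + c * s) (a $ 2 + c * t)" for s t
    by (rule mkpt_eqI) auto
  have "(\<integral>\<^sup>+x. f (a + c *\<^sub>R x) \<partial>lborel) = (\<integral>\<^sup>+s. \<integral>\<^sup>+t. f (mkpt (a $ 1 + c * s) (a $ 2 + c * t)) \<partial>lborel \<partial>lborel)"
    by (subst nn_integral_pt) (auto simp: v)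
  also have "\<dots> = (\<integral>\<^sup>+s. ennreal (1 / c) * (\<integral>\<^sup>+t. f (mkpt (a $ 1 + c * s) t) \<partial>lborel) \<partial>lborel)"
    using nn_integral_affine_real[of "\<lambda>t. f (mkpt s t)" c "a $ 2" for s] assms(2) by simp
  also have "\<dots> = ennreal (1 / c) * (\<integral>\<^sup>+s. (\<integral>\<^sup>+t. f (mkpt (a $ 1 + c * s) t) \<partial>lborel) \<partial>lborel)"
    by (rule nn_integral_cmult) measurable
  also have "\<dots> = ennreal (1 / c) * (ennreal (1 / c) * (\<integral>\<^sup>+s. \<integral>\<^sup>+t. f (mkpt s t) \<partial>lborel \<partial>lborel))"
    using nn_integral_affine_real[of "\<lambda>s. \<integral>\<^sup>+t. f (mkpt s t) \<partial>lborel" c "a $ 1"] assms(2) by simp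
  also have "\<dots> = ennreal (1 / c\<^sup>2) * (\<integral>\<^sup>+x. f x \<partial>lborel)"
    using assms(2) by (simp add: nn_integral_pt mult.assoc[symmetric] ennreal_mult[symmetric] power2_eq_square)
  finally show ?thesis .
qed

text \<open>The affine change of variables is done by two one-dimensional substitutions: t is traded
  for the first coordinate u, and, after exchanging the integrals, s for the second coordinate,
  which has slope k in s. The product d1 k is the determinant.\<close>

lemma nn_integral_shear_aux:
  fixes f :: "pt \<Rightarrow> ennreal"
  assumes [measurable]: "f \<in> borel_measurable borel" and d: "d1 \<noteq> 0" and det: "d1 * q2 - d2 * q1 \<noteq> 0"
  shows "(\<integral>\<^sup>+s. \<integral>\<^sup>+t. f (mkpt (a1 + t * d1 + s * q1) (a2 + t * d2 + s * q2)) \<partial>lborel \<partial>lborel)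
    = ennreal (1 / \<bar>d1 * q2 - d2 * q1\<bar>) * (\<integral>\<^sup>+x. f x \<partial>lborel)"
proof -
  define k where "k = q2 - d2 * q1 / d1"
  have k: "k \<noteq> 0" using det d by (auto simp: k_def field_simps)
  have arg: "a2 + ((a1 + t * d1 + s * q1) - a1) * d2 / d1 + k * s = a2 + t * d2 + s * q2"
    "a1 + s * q1 + d1 * t = a1 + t * d1 + s * q1" for s t
    using d by (simp_all add: k_def field_simps)
  have "(\<integral>\<^sup>+t. f (mkpt (a1 + t * d1 + s * q1) (a2 + t * d2 + s * q2)) \<partial>lborel) =
      ennreal (1 / \<bar>d1\<bar>) * (\<integral>\<^sup>+u. f (mkpt u ((a2 + (u - a1) * d2 / d1) + k * s)) \<partial>lborel)" for s
    using nn_integral_affine_real[of "\<lambda>u. f (mkpt u ((a2 + (u - a1) * d2 / d1) + k * s))" d1 "a1 + s * q1", OF _ d]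
    unfolding arg(2) arg(1) by simp
  then have "(\<integral>\<^sup>+s. \<integral>\<^sup>+t. f (mkpt (a1 + t * d1 + s * q1) (a2 + t * d2 + s * q2)) \<partial>lborel \<partial>lborel)
    = (\<integral>\<^sup>+s. ennreal (1 / \<bar>d1\<bar>) * (\<integral>\<^sup>+u. f (mkpt u ((a2 + (u - a1) * d2 / d1) + k * s)) \<partial>lborel) \<partial>lborel)"
    by simp
  also have "\<dots> = ennreal (1 / \<bar>d1\<bar>) * (\<integral>\<^sup>+s. (\<integral>\<^sup>+u. f (mkpt u ((a2 + (u - a1) * d2 / d1) + k * s)) \<partial>lborel) \<partial>lborel)"
    by (rule nn_integral_cmult) measurable
  also have "(\<integral>\<^sup>+s. (\<integral>\<^sup>+u. f (mkpt u ((a2 + (u - a1) * d2 / d1) + k * s)) \<partial>lborel) \<partial>lborel)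
      = (\<integral>\<^sup>+u. (\<integral>\<^sup>+s. f (mkpt u ((a2 + (u - a1) * d2 / d1) + k * s)) \<partial>lborel) \<partial>lborel)"
    by (rule lborel_pair.Fubini') (simp add: split_beta)
  also have "\<dots> = (\<integral>\<^sup>+u. ennreal (1 / \<bar>k\<bar>) * (\<integral>\<^sup>+s. f (mkpt u s) \<partial>lborel) \<partial>lborel)"
    using nn_integral_affine_real[of "\<lambda>s. f (mkpt u s)" k for u] k by simp
  also have "\<dots> = ennreal (1 / \<bar>k\<bar>) * (\<integral>\<^sup>+x. f x \<partial>lborel)"
    by (subst nn_integral_cmult) (auto simp: nn_integral_pt)
  also have "ennreal (1 / \<bar>d1\<bar>) * (ennreal (1 / \<bar>k\<bar>) * (\<integral>\<^sup>+x. f x \<partial>lborel)) = ennreal (1 / \<bar>d1 * q2 - d2 * q1\<bar>) * (\<integral>\<^sup>+x. f x \<partial>lborel)"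
  proof -
    have "d1 * q2 - d2 * q1 = d1 * k" using d by (simp add: k_def field_simps)
    then show ?thesis by (simp add: mult.assoc[symmetric] ennreal_mult[symmetric] abs_mult)
  qed
  finally show ?thesis .
qed

lemma nn_integral_shear:
  fixes f :: "pt \<Rightarrow> ennreal" and a d q :: pt
  assumes [measurable]: "f \<in> borel_measurable borel" and det: "d $ 1 * q $ 2 - d $ 2 * q $ 1 \<noteq> 0"
  shows "(\<integral>\<^sup>+s. \<integral>\<^sup>+t. f (a + t *\<^sub>R d + s *\<^sub>R q) \<partial>lborel \<partial>lborel)
    = ennreal (1 / \<bar>d $ 1 * q $ 2 - d $ 2 * q $ 1\<bar>) * (\<integral>\<^sup>+x. f x \<partial>lborel)"
proof -
  have v: "a + t *\<^sub>R d + s *\<^sub>R q = mkpt (a $ 1 + t * d $ 1 + s * q $ 1) (a $ 2 + t * d $ 2 + s * q $ 2)" for s t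
    by (rule mkpt_eqI) auto
  show ?thesis
  proof (cases "d $ 1 = 0")
    case False
    show ?thesis unfolding v by (rule nn_integral_shear_aux[OF assms(1) False det])
  next
    case True
    \<comment> \<open>When d is vertical, d and q exchange roles at the price of Fubini and of a
      sign in the determinant.\<close>
    then have q: "q $ 1 \<noteq> 0" using det by auto
    have "(\<integral>\<^sup>+s. \<integral>\<^sup>+t. f (a + t *\<^sub>R d + s *\<^sub>R q) \<partial>lborel \<partial>lborel) = (\<integral>\<^sup>+t. \<integral>\<^sup>+s. f (a + t *\<^sub>R d + s *\<^sub>R q) \<partial>lborel \<partial>lborel)"
      by (rule lborel_pair.Fubini') (simp add: split_beta)
    also have "\<dots> = (\<integral>\<^sup>+t. \<integral>\<^sup>+s. f (mkpt (a $ 1 + s * q $ 1 + t * d $ 1) (a $ 2 + s * q $ 2 + t * d $ 2)) \<partial>lborel \<partial>lborel)"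
      unfolding v by (simp add: add_ac)
    also have "\<dots> = ennreal (1 / \<bar>q $ 1 * d $ 2 - q $ 2 * d $ 1\<bar>) * (\<integral>\<^sup>+x. f x \<partial>lborel)"
      by (rule nn_integral_shear_aux[OF assms(1) q]) (use det in \<open>simp add: mult.commute\<close>)
    also have "\<bar>q $ 1 * d $ 2 - q $ 2 * d $ 1\<bar> = \<bar>d $ 1 * q $ 2 - d $ 2 * q $ 1\<bar>"
      by (simp add: abs_minus_commute mult.commute)
    finally show ?thesis .
  qed
qed

section \<open>Square integrable functions\<close>

lemma L2_measurable: "f \<in> L2 M \<Longrightarrow> f \<in> borel_measurable M"
  by (simp add: L2_def)

lemma L2_integrable_mult:
  assumes "f \<in> L2 M" "g \<in> L2 M"
  shows "integrable M (\<lambda>x. f x * g x)"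
proof (rule Bochner_Integration.integrable_bound)
  show "integrable M (\<lambda>x. (f x)\<^sup>2 + (g x)\<^sup>2)" using assms by (simp add: L2_def)
  show "(\<lambda>x. f x * g x) \<in> borel_measurable M" using assms by (auto simp: L2_def)
  have "\<bar>a * b\<bar> \<le> a\<^sup>2 + b\<^sup>2" for a b :: real
  proof -
    have "2 * (\<bar>a\<bar> * \<bar>b\<bar>) \<le> a\<^sup>2 + b\<^sup>2"
      using sum_squares_bound[of "\<bar>a\<bar>" "\<bar>b\<bar>"] by simp
    moreover have "0 \<le> \<bar>a\<bar> * \<bar>b\<bar>" by simp
    ultimately show ?thesis unfolding abs_mult by linarith
  qed
  then show "AE x in M. norm (f x * g x) \<le> norm ((f x)\<^sup>2 + (g x)\<^sup>2)" by simp
qed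

lemma semi_inner_L2: "semi_inner (L2 M) (L2_inner M)"
proof
  show "(\<lambda>x. 0) \<in> L2 M" by (simp add: L2_def)
  fix v w assume vw: "v \<in> L2 M" "w \<in> L2 M"
  have [measurable]: "v \<in> borel_measurable M" "w \<in> borel_measurable M"
    using vw by (auto simp: L2_def)
  have "integrable M (\<lambda>x. (v x)\<^sup>2 + 2 * (v x * w x) + (w x)\<^sup>2)"
    using vw L2_integrable_mult[OF vw] by (simp add: L2_def)
  then show "(\<lambda>x. v x + w x) \<in> L2 M"
    by (simp add: L2_def power2_sum algebra_simps)
  show "L2_inner M v w = L2_inner M w v" by (simp add: L2_inner_def mult.commute)
  fix z assume "z \<in> L2 M"
  then show "L2_inner M (\<lambda>x. v x + w x) z = L2_inner M v z + L2_inner M w z"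
    using vw by (simp add: L2_inner_def distrib_right L2_integrable_mult)
next
  fix v c assume v: "v \<in> L2 M"
  then show "(\<lambda>x. c * v x) \<in> L2 M" by (auto simp: L2_def power_mult_distrib)
  show "0 \<le> L2_inner M v v" by (simp add: L2_inner_def)
  fix z
  show "L2_inner M (\<lambda>x. c * v x) z = c * L2_inner M v z"
    by (simp add: L2_inner_def mult.assoc)
qed

lemma L2_nrm_eq: "semi_inner.nrm (L2_inner M) f = L2_nrm M f"
  using semi_inner.nrm_def[OF semi_inner_L2] by (simp add: L2_nrm_def)

lemma L2_nrm_sq: "(L2_nrm M f)\<^sup>2 = L2_inner M f f"
  by (simp add: L2_nrm_def L2_inner_def)

lemma nn_integral_L2: "f \<in> L2 M \<Longrightarrow> (\<integral>\<^sup>+x. ennreal ((f x)\<^sup>2) \<partial>M) = ennreal (L2_inner M f f)"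
  by (subst nn_integral_eq_integral) (auto simp: L2_def L2_inner_def power2_eq_square)

lemma L2_I:
  assumes "f \<in> borel_measurable M" "(\<integral>\<^sup>+x. ennreal ((f x)\<^sup>2) \<partial>M) \<le> ennreal c"
  shows "f \<in> L2 M"
proof -
  have "(\<integral>\<^sup>+x. ennreal (norm ((f x)\<^sup>2)) \<partial>M) < \<infinity>"
    using assms(2) by (simp add: le_less_trans)
  then show ?thesis using assms(1) by (simp add: L2_def integrable_iff_bounded)
qed

lemma L2_bounded:
  assumes "finite_measure M" "f \<in> borel_measurable M" "\<And>x. x \<in> space M \<Longrightarrow> \<bar>f x\<bar> \<le> B"
  shows "f \<in> L2 M"
proof -
  have "integrable M (\<lambda>x. (f x)\<^sup>2)"
    by (rule finite_measure.integrable_const_bound[OF assms(1), of _ "B\<^sup>2"])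
      (use assms in \<open>auto intro!: AE_I2 simp: abs_le_square_iff[symmetric] intro: order_trans[OF _ abs_ge_self]\<close>)
  then show ?thesis using assms by (simp add: L2_def)
qed

lemma L2_AE_cong:
  assumes "AE x in M. f x = g x" "f \<in> borel_measurable M" "g \<in> borel_measurable M" "h \<in> borel_measurable M"
  shows "L2_inner M f h = L2_inner M g h"
  unfolding L2_inner_def by (rule integral_cong_AE) (use assms in auto)

lemma L2_null_iff:
  assumes "f \<in> L2 M" shows "L2_inner M f f = 0 \<longleftrightarrow> (AE x in M. f x = 0)"
proof -
  have "L2_inner M f f = 0 \<longleftrightarrow> (AE x in M. f x * f x = 0)"
    unfolding L2_inner_def using L2_integrable_mult[OF assms assms]
    by (intro integral_nonneg_eq_0_iff_AE) auto
  then show ?thesis by simp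
qed

lemma L2_integrable:
  assumes "finite_measure M" "f \<in> L2 M" shows "integrable M f"
  using L2_integrable_mult[OF assms(2), of "\<lambda>_. 1"] L2_bounded[OF assms(1), of "\<lambda>_. 1" 1] by simp

text \<open>Riesz-Fischer. A subsequence with geometrically small steps converges almost everywhere,
  because on a finite measure space its steps are summable in L1; Fatou's lemma then gives norm
  convergence of the whole sequence.\<close>

lemma L2_complete:
  assumes M: "finite_measure M" and f: "\<And>n. f n \<in> L2 M"
    and cauchy: "\<And>e. e > 0 \<Longrightarrow> \<exists>N. \<forall>m\<ge>N. \<forall>n\<ge>N. L2_nrm M (\<lambda>x. f m x - f n x) < e"
  shows "\<exists>g\<in>L2 M. (\<lambda>n::nat. L2_nrm M (\<lambda>x. f n x - g x)) \<longlonglongrightarrow> 0"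
proof -
  interpret semi_inner "L2 M" "L2_inner M" by (rule semi_inner_L2)
  interpret finite_measure M by fact
  have fm [measurable]: "f n \<in> borel_measurable M" for n using f by (rule L2_measurable)
  have "\<forall>k. \<exists>N. \<forall>m\<ge>N. \<forall>n\<ge>N. L2_nrm M (\<lambda>x. f m x - f n x) < (1/2)^k"
    using cauchy by simp
  then obtain N where N: "\<And>k m n. m \<ge> N k \<Longrightarrow> n \<ge> N k \<Longrightarrow> L2_nrm M (\<lambda>x. f m x - f n x) < (1/2)^k"
    by metis
  \<comment> \<open>Summing the \<open>N i\<close> and adding k produces indices that increase and
    stay beyond every \<open>N k\<close>.\<close>
  define r where "r k = (\<Sum>i\<le>k. N i) + k" for k
  have rN: "r k \<ge> N k" for k
    unfolding r_def by (simp add: trans_le_add1 member_le_sum)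
  have rmono: "r k \<le> r (Suc k)" for k by (simp add: r_def)
  have rmono': "k \<le> l \<Longrightarrow> r k \<le> r l" for k l by (rule lift_Suc_mono_le[of r, OF rmono])
  define d where "d k x = f (r (Suc k)) x - f (r k) x" for k x
  have dL: "d k \<in> L2 M" for k unfolding d_def by (intro diff_mem f)
  have dm [measurable]: "d k \<in> borel_measurable M" for k using dL by (rule L2_measurable)
  have absL: "(\<lambda>x. \<bar>d k x\<bar>) \<in> L2 M" for k using dL[of k] by (simp add: L2_def)
  have oneL: "(\<lambda>x. 1) \<in> L2 M" by (rule L2_bounded[OF M]) auto
  define c where "c = L2_nrm M (\<lambda>x. 1)"
  have c0: "c \<ge> 0" using nrm_nonneg[OF oneL] by (simp add: c_def L2_nrm_eq)
  have dint: "(\<integral>\<^sup>+x. ennreal \<bar>d k x\<bar> \<partial>M) \<le> ennreal (c * (1/2)^k)" for k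
  proof -
    have "(\<integral>\<^sup>+x. ennreal \<bar>d k x\<bar> \<partial>M) = ennreal (L2_inner M (\<lambda>x. \<bar>d k x\<bar>) (\<lambda>x. 1))"
      using L2_integrable[OF M absL[of k]] by (simp add: nn_integral_eq_integral L2_inner_def)
    moreover have "\<bar>L2_inner M (\<lambda>x. \<bar>d k x\<bar>) (\<lambda>x. 1)\<bar> \<le> L2_nrm M (\<lambda>x. \<bar>d k x\<bar>) * c"
      using abs_le_nrm[OF absL oneL] by (simp add: L2_nrm_eq c_def)
    moreover have "L2_nrm M (\<lambda>x. \<bar>d k x\<bar>) = L2_nrm M (\<lambda>x. f (r (Suc k)) x - f (r k) x)"
      by (simp add: L2_nrm_def L2_inner_def d_def)
    moreover have "\<dots> \<le> (1/2)^k"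
      using N[of k "r (Suc k)" "r k"] rN[of k] rmono[of k] by simp
    ultimately have "L2_inner M (\<lambda>x. \<bar>d k x\<bar>) (\<lambda>x. 1) \<le> c * (1/2)^k"
      using mult_right_mono[of "L2_nrm M (\<lambda>x. \<bar>d k x\<bar>)" "(1/2)^k" c] c0 by (simp add: mult.commute)
    then show ?thesis
      using \<open>(\<integral>\<^sup>+x. ennreal \<bar>d k x\<bar> \<partial>M) = _\<close> by (simp add: ennreal_leI)
  qed
  have "(\<integral>\<^sup>+x. (\<Sum>k. ennreal \<bar>d k x\<bar>) \<partial>M) = (\<Sum>k. \<integral>\<^sup>+x. ennreal \<bar>d k x\<bar> \<partial>M)"
    by (rule nn_integral_suminf) measurable
  also have "\<dots> \<le> (\<Sum>k. ennreal (c * (1/2)^k))"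
    by (intro suminf_le dint) auto
  also have "\<dots> = ennreal (\<Sum>k. c * (1/2)^k)"
    by (rule suminf_ennreal2) (use c0 in \<open>auto intro!: summable_mult summable_geometric\<close>)
  finally have "(\<integral>\<^sup>+x. (\<Sum>k. ennreal \<bar>d k x\<bar>) \<partial>M) \<noteq> \<infinity>"
    by (metis ennreal_neq_top infinity_ennreal_def top.extremum_unique)
  then have "AE x in M. (\<Sum>k. ennreal \<bar>d k x\<bar>) \<noteq> \<infinity>"
    by (intro nn_integral_PInf_AE) measurable
  then have conv: "AE x in M. (\<lambda>k. f (r k) x) \<longlonglongrightarrow> lim (\<lambda>k. f (r k) x)"
  proof (rule AE_mp, intro AE_I2 impI)
    fix x assume "(\<Sum>k. ennreal \<bar>d k x\<bar>) \<noteq> \<infinity>"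
    then have "summable (\<lambda>k. \<bar>d k x\<bar>)"
      by (intro summable_suminf_not_top) auto
    then have "summable (\<lambda>k. f (r (Suc k)) x - f (r k) x)"
      unfolding d_def by (rule summable_rabs_cancel)
    then have "convergent (\<lambda>k. f (r k) x)"
      unfolding summable_iff_convergent sum_lessThan_telescope[of "\<lambda>i. f (r i) x"] by (simp add: convergent_diff_const_right_iff)
    then show "(\<lambda>k. f (r k) x) \<longlonglongrightarrow> lim (\<lambda>k. f (r k) x)"
      by (simp add: convergent_LIMSEQ_iff)
  qed
  \<comment> \<open>Where the subsequence diverges \<open>lim\<close> is arbitrary, but that set is
    null and g is measurable all the same.\<close>
  define g where "g x = lim (\<lambda>k. f (r k) x)" for x
  have gm [measurable]: "g \<in> borel_measurable M" unfolding g_def by measurable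
  have fat: "(\<integral>\<^sup>+x. ennreal ((f n x - g x)\<^sup>2) \<partial>M) \<le> ennreal (((1/2)^k)\<^sup>2)" if n: "n \<ge> N k" for n k
  proof -
    have "(\<integral>\<^sup>+x. ennreal ((f n x - g x)\<^sup>2) \<partial>M) = (\<integral>\<^sup>+x. liminf (\<lambda>j. ennreal ((f n x - f (r j) x)\<^sup>2)) \<partial>M)"
    proof (rule nn_integral_cong_AE, rule AE_mp[OF conv], intro AE_I2 impI)
      fix x assume "(\<lambda>k. f (r k) x) \<longlonglongrightarrow> lim (\<lambda>k. f (r k) x)"
      then have "(\<lambda>j. ennreal ((f n x - f (r j) x)\<^sup>2)) \<longlonglongrightarrow> ennreal ((f n x - g x)\<^sup>2)"
        unfolding g_def by (intro tendsto_intros)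
      then show "ennreal ((f n x - g x)\<^sup>2) = liminf (\<lambda>j. ennreal ((f n x - f (r j) x)\<^sup>2))"
        by (rule lim_imp_Liminf[OF sequentially_bot, symmetric])
    qed
    also have "\<dots> \<le> liminf (\<lambda>j. \<integral>\<^sup>+x. ennreal ((f n x - f (r j) x)\<^sup>2) \<partial>M)"
      by (rule nn_integral_liminf) measurable
    also have "\<dots> \<le> liminf (\<lambda>j::nat. ennreal (((1/2)^k)\<^sup>2))"
    proof (rule Liminf_mono, rule eventually_sequentiallyI[of k])
      fix j assume "k \<le> j"
      then have "r j \<ge> N k" using rN[of k] rmono' order_trans by blast
      then have lt: "L2_nrm M (\<lambda>x. f n x - f (r j) x) < (1/2)^k" using n N by blast
      have "(\<integral>\<^sup>+x. ennreal ((f n x - f (r j) x)\<^sup>2) \<partial>M) = ennreal ((L2_nrm M (\<lambda>x. f n x - f (r j) x))\<^sup>2)"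
        using nn_integral_L2[OF diff_mem[OF f f, of n "r j"]] by (simp add: L2_nrm_sq)
      also have "\<dots> \<le> ennreal (((1/2)^k)\<^sup>2)"
        using lt nrm_nonneg[OF diff_mem[OF f f, of n "r j"]]
        by (intro ennreal_leI power_mono) (auto simp: L2_nrm_eq)
      finally show "(\<integral>\<^sup>+x. ennreal ((f n x - f (r j) x)\<^sup>2) \<partial>M) \<le> ennreal (((1/2)^k)\<^sup>2)" .
    qed
    finally show ?thesis by (simp add: Liminf_const)
  qed
  have dg: "(\<lambda>x. f n x - g x) \<in> L2 M" if "n \<ge> N k" for n k
    using fat[OF that] by (intro L2_I) measurable
  have gL: "g \<in> L2 M"
    using diff_mem[OF f[of "N 0"] dg[of 0 "N 0"]] by simp
  have "(\<lambda>n. L2_nrm M (\<lambda>x. f n x - g x)) \<longlonglongrightarrow> 0"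
  proof (rule LIMSEQ_I)
    fix e :: real assume "e > 0"
    then obtain k where k: "(1/2)^k < e"
      using real_arch_pow_inv[of e "1/2"] by auto
    have "norm (L2_nrm M (\<lambda>x. f n x - g x) - 0) < e" if n: "n \<ge> N k" for n
    proof -
      have "ennreal (L2_inner M (\<lambda>x. f n x - g x) (\<lambda>x. f n x - g x)) \<le> ennreal (((1/2)^k)\<^sup>2)"
        using fat[OF n] nn_integral_L2[OF dg[OF n]] by simp
      then have "(L2_nrm M (\<lambda>x. f n x - g x))\<^sup>2 \<le> ((1/2)^k)\<^sup>2"
        by (simp add: L2_nrm_sq)
      then have "L2_nrm M (\<lambda>x. f n x - g x) \<le> (1/2)^k"
        by (rule power2_le_imp_le) simp
      moreover have "L2_nrm M (\<lambda>x. f n x - g x) \<ge> 0"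
        using nrm_nonneg[OF dg[OF n]] by (simp add: L2_nrm_eq)
      ultimately show ?thesis using k by simp
    qed
    then show "\<exists>no. \<forall>n\<ge>no. norm (L2_nrm M (\<lambda>x. f n x - g x) - 0) < e" by blast
  qed
  then show ?thesis using gL by blast
qed

section \<open>Weak gradients\<close>

locale plane_domain =
  fixes \<Omega> :: "pt set"
  assumes open_dom: "open \<Omega>" and bounded_dom: "bounded \<Omega>"
begin

abbreviation "M \<equiv> lebesgue_on \<Omega>"

lemma dom_sets [measurable]: "\<Omega> \<in> sets lebesgue" "\<Omega> \<in> sets borel"
  using open_dom by auto

lemma finite_M: "finite_measure M"
  using open_dom bounded_dom by (intro finite_measure_lebesgue_on) (simp add: bounded_set_imp_lmeasurable)

lemma measurable_M: "f \<in> borel_measurable borel \<Longrightarrow> f \<in> borel_measurable M"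
  by (simp add: measurable_completion measurable_restrict_space1)

lemma compact_closure: "compact (closure \<Omega>)"
  using bounded_dom by (simp add: compact_eq_bounded_closed bounded_closure)

lemma measurable_M_continuous:
  fixes f :: "pt \<Rightarrow> 'b::euclidean_space"
  assumes "continuous_on \<Omega> f" shows "f \<in> borel_measurable M"
  using assms by (intro continuous_imp_measurable_on_sets_lebesgue) auto

lemma L2_continuous:
  assumes "continuous_on (closure \<Omega>) f" shows "f \<in> L2 M"
proof -
  have "bounded (f ` closure \<Omega>)"
    using compact_continuous_image[OF assms compact_closure] by (rule compact_imp_bounded)
  then obtain B where "\<And>x. x \<in> closure \<Omega> \<Longrightarrow> \<bar>f x\<bar> \<le> B" by (auto simp: bounded_iff)
  then show ?thesis
    using closure_subset[of \<Omega>] assms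
    by (intro L2_bounded[OF finite_M, of _ B] measurable_M_continuous) (auto intro: continuous_on_subset)
qed

lemma test_family_continuous:
  assumes "test_family U D" shows "continuous_on A (D i j)"
proof -
  have "continuous_on UNIV (D i j)"
    using assms unfolding test_family_def deriv_family_def
    by (auto intro!: continuous_at_imp_continuous_on has_derivative_continuous)
  then show ?thesis by (rule continuous_on_subset) simp
qed

lemma test_family_L2: "test_family U D \<Longrightarrow> D i j \<in> L2 M"
  by (intro L2_continuous test_family_continuous)

lemma integral_M:
  fixes f :: "pt \<Rightarrow> real"
  shows "(LINT x|M. f x) = (LINT x|lebesgue. indicator \<Omega> x * f x)"
  by (subst integral_restrict_space) auto

lemma nn_integral_M:
  shows "(\<integral>\<^sup>+x. f x \<partial>M) = (\<integral>\<^sup>+x. f x * indicator \<Omega> x \<partial>lebesgue)"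
  by (subst nn_integral_restrict_space) auto

lemma nn_integral_M_borel:
  assumes "f \<in> borel_measurable borel"
  shows "(\<integral>\<^sup>+x. f x \<partial>M) = (\<integral>\<^sup>+x. f x * indicator \<Omega> x \<partial>lborel)"
  unfolding nn_integral_M using assms by (intro nn_integral_completion) measurable

lemma AE_M: "(AE x in M. P x) \<longleftrightarrow> (AE x in lebesgue. x \<in> \<Omega> \<longrightarrow> P x)"
  by (subst AE_restrict_space_iff) auto

lemma borel_representative:
  fixes f :: "pt \<Rightarrow> real"
  assumes "f \<in> borel_measurable M"
  obtains g where "g \<in> borel_measurable borel" "AE x in M. f x = g x"
proof -
  have "(\<lambda>x. indicator \<Omega> x * f x) \<in> borel_measurable lebesgue"
    using assms by (subst (asm) borel_measurable_restrict_space_iff) auto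
  from completion_ex_borel_measurable_real[OF this]
  obtain g where "g \<in> borel_measurable lborel" "AE x in lborel. indicator \<Omega> x * f x = g x" by blast
  then show ?thesis
    by (intro that[of g]) (auto simp: AE_M intro!: AE_completion elim!: eventually_mono)
qed

text \<open>The bumps on the box are test functions bounded by 1 that converge to its indicator, so
  dominated convergence applies with majorant |f|, which is integrable as the domain has finite
  measure.\<close>

lemma integral_box_zero:
  assumes f: "f \<in> L2 M" and zero: "\<And>D. test_family \<Omega> D \<Longrightarrow> (LINT x|M. f x * D 0 0 x) = 0"
    and box: "cbox a b \<subseteq> \<Omega>"
  shows "(LINT x|M. f x * indicator (box a b) x) = 0"
proof -
  define \<beta> where "\<beta> n x = bump n (a $ 1) (b $ 1) (x $ 1) * bump n (a $ 2) (b $ 2) (x $ 2)" for n and x :: pt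
  have \<beta>b: "\<beta> n \<in> borel_measurable borel" for n
    unfolding \<beta>_def
    by (intro borel_measurable_continuous_onI continuous_intros continuous_on_compose2[OF continuous_on_bumps[OF bump_mem, of UNIV]]) auto
  have fm [measurable]: "f \<in> borel_measurable M" "\<And>n. \<beta> n \<in> borel_measurable M" "indicator (box a b) \<in> borel_measurable M"
    using f \<beta>b by (auto intro: L2_measurable measurable_M)
  have "(\<lambda>n. LINT x|M. f x * \<beta> n x) \<longlonglongrightarrow> (LINT x|M. f x * indicator (box a b) x)"
  proof (rule integral_dominated_convergence[where w="\<lambda>x. \<bar>f x\<bar>"])
    show "integrable M (\<lambda>x. \<bar>f x\<bar>)" using L2_integrable[OF finite_M f] by simp
    show "AE x in M. (\<lambda>n. f x * \<beta> n x) \<longlonglongrightarrow> f x * indicator (box a b) x"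
    proof (rule AE_I2)
      fix x :: pt
      have "(\<lambda>n. \<beta> n x) \<longlonglongrightarrow> indicator {a $ 1<..<b $ 1} (x $ 1) * indicator {a $ 2<..<b $ 2} (x $ 2)"
        unfolding \<beta>_def by (intro tendsto_mult bump_tendsto)
      also have "indicator {a $ 1<..<b $ 1} (x $ 1) * indicator {a $ 2<..<b $ 2} (x $ 2) = (indicator (box a b) x :: real)"
        by (auto simp: indicator_def mem_box_pt)
      finally show "(\<lambda>n. f x * \<beta> n x) \<longlonglongrightarrow> f x * indicator (box a b) x" by (intro tendsto_intros)
    qed
    show "AE x in M. norm (f x * \<beta> n x) \<le> \<bar>f x\<bar>" for n
      by (rule AE_I2) (auto simp: abs_mult \<beta>_def bump_nonneg bump_le_1 intro!: mult_left_le mult_le_one)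
  qed measurable
  moreover have "(LINT x|M. f x * \<beta> n x) = 0" for n
  proof -
    obtain D where "test_family \<Omega> D" "D 0 0 = \<beta> n"
      using test_family_bump[OF box, of n] unfolding \<beta>_def by metis
    then show ?thesis using zero by metis
  qed
  ultimately show ?thesis by (simp add: LIMSEQ_const_iff)
qed

text \<open>Boxes generate the Borel sets and are closed under intersection, so vanishing integrals
  over small boxes propagate to all Borel sets by a Dynkin argument, and a function with all
  integrals zero is a null function. Passing to a Borel function supported in the box makes this a
  statement about the plane.\<close>

lemma AE_zero_box:
  assumes f: "f \<in> L2 M" and zero: "\<And>D. test_family \<Omega> D \<Longrightarrow> (LINT x|M. f x * D 0 0 x) = 0"
    and box: "cbox a b \<subseteq> \<Omega>"
  shows "AE x in lborel. x \<in> box a b \<longrightarrow> f x = 0"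
proof -
  obtain g where g [measurable]: "g \<in> borel_measurable borel" and fg: "AE x in M. f x = g x"
    using borel_representative[OF L2_measurable[OF f]] by blast
  have fm [measurable]: "f \<in> borel_measurable M" "g \<in> borel_measurable M"
    using f g by (auto intro: L2_measurable measurable_M)
  have boxM [measurable]: "indicator (box c d) \<in> borel_measurable M" for c d :: pt
    by (intro measurable_M) simp
  define h where "h x = g x * indicator (box a b) x" for x
  have hm [measurable]: "h \<in> borel_measurable borel" unfolding h_def by measurable
  have transfer: "(LINT x|lborel. h x * indicator (box c d) x) = 0" for c d
  proof -
    \<comment> \<open>Corners of the intersection with the given box, which is again a (possibly
      empty) box inside the domain.\<close>
    define c' d' where "c' = mkpt (max (a $ 1) (c $ 1)) (max (a $ 2) (c $ 2))"
      and "d' = mkpt (min (b $ 1) (d $ 1)) (min (b $ 2) (d $ 2))"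
    have int: "box a b \<inter> box c d = box c' d'"
      by (auto simp: mem_box_pt c'_def d'_def)
    have sub: "cbox c' d' \<subseteq> \<Omega>"
      using box by (auto simp: mem_cbox_pt c'_def d'_def subset_iff)
    have "(LINT x|lborel. h x * indicator (box c d) x) = (LINT x|lebesgue. h x * indicator (box c d) x)"
      by (subst integral_completion) auto
    also have "\<dots> = (LINT x|lebesgue. indicator \<Omega> x * (g x * indicator (box c' d') x))"
      by (rule Bochner_Integration.integral_cong)
        (use box box_subset_cbox[of a b] in \<open>auto simp: h_def indicator_def int[symmetric]\<close>)
    also have "\<dots> = (LINT x|M. g x * indicator (box c' d') x)" by (simp add: integral_M)
    also have "\<dots> = (LINT x|M. f x * indicator (box c' d') x)"
      by (rule integral_cong_AE) (use fg in \<open>auto elim!: eventually_mono\<close>)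
    also have "\<dots> = 0" by (rule integral_box_zero) (use f zero sub in auto)
    finally show ?thesis .
  qed
  have hint: "integrable lborel h"
  proof -
    have "integrable M g"
      using L2_integrable[OF finite_M f] fg by (subst integrable_cong_AE[of _ _ f]) (auto elim!: eventually_mono)
    then have "integrable M (\<lambda>x. g x * indicator (box a b) x)"
      by (rule Bochner_Integration.integrable_bound) (measurable, auto simp: indicator_def)
    then have "integrable lebesgue (\<lambda>x. indicator \<Omega> x * h x)"
      by (subst (asm) integrable_restrict_space) (auto simp: h_def)
    moreover have "(\<lambda>x. indicator \<Omega> x * h x) = h"
      using box box_subset_cbox[of a b] by (auto simp: h_def indicator_def fun_eq_iff)
    ultimately show ?thesis by (simp add: integrable_completion)
  qed
  have all: "(LINT x|lborel. h x * indicator A x) = 0" if "A \<in> sets borel" for A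
  proof -
    have setsb: "sets borel = sigma_sets UNIV (range (\<lambda>(a, b). box a b :: pt set))"
      by (simp add: borel_eq_box)
    have Int_st: "Int_stable (range (\<lambda>(a, b). box a b :: pt set))"
    proof (rule Int_stableI)
      fix A B :: "pt set" assume "A \<in> range (\<lambda>(a, b). box a b)" "B \<in> range (\<lambda>(a, b). box a b)"
      then obtain a b c d where AB: "A = box a b" "B = box c d" by auto
      have "A \<inter> B = box (mkpt (max (a $ 1) (c $ 1)) (max (a $ 2) (c $ 2))) (mkpt (min (b $ 1) (d $ 1)) (min (b $ 2) (d $ 2)))"
        by (auto simp: mem_box_pt AB)
      then show "A \<inter> B \<in> range (\<lambda>(a, b). box a b)" by auto
    qed
    have i: "integrable lborel (\<lambda>x. h x * indicator A x)" if "A \<in> sets borel" for A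
      using hint by (rule Bochner_Integration.integrable_bound) (use that in \<open>auto simp: indicator_def\<close>)
    have "range (\<lambda>(a, b). box a b :: pt set) \<subseteq> Pow UNIV" by simp
    from Int_st this that[unfolded setsb] show ?thesis
    proof (induction rule: sigma_sets_induct_disjoint)
      case (basic A)
      then show ?case using transfer by auto
    next
      case empty
      then show ?case by simp
    next
      case (compl A)
      \<comment> \<open>Since h vanishes off the box, its integral over the plane is one over a box
        and hence 0; this is what the complement step needs.\<close>
      have "(\<lambda>x. h x * indicator (box a b) x) = h"
        by (auto simp: h_def indicator_def fun_eq_iff)
      then have "(LINT x|lborel. h x) = 0"
        using transfer[of a b] by simp
      then have "(LINT x|lborel. h x - h x * indicator A x) = 0"
        using compl hint i by (simp add: setsb)
      moreover have "(\<lambda>x. h x - h x * indicator A x) = (\<lambda>x. h x * indicator (UNIV - A) x)"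
        by (auto simp: indicator_def)
      ultimately show ?case by simp
    next
      case (union A)
      have Ab: "A k \<in> sets borel" for k using union(2) by (auto simp: setsb)
      have "(LINT x:(\<Union>k. A k)|lborel. h x) = (\<Sum>k. LINT x:A k|lborel. h x)"
        by (rule lebesgue_integral_countable_add)
          (use Ab union(1) i[of "\<Union>k. A k"] in \<open>auto simp: disjoint_family_on_def set_integrable_def mult.commute\<close>)
      then show ?case using union(3) by (simp add: set_lebesgue_integral_def mult.commute)
    qed
  qed
  have "AE x in lborel. h x = 0"
    by (rule sigma_finite_measure.density_zero[OF sigma_finite_lborel hint]) (use all in \<open>auto simp: set_lebesgue_integral_def mult.commute\<close>)
  moreover have "AE x in lborel. x \<in> \<Omega> \<longrightarrow> f x = g x"
    using fg unfolding AE_M by (simp add: AE_completion_iff)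
  ultimately show ?thesis
    by eventually_elim (use box box_subset_cbox[of a b] in \<open>auto simp: h_def\<close>)
qed

text \<open>The fundamental lemma of the calculus of variations. By Lindelof countably many
  admissible boxes cover the domain, so the exceptional null sets of \<open>AE_zero_box\<close> can
  be united. Uniqueness of weak gradients follows from it.\<close>

lemma AE_zero_if_tests_zero:
  assumes f: "f \<in> L2 M" and zero: "\<And>D. test_family \<Omega> D \<Longrightarrow> (LINT x|M. f x * D 0 0 x) = 0"
  shows "AE x in M. f x = 0"
proof -
  define F where "F = {box a b | a b. cbox a b \<subseteq> \<Omega>}"
  have "open S" if "S \<in> F" for S using that by (auto simp: F_def open_box)
  then obtain F' where F': "F' \<subseteq> F" "countable F'" "\<Union>F' = \<Union>F" using Lindelof by blast
  have "AE x in lborel. x \<in> S \<longrightarrow> f x = 0" if "S \<in> F'" for S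
    using that F'(1) by (auto simp: F_def intro!: AE_zero_box f zero)
  then have "AE x in lborel. \<forall>S\<in>F'. x \<in> S \<longrightarrow> f x = 0"
    using F'(2) by (rule AE_ball_countable')
  moreover have "\<Omega> \<subseteq> \<Union>F"
  proof
    fix x assume "x \<in> \<Omega>"
    then obtain a b where "x \<in> box a b" "cbox a b \<subseteq> \<Omega>"
      using open_contains_cbox[of \<Omega>] open_dom by blast
    then show "x \<in> \<Union>F" unfolding F_def by blast
  qed
  ultimately have "AE x in lborel. x \<in> \<Omega> \<longrightarrow> f x = 0"
    using F'(3) by (auto elim!: eventually_mono)
  then show ?thesis by (simp add: AE_M AE_completion_iff)
qed

lemma has_weak_gradD:
  assumes "has_weak_grad \<Omega> z g"
  shows "(\<lambda>x. g x $ i) \<in> L2 M"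
    and "test_family \<Omega> D \<Longrightarrow> (LINT x|M. z x * D 1 0 x) = - (LINT x|M. g x $ 1 * D 0 0 x)"
    and "test_family \<Omega> D \<Longrightarrow> (LINT x|M. z x * D 0 1 x) = - (LINT x|M. g x $ 2 * D 0 0 x)"
  using assms unfolding has_weak_grad_def by auto

lemma weak_grad_unique:
  assumes g: "has_weak_grad \<Omega> z g" and h: "has_weak_grad \<Omega> z h"
  shows "AE x in M. g x = h x"
proof -
  have "AE x in M. g x $ i - h x $ i = 0" for i
  proof (rule AE_zero_if_tests_zero)
    show "(\<lambda>x. g x $ i - h x $ i) \<in> L2 M"
      using has_weak_gradD(1)[OF g] has_weak_gradD(1)[OF h] by (rule semi_inner.diff_mem[OF semi_inner_L2])
    fix D assume D: "test_family \<Omega> D"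
    have "(LINT x|M. g x $ i * D 0 0 x) = (LINT x|M. h x $ i * D 0 0 x)"
      using has_weak_gradD(2,3)[OF g D] has_weak_gradD(2,3)[OF h D] exhaust_2[of i] by auto
    then show "(LINT x|M. (g x $ i - h x $ i) * D 0 0 x) = 0"
      using has_weak_gradD(1)[OF g, of i] has_weak_gradD(1)[OF h, of i] test_family_L2[OF D]
      by (simp add: left_diff_distrib L2_integrable_mult)
  qed
  from this[of 1] this[of 2] show ?thesis
    by eventually_elim (rule mkpt_eqI; simp)
qed

lemma has_weak_grad_add:
  assumes "z \<in> L2 M" "w \<in> L2 M" "has_weak_grad \<Omega> z g" "has_weak_grad \<Omega> w h"
  shows "has_weak_grad \<Omega> (\<lambda>x. z x + w x) (\<lambda>x. g x + h x)"
  unfolding has_weak_grad_def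
proof (intro conjI allI impI)
  note L = has_weak_gradD[OF assms(3)] has_weak_gradD[OF assms(4)]
  show "(\<lambda>x. (g x + h x) $ i) \<in> L2 M" for i
    using semi_inner.add_mem[OF semi_inner_L2 L(1) L(4)] by simp
  fix D assume D: "test_family \<Omega> D"
  show "(LINT x|M. (z x + w x) * D 1 0 x) = - (LINT x|M. (g x + h x) $ 1 * D 0 0 x)"
    "(LINT x|M. (z x + w x) * D 0 1 x) = - (LINT x|M. (g x + h x) $ 2 * D 0 0 x)"
    using L(2,3,5,6)[OF D] L(1,4) assms(1,2) test_family_L2[OF D]
    by (simp_all add: distrib_right L2_integrable_mult)
qed

lemma has_weak_grad_scale:
  assumes "has_weak_grad \<Omega> z g"
  shows "has_weak_grad \<Omega> (\<lambda>x. c * z x) (\<lambda>x. c *\<^sub>R g x)"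
  unfolding has_weak_grad_def
proof (intro conjI allI impI)
  note L = has_weak_gradD[OF assms]
  show "(\<lambda>x. (c *\<^sub>R g x) $ i) \<in> L2 M" for i
    using semi_inner.scale_mem[OF semi_inner_L2 L(1)] by simp
  fix D assume D: "test_family \<Omega> D"
  show "(LINT x|M. c * z x * D 1 0 x) = - (LINT x|M. (c *\<^sub>R g x) $ 1 * D 0 0 x)"
    "(LINT x|M. c * z x * D 0 1 x) = - (LINT x|M. (c *\<^sub>R g x) $ 2 * D 0 0 x)"
    using L(2,3)[OF D] by (simp_all add: mult.assoc)
qed

lemma has_weak_grad_cong:
  assumes "\<And>x. x \<in> \<Omega> \<Longrightarrow> z x = w x"
  shows "has_weak_grad \<Omega> z = has_weak_grad \<Omega> w"
proof -
  have "(LINT x|M. z x * f x) = (LINT x|M. w x * f x)" for f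
    by (rule Bochner_Integration.integral_cong) (use assms in auto)
  then show ?thesis by (auto simp: has_weak_grad_def fun_eq_iff)
qed

lemma grad_cong: "(\<And>x. x \<in> \<Omega> \<Longrightarrow> z x = w x) \<Longrightarrow> grad \<Omega> z = grad \<Omega> w"
  unfolding grad_def using has_weak_grad_cong by metis

lemma H1_L2: "z \<in> H1 \<Omega> \<Longrightarrow> z \<in> L2 M"
  by (simp add: H1_def)

lemma has_weak_grad_grad: "z \<in> H1 \<Omega> \<Longrightarrow> has_weak_grad \<Omega> z (grad \<Omega> z)"
  unfolding H1_def grad_def using someI_ex[of "has_weak_grad \<Omega> z"] by blast

lemma grad_L2: "z \<in> H1 \<Omega> \<Longrightarrow> (\<lambda>x. grad \<Omega> z x $ i) \<in> L2 M"
  using has_weak_grad_grad has_weak_gradD(1) by blast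

lemma grad_measurable [measurable (raw)]: "z \<in> H1 \<Omega> \<Longrightarrow> grad \<Omega> z \<in> borel_measurable M"
proof -
  assume "z \<in> H1 \<Omega>"
  then have [measurable]: "(\<lambda>x. grad \<Omega> z x $ i) \<in> borel_measurable M" for i
    by (intro L2_measurable grad_L2)
  have "(\<lambda>x. mkpt (grad \<Omega> z x $ 1) (grad \<Omega> z x $ 2)) \<in> borel_measurable M" by measurable
  then show ?thesis by simp
qed

lemma H1_zero: "(\<lambda>x. 0) \<in> H1 \<Omega>"
proof -
  have "has_weak_grad \<Omega> (\<lambda>x. 0) (\<lambda>x. 0)"
    by (simp add: has_weak_grad_def semi_inner.zero_mem[OF semi_inner_L2])
  then show ?thesis
    unfolding H1_def using semi_inner.zero_mem[OF semi_inner_L2] by blast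
qed

lemma H1_add: "z \<in> H1 \<Omega> \<Longrightarrow> w \<in> H1 \<Omega> \<Longrightarrow> (\<lambda>x. z x + w x) \<in> H1 \<Omega>"
  using has_weak_grad_add[OF H1_L2 H1_L2 has_weak_grad_grad has_weak_grad_grad]
    semi_inner.add_mem[OF semi_inner_L2 H1_L2 H1_L2] unfolding H1_def by blast

lemma H1_scale: "z \<in> H1 \<Omega> \<Longrightarrow> (\<lambda>x. c * z x) \<in> H1 \<Omega>"
  using has_weak_grad_scale[OF has_weak_grad_grad]
    semi_inner.scale_mem[OF semi_inner_L2 H1_L2] unfolding H1_def by blast

text \<open>\<open>grad\<close> picks an arbitrary representative for each function, so linearity is
  available only almost everywhere and is used only under integrals.\<close>

lemma grad_add: "z \<in> H1 \<Omega> \<Longrightarrow> w \<in> H1 \<Omega> \<Longrightarrow> AE x in M. grad \<Omega> (\<lambda>x. z x + w x) x = grad \<Omega> z x + grad \<Omega> w x"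
  by (intro weak_grad_unique[where z="\<lambda>x. z x + w x"] has_weak_grad_grad H1_add has_weak_grad_add H1_L2)

lemma grad_scale: "z \<in> H1 \<Omega> \<Longrightarrow> AE x in M. grad \<Omega> (\<lambda>x. c * z x) x = c *\<^sub>R grad \<Omega> z x"
  by (intro weak_grad_unique[where z="\<lambda>x. c * z x"] has_weak_grad_grad H1_scale has_weak_grad_scale)

end

definition dform :: "pt set \<Rightarrow> scal \<Rightarrow> scal \<Rightarrow> real" where
  "dform \<Omega> z w = L2v_inner (lebesgue_on \<Omega>) (grad \<Omega> z) (grad \<Omega> w)"

definition h1form :: "pt set \<Rightarrow> scal \<Rightarrow> scal \<Rightarrow> real" where
  "h1form \<Omega> z w = L2_inner (lebesgue_on \<Omega>) z w + dform \<Omega> z w"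

lemma dform_self: "(L2v_nrm (lebesgue_on \<Omega>) (grad \<Omega> z))\<^sup>2 = dform \<Omega> z z"
  by (simp add: L2v_nrm_def dform_def L2v_inner_def)

lemma H1_nrm_eq: "H1_nrm \<Omega> z = sqrt (h1form \<Omega> z z)"
  by (simp add: H1_nrm_def h1form_def dform_self L2_nrm_sq)

context plane_domain
begin

lemma grad_inner_integrable:
  assumes "z \<in> H1 \<Omega>" "w \<in> H1 \<Omega>" shows "integrable M (\<lambda>x. grad \<Omega> z x \<bullet> grad \<Omega> w x)"
  using L2_integrable_mult[OF grad_L2 grad_L2, OF assms] by (simp add: inner_vec_def sum_2)

lemma dform_components:
  assumes "z \<in> H1 \<Omega>" "w \<in> H1 \<Omega>"
  shows "dform \<Omega> z w = L2_inner M (\<lambda>x. grad \<Omega> z x $ 1) (\<lambda>x. grad \<Omega> w x $ 1)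
    + L2_inner M (\<lambda>x. grad \<Omega> z x $ 2) (\<lambda>x. grad \<Omega> w x $ 2)"
  using L2_integrable_mult[OF grad_L2 grad_L2, OF assms]
  by (simp add: dform_def L2v_inner_def L2_inner_def inner_vec_def sum_2)

lemma dform_left_cong:
  assumes "z \<in> H1 \<Omega>" "w \<in> H1 \<Omega>" "g \<in> borel_measurable M" "AE x in M. grad \<Omega> z x = g x"
  shows "dform \<Omega> z w = (LINT x|M. g x \<bullet> grad \<Omega> w x)"
  unfolding dform_def L2v_inner_def
  by (rule integral_cong_AE) (use assms in \<open>auto elim!: eventually_mono\<close>)

lemma semi_inner_dform: "semi_inner (H1 \<Omega>) (dform \<Omega>)"
proof
  show "(\<lambda>x. 0) \<in> H1 \<Omega>" by (rule H1_zero)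
  fix v w assume vw: "v \<in> H1 \<Omega>" "w \<in> H1 \<Omega>"
  show "(\<lambda>x. v x + w x) \<in> H1 \<Omega>" using vw by (rule H1_add)
  show "dform \<Omega> v w = dform \<Omega> w v" by (simp add: dform_def L2v_inner_def inner_commute)
  fix z assume z: "z \<in> H1 \<Omega>"
  have "dform \<Omega> (\<lambda>x. v x + w x) z = (LINT x|M. (grad \<Omega> v x + grad \<Omega> w x) \<bullet> grad \<Omega> z x)"
    using vw z by (intro dform_left_cong H1_add grad_add) measurable
  also have "\<dots> = dform \<Omega> v z + dform \<Omega> w z"
    using grad_inner_integrable vw z by (simp add: inner_add_left dform_def L2v_inner_def)
  finally show "dform \<Omega> (\<lambda>x. v x + w x) z = dform \<Omega> v z + dform \<Omega> w z" .
next
  fix v c assume v: "v \<in> H1 \<Omega>"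
  show "(\<lambda>x. c * v x) \<in> H1 \<Omega>" using v by (rule H1_scale)
  show "0 \<le> dform \<Omega> v v" by (simp add: dform_def L2v_inner_def)
  fix z assume z: "z \<in> H1 \<Omega>"
  have "dform \<Omega> (\<lambda>x. c * v x) z = (LINT x|M. (c *\<^sub>R grad \<Omega> v x) \<bullet> grad \<Omega> z x)"
    using v z by (intro dform_left_cong H1_scale grad_scale) measurable
  also have "\<dots> = c * dform \<Omega> v z" by (simp add: dform_def L2v_inner_def)
  finally show "dform \<Omega> (\<lambda>x. c * v x) z = c * dform \<Omega> v z" .
qed

sublocale L2: semi_inner "L2 M" "L2_inner M" by (rule semi_inner_L2)

sublocale D: semi_inner "H1 \<Omega>" "dform \<Omega>" by (rule semi_inner_dform)

lemma semi_inner_h1form: "semi_inner (H1 \<Omega>) (h1form \<Omega>)"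
proof
  fix v w assume "v \<in> H1 \<Omega>" "w \<in> H1 \<Omega>"
  then show "h1form \<Omega> v w = h1form \<Omega> w v"
    using L2.sym[of v w] D.sym[of v w] by (simp add: h1form_def H1_L2)
next
  fix v assume "v \<in> H1 \<Omega>"
  then show "0 \<le> h1form \<Omega> v v"
    using L2.nonneg[of v] D.nonneg[of v] by (simp add: h1form_def H1_L2)
qed (simp_all add: h1form_def L2.bilin D.bilin H1_L2 algebra_simps)

sublocale H: semi_inner "H1 \<Omega>" "h1form \<Omega>" by (rule semi_inner_h1form)

lemma H_nrm_eq: "semi_inner.nrm (h1form \<Omega>) z = H1_nrm \<Omega> z"
  by (simp add: H.nrm_def H1_nrm_eq)

lemma H1_nrm_sq: "z \<in> H1 \<Omega> \<Longrightarrow> (H1_nrm \<Omega> z)\<^sup>2 = h1form \<Omega> z z"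
  by (metis H.nrm_sq H_nrm_eq)

lemma H1_nrm_nonneg: "z \<in> H1 \<Omega> \<Longrightarrow> 0 \<le> H1_nrm \<Omega> z"
  by (metis H.nrm_nonneg H_nrm_eq)

lemma L2_le_h1form: "z \<in> H1 \<Omega> \<Longrightarrow> L2_inner M z z \<le> h1form \<Omega> z z"
  by (simp add: h1form_def D.nonneg)

lemma dform_le_h1form: "z \<in> H1 \<Omega> \<Longrightarrow> dform \<Omega> z z \<le> h1form \<Omega> z z"
  by (simp add: h1form_def L2.nonneg H1_L2)

lemma L2_tendsto_integral:
  assumes "\<And>n. f n \<in> L2 M" "g \<in> L2 M" "(\<lambda>n::nat. L2_nrm M (\<lambda>x. f n x - g x)) \<longlonglongrightarrow> 0" "h \<in> L2 M"
  shows "(\<lambda>n. LINT x|M. f n x * h x) \<longlonglongrightarrow> (LINT x|M. g x * h x)"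
proof -
  have "(\<lambda>n. L2_inner M (f n) h - L2_inner M g h) \<longlonglongrightarrow> 0"
  proof (rule Lim_null_comparison)
    show "\<forall>\<^sub>F n in sequentially. norm (L2_inner M (f n) h - L2_inner M g h) \<le> L2_nrm M (\<lambda>x. f n x - g x) * L2_nrm M h"
      using L2.abs_le_nrm[OF L2.diff_mem[OF assms(1,2)] assms(4)]
      by (intro always_eventually allI) (simp add: L2_nrm_eq L2.bilin assms)
    show "(\<lambda>n. L2_nrm M (\<lambda>x. f n x - g x) * L2_nrm M h) \<longlonglongrightarrow> 0"
      using tendsto_mult_left_zero[OF assms(3)] by simp
  qed
  then show ?thesis by (simp add: L2_inner_def LIM_zero_iff)
qed

text \<open>Both sides of the defining identity are L2 pairings with a fixed test function and so
  pass to norm limits: the weak gradient is a closed operator.\<close>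

lemma weak_grad_limit:
  assumes z: "\<And>n. z n \<in> H1 \<Omega>" "w \<in> L2 M" "(\<lambda>n::nat. L2_nrm M (\<lambda>x. z n x - w x)) \<longlonglongrightarrow> 0"
    and g: "\<And>i. (\<lambda>x. g x $ i) \<in> L2 M" "\<And>i. (\<lambda>n. L2_nrm M (\<lambda>x. grad \<Omega> (z n) x $ i - g x $ i)) \<longlonglongrightarrow> 0"
  shows "has_weak_grad \<Omega> w g"
  unfolding has_weak_grad_def
proof (intro conjI allI impI)
  fix D assume D: "test_family \<Omega> D"
  note lim = L2_tendsto_integral[OF H1_L2[OF z(1)] z(2,3) test_family_L2[OF D]]
    L2_tendsto_integral[OF grad_L2[OF z(1)] g test_family_L2[OF D]]
  show "(LINT x|M. w x * D 1 0 x) = - (LINT x|M. g x $ 1 * D 0 0 x)"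
    using LIMSEQ_unique[OF lim(1)[of 1 0]] tendsto_minus[OF lim(2)[of 1 0 0]]
      has_weak_gradD(2)[OF has_weak_grad_grad[OF z(1)] D] by simp
  show "(LINT x|M. w x * D 0 1 x) = - (LINT x|M. g x $ 2 * D 0 0 x)"
    using LIMSEQ_unique[OF lim(1)[of 0 1]] tendsto_minus[OF lim(2)[of 2 0 0]]
      has_weak_gradD(3)[OF has_weak_grad_grad[OF z(1)] D] by simp
qed (rule g)

lemma L2_nrm_grad_diff:
  assumes "z \<in> H1 \<Omega>" "w \<in> H1 \<Omega>"
  shows "L2_nrm M (\<lambda>x. grad \<Omega> z x $ i - grad \<Omega> w x $ i) \<le> H1_nrm \<Omega> (\<lambda>x. z x - w x)"
proof -
  have d: "(\<lambda>x. z x - w x) \<in> H1 \<Omega>" using assms by (rule H.diff_mem)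
  have "AE x in M. grad \<Omega> z x $ i - grad \<Omega> w x $ i = grad \<Omega> (\<lambda>x. z x - w x) x $ i"
    using grad_add[OF d assms(2)] by (auto elim!: eventually_mono simp: vec_eq_iff)
  then have "L2_inner M (\<lambda>x. grad \<Omega> z x $ i - grad \<Omega> w x $ i) (\<lambda>x. grad \<Omega> z x $ i - grad \<Omega> w x $ i)
      = L2_inner M (\<lambda>x. grad \<Omega> (\<lambda>x. z x - w x) x $ i) (\<lambda>x. grad \<Omega> (\<lambda>x. z x - w x) x $ i)"
    unfolding L2_inner_def using assms d grad_L2[THEN L2_measurable]
    by (intro integral_cong_AE) (auto elim!: eventually_mono)
  also have "\<dots> \<le> dform \<Omega> (\<lambda>x. z x - w x) (\<lambda>x. z x - w x)"
    using exhaust_2[of i] L2.nonneg[OF grad_L2[OF d]] by (auto simp: dform_components d)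
  also have "\<dots> \<le> h1form \<Omega> (\<lambda>x. z x - w x) (\<lambda>x. z x - w x)" by (rule dform_le_h1form[OF d])
  finally show ?thesis by (simp add: L2_nrm_def H1_nrm_eq)
qed

lemma L2_nrm_le_H1_nrm: "z \<in> H1 \<Omega> \<Longrightarrow> L2_nrm M z \<le> H1_nrm \<Omega> z"
  using L2_le_h1form by (simp add: L2_nrm_def H1_nrm_eq)

text \<open>The functions and the components of their gradients converge separately in L2;
  closedness of the weak gradient identifies the limits.\<close>

lemma H1_complete:
  assumes z: "\<And>n. z n \<in> H1 \<Omega>"
    and cauchy: "\<And>e. e > 0 \<Longrightarrow> \<exists>N. \<forall>m\<ge>N. \<forall>n\<ge>N. H1_nrm \<Omega> (\<lambda>x. z m x - z n x) < e"
  shows "\<exists>w\<in>H1 \<Omega>. (\<lambda>n::nat. H1_nrm \<Omega> (\<lambda>x. z n x - w x)) \<longlonglongrightarrow> 0"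
proof -
  have weaker: "\<exists>N. \<forall>m\<ge>N. \<forall>n\<ge>N. k m n < e"
    if le: "\<And>m n. k m n \<le> H1_nrm \<Omega> (\<lambda>x. z m x - z n x)" and e: "e > 0" for k :: "nat \<Rightarrow> nat \<Rightarrow> real" and e
  proof -
    obtain N where "\<And>m n. m \<ge> N \<Longrightarrow> n \<ge> N \<Longrightarrow> H1_nrm \<Omega> (\<lambda>x. z m x - z n x) < e"
      using cauchy[OF e] by blast
    then show ?thesis by (intro exI[of _ N]) (auto intro: le_less_trans[OF le])
  qed
  have "\<exists>w\<in>L2 M. (\<lambda>n. L2_nrm M (\<lambda>x. z n x - w x)) \<longlonglongrightarrow> 0"
    by (intro L2_complete[OF finite_M H1_L2[OF z]] weaker L2_nrm_le_H1_nrm[OF H.diff_mem[OF z z]])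
  then obtain w where w: "w \<in> L2 M" "(\<lambda>n. L2_nrm M (\<lambda>x. z n x - w x)) \<longlonglongrightarrow> 0" by blast
  have "\<exists>h\<in>L2 M. (\<lambda>n. L2_nrm M (\<lambda>x. grad \<Omega> (z n) x $ i - h x)) \<longlonglongrightarrow> 0" for i
    by (intro L2_complete[OF finite_M grad_L2[OF z]] weaker L2_nrm_grad_diff[OF z z])
  then have "\<forall>i. \<exists>h. h \<in> L2 M \<and> (\<lambda>n. L2_nrm M (\<lambda>x. grad \<Omega> (z n) x $ i - h x)) \<longlonglongrightarrow> 0" by blast
  from choice[OF this] obtain h
    where h: "\<And>i. h i \<in> L2 M" "\<And>i. (\<lambda>n. L2_nrm M (\<lambda>x. grad \<Omega> (z n) x $ i - h i x)) \<longlonglongrightarrow> 0"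
    by blast
  define g where "g x = (\<chi> i. h i x)" for x
  have wg: "has_weak_grad \<Omega> w g"
    by (rule weak_grad_limit[OF z w]) (simp_all add: g_def h)
  then have wH: "w \<in> H1 \<Omega>" using w by (auto simp: H1_def)
  have AEg: "AE x in M. grad \<Omega> w x = g x" using weak_grad_unique[OF has_weak_grad_grad[OF wH] wg] .
  have dd: "dform \<Omega> (\<lambda>x. z n x - w x) (\<lambda>x. z n x - w x)
      = (\<Sum>i\<in>UNIV. (L2_nrm M (\<lambda>x. grad \<Omega> (z n) x $ i - h i x))\<^sup>2)" for n
  proof -
    have d: "(\<lambda>x. z n x - w x) \<in> H1 \<Omega>" using z wH by (rule H.diff_mem)
    have "AE x in M. grad \<Omega> (\<lambda>x. z n x - w x) x = grad \<Omega> (z n) x - g x"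
      using grad_add[OF d wH] AEg by eventually_elim (simp add: algebra_simps)
    then have "L2_inner M (\<lambda>x. grad \<Omega> (\<lambda>x. z n x - w x) x $ i) (\<lambda>x. grad \<Omega> (\<lambda>x. z n x - w x) x $ i)
      = L2_inner M (\<lambda>x. grad \<Omega> (z n) x $ i - h i x) (\<lambda>x. grad \<Omega> (z n) x $ i - h i x)" for i
      unfolding L2_inner_def using d z h(1) grad_L2[THEN L2_measurable] L2_measurable[OF h(1)]
      by (intro integral_cong_AE) (auto elim!: eventually_mono simp: g_def)
    then show ?thesis by (simp add: dform_components d sum_2 L2_nrm_sq)
  qed
  have "(\<lambda>n. sqrt ((L2_nrm M (\<lambda>x. z n x - w x))\<^sup>2 + (\<Sum>i\<in>UNIV. (L2_nrm M (\<lambda>x. grad \<Omega> (z n) x $ i - h i x))\<^sup>2))) \<longlonglongrightarrow> sqrt (0\<^sup>2 + (\<Sum>i\<in>(UNIV :: 2 set). 0\<^sup>2))"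
    by (intro tendsto_intros w h)
  then have "(\<lambda>n. H1_nrm \<Omega> (\<lambda>x. z n x - w x)) \<longlonglongrightarrow> 0"
    by (simp add: H1_nrm_eq h1form_def dd L2_nrm_sq)
  then show ?thesis using wH by blast
qed

end

section \<open>Mollification and energy along segments\<close>

text \<open>This is nonnegativity of the integral of (f - m)^2 with m the mean of f. The right-hand
  side is a nonnegative integral because it is later combined with lower limits.\<close>

lemma integral_sq_le:
  fixes f :: "real \<Rightarrow> real"
  assumes "a \<le> b" and f: "continuous_on {a..b} f"
  shows "ennreal ((integral {a..b} f)\<^sup>2) \<le> ennreal (b - a) * (\<integral>\<^sup>+t\<in>{a..b}. ennreal ((f t)\<^sup>2) \<partial>lborel)"
proof (cases "a = b")
  case False
  then have ab: "a < b" using assms by simp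
  let ?I = "integral {a..b} f" and ?J = "integral {a..b} (\<lambda>t. (f t)\<^sup>2)"
  have cont2: "continuous_on {a..b} (\<lambda>t. (f t)\<^sup>2)" using f by (intro continuous_intros)
  note i = integrable_continuous_real[OF f] integrable_continuous_real[OF cont2]
  define m where "m = ?I / (b - a)"
  have "0 \<le> integral {a..b} (\<lambda>t. (f t - m)\<^sup>2)" by (intro integral_nonneg integrable_continuous_real continuous_intros f) auto
  also have "integral {a..b} (\<lambda>t. (f t - m)\<^sup>2) = integral {a..b} (\<lambda>t. (f t)\<^sup>2 - 2 * m * f t + m\<^sup>2)"
    by (simp add: power2_diff algebra_simps)
  also have "\<dots> = ?J - 2 * m * ?I + m\<^sup>2 * (b - a)"
  proof (rule integral_unique)
    have "((\<lambda>t. (f t)\<^sup>2 - 2 * m * f t + m\<^sup>2) has_integral ?J - 2 * m * ?I + measure lborel {a..b} *\<^sub>R m\<^sup>2) {a..b}"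
      by (intro has_integral_add has_integral_diff has_integral_mult_right integrable_integral i has_integral_const_real)
    then show "((\<lambda>t. (f t)\<^sup>2 - 2 * m * f t + m\<^sup>2) has_integral ?J - 2 * m * ?I + m\<^sup>2 * (b - a)) {a..b}"
      using ab by (simp add: mult.commute)
  qed
  also have "\<dots> = ?J - ?I\<^sup>2 / (b - a)"
  proof -
    have I: "?I = m * (b - a)" using ab by (simp add: m_def)
    have "(m * (b - a))\<^sup>2 / (b - a) = m\<^sup>2 * (b - a)" using ab by (simp add: power2_eq_square)
    then show ?thesis unfolding I by (simp add: power2_eq_square algebra_simps)
  qed
  finally have "?I\<^sup>2 \<le> (b - a) * ?J" using ab by (simp add: field_simps)
  then have "ennreal (?I\<^sup>2) \<le> ennreal (b - a) * ennreal ?J"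
    using ab by (simp add: ennreal_mult'[symmetric] ennreal_leI)
  also have "ennreal ?J = (\<integral>\<^sup>+t\<in>{a..b}. ennreal ((f t)\<^sup>2) \<partial>lborel)"
  proof -
    have int: "set_integrable lborel {a..b} (\<lambda>t. (f t)\<^sup>2)"
      unfolding set_integrable_def by (rule borel_integrable_compact) (use cont2 in auto)
    have "ennreal ?J = (\<integral>\<^sup>+t. ennreal (indicator {a..b} t *\<^sub>R (f t)\<^sup>2) \<partial>lborel)"
      using set_borel_integral_eq_integral(2)[OF int] int
      by (subst nn_integral_eq_integral) (auto simp: set_lebesgue_integral_def set_integrable_def)
    also have "\<dots> = (\<integral>\<^sup>+t\<in>{a..b}. ennreal ((f t)\<^sup>2) \<partial>lborel)"
      by (rule nn_integral_cong) (simp add: indicator_def)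
    finally show ?thesis .
  qed
  finally show ?thesis .
qed simp

lemma norm_sq_pt: "(norm v)\<^sup>2 = (v $ 1)\<^sup>2 + (v $ 2)\<^sup>2" for v :: pt
  unfolding power2_norm_eq_inner by (simp add: inner_vec_def sum_2 power2_eq_square)

lemma liminf_cmult_ennreal:
  fixes g :: "nat \<Rightarrow> ennreal"
  shows "liminf (\<lambda>n. ennreal c * g n) = ennreal c * liminf g"
  by (rule Liminf_compose_continuous_mono)
    (auto intro!: ennreal_continuous_on_cmult continuous_on_id mult_left_mono monoI)

lemma family_eq_0:
  fixes d :: "nat \<Rightarrow> real \<Rightarrow> real"
  assumes "\<And>i t. (d i has_real_derivative d (Suc i) t) (at t)" "open U" "\<And>t. t \<in> U \<Longrightarrow> d 0 t = 0"
  shows "t \<in> U \<Longrightarrow> d i t = 0"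
proof (induction i arbitrary: t)
  case (Suc i)
  have "((\<lambda>_. 0) has_real_derivative d (Suc i) t) (at t)"
    by (rule has_field_derivative_transform_within_open[OF assms(1,2) Suc.prems Suc.IH])
  then show ?case using DERIV_unique[OF _ DERIV_const] by blast
qed (use assms in simp)

lemma bump_symmetric: "bump n (- e) e (- t) = bump n (- e) e t"
  by (simp add: bump_def algebra_simps)

text \<open>\<open>\<psi>\<close> extends z continuously to the plane so that averages exist at
  every point, although they reflect the weak gradient only where the averaging square stays inside
  the domain. The family d lists all derivatives of a bump in one variable; products of them give
  the kernel and its derivatives.\<close>

locale mollifier = plane_domain +
  fixes z \<psi> :: scal and \<epsilon> :: real and d :: "nat \<Rightarrow> real \<Rightarrow> real"
  assumes z: "z \<in> H1 \<Omega>" and \<psi>: "continuous_on UNIV \<psi>" "\<And>x. x \<in> \<Omega> \<Longrightarrow> \<psi> x = z x"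
    and \<epsilon>: "\<epsilon> > 0"
    and d: "d 0 = bump 1 (- \<epsilon>) \<epsilon>" "\<And>i t. (d i has_real_derivative d (Suc i) t) (at t)"
begin

definition w :: "nat \<Rightarrow> nat \<Rightarrow> pt \<Rightarrow> pt \<Rightarrow> real" where
  "w i j x y = d i (y $ 1 - x $ 1) * d j (y $ 2 - x $ 2)"

definition c :: real where "c = (LINT y|lborel. w 0 0 0 y)"

definition mol :: "pt \<Rightarrow> real" where
  "mol x = (LINT y|lborel. \<psi> y * w 0 0 x y) / c"

text \<open>The gradient of \<open>mol\<close>. The kernel is a function of y - x and
  \<open>w\<close> stores derivatives in that difference, whence the minus signs.\<close>

definition gr :: "pt \<Rightarrow> pt" where
  "gr x = mkpt (- (LINT y|lborel. \<psi> y * w 1 0 x y) / c) (- (LINT y|lborel. \<psi> y * w 0 1 x y) / c)"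

lemma d_continuous: "continuous_on A (d i)"
  by (rule DERIV_continuous_on[OF has_field_derivative_at_within[OF d(2)]])

lemma d_eq_0: "\<bar>t\<bar> > \<epsilon> \<Longrightarrow> d i t = 0"
proof -
  have "d i t = 0" if "t \<in> {..<- \<epsilon>} \<union> {\<epsilon><..}" for t
    by (rule family_eq_0[of d, OF d(2) _ _ that]) (use bump_eq_0 \<epsilon> in \<open>auto simp: d(1)\<close>)
  then show "\<bar>t\<bar> > \<epsilon> \<Longrightarrow> d i t = 0" by (auto simp: abs_if split: if_splits)
qed

abbreviation "nb x \<equiv> cbox (x - mkpt \<epsilon> \<epsilon>) (x + mkpt \<epsilon> \<epsilon>)"

lemma w_eq_0: "y \<notin> nb x \<Longrightarrow> w i j x y = 0"
proof -
  assume "y \<notin> nb x"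
  then have "\<bar>y $ 1 - x $ 1\<bar> > \<epsilon> \<or> \<bar>y $ 2 - x $ 2\<bar> > \<epsilon>"
    by (auto simp: mem_cbox_pt)
  then show ?thesis using d_eq_0 by (auto simp: w_def)
qed

lemma continuous_w [continuous_intros]:
  "continuous_on A f \<Longrightarrow> continuous_on A g \<Longrightarrow> continuous_on A (\<lambda>x. w i j (f x) (g x))"
  unfolding w_def
  by (intro continuous_intros continuous_on_compose2[OF d_continuous[of UNIV]]) auto

lemma w_measurable [measurable (raw)]:
  assumes [measurable]: "f \<in> borel_measurable N" "g \<in> borel_measurable N"
  shows "(\<lambda>x. w i j (f x) (g x)) \<in> borel_measurable N"
proof -
  have [measurable]: "d i \<in> borel_measurable borel" for i
    by (rule borel_measurable_continuous_onI[OF d_continuous])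
  show ?thesis unfolding w_def by measurable
qed

lemma \<psi>_measurable [measurable]: "\<psi> \<in> borel_measurable borel"
  by (rule borel_measurable_continuous_onI[OF \<psi>(1)])

lemma w_nonneg: "0 \<le> w 0 0 x y"
  by (simp add: w_def d bump_nonneg)

lemma w_le_1: "w 0 0 x y \<le> 1"
  by (simp add: w_def d bump_nonneg bump_le_1 mult_le_one)

lemma integrable_w:
  assumes "continuous_on UNIV f" shows "integrable lborel (\<lambda>y. f y * w i j x y)"
proof -
  have "integrable lborel (\<lambda>y. indicator (nb x) y *\<^sub>R (f y * w i j x y))"
    by (rule borel_integrable_compact) (auto intro!: continuous_intros continuous_on_subset[OF assms])
  moreover have "(\<lambda>y. indicator (nb x) y *\<^sub>R (f y * w i j x y)) = (\<lambda>y. f y * w i j x y)"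
    using w_eq_0[of _ x i j] by (auto simp: indicator_def fun_eq_iff)
  ultimately show ?thesis by simp
qed

lemma integral_w_cbox:
  assumes "continuous_on UNIV f" "nb x \<subseteq> cbox a b"
  shows "(LINT y|lborel. f y * w i j x y) = integral (cbox a b) (\<lambda>y. f y * w i j x y)"
proof -
  have eq: "(\<lambda>y. indicator (cbox a b) y *\<^sub>R (f y * w i j x y)) = (\<lambda>y. f y * w i j x y)"
    using w_eq_0[of _ x i j] assms(2) by (force simp: indicator_def fun_eq_iff)
  have "set_integrable lborel (cbox a b) (\<lambda>y. f y * w i j x y)"
    unfolding set_integrable_def eq by (rule integrable_w[OF assms(1)])
  from set_borel_integral_eq_integral(2)[OF this] show ?thesis
    unfolding set_lebesgue_integral_def eq .
qed

lemma nn_integral_w: "(\<integral>\<^sup>+y. ennreal (w 0 0 x y) \<partial>lborel) = ennreal c"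
proof -
  have "(\<integral>\<^sup>+y. ennreal (w 0 0 x y) \<partial>lborel) = (\<integral>\<^sup>+y. ennreal (w 0 0 x (x + 1 *\<^sub>R y)) \<partial>lborel)"
    by (subst nn_integral_scale_pt[where f="\<lambda>y. ennreal (w 0 0 x y)"]) auto
  also have "\<dots> = (\<integral>\<^sup>+y. ennreal (w 0 0 0 y) \<partial>lborel)" by (simp add: w_def)
  also have "\<dots> = ennreal c"
    unfolding c_def using integrable_w[of "\<lambda>_. 1" 0 0 0] w_nonneg by (intro nn_integral_eq_integral) auto
  finally show ?thesis .
qed

lemma w_sym: "w 0 0 x y = w 0 0 y x"
  using bump_symmetric[of 1 \<epsilon> "y $ 1 - x $ 1"] bump_symmetric[of 1 \<epsilon> "y $ 2 - x $ 2"]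
  by (simp add: w_def d)

text \<open>The kernel is even, so its mass is the same in either variable; this enters when
  integrals are exchanged in \<open>gr_energy\<close>.\<close>

lemma nn_integral_w': "(\<integral>\<^sup>+x. ennreal (w 0 0 x y) \<partial>lborel) = ennreal c"
  using nn_integral_w[of y] by (simp add: w_sym[of y])

lemma c_pos: "c > 0"
proof (rule ccontr)
  assume "\<not> c > 0"
  then have "(\<integral>\<^sup>+y. ennreal (w 0 0 0 y) \<partial>lborel) = 0" using nn_integral_w[of 0] by (simp add: ennreal_neg)
  then have "AE y in lborel. ennreal (w 0 0 0 y) = 0"
    by (subst (asm) nn_integral_0_iff_AE) auto
  then have "AE y in lebesgue. y \<notin> box (- mkpt \<epsilon> \<epsilon>) (mkpt \<epsilon> \<epsilon>)"
  proof (intro AE_completion, eventually_elim)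
    fix y assume "ennreal (w 0 0 0 y) = 0"
    moreover have "0 < w 0 0 0 y" if "y \<in> box (- mkpt \<epsilon> \<epsilon>) (mkpt \<epsilon> \<epsilon>)"
      using that by (auto simp: w_def d mem_box_pt intro!: mult_pos_pos bump_pos)
    ultimately show "y \<notin> box (- mkpt \<epsilon> \<epsilon>) (mkpt \<epsilon> \<epsilon>)" by (auto simp: ennreal_eq_0_iff)
  qed
  then have "negligible (box (- mkpt \<epsilon> \<epsilon>) (mkpt \<epsilon> \<epsilon>))"
    unfolding negligible_iff_null_sets by (subst AE_iff_null_sets) auto
  moreover have "0 \<in> box (- mkpt \<epsilon> \<epsilon>) (mkpt \<epsilon> \<epsilon>)" using \<epsilon> by (simp add: mem_box_pt)
  ultimately show False using open_not_negligible open_box by blast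
qed

lemma integral_w: "(LINT y|lborel. w 0 0 x y) = c"
  using nn_integral_w[of x] w_nonneg c_pos
  by (subst integral_eq_nn_integral) auto

lemma mol_close:
  assumes "\<And>y. y \<in> nb x \<Longrightarrow> \<bar>\<psi> y - \<psi> x\<bar> \<le> e"
  shows "\<bar>mol x - \<psi> x\<bar> \<le> e"
proof -
  have i: "integrable lborel (\<lambda>y. (\<psi> y - \<psi> x) * w 0 0 x y)"
    by (rule integrable_w) (intro continuous_intros \<psi>(1))
  have i1: "integrable lborel (\<lambda>y. e * w 0 0 x y)" by (rule integrable_w) (intro continuous_intros)
  have i2: "integrable lborel (\<lambda>y. \<psi> y * w 0 0 x y)" "integrable lborel (\<lambda>y. \<psi> x * w 0 0 x y)"
    by (rule integrable_w; intro continuous_intros \<psi>(1))+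
  have "(LINT y|lborel. (\<psi> y - \<psi> x) * w 0 0 x y) = c * (mol x - \<psi> x)"
    using c_pos i2 by (simp add: left_diff_distrib mol_def integral_w algebra_simps)
  moreover have "\<bar>LINT y|lborel. (\<psi> y - \<psi> x) * w 0 0 x y\<bar> \<le> (LINT y|lborel. e * w 0 0 x y)"
  proof (rule order_trans[OF integral_abs_bound integral_mono[OF _ i1]])
    show "integrable lborel (\<lambda>y. \<bar>(\<psi> y - \<psi> x) * w 0 0 x y\<bar>)" using i by (rule integrable_abs)
    fix y
    show "\<bar>(\<psi> y - \<psi> x) * w 0 0 x y\<bar> \<le> e * w 0 0 x y"
      using assms[of y] w_eq_0[of y x 0 0] w_nonneg[of x y]
      by (cases "y \<in> nb x") (auto simp: abs_mult intro: mult_right_mono)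
  qed
  moreover have "(LINT y|lborel. e * w 0 0 x y) = c * e" using integral_w[of x] by simp
  ultimately have "\<bar>c * (mol x - \<psi> x)\<bar> \<le> c * e" by metis
  then have "c * \<bar>mol x - \<psi> x\<bar> \<le> c * e" using c_pos by (simp add: abs_mult)
  then show ?thesis using c_pos by simp
qed

lemma w_has_derivative:
  "((\<lambda>t. w i j (p + t *\<^sub>R q) y) has_real_derivative
     - (q $ 1 * w (Suc i) j (p + t *\<^sub>R q) y + q $ 2 * w i (Suc j) (p + t *\<^sub>R q) y)) (at t within U)"
proof -
  have 1: "((\<lambda>t. d k (y $ l - (p + t *\<^sub>R q) $ l)) has_real_derivative
      d (Suc k) (y $ l - (p + t *\<^sub>R q) $ l) * (- q $ l)) (at t within U)" for k and l :: 2
    by (rule DERIV_chain'[OF _ d(2), THEN has_field_derivative_at_within])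
      (auto intro!: derivative_eq_intros)
  show ?thesis
    unfolding w_def by (rule DERIV_cong[OF DERIV_mult[OF 1 1]]) (simp add: algebra_simps)
qed

text \<open>Differentiation under the integral sign along the line, followed by the fundamental
  theorem of calculus. Continuity of \<open>\<psi>\<close> is enough because all derivatives fall on
  the kernel.\<close>

lemma mol_along_line:
  assumes "a \<le> b"
  shows "continuous_on {a..b} (\<lambda>t. gr (p + t *\<^sub>R q) \<bullet> q)"
    and "mol (p + b *\<^sub>R q) - mol (p + a *\<^sub>R q) = integral {a..b} (\<lambda>t. gr (p + t *\<^sub>R q) \<bullet> q)"
proof -
  \<comment> \<open>The square of half-width A contains the kernel supports of all points of the
    segment, so every average becomes an integral over one compact set.\<close>
  define A where "A = norm p + (\<bar>a\<bar> + \<bar>b\<bar>) * norm q + \<epsilon>"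
  let ?R = "cbox (- mkpt A A) (mkpt A A)"
  have sub: "nb (p + t *\<^sub>R q) \<subseteq> ?R" if t: "t \<in> {a..b}" for t
  proof -
    have "\<bar>(p + t *\<^sub>R q) $ i\<bar> \<le> A - \<epsilon>" for i
    proof -
      have "\<bar>(p + t *\<^sub>R q) $ i\<bar> \<le> norm (p + t *\<^sub>R q)" by (rule component_le_norm_cart)
      also have "\<dots> \<le> norm p + \<bar>t\<bar> * norm q" using norm_triangle_ineq[of p "t *\<^sub>R q"] by simp
      also have "\<dots> \<le> A - \<epsilon>" using t by (auto simp: A_def intro!: mult_right_mono)
      finally show ?thesis .
    qed
    from this[of 1] this[of 2] show ?thesis by (auto simp: mem_cbox_pt)
  qed
  define F where "F t y = \<psi> y * w 0 0 (p + t *\<^sub>R q) y" for t y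
  define F' where "F' t y = \<psi> y * - (q $ 1 * w 1 0 (p + t *\<^sub>R q) y + q $ 2 * w 0 1 (p + t *\<^sub>R q) y)" for t y
  have contF': "continuous_on ({a..b} \<times> ?R) (\<lambda>(t, y). F' t y)"
    unfolding F'_def split_beta
    by (intro continuous_intros continuous_on_compose2[OF \<psi>(1)]) auto
  have molF: "mol (p + t *\<^sub>R q) = integral ?R (F t) / c" if "t \<in> {a..b}" for t
    unfolding mol_def F_def using integral_w_cbox[OF \<psi>(1) sub[OF that]] by simp
  have grF: "gr (p + t *\<^sub>R q) \<bullet> q = integral ?R (F' t) / c" if "t \<in> {a..b}" for t
  proof -
    have "gr (p + t *\<^sub>R q) \<bullet> q = - (integral ?R (\<lambda>y. \<psi> y * w 1 0 (p + t *\<^sub>R q) y) * q $ 1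
        + integral ?R (\<lambda>y. \<psi> y * w 0 1 (p + t *\<^sub>R q) y) * q $ 2) / c"
      unfolding gr_def using integral_w_cbox[OF \<psi>(1) sub[OF that]]
      by (simp add: inner_vec_def sum_2 add_divide_distrib diff_divide_distrib)
    also have "integral ?R (\<lambda>y. \<psi> y * w 1 0 (p + t *\<^sub>R q) y) * q $ 1 + integral ?R (\<lambda>y. \<psi> y * w 0 1 (p + t *\<^sub>R q) y) * q $ 2
        = integral ?R (\<lambda>y. \<psi> y * w 1 0 (p + t *\<^sub>R q) y * q $ 1 + \<psi> y * w 0 1 (p + t *\<^sub>R q) y * q $ 2)"
      by (subst integral_add)
        (auto intro!: integrable_continuous continuous_intros continuous_on_subset[OF \<psi>(1)])
    also have "- \<dots> = integral ?R (F' t)"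
      unfolding F'_def by (simp add: algebra_simps flip: integral_neg)
    finally show ?thesis .
  qed
  show "continuous_on {a..b} (\<lambda>t. gr (p + t *\<^sub>R q) \<bullet> q)"
  proof -
    have "continuous_on {a..b} (\<lambda>t. integral ?R (F' t) / c)"
      using c_pos by (intro continuous_intros integral_continuous_on_param contF') auto
    then show ?thesis by (rule continuous_on_eq) (simp add: grF)
  qed
  have "((\<lambda>t. integral ?R (F t)) has_vector_derivative integral ?R (F' t)) (at t within {a..b})" if "t \<in> {a..b}" for t
  proof (rule leibniz_rule_vector_derivative[OF _ _ contF' that])
    show "((\<lambda>t. F t y) has_vector_derivative F' t y) (at t within {a..b})" for t y
      unfolding F_def F'_def has_real_derivative_iff_has_vector_derivative[symmetric]
      using DERIV_cmult[OF w_has_derivative[of 0 0 p q y t "{a..b}"], of "\<psi> y"] by simp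
    show "F t integrable_on ?R" for t
      unfolding F_def by (intro integrable_continuous continuous_intros continuous_on_subset[OF \<psi>(1)]) auto
  qed auto
  then have "((\<lambda>t. integral ?R (F t) / c) has_vector_derivative integral ?R (F' t) / c) (at t within {a..b})" if "t \<in> {a..b}" for t
    using that by (intro has_vector_derivative_divide) auto
  from fundamental_theorem_of_calculus[OF assms this]
  have "integral {a..b} (\<lambda>t. integral ?R (F' t) / c) = integral ?R (F b) / c - integral ?R (F a) / c"
    by (rule integral_unique)
  then show "mol (p + b *\<^sub>R q) - mol (p + a *\<^sub>R q) = integral {a..b} (\<lambda>t. gr (p + t *\<^sub>R q) \<bullet> q)"
    using molF[of a] molF[of b] assms Henstock_Kurzweil_Integration.integral_cong[OF grF, of "{a..b}"] by simp
qed

text \<open>When the averaging square lies inside the domain the kernel is a test function of y, and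
  the definition of the weak gradient moves the derivative onto z; the two minus signs
  cancel.\<close>

lemma gr_eq_average:
  assumes nb: "nb x \<subseteq> \<Omega>"
  shows "gr x $ i = (LINT y|M. grad \<Omega> z y $ i * w 0 0 x y) / c"
proof -
  define D where "D = (\<lambda>i j y. w i j x y)"
  have d': "((\<lambda>t. d i (t - s)) has_real_derivative d (Suc i) (t - s)) (at t)" for i s t
  proof -
    have "((\<lambda>t. t - s) has_real_derivative 1) (at t)" by (auto intro!: derivative_eq_intros)
    from DERIV_chain'[OF this d(2)[of i "t - s"]] show ?thesis by simp
  qed
  have "test_family \<Omega> (\<lambda>i j y. d i (y $ 1 - x $ 1) * d j (y $ 2 - x $ 2))"
    by (rule test_family_product[where d="\<lambda>i t. d i (t - x $ 1)" and e="\<lambda>i t. d i (t - x $ 2)", OF d' d' _ nb])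
      (use w_eq_0[of _ x 0 0] in \<open>auto simp: w_def\<close>)
  then have D: "test_family \<Omega> D" unfolding D_def w_def .
  have "(LINT y|lborel. \<psi> y * w k l x y) = (LINT y|M. z y * D k l y)" for k l
  proof -
    have "(LINT y|lborel. \<psi> y * w k l x y) = (LINT y|lebesgue. \<psi> y * w k l x y)"
      by (rule integral_completion[symmetric]) measurable
    also have "\<dots> = (LINT y|lebesgue. indicator \<Omega> y * (z y * w k l x y))"
      by (rule Bochner_Integration.integral_cong)
        (use nb \<psi>(2) w_eq_0[of _ x k l] in \<open>auto simp: indicator_def\<close>)
    finally show ?thesis by (simp add: integral_M D_def)
  qed
  then show ?thesis
    using has_weak_gradD(2,3)[OF has_weak_grad_grad[OF z] D] exhaust_2[of i]
    by (auto simp: gr_def D_def)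
qed

text \<open>Jensen's inequality for the average, obtained from Cauchy-Schwarz by writing the kernel
  as a product of two square roots.\<close>

lemma gr_sq_le_average:
  assumes nb: "nb x \<subseteq> \<Omega>"
  shows "ennreal ((gr x $ i)\<^sup>2) \<le> ennreal (1 / c) * (\<integral>\<^sup>+y. ennreal ((grad \<Omega> z y $ i)\<^sup>2 * w 0 0 x y) \<partial>M)"
proof -
  let ?g = "\<lambda>y. grad \<Omega> z y $ i" and ?W = "\<lambda>y. w 0 0 x y"
  have gL: "?g \<in> L2 M" by (rule grad_L2[OF z])
  have gm [measurable]: "?g \<in> borel_measurable M" using gL by (rule L2_measurable)
  have Wm [measurable]: "?W \<in> borel_measurable M" by (intro measurable_M) measurable
  have i1: "integrable M (\<lambda>y. (?g y)\<^sup>2 * ?W y)"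
    by (rule Bochner_Integration.integrable_bound[of _ "\<lambda>y. (?g y)\<^sup>2"])
      (use gL w_nonneg w_le_1 in \<open>auto simp: L2_def abs_mult intro!: AE_I2 mult_left_le\<close>)
  have L: "(\<lambda>y. ?g y * sqrt (?W y)) \<in> L2 M" "(\<lambda>y. sqrt (?W y)) \<in> L2 M"
  proof -
    show "(\<lambda>y. ?g y * sqrt (?W y)) \<in> L2 M"
      unfolding L2_def using i1 w_nonneg by (auto simp: power_mult_distrib)
    show "(\<lambda>y. sqrt (?W y)) \<in> L2 M"
      by (rule L2_bounded[OF finite_M, of _ 1]) (use w_nonneg w_le_1 in auto)
  qed
  have "(LINT y|M. ?g y * ?W y)\<^sup>2 \<le> (LINT y|M. (?g y)\<^sup>2 * ?W y) * (LINT y|M. ?W y)"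
  proof -
    have "?g y * sqrt (?W y) * sqrt (?W y) = ?g y * ?W y" "?g y * sqrt (?W y) * (?g y * sqrt (?W y)) = (?g y)\<^sup>2 * ?W y"
      "sqrt (?W y) * sqrt (?W y) = ?W y" for y
      using real_sqrt_mult_self[of "?W y"] w_nonneg[of x y] by (simp_all add: power2_eq_square mult_ac)
    then show ?thesis using L2.Cauchy_Schwarz[OF L] by (simp only: L2_inner_def)
  qed
  also have "(LINT y|M. ?W y) = c"
  proof -
    have "(LINT y|M. ?W y) = (LINT y|lebesgue. ?W y)"
      unfolding integral_M by (rule Bochner_Integration.integral_cong)
        (use nb w_eq_0[of _ x 0 0] in \<open>auto simp: indicator_def\<close>)
    also have "\<dots> = c" by (subst integral_completion) (auto simp: integral_w)
    finally show ?thesis .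
  qed
  finally have "(gr x $ i)\<^sup>2 \<le> (LINT y|M. (?g y)\<^sup>2 * ?W y) * (1 / c)"
    unfolding gr_eq_average[OF nb] using c_pos by (simp add: power_divide field_simps power2_eq_square)
  then have "ennreal ((gr x $ i)\<^sup>2) \<le> ennreal (1 / c) * ennreal (LINT y|M. (?g y)\<^sup>2 * ?W y)"
    using c_pos by (subst ennreal_mult'[symmetric]) (auto simp: mult.commute intro: ennreal_leI)
  also have "ennreal (LINT y|M. (?g y)\<^sup>2 * ?W y) = (\<integral>\<^sup>+y. ennreal ((?g y)\<^sup>2 * ?W y) \<partial>M)"
    using i1 w_nonneg by (intro nn_integral_eq_integral[symmetric]) auto
  finally show ?thesis .
qed

lemma gr_measurable [measurable]: "gr \<in> borel_measurable borel"
proof -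
  have "(\<lambda>x. LINT y|lborel. \<psi> y * w i j x y) \<in> borel_measurable borel" for i j
    by (rule lborel.borel_measurable_lebesgue_integral) measurable
  then show ?thesis unfolding gr_def by measurable
qed

text \<open>Mollification does not increase the energy: the pointwise bound is integrated, the
  integrals are exchanged, and the kernel has mass \<open>c\<close> in x too, which cancels 1/c. A
  Borel representative of the gradient makes Fubini applicable.\<close>

lemma gr_energy:
  assumes U [measurable]: "U \<in> sets borel" and nb: "\<And>x. x \<in> U \<Longrightarrow> nb x \<subseteq> \<Omega>"
  shows "(\<integral>\<^sup>+x. ennreal ((gr x $ i)\<^sup>2) * indicator U x \<partial>lborel) \<le> ennreal (L2_inner M (\<lambda>x. grad \<Omega> z x $ i) (\<lambda>x. grad \<Omega> z x $ i))"
proof -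
  let ?g = "\<lambda>y. grad \<Omega> z y $ i"
  obtain h where h [measurable]: "h \<in> borel_measurable borel" and gh: "AE y in M. ?g y = h y"
    using borel_representative[OF L2_measurable[OF grad_L2[OF z]]] by blast
  have rep: "(\<integral>\<^sup>+y. ennreal ((?g y)\<^sup>2 * w 0 0 x y) \<partial>M) = (\<integral>\<^sup>+y. ennreal ((h y)\<^sup>2) * indicator \<Omega> y * ennreal (w 0 0 x y) \<partial>lborel)" for x
  proof -
    have "(\<integral>\<^sup>+y. ennreal ((?g y)\<^sup>2 * w 0 0 x y) \<partial>M) = (\<integral>\<^sup>+y. ennreal ((h y)\<^sup>2 * w 0 0 x y) \<partial>M)"
      by (rule nn_integral_cong_AE) (use gh in \<open>auto elim!: eventually_mono\<close>)
    also have "\<dots> = (\<integral>\<^sup>+y. ennreal ((h y)\<^sup>2 * w 0 0 x y) * indicator \<Omega> y \<partial>lborel)"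
      by (rule nn_integral_M_borel) measurable
    also have "\<dots> = (\<integral>\<^sup>+y. ennreal ((h y)\<^sup>2) * indicator \<Omega> y * ennreal (w 0 0 x y) \<partial>lborel)"
      by (rule nn_integral_cong) (simp add: ennreal_mult w_nonneg mult_ac)
    finally show ?thesis .
  qed
  have "(\<integral>\<^sup>+x. ennreal ((gr x $ i)\<^sup>2) * indicator U x \<partial>lborel)
      \<le> (\<integral>\<^sup>+x. ennreal (1 / c) * (\<integral>\<^sup>+y. ennreal ((h y)\<^sup>2) * indicator \<Omega> y * ennreal (w 0 0 x y) \<partial>lborel) \<partial>lborel)"
    by (rule nn_integral_mono) (use gr_sq_le_average[OF nb, of _ i] in \<open>simp add: rep indicator_def\<close>)
  also have "\<dots> = ennreal (1 / c) * (\<integral>\<^sup>+x. \<integral>\<^sup>+y. ennreal ((h y)\<^sup>2) * indicator \<Omega> y * ennreal (w 0 0 x y) \<partial>lborel \<partial>lborel)"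
    by (rule nn_integral_cmult) measurable
  also have "(\<integral>\<^sup>+x. \<integral>\<^sup>+y. ennreal ((h y)\<^sup>2) * indicator \<Omega> y * ennreal (w 0 0 x y) \<partial>lborel \<partial>lborel)
     = (\<integral>\<^sup>+y. \<integral>\<^sup>+x. ennreal ((h y)\<^sup>2) * indicator \<Omega> y * ennreal (w 0 0 x y) \<partial>lborel \<partial>lborel)"
    by (rule pair_sigma_finite.Fubini'[OF pair_sigma_finite.intro[OF sigma_finite_lborel sigma_finite_lborel]]) measurable
  also have "\<dots> = (\<integral>\<^sup>+y. ennreal ((h y)\<^sup>2) * indicator \<Omega> y * ennreal c \<partial>lborel)"
    by (subst nn_integral_cmult) (auto simp: nn_integral_w')
  also have "\<dots> = (\<integral>\<^sup>+y. ennreal ((h y)\<^sup>2) * indicator \<Omega> y \<partial>lborel) * ennreal c"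
    by (rule nn_integral_multc) measurable
  also have "(\<integral>\<^sup>+y. ennreal ((h y)\<^sup>2) * indicator \<Omega> y \<partial>lborel) = (\<integral>\<^sup>+y. ennreal ((h y)\<^sup>2) \<partial>M)"
    by (rule nn_integral_M_borel[symmetric]) measurable
  also have "\<dots> = (\<integral>\<^sup>+y. ennreal ((?g y)\<^sup>2) \<partial>M)"
    by (rule nn_integral_cong_AE) (use gh in \<open>auto elim!: eventually_mono\<close>)
  also have "\<dots> = ennreal (L2_inner M ?g ?g)" by (rule nn_integral_L2[OF grad_L2[OF z]])
  also have "ennreal (1 / c) * (ennreal (L2_inner M ?g ?g) * ennreal c) = ennreal (L2_inner M ?g ?g)"
    using c_pos L2.nonneg[OF grad_L2[OF z]] by (simp add: ennreal_mult[symmetric])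
  finally show ?thesis .
qed

end

context plane_domain
begin

text \<open>The factor 2 leaves room for the averaging square of half-width \<epsilon>, whose points
  are within 2 \<epsilon> of the centre by the l1 bound.\<close>

definition inner_part :: "real \<Rightarrow> pt set" where
  "inner_part \<epsilon> = {x. infdist x (- \<Omega>) > 2 * \<epsilon>}"

lemma complement_nonempty: "- \<Omega> \<noteq> {}"
  using bounded_dom not_bounded_UNIV by (metis Compl_empty_eq double_complement)

lemma inner_part_borel [measurable]: "inner_part \<epsilon> \<in> sets borel"
  unfolding inner_part_def by (intro borel_open open_Collect_less continuous_intros)

lemma inner_part_nb:
  assumes "x \<in> inner_part \<epsilon>" "\<epsilon> > 0" shows "cbox (x - mkpt \<epsilon> \<epsilon>) (x + mkpt \<epsilon> \<epsilon>) \<subseteq> \<Omega>"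
proof
  fix y assume "y \<in> cbox (x - mkpt \<epsilon> \<epsilon>) (x + mkpt \<epsilon> \<epsilon>)"
  then have "\<bar>(x - y) $ 1\<bar> \<le> \<epsilon>" "\<bar>(x - y) $ 2\<bar> \<le> \<epsilon>" by (auto simp: mem_cbox_pt)
  then have "dist x y \<le> 2 * \<epsilon>"
    using norm_le_l1_cart[of "x - y"] by (simp add: dist_norm sum_2)
  then show "y \<in> \<Omega>"
    using assms(1) infdist_le[of y "- \<Omega>" x] by (force simp: inner_part_def)
qed

lemma compact_subset_inner_part:
  assumes "compact S" "S \<subseteq> \<Omega>" obtains \<delta> where "\<delta> > 0" "\<And>\<epsilon>. \<epsilon> < \<delta> \<Longrightarrow> S \<subseteq> inner_part \<epsilon>"
proof (cases "S = {}")
  case False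
  have "continuous_on S (\<lambda>x. infdist x (- \<Omega>))" by (intro continuous_intros)
  from continuous_attains_inf[OF assms(1) False this]
  obtain x where x: "x \<in> S" "\<And>y. y \<in> S \<Longrightarrow> infdist x (- \<Omega>) \<le> infdist y (- \<Omega>)" by blast
  have "infdist x (- \<Omega>) > 0"
    using x(1) assms(2) open_dom complement_nonempty by (intro infdist_pos_not_in_closed) auto
  then show ?thesis
    by (intro that[of "infdist x (- \<Omega>) / 2"]) (use x(2) in \<open>force simp: inner_part_def\<close>)+
qed (use that[of 1] in auto)

text \<open>Absolute continuity on almost every segment is replaced by a bound for each segment whose
  right-hand side is a lower limit; after integration Fatou's lemma applies.\<close>

lemma energy_on_segments:
  assumes z: "z \<in> H1 \<Omega>" and cont: "continuous_on (closure \<Omega>) z"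
  obtains k :: "nat \<Rightarrow> pt \<Rightarrow> ennreal"
  where "\<And>n. k n \<in> borel_measurable borel" "\<And>n. (\<integral>\<^sup>+x. k n x \<partial>lborel) \<le> ennreal (dform \<Omega> z z)"
    "\<And>p q a b. a \<le> b \<Longrightarrow> (\<And>t. t \<in> {a..b} \<Longrightarrow> p + t *\<^sub>R q \<in> \<Omega>) \<Longrightarrow>
      ennreal ((z (p + b *\<^sub>R q) - z (p + a *\<^sub>R q))\<^sup>2)
        \<le> ennreal ((norm q)\<^sup>2 * (b - a)) * liminf (\<lambda>n. \<integral>\<^sup>+t\<in>{a..b}. k n (p + t *\<^sub>R q) \<partial>lborel)"
proof -
  \<comment> \<open>Tietze's theorem supplies the values beyond the domain that the mollifier
    averages over.\<close>
  obtain \<psi> where \<psi>: "continuous_on UNIV \<psi>" "\<And>x. x \<in> closure \<Omega> \<Longrightarrow> \<psi> x = z x"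
    using Tietze_unbounded[OF cont, of UNIV] by auto
  define \<epsilon> where "\<epsilon> n = inverse (real (Suc n))" for n
  have \<epsilon>: "\<epsilon> n > 0" for n by (simp add: \<epsilon>_def)
  have \<epsilon>0: "\<epsilon> \<longlonglongrightarrow> 0" unfolding \<epsilon>_def by (rule LIMSEQ_inverse_real_of_nat)
  have "\<exists>d. d 0 = bump 1 (- \<epsilon> n) (\<epsilon> n) \<and> (\<forall>i t. (d i has_real_derivative d (Suc i) t) (at t))" for n
    using bumps_family[OF bump_mem, of 1 "- \<epsilon> n" "\<epsilon> n"] by metis
  then have "\<forall>n. \<exists>d. d 0 = bump 1 (- \<epsilon> n) (\<epsilon> n) \<and> (\<forall>i t. (d i has_real_derivative d (Suc i) t) (at t))" by blast
  from choice[OF this] obtain d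
    where d: "\<And>n. d n 0 = bump 1 (- \<epsilon> n) (\<epsilon> n)" "\<And>n i t. (d n i has_real_derivative d n (Suc i) t) (at t)"
    by blast
  have mo: "mollifier \<Omega> z \<psi> (\<epsilon> n) (d n)" for n
    by unfold_locales (use z \<psi> \<epsilon> d closure_subset[of \<Omega>] in auto)
  define g where "g n = mollifier.gr \<psi> (d n)" for n
  define mo where "mo n = mollifier.mol \<psi> (d n)" for n
  \<comment> \<open>The squared length of the mollified gradient, cut off where the weak gradient
    does not control it. A fixed segment inside the domain lies in the inner part from some n on, so
    the cut-off costs nothing in the limit.\<close>
  define k where "k n x = ennreal ((g n x $ 1)\<^sup>2) * indicator (inner_part (\<epsilon> n)) x + ennreal ((g n x $ 2)\<^sup>2) * indicator (inner_part (\<epsilon> n)) x" for n x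
  have gm [measurable]: "g n \<in> borel_measurable borel" for n
    unfolding g_def by (rule mollifier.gr_measurable[OF mo])
  have km: "k n \<in> borel_measurable borel" for n
    unfolding k_def by measurable
  have kint: "(\<integral>\<^sup>+x. k n x \<partial>lborel) \<le> ennreal (dform \<Omega> z z)" for n
  proof -
    have "(\<integral>\<^sup>+x. k n x \<partial>lborel) = (\<integral>\<^sup>+x. ennreal ((g n x $ 1)\<^sup>2) * indicator (inner_part (\<epsilon> n)) x \<partial>lborel)
        + (\<integral>\<^sup>+x. ennreal ((g n x $ 2)\<^sup>2) * indicator (inner_part (\<epsilon> n)) x \<partial>lborel)"
      unfolding k_def by (rule nn_integral_add) measurable
    also have "\<dots> \<le> ennreal (L2_inner M (\<lambda>x. grad \<Omega> z x $ 1) (\<lambda>x. grad \<Omega> z x $ 1)) + ennreal (L2_inner M (\<lambda>x. grad \<Omega> z x $ 2) (\<lambda>x. grad \<Omega> z x $ 2))"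
      unfolding g_def using inner_part_nb[OF _ \<epsilon>]
      by (intro add_mono mollifier.gr_energy[OF mo]) auto
    also have "\<dots> = ennreal (dform \<Omega> z z)"
      using L2.nonneg[OF grad_L2[OF z]] by (simp add: dform_components[OF z z] ennreal_plus)
    finally show ?thesis .
  qed
  have lim: "(\<lambda>n. mo n x) \<longlonglongrightarrow> z x" if x: "x \<in> \<Omega>" for x
  proof (rule LIMSEQ_I)
    fix e :: real assume e: "e > 0"
    have "isCont \<psi> x" using \<psi>(1) by (simp add: continuous_on_eq_continuous_at)
    then obtain s where s: "s > 0" "\<And>y. dist y x < s \<Longrightarrow> dist (\<psi> y) (\<psi> x) < e / 2"
      using e unfolding continuous_at_eps_delta by (metis half_gt_zero)
    obtain N where N: "\<And>n. n \<ge> N \<Longrightarrow> \<epsilon> n < s / 2"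
      using order_tendstoD(2)[OF \<epsilon>0, of "s / 2"] s(1) by (auto simp: eventually_sequentially)
    have "norm (mo n x - z x) < e" if n: "n \<ge> N" for n
    proof -
      have "\<bar>mo n x - \<psi> x\<bar> \<le> e / 2"
        unfolding mo_def
      proof (rule mollifier.mol_close[OF mo])
        fix y assume "y \<in> cbox (x - mkpt (\<epsilon> n) (\<epsilon> n)) (x + mkpt (\<epsilon> n) (\<epsilon> n))"
        then have "\<bar>(y - x) $ 1\<bar> \<le> \<epsilon> n" "\<bar>(y - x) $ 2\<bar> \<le> \<epsilon> n" by (auto simp: mem_cbox_pt)
        then have "dist y x < s"
          using norm_le_l1_cart[of "y - x"] N[OF n] by (simp add: dist_norm sum_2)
        then show "\<bar>\<psi> y - \<psi> x\<bar> \<le> e / 2" using s(2)[of y] by (simp add: dist_real_def)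
      qed
      then show ?thesis using \<psi>(2)[of x] x closure_subset[of \<Omega>] e by auto
    qed
    then show "\<exists>no. \<forall>n\<ge>no. norm (mo n x - z x) < e" by blast
  qed
  have seg: "ennreal ((z (p + b *\<^sub>R q) - z (p + a *\<^sub>R q))\<^sup>2)
        \<le> ennreal ((norm q)\<^sup>2 * (b - a)) * liminf (\<lambda>n. \<integral>\<^sup>+t\<in>{a..b}. k n (p + t *\<^sub>R q) \<partial>lborel)"
    if ab: "a \<le> b" and sub: "\<And>t. t \<in> {a..b} \<Longrightarrow> p + t *\<^sub>R q \<in> \<Omega>" for p q a b
  proof -
    let ?S = "(\<lambda>t. p + t *\<^sub>R q) ` {a..b}"
    have "compact ?S" by (intro compact_continuous_image continuous_intros) auto
    then obtain \<delta> where \<delta>: "\<delta> > 0" "\<And>\<epsilon>. \<epsilon> < \<delta> \<Longrightarrow> ?S \<subseteq> inner_part \<epsilon>"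
      using compact_subset_inner_part[of ?S] sub by blast
    have "(\<lambda>n. ennreal ((mo n (p + b *\<^sub>R q) - mo n (p + a *\<^sub>R q))\<^sup>2)) \<longlonglongrightarrow> ennreal ((z (p + b *\<^sub>R q) - z (p + a *\<^sub>R q))\<^sup>2)"
      by (intro tendsto_intros lim sub) (use ab in auto)
    then have "ennreal ((z (p + b *\<^sub>R q) - z (p + a *\<^sub>R q))\<^sup>2) = liminf (\<lambda>n. ennreal ((mo n (p + b *\<^sub>R q) - mo n (p + a *\<^sub>R q))\<^sup>2))"
      by (rule lim_imp_Liminf[OF sequentially_bot, symmetric])
    also have "\<dots> \<le> liminf (\<lambda>n. ennreal ((norm q)\<^sup>2 * (b - a)) * (\<integral>\<^sup>+t\<in>{a..b}. k n (p + t *\<^sub>R q) \<partial>lborel))"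
    proof (rule Liminf_mono)
      show "\<forall>\<^sub>F n in sequentially. ennreal ((mo n (p + b *\<^sub>R q) - mo n (p + a *\<^sub>R q))\<^sup>2)
          \<le> ennreal ((norm q)\<^sup>2 * (b - a)) * (\<integral>\<^sup>+t\<in>{a..b}. k n (p + t *\<^sub>R q) \<partial>lborel)"
        using order_tendstoD(2)[OF \<epsilon>0 \<delta>(1)]
      proof eventually_elim
        fix n assume "\<epsilon> n < \<delta>"
        then have S: "?S \<subseteq> inner_part (\<epsilon> n)" by (rule \<delta>(2))
        have "ennreal ((mo n (p + b *\<^sub>R q) - mo n (p + a *\<^sub>R q))\<^sup>2)
            \<le> ennreal (b - a) * (\<integral>\<^sup>+t\<in>{a..b}. ennreal ((g n (p + t *\<^sub>R q) \<bullet> q)\<^sup>2) \<partial>lborel)"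
          using integral_sq_le[OF ab mollifier.mol_along_line(1)[OF mo ab]] mollifier.mol_along_line(2)[OF mo ab]
          by (simp add: mo_def g_def)
        also have "(\<integral>\<^sup>+t\<in>{a..b}. ennreal ((g n (p + t *\<^sub>R q) \<bullet> q)\<^sup>2) \<partial>lborel) \<le> (\<integral>\<^sup>+t. ennreal ((norm q)\<^sup>2) * (k n (p + t *\<^sub>R q) * indicator {a..b} t) \<partial>lborel)"
        proof (rule nn_integral_mono)
          fix t
          show "ennreal ((g n (p + t *\<^sub>R q) \<bullet> q)\<^sup>2) * indicator {a..b} t \<le> ennreal ((norm q)\<^sup>2) * (k n (p + t *\<^sub>R q) * indicator {a..b} t)"
          proof (cases "t \<in> {a..b}")
            case True
            then have "p + t *\<^sub>R q \<in> inner_part (\<epsilon> n)" using S by blast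
            then have "k n (p + t *\<^sub>R q) = ennreal ((norm (g n (p + t *\<^sub>R q)))\<^sup>2)"
              by (simp add: k_def norm_sq_pt ennreal_plus)
            moreover have "(g n (p + t *\<^sub>R q) \<bullet> q)\<^sup>2 \<le> (norm q)\<^sup>2 * (norm (g n (p + t *\<^sub>R q)))\<^sup>2"
              using Cauchy_Schwarz_ineq[of "g n (p + t *\<^sub>R q)" q] by (simp add: power2_norm_eq_inner mult.commute)
            ultimately show ?thesis using True by (simp add: ennreal_mult[symmetric] ennreal_leI)
          qed simp
        qed
        also have "\<dots> = ennreal ((norm q)\<^sup>2) * (\<integral>\<^sup>+t\<in>{a..b}. k n (p + t *\<^sub>R q) \<partial>lborel)"
        proof -
          note [measurable] = km
          show ?thesis by (intro nn_integral_cmult) measurable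
        qed
        finally show "ennreal ((mo n (p + b *\<^sub>R q) - mo n (p + a *\<^sub>R q))\<^sup>2)
          \<le> ennreal ((norm q)\<^sup>2 * (b - a)) * (\<integral>\<^sup>+t\<in>{a..b}. k n (p + t *\<^sub>R q) \<partial>lborel)"
          using ab by (simp add: ennreal_mult mult_ac mult_right_mono)
      qed
    qed
    also have "\<dots> = ennreal ((norm q)\<^sup>2 * (b - a)) * liminf (\<lambda>n. \<integral>\<^sup>+t\<in>{a..b}. k n (p + t *\<^sub>R q) \<partial>lborel)"
      by (rule liminf_cmult_ennreal)
    finally show ?thesis .
  qed
  show ?thesis using that[of k, OF km kint seg] .
qed

end

section \<open>Geometry of polygonal domains\<close>

text \<open>In the application h and x are the coordinates, across and along one side, of the point
  with parameter l on another side. Let h vanish at r. If x(r) is outside (0,1), then min x (1 - x)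
  is at most a multiple of |l - r| by Lipschitz continuity, hence of |h|. If x(r) is inside, the
  assumption pushes r out of [0,1], and |h| is bounded below.\<close>

lemma affine_pair_separation:
  fixes h0 h1 x0 x1 :: real
  assumes "\<And>l. 0 \<le> l \<Longrightarrow> l \<le> 1 \<Longrightarrow> h0 + l * h1 = 0 \<Longrightarrow> 0 < x0 + l * x1 \<Longrightarrow> x0 + l * x1 < 1 \<Longrightarrow> False"
  shows "\<exists>e>0. \<forall>l. 0 \<le> l \<and> l \<le> 1 \<and> 0 < x0 + l * x1 \<and> x0 + l * x1 < 1 \<longrightarrow>
    e * min (x0 + l * x1) (1 - (x0 + l * x1)) \<le> \<bar>h0 + l * h1\<bar>"
proof (cases "h1 = 0")
  case True
  show ?thesis
  proof (cases "h0 = 0")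
    case True
    then show ?thesis using \<open>h1 = 0\<close> assms by (intro exI[of _ 1]) auto
  next
    case False
    have "\<bar>h0\<bar> * min y (1 - y) \<le> \<bar>h0\<bar>" if "0 < y" for y :: real
      using that by (intro mult_left_le) auto
    then show ?thesis using False True by (intro exI[of _ "\<bar>h0\<bar>"]) auto
  qed
next
  case False
  define r where "r = - h0 / h1"
  have h: "\<bar>h0 + l * h1\<bar> = \<bar>h1\<bar> * \<bar>l - r\<bar>" for l
    using False by (simp add: r_def abs_mult[symmetric] algebra_simps)
  define X where "X = x0 + r * x1"
  have x: "x0 + l * x1 = X + x1 * (l - r)" for l by (simp add: X_def algebra_simps)
  consider "X \<le> 0" | "X \<ge> 1" | "0 < X" "X < 1" by linarith
  then show ?thesis
  proof cases
    case 3
    have "h0 + r * h1 = 0" using False by (simp add: r_def)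
    then have r: "r < 0 \<or> r > 1" using assms[of r] 3 by (force simp: X_def)
    define s where "s = (if r < 0 then - r else r - 1)"
    have s: "s > 0" "\<And>l. 0 \<le> l \<Longrightarrow> l \<le> 1 \<Longrightarrow> s \<le> \<bar>l - r\<bar>" using r by (auto simp: s_def)
    show ?thesis
    proof (intro exI[of _ "\<bar>h1\<bar> * s"] conjI allI impI)
      show "0 < \<bar>h1\<bar> * s" using False s by simp
      fix l assume l: "0 \<le> l \<and> l \<le> 1 \<and> 0 < x0 + l * x1 \<and> x0 + l * x1 < 1"
      have "\<bar>h1\<bar> * s * min (x0 + l * x1) (1 - (x0 + l * x1)) \<le> \<bar>h1\<bar> * s"
        using l s(1) by (intro mult_left_le) auto
      also have "\<dots> \<le> \<bar>h1\<bar> * \<bar>l - r\<bar>" using s(2)[of l] l by (intro mult_left_mono) auto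
      finally show "\<bar>h1\<bar> * s * min (x0 + l * x1) (1 - (x0 + l * x1)) \<le> \<bar>h0 + l * h1\<bar>" by (simp add: h)
    qed
  next
    case (1)
    have m: "min (x0 + l * x1) (1 - (x0 + l * x1)) \<le> (\<bar>x1\<bar> + 1) * \<bar>l - r\<bar>" for l
    proof -
      have "x1 * (l - r) \<le> \<bar>x1\<bar> * \<bar>l - r\<bar>" by (metis abs_ge_self abs_mult)
      then show ?thesis using 1 by (auto simp: x algebra_simps min_def)
    qed
    show ?thesis
    proof (intro exI[of _ "\<bar>h1\<bar> / (\<bar>x1\<bar> + 1)"] conjI allI impI)
      fix l
      have "\<bar>h1\<bar> / (\<bar>x1\<bar> + 1) * min (x0 + l * x1) (1 - (x0 + l * x1)) \<le> \<bar>h1\<bar> / (\<bar>x1\<bar> + 1) * ((\<bar>x1\<bar> + 1) * \<bar>l - r\<bar>)"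
        by (intro mult_left_mono m) auto
      also have "\<dots> = \<bar>h1\<bar> * \<bar>l - r\<bar>" by (simp add: field_simps)
      finally show "\<bar>h1\<bar> / (\<bar>x1\<bar> + 1) * min (x0 + l * x1) (1 - (x0 + l * x1)) \<le> \<bar>h0 + l * h1\<bar>" by (simp add: h)
    qed (use False in auto)
  next
    case (2)
    have m: "min (x0 + l * x1) (1 - (x0 + l * x1)) \<le> (\<bar>x1\<bar> + 1) * \<bar>l - r\<bar>" for l
    proof -
      have "- (x1 * (l - r)) \<le> \<bar>x1\<bar> * \<bar>l - r\<bar>" by (metis abs_ge_minus_self abs_mult)
      then show ?thesis using 2 by (auto simp: x algebra_simps min_def)
    qed
    show ?thesis
    proof (intro exI[of _ "\<bar>h1\<bar> / (\<bar>x1\<bar> + 1)"] conjI allI impI)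
      fix l
      have "\<bar>h1\<bar> / (\<bar>x1\<bar> + 1) * min (x0 + l * x1) (1 - (x0 + l * x1)) \<le> \<bar>h1\<bar> / (\<bar>x1\<bar> + 1) * ((\<bar>x1\<bar> + 1) * \<bar>l - r\<bar>)"
        by (intro mult_left_mono m) auto
      also have "\<dots> = \<bar>h1\<bar> * \<bar>l - r\<bar>" by (simp add: field_simps)
      finally show "\<bar>h1\<bar> / (\<bar>x1\<bar> + 1) * min (x0 + l * x1) (1 - (x0 + l * x1)) \<le> \<bar>h0 + l * h1\<bar>" by (simp add: h)
    qed (use False in auto)
  qed
qed

locale polygon_domain =
  fixes \<Omega> :: "pt set" and P :: polygon
  assumes pd: "polygonal_domain \<Omega> P"
begin

lemma pd_facts:
  "open \<Omega>" "connected \<Omega>" "bounded \<Omega>" "\<Omega> \<noteq> {}" "inj_on (vertex P) {1..nvert P}"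
  "bij_betw (nxt P) {1..nvert P} {1..nvert P}" "\<And>j. j \<in> {1..nvert P} \<Longrightarrow> nxt P j \<noteq> j"
  "\<And>j k. j \<in> {1..nvert P} \<Longrightarrow> k \<in> {1..nvert P} \<Longrightarrow> j \<noteq> k \<Longrightarrow>
     side P j \<inter> side P k = {vertex P j, vertex P (nxt P j)} \<inter> {vertex P k, vertex P (nxt P k)}"
  "frontier \<Omega> = bdry P"
  using pd unfolding polygonal_domain_def by blast+

sublocale plane_domain \<Omega>
  by unfold_locales (fact pd_facts)+

abbreviation "J \<equiv> {1..nvert P}"

definition sp :: "nat \<Rightarrow> real \<Rightarrow> pt" where
  "sp j t = vertex P j + t *\<^sub>R (vertex P (nxt P j) - vertex P j)"

lemma side_eq: "side P j = sp j ` {0..1}"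
  unfolding side_def closed_segment_image_interval
  by (rule image_cong) (simp_all add: sp_def algebra_simps)

lemma frontier_eq: "frontier \<Omega> = bdry P"
  by (rule pd_facts)

lemma nxt_mem: "j \<in> J \<Longrightarrow> nxt P j \<in> J"
  using pd_facts(6) by (rule bij_betwE[THEN bspec])

lemma vertex_neq: "j \<in> J \<Longrightarrow> vertex P j \<noteq> vertex P (nxt P j)"
  using pd_facts(7)[of j] inj_onD[OF pd_facts(5), of j "nxt P j"] nxt_mem[of j] by auto

lemma side_inter: "i \<in> J \<Longrightarrow> j \<in> J \<Longrightarrow> i \<noteq> j \<Longrightarrow> side P i \<inter> side P j \<subseteq> {vertex P j, vertex P (nxt P j)}"
  using pd_facts(8)[of i j] by blast

lemma side_subset: "j \<in> J \<Longrightarrow> side P j \<subseteq> bdry P"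
  by (auto simp: bdry_def)

lemma bdry_disjoint: "x \<in> bdry P \<Longrightarrow> x \<notin> \<Omega>"
  unfolding frontier_eq[symmetric] frontier_def using open_dom by (simp add: interior_open)

lemma bdry_closure: "bdry P \<subseteq> closure \<Omega>"
  unfolding frontier_eq[symmetric] frontier_def by blast

text \<open>The domain is described through its frontier, so a point is shown to belong to it by a
  connected set that avoids all sides and contains a known point.\<close>

lemma connected_in_domain:
  assumes "connected T" "T \<inter> bdry P = {}" "T \<inter> \<Omega> \<noteq> {}" shows "T \<subseteq> \<Omega>"
  using connected_Int_frontier[of T \<Omega>] assms by (auto simp: frontier_eq)

lemma vertex_on_side:
  assumes "j \<in> J" "k \<in> J" "vertex P k \<in> side P j"
  shows "vertex P k = vertex P j \<or> vertex P k = vertex P (nxt P j)"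
proof (cases "j = k")
  case False
  have "vertex P k \<in> side P k" by (simp add: side_def)
  then show ?thesis using side_inter[OF assms(2,1)] False assms(3) by auto
qed simp

lemma radial_segment:
  fixes S e x :: pt
  assumes "S + l *\<^sub>R (x - S) \<in> closed_segment S e" "l > 0" "dist x S < dist S e"
  shows "x \<in> closed_segment S e"
proof -
  obtain u where u: "0 \<le> u" "u \<le> 1" "S + l *\<^sub>R (x - S) = (1 - u) *\<^sub>R S + u *\<^sub>R e"
    using assms(1) by (auto simp: closed_segment_def)
  then have "l *\<^sub>R (x - S) = u *\<^sub>R (e - S)" by (simp add: algebra_simps)
  then have eq: "x - S = (u / l) *\<^sub>R (e - S)"
    using assms(2) by (metis divideR_right less_numeral_extra(3) scaleR_scaleR divide_inverse mult.commute)
  have "norm (x - S) = (u / l) * norm (e - S)" unfolding eq using u assms(2) by simp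
  then have "(u / l) * norm (e - S) < norm (e - S)"
    using assms(3) by (simp add: dist_norm norm_minus_commute)
  then have "u / l < 1" using norm_ge_zero[of "e - S"] by (smt (verit) mult_le_cancel_right1)
  moreover have "x = (1 - u / l) *\<^sub>R S + (u / l) *\<^sub>R e" using eq by (simp add: algebra_simps)
  ultimately show ?thesis using u assms(2) by (auto simp: closed_segment_def intro!: exI[of _ "u / l"])
qed

text \<open>Either the side has positive distance from the vertex, or the vertex is one of its ends
  and the side is radial there. In both cases a dilation about the vertex that stays nearby cannot
  carry a point off the side onto it.\<close>

lemma side_near_vertex:
  assumes "j \<in> J" "k \<in> J"
  shows "\<exists>r>0. \<forall>x l. dist x (vertex P k) < r \<and> l > 0 \<and> l * dist x (vertex P k) < r \<and>
    vertex P k + l *\<^sub>R (x - vertex P k) \<in> side P j \<longrightarrow> x \<in> side P j"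
proof (cases "vertex P k \<in> side P j")
  case False
  have "closed (side P j)" "side P j \<noteq> {}" by (auto simp: side_def)
  then have pos: "infdist (vertex P k) (side P j) > 0" using False by (rule infdist_pos_not_in_closed)
  have "\<not> vertex P k + l *\<^sub>R (x - vertex P k) \<in> side P j"
    if "l > 0" "l * dist x (vertex P k) < infdist (vertex P k) (side P j)" for x l
  proof
    assume "vertex P k + l *\<^sub>R (x - vertex P k) \<in> side P j"
    then have "infdist (vertex P k) (side P j) \<le> dist (vertex P k) (vertex P k + l *\<^sub>R (x - vertex P k))"
      by (rule infdist_le)
    then show False using that by (simp add: dist_norm)
  qed
  then show ?thesis using pos by blast
next
  case True
  obtain e where e: "side P j = closed_segment (vertex P k) e" "e \<noteq> vertex P k"
  proof (cases "vertex P k = vertex P j")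
    case True
    then show ?thesis using that[of "vertex P (nxt P j)"] vertex_neq[OF assms(1)] by (simp add: side_def)
  next
    case False
    then show ?thesis
      using that[of "vertex P j"] vertex_neq[OF assms(1)] vertex_on_side[OF assms True]
      by (simp add: side_def closed_segment_commute)
  qed
  show ?thesis
    by (rule exI[of _ "dist (vertex P k) e"]) (use e radial_segment in auto)
qed

text \<open>Near a vertex the domain is invariant under dilations. The dilates of x by factors
  between 1 and l form a connected set that contains x and misses every side by
  \<open>side_near_vertex\<close>. The bound r \<le> 1 later keeps nonnegative powers of the
  distance below 1.\<close>

lemma cone_at_vertex:
  assumes k: "k \<in> J"
  shows "\<exists>r>0. r \<le> 1 \<and> (\<forall>x l. x \<in> \<Omega> \<and> dist x (vertex P k) < r \<and> l > 0 \<and> l * dist x (vertex P k) < r \<longrightarrow>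
    vertex P k + l *\<^sub>R (x - vertex P k) \<in> \<Omega>)"
proof -
  let ?S = "vertex P k"
  have "\<forall>j\<in>J. \<exists>r>0. \<forall>x l. dist x ?S < r \<and> l > 0 \<and> l * dist x ?S < r \<and> ?S + l *\<^sub>R (x - ?S) \<in> side P j \<longrightarrow> x \<in> side P j"
    using side_near_vertex k by blast
  from bchoice[OF this] obtain r where r: "\<And>j. j \<in> J \<Longrightarrow> r j > 0"
    "\<And>j x l. j \<in> J \<Longrightarrow> dist x ?S < r j \<Longrightarrow> l > 0 \<Longrightarrow> l * dist x ?S < r j \<Longrightarrow> ?S + l *\<^sub>R (x - ?S) \<in> side P j \<Longrightarrow> x \<in> side P j"
    by blast
  define R where "R = Min (insert 1 (r ` J))"
  have R: "R > 0" "R \<le> 1" using r(1) by (auto simp: R_def)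
  have R3: "R \<le> r j" if "j \<in> J" for j
    unfolding R_def by (rule Min_le) (use that in auto)
  have "?S + l *\<^sub>R (x - ?S) \<in> \<Omega>" if x: "x \<in> \<Omega>" "dist x ?S < R" "l > 0" "l * dist x ?S < R" for x l
  proof -
    let ?T = "(\<lambda>m. ?S + m *\<^sub>R (x - ?S)) ` closed_segment 1 l"
    have "connected ?T" by (intro connected_continuous_image continuous_intros) auto
    moreover have "?T \<inter> bdry P = {}"
    proof (rule ccontr)
      assume "?T \<inter> bdry P \<noteq> {}"
      then obtain m j where m: "m \<in> closed_segment 1 l" and j: "j \<in> J" "?S + m *\<^sub>R (x - ?S) \<in> side P j"
        unfolding bdry_def by blast
      have "m > 0" "m \<le> max 1 l" using m x(3) by (auto simp: closed_segment_eq_real_ivl split: if_splits)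
      then have "m * dist x ?S \<le> max 1 l * dist x ?S" by (intro mult_right_mono) auto
      also have "\<dots> < R" using x by (auto simp: max_def)
      finally have "m * dist x ?S < r j" "dist x ?S < r j" using R3[OF j(1)] x(2) by auto
      then have "x \<in> side P j" using r(2)[OF j(1) _ \<open>m > 0\<close>] j(2) by blast
      then show False using bdry_disjoint x(1) side_subset[OF j(1)] by blast
    qed
    moreover have "x \<in> ?T \<inter> \<Omega>" using x by (auto intro!: image_eqI[of _ _ 1])
    ultimately have "?T \<subseteq> \<Omega>" by (intro connected_in_domain) auto
    then show ?thesis by auto
  qed
  then show ?thesis using R by blast
qed

definition perp :: "pt \<Rightarrow> pt" where
  "perp d = mkpt (- d $ 2) (d $ 1)"

lemma perp_coordinates:
  assumes "d \<noteq> 0"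
  shows "x = ((x \<bullet> d) / (d \<bullet> d)) *\<^sub>R d + ((x \<bullet> perp d) / (d \<bullet> d)) *\<^sub>R perp d"
proof -
  have D: "d \<bullet> d \<noteq> 0" using assms by simp
  have e: "d \<bullet> d = d $ 1 * d $ 1 + d $ 2 * d $ 2" by (simp add: inner_vec_def sum_2)
  have "(d \<bullet> d) *\<^sub>R x = (x \<bullet> d) *\<^sub>R d + (x \<bullet> perp d) *\<^sub>R perp d"
    by (rule mkpt_eqI) (simp_all add: perp_def inner_vec_def sum_2 algebra_simps)
  then have "x = (1 / (d \<bullet> d)) *\<^sub>R ((x \<bullet> d) *\<^sub>R d + (x \<bullet> perp d) *\<^sub>R perp d)"
    using D by (metis divide_inverse mult_1 right_inverse scaleR_one scaleR_scaleR mult.commute)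
  then show ?thesis by (simp add: scaleR_add_right)
qed

lemma perp_inner [simp]: "perp d \<bullet> perp d = d \<bullet> d" "d \<bullet> perp d = 0" "perp d \<bullet> d = 0"
  by (auto simp: perp_def inner_vec_def sum_2)

text \<open>Another side can meet this one only at its ends and may leave it there at any angle. The
  free region around the open side is therefore wedge-shaped at the ends and not a strip of constant
  width.\<close>

lemma side_separation:
  assumes ij: "i \<in> J" "j \<in> J" "i \<noteq> j"
  defines "a \<equiv> vertex P j" and "d \<equiv> vertex P (nxt P j) - vertex P j"
  shows "\<exists>e>0. \<forall>s t. 0 < s \<and> s < 1 \<and> a + s *\<^sub>R d + t *\<^sub>R perp d \<in> side P i \<longrightarrow> e * min s (1 - s) \<le> \<bar>t\<bar>"
proof -
  have d0: "d \<noteq> 0" using vertex_neq[OF ij(2)] by (simp add: d_def)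
  then have D: "d \<bullet> d > 0" by simp
  let ?c = "vertex P i - a" and ?f = "vertex P (nxt P i) - vertex P i"
  define x0 x1 where "x0 = (?c \<bullet> d) / (d \<bullet> d)" and "x1 = (?f \<bullet> d) / (d \<bullet> d)"
  define h0 h1 where "h0 = (?c \<bullet> perp d) / (d \<bullet> d)" and "h1 = (?f \<bullet> perp d) / (d \<bullet> d)"
  have pt: "sp i l = a + (x0 + l * x1) *\<^sub>R d + (h0 + l * h1) *\<^sub>R perp d" for l
    using perp_coordinates[OF d0, of "?c + l *\<^sub>R ?f"]
    by (simp add: sp_def x0_def x1_def h0_def h1_def inner_add_left inner_diff_left add_divide_distrib diff_divide_distrib algebra_simps)
  have coord: "s = s' \<and> t = t'" if "a + s *\<^sub>R d + t *\<^sub>R perp d = a + s' *\<^sub>R d + t' *\<^sub>R perp d" for s s' t t'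
  proof -
    have "(s *\<^sub>R d + t *\<^sub>R perp d) \<bullet> d = (s' *\<^sub>R d + t' *\<^sub>R perp d) \<bullet> d"
      "(s *\<^sub>R d + t *\<^sub>R perp d) \<bullet> perp d = (s' *\<^sub>R d + t' *\<^sub>R perp d) \<bullet> perp d"
      using that by (simp_all add: add.assoc)
    then show ?thesis using D by (simp add: inner_add_left)
  qed
  have "\<exists>e>0. \<forall>l. 0 \<le> l \<and> l \<le> 1 \<and> 0 < x0 + l * x1 \<and> x0 + l * x1 < 1 \<longrightarrow>
    e * min (x0 + l * x1) (1 - (x0 + l * x1)) \<le> \<bar>h0 + l * h1\<bar>"
  proof (rule affine_pair_separation)
    fix l :: real assume l: "0 \<le> l" "l \<le> 1" "h0 + l * h1 = 0" "0 < x0 + l * x1" "x0 + l * x1 < 1"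
    have "sp i l \<in> side P i" using l by (auto simp: side_eq)
    moreover have spj: "sp i l = sp j (x0 + l * x1)" unfolding pt l(3) by (simp add: sp_def a_def d_def)
    moreover have "sp j (x0 + l * x1) \<in> side P j" using l by (auto simp: side_eq)
    ultimately have "sp j (x0 + l * x1) \<in> {vertex P j, vertex P (nxt P j)}" using side_inter[OF ij] by auto
    then show False
      using coord[of "x0 + l * x1" 0 0 0] coord[of "x0 + l * x1" 0 1 0] l by (auto simp: sp_def a_def d_def)
  qed
  then obtain e where e: "e > 0" "\<And>l. 0 \<le> l \<Longrightarrow> l \<le> 1 \<Longrightarrow> 0 < x0 + l * x1 \<Longrightarrow> x0 + l * x1 < 1 \<Longrightarrow>
    e * min (x0 + l * x1) (1 - (x0 + l * x1)) \<le> \<bar>h0 + l * h1\<bar>" by blast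
  show ?thesis
  proof (intro exI[of _ e] conjI e(1) allI impI)
    fix s t assume st: "0 < s \<and> s < 1 \<and> a + s *\<^sub>R d + t *\<^sub>R perp d \<in> side P i"
    then obtain l where l: "0 \<le> l" "l \<le> 1" "a + s *\<^sub>R d + t *\<^sub>R perp d = sp i l" by (auto simp: side_eq)
    then show "e * min s (1 - s) \<le> \<bar>t\<bar>" using coord[OF l(3)[unfolded pt]] e(2)[of l] st by auto
  qed
qed

text \<open>The wedges of \<open>side_separation\<close> contain an open triangle on each side of
  the segment that misses the boundary. Being connected, such a triangle lies in the domain once it
  meets it, and a domain point close to the midpoint of the side decides which of the two
  does.\<close>

lemma side_triangle:
  assumes j: "j \<in> J"
  defines "a \<equiv> vertex P j" and "d \<equiv> vertex P (nxt P j) - vertex P j"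
  shows "\<exists>q. d $ 1 * q $ 2 - d $ 2 * q $ 1 \<noteq> 0 \<and> (\<forall>s t. 0 < s \<and> 0 < t \<and> s + t < 1 \<longrightarrow> a + s *\<^sub>R d + t *\<^sub>R q \<in> \<Omega>)"
proof -
  have d0: "d \<noteq> 0" using vertex_neq[OF j] by (simp add: d_def)
  then have D: "d \<bullet> d > 0" by simp
  have "\<forall>i\<in>J - {j}. \<exists>e>0. \<forall>s t. 0 < s \<and> s < 1 \<and> a + s *\<^sub>R d + t *\<^sub>R perp d \<in> side P i \<longrightarrow> e * min s (1 - s) \<le> \<bar>t\<bar>"
    using side_separation j unfolding a_def d_def by blast
  from bchoice[OF this] obtain f where f: "\<And>i. i \<in> J - {j} \<Longrightarrow> f i > 0"
    "\<And>i s t. i \<in> J - {j} \<Longrightarrow> 0 < s \<Longrightarrow> s < 1 \<Longrightarrow> a + s *\<^sub>R d + t *\<^sub>R perp d \<in> side P i \<Longrightarrow> f i * min s (1 - s) \<le> \<bar>t\<bar>" by blast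
  define e where "e = Min (insert 1 (f ` (J - {j})))"
  have e: "e > 0" "\<And>i. i \<in> J - {j} \<Longrightarrow> e \<le> f i" using f(1) by (auto simp: e_def)
  have off: "a + s *\<^sub>R d + t *\<^sub>R perp d \<notin> bdry P" if st: "0 < s" "s < 1" "t \<noteq> 0" "\<bar>t\<bar> < e * min s (1 - s)" for s t
  proof
    assume "a + s *\<^sub>R d + t *\<^sub>R perp d \<in> bdry P"
    then obtain i where i: "i \<in> J" "a + s *\<^sub>R d + t *\<^sub>R perp d \<in> side P i" by (auto simp: bdry_def)
    show False
    proof (cases "i = j")
      case True
      then obtain l where "a + s *\<^sub>R d + t *\<^sub>R perp d = sp j l" using i by (auto simp: side_eq)
      then have "(s *\<^sub>R d + t *\<^sub>R perp d) \<bullet> perp d = (l *\<^sub>R d) \<bullet> perp d" by (simp add: sp_def a_def d_def add.assoc)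
      then show False using D st by (simp add: inner_add_left)
    next
      case False
      then have "f i * min s (1 - s) \<le> \<bar>t\<bar>" using f(2)[of i] i st by auto
      moreover have "e * min s (1 - s) \<le> f i * min s (1 - s)"
        using e(2)[of i] i False st by (intro mult_right_mono) auto
      ultimately show False using st by linarith
    qed
  qed
  \<comment> \<open>The apex sits over the midpoint. In the coordinates of \<open>qpt\<close> the
    height is e t / 2, while s + t/2 and 1 - (s + t/2) both exceed t/2, so the wedge condition holds
    strictly.\<close>
  define q where "q \<sigma> = (1/2) *\<^sub>R d + (\<sigma> * e / 2) *\<^sub>R perp d" for \<sigma> :: real
  define T where "T \<sigma> = {a + s *\<^sub>R d + t *\<^sub>R q \<sigma> | s t. 0 < s \<and> 0 < t \<and> s + t < 1}" for \<sigma>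
  have qpt: "a + s *\<^sub>R d + t *\<^sub>R q \<sigma> = a + (s + t / 2) *\<^sub>R d + (\<sigma> * e * t / 2) *\<^sub>R perp d" for s t \<sigma>
    by (simp add: q_def algebra_simps)
  have T_in: "T \<sigma> \<subseteq> \<Omega>" if \<sigma>: "\<bar>\<sigma>\<bar> = 1" and meet: "T \<sigma> \<inter> \<Omega> \<noteq> {}" for \<sigma>
  proof (rule connected_in_domain[OF _ _ meet])
    have "convex (T \<sigma>)"
      unfolding convex_def
    proof (intro ballI allI impI)
      fix x y and u v :: real assume "x \<in> T \<sigma>" "y \<in> T \<sigma>" and uv: "0 \<le> u" "0 \<le> v" "u + v = 1"
      then obtain s t s' t' where x: "x = a + s *\<^sub>R d + t *\<^sub>R q \<sigma>" "0 < s" "0 < t" "s + t < 1"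
        and y: "y = a + s' *\<^sub>R d + t' *\<^sub>R q \<sigma>" "0 < s'" "0 < t'" "s' + t' < 1" by (auto simp: T_def)
      have pos: "0 < u * r + v * r'" if "0 < r" "0 < r'" for r r' :: real
        using that uv by (metis add_cancel_left_left add_nonneg_pos add_pos_nonneg less_eq_real_def mult_nonneg_nonneg mult_pos_pos zero_less_one)
      have "u *\<^sub>R x + v *\<^sub>R y = (u + v) *\<^sub>R a + (u * s + v * s') *\<^sub>R d + (u * t + v * t') *\<^sub>R q \<sigma>"
        by (simp add: x y algebra_simps)
      moreover have "0 < u * (1 - (s + t)) + v * (1 - (s' + t'))" using pos x y by simp
      then have "(u * s + v * s') + (u * t + v * t') < u + v" by (simp add: algebra_simps)
      ultimately show "u *\<^sub>R x + v *\<^sub>R y \<in> T \<sigma>"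
        unfolding T_def using pos[of s s'] pos[of t t'] x y uv by auto
    qed
    then show "connected (T \<sigma>)" by (rule convex_connected)
    show "T \<sigma> \<inter> bdry P = {}"
    proof (rule ccontr)
      assume "T \<sigma> \<inter> bdry P \<noteq> {}"
      then obtain s t where st: "0 < s" "0 < t" "s + t < 1" "a + s *\<^sub>R d + t *\<^sub>R q \<sigma> \<in> bdry P" by (auto simp: T_def)
      have "\<bar>\<sigma> * e * t / 2\<bar> = e * (t / 2)" using \<sigma> e(1) st by (simp add: abs_mult)
      also have "\<dots> < e * min (s + t / 2) (1 - (s + t / 2))" using e(1) st by (intro mult_strict_left_mono) auto
      finally show False using off[of "s + t / 2" "\<sigma> * e * t / 2"] st \<sigma> e(1) by (auto simp: qpt)
    qed
  qed
  \<comment> \<open>A neighbourhood of the midpoint so small that its points off the side belong to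
    one of the two triangles.\<close>
  define U where "U = {x. \<bar>((x - a) \<bullet> d) / (d \<bullet> d) - 1/2\<bar> < 1/8} \<inter> {x. \<bar>((x - a) \<bullet> perp d) / (d \<bullet> d)\<bar> < e / 8}"
  have "open U" unfolding U_def
    by (intro open_Int open_Collect_less continuous_intros) (use D in auto)
  have "sp j (1/2) = a + (1/2) *\<^sub>R d" by (simp add: sp_def a_def d_def)
  then have "sp j (1/2) \<in> U" using D e(1) by (simp add: U_def)
  moreover have "sp j (1/2) \<in> closure \<Omega>"
  proof -
    have "sp j (1/2) \<in> side P j" unfolding side_eq by (rule imageI) simp
    then show ?thesis using bdry_closure side_subset[OF j] by blast
  qed
  ultimately obtain x where x: "x \<in> U" "x \<in> \<Omega>"
    using \<open>open U\<close> by (metis closure_iff_nhds_not_empty disjoint_iff order_refl)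
  define s where "s = ((x - a) \<bullet> d) / (d \<bullet> d)"
  define t where "t = ((x - a) \<bullet> perp d) / (d \<bullet> d)"
  have xst: "x = a + s *\<^sub>R d + t *\<^sub>R perp d"
    using perp_coordinates[OF d0, of "x - a"] by (simp add: s_def t_def algebra_simps)
  have b: "\<bar>s - 1/2\<bar> < 1/8" "\<bar>t\<bar> < e / 8" using x(1) by (auto simp: U_def s_def t_def)
  have t0: "t \<noteq> 0"
  proof
    assume "t = 0"
    then have "x = sp j s" by (simp add: xst sp_def a_def d_def)
    moreover have "s \<in> {0..1}" unfolding atLeastAtMost_iff using b(1) by linarith
    ultimately have "x \<in> side P j" by (auto simp: side_eq)
    then show False using bdry_disjoint side_subset[OF j] x(2) by blast
  qed
  define \<sigma> where "\<sigma> = sgn t"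
  have \<sigma>: "\<bar>\<sigma>\<bar> = 1" using t0 by (simp add: \<sigma>_def)
  \<comment> \<open>Solves \<sigma> e r / 2 = t: r is the coordinate of x along
    \<open>q \<sigma>\<close>.\<close>
  define r where "r = 2 * \<bar>t\<bar> / e"
  have r: "0 < r" "r < 1/4" using b(2) t0 e(1) by (auto simp: r_def field_simps)
  have "x = a + (s - r / 2) *\<^sub>R d + r *\<^sub>R q \<sigma>"
  proof -
    have "\<sigma> * e * r / 2 = t" using e(1) sgn_mult_abs[of t] by (simp add: r_def \<sigma>_def)
    then show ?thesis unfolding qpt by (simp add: xst)
  qed
  moreover have "0 < s - r / 2" "s - r / 2 + r < 1" using b(1) r by linarith+
  ultimately have "x \<in> T \<sigma>" unfolding T_def using r(1) by blast
  then have sub: "T \<sigma> \<subseteq> \<Omega>" using T_in[OF \<sigma>] x(2) by blast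
  have "d $ 1 * q \<sigma> $ 2 - d $ 2 * q \<sigma> $ 1 = (\<sigma> * e / 2) * (d \<bullet> d)"
    by (simp add: q_def perp_def inner_vec_def sum_2 algebra_simps)
  also have "\<dots> \<noteq> 0" using \<sigma> e(1) D by auto
  finally show ?thesis using sub by (intro exI[of _ "q \<sigma>"]) (auto simp: T_def)
qed

end

section \<open>Trace, Friedrichs and Hardy inequalities\<close>

context plane_domain
begin

text \<open>The initial point of a segment may lie on the boundary, where trace values are read off.
  One sequence k serves all segments, so the bounds can be integrated over families of them.\<close>

definition energy_bound :: "scal \<Rightarrow> (nat \<Rightarrow> pt \<Rightarrow> ennreal) \<Rightarrow> bool" where
  "energy_bound z k \<longleftrightarrow> (\<forall>n. k n \<in> borel_measurable borel) \<and>
     (\<forall>n. (\<integral>\<^sup>+x. k n x \<partial>lborel) \<le> ennreal (dform \<Omega> z z)) \<and>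
     (\<forall>p q a b. a < b \<longrightarrow> (\<forall>t. a < t \<and> t \<le> b \<longrightarrow> p + t *\<^sub>R q \<in> \<Omega>) \<longrightarrow>
       ennreal ((z (p + b *\<^sub>R q) - z (p + a *\<^sub>R q))\<^sup>2)
         \<le> ennreal ((norm q)\<^sup>2 * (b - a)) * liminf (\<lambda>n. \<integral>\<^sup>+t\<in>{a..b}. k n (p + t *\<^sub>R q) \<partial>lborel))"

lemma segment_closure:
  fixes p q :: pt
  assumes "a < b" "\<And>t. a < t \<Longrightarrow> t \<le> b \<Longrightarrow> p + t *\<^sub>R q \<in> \<Omega>" "t \<in> {a..b}"
  shows "p + t *\<^sub>R q \<in> closure \<Omega>"
proof -
  have "(\<lambda>t. p + t *\<^sub>R q) ` closure {a<..b} \<subseteq> closure \<Omega>"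
    using closure_subset[of \<Omega>] assms(2)
    by (intro image_closure_subset continuous_intros) auto
  then have "(\<lambda>t. p + t *\<^sub>R q) ` {a..b} \<subseteq> closure \<Omega>"
    using assms(1) by (simp add: closure_greaterThanAtMost)
  then show ?thesis using assms(3) by blast
qed

lemma energy_boundD:
  assumes "energy_bound z k" "a < b" "\<And>t. a < t \<Longrightarrow> t \<le> b \<Longrightarrow> p + t *\<^sub>R q \<in> \<Omega>"
  shows "ennreal ((z (p + b *\<^sub>R q) - z (p + a *\<^sub>R q))\<^sup>2)
    \<le> ennreal ((norm q)\<^sup>2 * (b - a)) * liminf (\<lambda>n. \<integral>\<^sup>+t\<in>{a..b}. k n (p + t *\<^sub>R q) \<partial>lborel)"
  using assms unfolding energy_bound_def by blast

text \<open>The initial point is moved into the domain, where \<open>energy_on_segments\<close>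
  applies, and then returned: the left side converges by continuity of z, and the right side only
  grows with the segment.\<close>

lemma energy_bound_exists:
  assumes z: "z \<in> H1 \<Omega>" and cont: "continuous_on (closure \<Omega>) z"
  shows "\<exists>k. energy_bound z k"
proof -
  obtain k where k: "\<And>n. k n \<in> borel_measurable borel" "\<And>n. (\<integral>\<^sup>+x. k n x \<partial>lborel) \<le> ennreal (dform \<Omega> z z)"
    and seg: "\<And>p q a b. a \<le> b \<Longrightarrow> (\<And>t. t \<in> {a..b} \<Longrightarrow> p + t *\<^sub>R q \<in> \<Omega>) \<Longrightarrow>
      ennreal ((z (p + b *\<^sub>R q) - z (p + a *\<^sub>R q))\<^sup>2)
        \<le> ennreal ((norm q)\<^sup>2 * (b - a)) * liminf (\<lambda>n. \<integral>\<^sup>+t\<in>{a..b}. k n (p + t *\<^sub>R q) \<partial>lborel)"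
    by (rule energy_on_segments[OF z cont]) blast
  have "ennreal ((z (p + b *\<^sub>R q) - z (p + a *\<^sub>R q))\<^sup>2)
        \<le> ennreal ((norm q)\<^sup>2 * (b - a)) * liminf (\<lambda>n. \<integral>\<^sup>+t\<in>{a..b}. k n (p + t *\<^sub>R q) \<partial>lborel)"
    if ab: "a < b" and sub: "\<And>t. a < t \<Longrightarrow> t \<le> b \<Longrightarrow> p + t *\<^sub>R q \<in> \<Omega>" for p q a b
  proof (rule tendsto_upperbound)
    have "continuous_on {a..b} (\<lambda>s. z (p + s *\<^sub>R q))"
      by (rule continuous_on_compose2[OF cont]) (use segment_closure[OF ab sub] in \<open>auto intro!: continuous_intros\<close>)
    from continuous_on_Icc_at_rightD[OF this ab]
    have "((\<lambda>s. z (p + s *\<^sub>R q)) \<longlongrightarrow> z (p + a *\<^sub>R q)) (at_right a)" .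
    then show "((\<lambda>s. ennreal ((z (p + b *\<^sub>R q) - z (p + s *\<^sub>R q))\<^sup>2)) \<longlongrightarrow> ennreal ((z (p + b *\<^sub>R q) - z (p + a *\<^sub>R q))\<^sup>2)) (at_right a)"
      by (intro tendsto_intros)
    show "\<forall>\<^sub>F s in at_right a. ennreal ((z (p + b *\<^sub>R q) - z (p + s *\<^sub>R q))\<^sup>2)
        \<le> ennreal ((norm q)\<^sup>2 * (b - a)) * liminf (\<lambda>n. \<integral>\<^sup>+t\<in>{a..b}. k n (p + t *\<^sub>R q) \<partial>lborel)"
      using eventually_at_right_real[OF ab]
    proof eventually_elim
      fix s assume s: "s \<in> {a<..<b}"
      have "ennreal ((z (p + b *\<^sub>R q) - z (p + s *\<^sub>R q))\<^sup>2)
        \<le> ennreal ((norm q)\<^sup>2 * (b - s)) * liminf (\<lambda>n. \<integral>\<^sup>+t\<in>{s..b}. k n (p + t *\<^sub>R q) \<partial>lborel)"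
        by (rule seg) (use s sub in auto)
      also have "\<dots> \<le> ennreal ((norm q)\<^sup>2 * (b - a)) * liminf (\<lambda>n. \<integral>\<^sup>+t\<in>{a..b}. k n (p + t *\<^sub>R q) \<partial>lborel)"
        using s by (intro mult_mono Liminf_mono always_eventually allI nn_integral_mono ennreal_leI mult_left_mono)
          (auto simp: indicator_def)
      finally show "ennreal ((z (p + b *\<^sub>R q) - z (p + s *\<^sub>R q))\<^sup>2)
        \<le> ennreal ((norm q)\<^sup>2 * (b - a)) * liminf (\<lambda>n. \<integral>\<^sup>+t\<in>{a..b}. k n (p + t *\<^sub>R q) \<partial>lborel)" .
    qed
  qed (simp add: trivial_limit_at_right_real)
  then show ?thesis unfolding energy_bound_def using k by blast
qed

text \<open>Values outside the domain carry no meaning. Removing them leaves a Borel function on the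
  plane, so integrals over whole lines may be used without tracking where the lines leave the
  domain.\<close>

definition cut :: "scal \<Rightarrow> scal" where
  "cut z x = indicator \<Omega> x * z x"

lemma cut_eq: "x \<in> \<Omega> \<Longrightarrow> cut z x = z x"
  by (simp add: cut_def)

lemma cut_measurable:
  assumes "continuous_on (closure \<Omega>) z" shows "cut z \<in> borel_measurable borel"
proof -
  have "(\<lambda>x. indicator \<Omega> x *\<^sub>R z x) \<in> borel_measurable borel"
    by (rule borel_measurable_continuous_on_indicator)
      (use closure_subset[of \<Omega>] assms in \<open>auto intro: continuous_on_subset\<close>)
  then show ?thesis by (simp add: cut_def[abs_def])
qed

lemma nn_integral_cut:
  assumes z: "z \<in> H1 \<Omega>" and cont: "continuous_on (closure \<Omega>) z"
  shows "(\<integral>\<^sup>+x. ennreal ((cut z x)\<^sup>2) \<partial>lborel) = ennreal (L2_inner M z z)"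
proof -
  note [measurable] = cut_measurable[OF cont]
  have "(\<integral>\<^sup>+x. ennreal ((cut z x)\<^sup>2) \<partial>lborel) = (\<integral>\<^sup>+x. ennreal ((cut z x)\<^sup>2) * indicator \<Omega> x \<partial>lborel)"
    by (rule nn_integral_cong) (auto simp: cut_def indicator_def)
  also have "\<dots> = (\<integral>\<^sup>+x. ennreal ((cut z x)\<^sup>2) \<partial>M)"
    by (rule nn_integral_M_borel[symmetric]) measurable
  also have "\<dots> = (\<integral>\<^sup>+x. ennreal ((z x)\<^sup>2) \<partial>M)"
    by (rule nn_integral_cong) (auto simp: cut_def)
  finally show ?thesis using nn_integral_L2[OF H1_L2[OF z]] by simp
qed

lemma ennreal_sq_le:
  fixes x y :: real
  shows "ennreal (x\<^sup>2) \<le> 2 * ennreal (y\<^sup>2) + 2 * ennreal ((y - x)\<^sup>2)"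
proof -
  have "x\<^sup>2 \<le> 2 * y\<^sup>2 + 2 * (y - x)\<^sup>2"
    using zero_le_power2[of "2 * y - x"] by (simp add: power2_eq_square algebra_simps)
  then have "ennreal (x\<^sup>2) \<le> ennreal (2 * y\<^sup>2 + 2 * (y - x)\<^sup>2)" by (rule ennreal_leI)
  then show ?thesis by (simp add: ennreal_plus ennreal_mult)
qed

text \<open>The value at a boundary point is compared with the value s units of q away, and the
  result is averaged over 0 < s < th. Averaging costs 1/th on the L2 part, while the squared
  increment brings a factor s \<le> th on the energy; this is the origin of the two opposite
  powers.\<close>

lemma strip_trace:
  fixes a d q :: pt
  assumes z: "z \<in> H1 \<Omega>" and cont: "continuous_on (closure \<Omega>) z"
    and det: "d $ 1 * q $ 2 - d $ 2 * q $ 1 \<noteq> 0"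
    and strip: "\<And>t s. l < t \<Longrightarrow> t < u \<Longrightarrow> 0 < s \<Longrightarrow> s < 1 \<Longrightarrow> a + t *\<^sub>R d + s *\<^sub>R q \<in> \<Omega>"
    and th: "0 < th" "th \<le> 1"
  defines "c \<equiv> 1 / \<bar>d $ 1 * q $ 2 - d $ 2 * q $ 1\<bar>"
  shows "(\<integral>\<^sup>+t\<in>{l<..<u}. ennreal ((z (a + t *\<^sub>R d))\<^sup>2) \<partial>lborel)
    \<le> ennreal (2 / th * c * L2_inner M z z + 2 * (norm q)\<^sup>2 * th * c * dform \<Omega> z z)"
proof -
  have c0: "c \<ge> 0" by (simp add: c_def)
  obtain k where eb: "energy_bound z k" using energy_bound_exists[OF z cont] by blast
  then have km [measurable]: "\<And>n. k n \<in> borel_measurable borel"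
    and kint: "\<And>n. (\<integral>\<^sup>+x. k n x \<partial>lborel) \<le> ennreal (dform \<Omega> z z)"
    by (auto simp: energy_bound_def)
  note cm [measurable] = cut_measurable[OF cont]
  \<comment> \<open>\<open>A\<close> and \<open>H\<close> integrate over the whole transverse line;
    nonnegativity permits this enlargement, and it makes the shear formula applicable.\<close>
  define A where "A t = (\<integral>\<^sup>+s. ennreal ((cut z (a + s *\<^sub>R q + t *\<^sub>R d))\<^sup>2) \<partial>lborel)" for t
  define H where "H t = liminf (\<lambda>n. \<integral>\<^sup>+s. k n (a + s *\<^sub>R q + t *\<^sub>R d) \<partial>lborel)" for t
  have Am [measurable]: "A \<in> borel_measurable borel" unfolding A_def by measurable
  have Hm [measurable]: "H \<in> borel_measurable borel" unfolding H_def by measurable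
  have det': "q $ 1 * d $ 2 - q $ 2 * d $ 1 \<noteq> 0" using det by (simp add: mult.commute)
  have c': "1 / \<bar>q $ 1 * d $ 2 - q $ 2 * d $ 1\<bar> = c"
    by (simp add: c_def abs_minus_commute mult.commute)
  have shear: "(\<integral>\<^sup>+t. \<integral>\<^sup>+s. f (a + s *\<^sub>R q + t *\<^sub>R d) \<partial>lborel \<partial>lborel) = ennreal c * (\<integral>\<^sup>+x. f x \<partial>lborel)"
    if "f \<in> borel_measurable borel" for f :: "pt \<Rightarrow> ennreal"
    using nn_integral_shear[OF that det', of a] by (simp add: c')
  have pw: "ennreal ((z (a + t *\<^sub>R d))\<^sup>2) \<le> ennreal (2 / th) * A t + ennreal (2 * (norm q)\<^sup>2 * th) * H t"
    if t: "l < t" "t < u" for t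
  proof -
    let ?y = "a + t *\<^sub>R d"
    have one: "ennreal ((z ?y)\<^sup>2) \<le> 2 * ennreal ((cut z (a + s *\<^sub>R q + t *\<^sub>R d))\<^sup>2) + ennreal (2 * (norm q)\<^sup>2 * th) * H t"
      if s: "s \<in> {0<..<th}" for s
    proof -
      have in\<Omega>: "?y + r *\<^sub>R q \<in> \<Omega>" if "0 < r" "r \<le> s" for r
        using strip[OF t, of r] that s th by simp
      have "ennreal ((z (?y + s *\<^sub>R q) - z (?y + 0 *\<^sub>R q))\<^sup>2)
          \<le> ennreal ((norm q)\<^sup>2 * (s - 0)) * liminf (\<lambda>n. \<integral>\<^sup>+r\<in>{0..s}. k n (?y + r *\<^sub>R q) \<partial>lborel)"
        by (rule energy_boundD[OF eb]) (use s in\<Omega> in auto)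
      also have "\<dots> \<le> ennreal ((norm q)\<^sup>2 * th) * H t"
        unfolding H_def using s th
        by (intro mult_mono Liminf_mono always_eventually allI nn_integral_mono ennreal_leI mult_left_mono)
          (auto simp: indicator_def add_ac)
      finally have "2 * ennreal ((z (?y + s *\<^sub>R q) - z ?y)\<^sup>2) \<le> 2 * (ennreal ((norm q)\<^sup>2 * th) * H t)"
        by (intro mult_left_mono) auto
      also have "\<dots> = ennreal (2 * (norm q)\<^sup>2 * th) * H t"
        using th by (simp add: ennreal_mult mult.assoc)
      finally have "ennreal ((z ?y)\<^sup>2) \<le> 2 * ennreal ((z (?y + s *\<^sub>R q))\<^sup>2) + ennreal (2 * (norm q)\<^sup>2 * th) * H t"
        using ennreal_sq_le[of "z ?y" "z (?y + s *\<^sub>R q)"] by (meson add_left_mono order_trans)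
      also have "z (?y + s *\<^sub>R q) = cut z (a + s *\<^sub>R q + t *\<^sub>R d)"
        using in\<Omega>[of s] s cut_eq[of "?y + s *\<^sub>R q" z] by (simp add: add_ac)
      finally show ?thesis .
    qed
    \<comment> \<open>Averaging over s: the left integrand is constant on an interval of length
      th.\<close>
    have "ennreal th * ennreal ((z ?y)\<^sup>2) = (\<integral>\<^sup>+s. ennreal ((z ?y)\<^sup>2) * indicator {0<..<th} s \<partial>lborel)"
      using th by (subst nn_integral_cmult) (auto simp: mult.commute)
    also have "\<dots> \<le> (\<integral>\<^sup>+s. 2 * ennreal ((cut z (a + s *\<^sub>R q + t *\<^sub>R d))\<^sup>2) + ennreal (2 * (norm q)\<^sup>2 * th) * H t * indicator {0<..<th} s \<partial>lborel)"
      by (rule nn_integral_mono) (use one in \<open>auto simp: indicator_def\<close>)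
    also have "\<dots> = 2 * A t + ennreal (2 * (norm q)\<^sup>2 * th) * H t * ennreal th"
      unfolding A_def using th by (subst nn_integral_add) (auto simp: nn_integral_cmult)
    finally have "ennreal (1 / th) * (ennreal th * ennreal ((z ?y)\<^sup>2)) \<le> ennreal (1 / th) * (2 * A t + ennreal (2 * (norm q)\<^sup>2 * th) * H t * ennreal th)"
      by (rule mult_left_mono) simp
    moreover have inv: "ennreal (1 / th) * (ennreal th * X) = X" for X
      using th by (simp add: mult.assoc[symmetric] ennreal_mult[symmetric])
    moreover have "ennreal (1 / th) * (2 * A t) = ennreal (2 / th) * A t"
      using th ennreal_mult[of 2 "1 / th"] by (simp add: mult_ac)
    moreover have "ennreal (1 / th) * (Y * ennreal th) = Y" for Y
      using inv[of Y] by (simp add: mult.commute)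
    ultimately show ?thesis by (simp only: distrib_left)
  qed
  have "(\<integral>\<^sup>+t\<in>{l<..<u}. ennreal ((z (a + t *\<^sub>R d))\<^sup>2) \<partial>lborel) \<le> (\<integral>\<^sup>+t. ennreal (2 / th) * A t + ennreal (2 * (norm q)\<^sup>2 * th) * H t \<partial>lborel)"
    by (rule nn_integral_mono) (use pw in \<open>auto simp: indicator_def\<close>)
  also have "\<dots> = ennreal (2 / th) * (\<integral>\<^sup>+t. A t \<partial>lborel) + ennreal (2 * (norm q)\<^sup>2 * th) * (\<integral>\<^sup>+t. H t \<partial>lborel)"
    by (subst nn_integral_add) (auto simp: nn_integral_cmult)
  also have "(\<integral>\<^sup>+t. A t \<partial>lborel) = ennreal c * ennreal (L2_inner M z z)"
    unfolding A_def by (subst shear) (auto simp: nn_integral_cut[OF z cont])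
  also have "(\<integral>\<^sup>+t. H t \<partial>lborel) \<le> ennreal c * ennreal (dform \<Omega> z z)"
  proof -
    have "(\<integral>\<^sup>+t. H t \<partial>lborel) \<le> liminf (\<lambda>n. \<integral>\<^sup>+t. \<integral>\<^sup>+s. k n (a + s *\<^sub>R q + t *\<^sub>R d) \<partial>lborel \<partial>lborel)"
      unfolding H_def by (rule nn_integral_liminf) measurable
    also have "\<dots> = liminf (\<lambda>n. ennreal c * (\<integral>\<^sup>+x. k n x \<partial>lborel))" by (simp add: shear km)
    also have "\<dots> \<le> liminf (\<lambda>n::nat. ennreal c * ennreal (dform \<Omega> z z))"
      by (intro Liminf_mono always_eventually allI mult_left_mono kint) simp
    finally show ?thesis by (simp add: Liminf_const)
  qed
  also have "ennreal (2 / th) * (ennreal c * ennreal (L2_inner M z z)) + ennreal (2 * (norm q)\<^sup>2 * th) * (ennreal c * ennreal (dform \<Omega> z z))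
      = ennreal (2 / th * c * L2_inner M z z + 2 * (norm q)\<^sup>2 * th * c * dform \<Omega> z z)"
    using th c0 L2.nonneg[OF H1_L2[OF z]] D.nonneg[OF z]
    by (simp add: ennreal_mult[symmetric] ennreal_plus[symmetric] mult.assoc del: ennreal_plus)
  finally show ?thesis by (simp add: add_left_mono mult_left_mono)
qed

end

section \<open>Arc length and the trace inequality\<close>

context polygon_domain
begin

abbreviation "\<Gamma> \<equiv> arclength P"

definition len :: "nat \<Rightarrow> real" where
  "len j = dist (vertex P j) (vertex P (nxt P j))"

lemma sets_\<Gamma>: "sets \<Gamma> = sets (restrict_space borel (bdry P))"
  by (simp add: arclength_def)

lemma space_\<Gamma>: "space \<Gamma> = bdry P"
  by (simp add: arclength_def space_restrict_space)

lemma sp_mem: "j \<in> J \<Longrightarrow> t \<in> {0..1} \<Longrightarrow> sp j t \<in> bdry P"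
  using side_subset[of j] unfolding side_eq by blast

lemma continuous_sp [continuous_intros]: "continuous_on A f \<Longrightarrow> continuous_on A (\<lambda>x. sp j (f x))"
  unfolding sp_def by (intro continuous_intros)

lemma measurable_sp [measurable]: "sp j \<in> borel_measurable borel"
  by (intro borel_measurable_continuous_onI continuous_sp continuous_on_id)

lemma sp_measurable_bdry: "j \<in> J \<Longrightarrow> sp j \<in> measurable (restrict_space lborel {0..1}) (restrict_space borel (bdry P))"
  using sp_mem by (intro measurable_restrict_space2 measurable_restrict_space1) (auto simp: space_restrict_space)

text \<open>Fubini for counting measure on the sides times Lebesgue measure on [0,1]; the density
  contributes the side lengths.\<close>

lemma nn_integral_\<Gamma>:
  assumes f: "f \<in> borel_measurable \<Gamma>"
  shows "(\<integral>\<^sup>+x. f x \<partial>\<Gamma>) = (\<Sum>j\<in>J. ennreal (len j) * (\<integral>\<^sup>+t\<in>{0..1}. f (sp j t) \<partial>lborel))"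
proof -
  let ?I = "restrict_space lborel {0..1::real}"
  let ?N = "count_space J \<Otimes>\<^sub>M ?I"
  let ?m = "\<lambda>(j, t). sp j t"
  have fb: "f \<in> borel_measurable (restrict_space borel (bdry P))"
    using f by (simp cong: measurable_cong_sets add: sets_\<Gamma>)
  have mm: "?m \<in> measurable ?N (restrict_space borel (bdry P))"
    by (rule measurable_pair_measure_countable1) (use sp_measurable_bdry in auto)
  have lm: "(\<lambda>(j, t::real). ennreal (len j)) \<in> borel_measurable ?N"
    by (rule measurable_pair_measure_countable1) auto
  have sf: "sigma_finite_measure ?I"
    by (intro finite_measure.axioms finite_measureI) (simp add: emeasure_restrict_space space_restrict_space)
  have "\<Gamma> = distr (density ?N (\<lambda>(j, t). ennreal (len j))) (restrict_space borel (bdry P)) ?m"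
    by (simp add: arclength_def len_def sp_def)
  then have "(\<integral>\<^sup>+x. f x \<partial>\<Gamma>) = (\<integral>\<^sup>+x. f (?m x) \<partial>density ?N (\<lambda>(j, t). ennreal (len j)))"
    using mm fb by (simp add: nn_integral_distr)
  also have "\<dots> = (\<integral>\<^sup>+x. (case x of (j, t) \<Rightarrow> ennreal (len j)) * f (?m x) \<partial>?N)"
    using measurable_compose[OF mm fb] lm by (intro nn_integral_density) auto
  also have "\<dots> = (\<integral>\<^sup>+j. \<integral>\<^sup>+t. ennreal (len j) * f (sp j t) \<partial>?I \<partial>count_space J)"
    using sigma_finite_measure.nn_integral_fst[OF sf, of "\<lambda>x. (case x of (j, t) \<Rightarrow> ennreal (len j)) * f (?m x)" "count_space J"]
      measurable_compose[OF mm fb] lm by simp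
  also have "\<dots> = (\<Sum>j\<in>J. \<integral>\<^sup>+t. ennreal (len j) * f (sp j t) \<partial>?I)"
    by (simp add: nn_integral_count_space_finite)
  also have "\<dots> = (\<Sum>j\<in>J. ennreal (len j) * (\<integral>\<^sup>+t\<in>{0..1}. f (sp j t) \<partial>lborel))"
  proof (rule sum.cong[OF refl])
    fix j assume j: "j \<in> J"
    have "(\<integral>\<^sup>+t. ennreal (len j) * f (sp j t) \<partial>?I) = ennreal (len j) * (\<integral>\<^sup>+t. f (sp j t) \<partial>?I)"
      by (rule nn_integral_cmult) (rule measurable_compose[OF sp_measurable_bdry[OF j] fb])
    then show "(\<integral>\<^sup>+t. ennreal (len j) * f (sp j t) \<partial>?I) = ennreal (len j) * (\<integral>\<^sup>+t\<in>{0..1}. f (sp j t) \<partial>lborel)"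
      by (simp add: nn_integral_restrict_space)
  qed
  finally show ?thesis .
qed

lemma finite_\<Gamma>: "finite_measure \<Gamma>"
proof (rule finite_measureI)
  have "emeasure \<Gamma> (space \<Gamma>) = (\<integral>\<^sup>+x. 1 \<partial>\<Gamma>)" by simp
  also have "\<dots> < \<infinity>" by (subst nn_integral_\<Gamma>) (auto simp: ennreal_mult_less_top)
  finally show "emeasure \<Gamma> (space \<Gamma>) \<noteq> \<infinity>" by simp
qed

lemma L2_\<Gamma>_continuous:
  assumes "continuous_on (closure \<Omega>) z" shows "z \<in> L2 \<Gamma>"
proof -
  have c: "continuous_on (bdry P) z" using assms bdry_closure by (rule continuous_on_subset)
  have "compact (bdry P)"
    unfolding frontier_eq[symmetric] using bounded_dom by (rule compact_frontier_bounded)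
  then have "bounded (z ` bdry P)" by (intro compact_imp_bounded compact_continuous_image c)
  then obtain B where "\<And>x. x \<in> bdry P \<Longrightarrow> \<bar>z x\<bar> \<le> B" unfolding bounded_iff by force
  moreover have "z \<in> borel_measurable \<Gamma>"
    using borel_measurable_continuous_on_restrict[OF c] by (simp cong: measurable_cong_sets add: sets_\<Gamma>)
  ultimately show ?thesis by (intro L2_bounded[OF finite_\<Gamma>, of _ B]) (auto simp: space_\<Gamma>)
qed

lemma nn_integral_\<Gamma>_sq:
  assumes "continuous_on (closure \<Omega>) z"
  shows "ennreal (L2_inner \<Gamma> z z) = (\<Sum>j\<in>J. ennreal (len j) * (\<integral>\<^sup>+t\<in>{0..1}. ennreal ((z (sp j t))\<^sup>2) \<partial>lborel))"
  using nn_integral_L2[OF L2_\<Gamma>_continuous[OF assms]] L2_measurable[OF L2_\<Gamma>_continuous[OF assms]]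
  by (subst nn_integral_\<Gamma>[symmetric]) auto

lemma side_trace_measurable:
  fixes z :: scal
  assumes "continuous_on (closure \<Omega>) z" "j \<in> J"
  shows "(\<lambda>t. indicator {0..1} t * z (sp j t)) \<in> borel_measurable borel"
proof -
  have "continuous_on {0..1} (\<lambda>t. z (sp j t))"
    by (rule continuous_on_compose2[OF assms(1)]) (use sp_mem[OF assms(2)] bdry_closure in \<open>auto intro!: continuous_intros\<close>)
  then have "(\<lambda>t. indicator {0..1} t *\<^sub>R z (sp j t)) \<in> borel_measurable borel"
    by (intro borel_measurable_continuous_on_indicator) auto
  then show ?thesis by simp
qed

text \<open>Over a whole side only a triangle is available, not a strip. It does contain a strip
  over each half of the side, in direction q/2 over the first half and (q - d)/2 over the second,
  and the ends and the midpoint are null sets.\<close>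

lemma side_trace_inequality:
  assumes j: "j \<in> J"
  shows "\<exists>C\<ge>0. \<forall>z th. z \<in> H1 \<Omega> \<and> continuous_on (closure \<Omega>) z \<and> 0 < th \<and> th \<le> 1 \<longrightarrow>
    (\<integral>\<^sup>+t\<in>{0..1}. ennreal ((z (sp j t))\<^sup>2) \<partial>lborel) \<le> ennreal (C * (L2_inner M z z / th + th * dform \<Omega> z z))"
proof -
  let ?a = "vertex P j" and ?d = "vertex P (nxt P j) - vertex P j"
  obtain q where det: "?d $ 1 * q $ 2 - ?d $ 2 * q $ 1 \<noteq> 0"
    and tri: "\<And>s t. 0 < s \<Longrightarrow> 0 < t \<Longrightarrow> s + t < 1 \<Longrightarrow> ?a + s *\<^sub>R ?d + t *\<^sub>R q \<in> \<Omega>"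
    using side_triangle[OF j] by blast
  define q1 q2 where "q1 = (1/2) *\<^sub>R q" and "q2 = (1/2) *\<^sub>R (q - ?d)"
  \<comment> \<open>The two directions differ by a multiple of d, so both shears have the same
    Jacobian.\<close>
  define D where "D = \<bar>?d $ 1 * q $ 2 - ?d $ 2 * q $ 1\<bar> / 2"
  have D1: "\<bar>?d $ 1 * q1 $ 2 - ?d $ 2 * q1 $ 1\<bar> = D"
  proof -
    have "?d $ 1 * q1 $ 2 - ?d $ 2 * q1 $ 1 = (?d $ 1 * q $ 2 - ?d $ 2 * q $ 1) / 2"
      unfolding q1_def by (simp add: algebra_simps)
    then show ?thesis unfolding D_def by (simp only: abs_divide abs_numeral)
  qed
  have D2: "\<bar>?d $ 1 * q2 $ 2 - ?d $ 2 * q2 $ 1\<bar> = D"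
  proof -
    have "?d $ 1 * q2 $ 2 - ?d $ 2 * q2 $ 1 = (?d $ 1 * q $ 2 - ?d $ 2 * q $ 1) / 2"
      unfolding q2_def by (simp add: field_simps)
    then show ?thesis unfolding D_def by (simp only: abs_divide abs_numeral)
  qed
  have D0: "D > 0" using det by (simp add: D_def)
  have s1: "?a + t *\<^sub>R ?d + s *\<^sub>R q1 \<in> \<Omega>" if "0 < t" "t < 1/2" "0 < s" "s < 1" for t s
    using tri[of t "s / 2"] that by (simp add: q1_def)
  have s2: "?a + t *\<^sub>R ?d + s *\<^sub>R q2 \<in> \<Omega>" if "1/2 < t" "t < 1" "0 < s" "s < 1" for t s
  proof -
    have eq: "?a + (t - s / 2) *\<^sub>R ?d + (s / 2) *\<^sub>R q = ?a + t *\<^sub>R ?d + s *\<^sub>R q2"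
      by (simp add: q2_def algebra_simps)
    have "?a + (t - s / 2) *\<^sub>R ?d + (s / 2) *\<^sub>R q \<in> \<Omega>"
      by (rule tri) (use that in auto)
    then show ?thesis unfolding eq .
  qed
  \<comment> \<open>Dominates 1 and both squared direction lengths, so one constant covers the L2
    part and the gradient part on both halves.\<close>
  define N where "N = 1 + (norm q1)\<^sup>2 + (norm q2)\<^sup>2"
  show ?thesis
  proof (intro exI[of _ "4 / D * N"] conjI allI impI)
    show "0 \<le> 4 / D * N" using D0 by (simp add: N_def)
    fix z th assume "z \<in> H1 \<Omega> \<and> continuous_on (closure \<Omega>) z \<and> 0 < th \<and> (th::real) \<le> 1"
    then have z: "z \<in> H1 \<Omega>" and cont: "continuous_on (closure \<Omega>) z" and th: "0 < th" "th \<le> 1" by auto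
    have nn: "0 \<le> L2_inner M z z" "0 \<le> dform \<Omega> z z" using L2.nonneg[OF H1_L2[OF z]] D.nonneg[OF z] .
    define X where "X = L2_inner M z z / th" define Y where "Y = th * dform \<Omega> z z"
    have XY: "X \<ge> 0" "Y \<ge> 0" using nn th by (auto simp: X_def Y_def)
    let ?u = "\<lambda>t. indicator {0..1} t * z (sp j t)"
    note [measurable] = side_trace_measurable[OF cont j]
    have half: "(\<integral>\<^sup>+t\<in>{l<..<u}. ennreal ((?u t)\<^sup>2) \<partial>lborel) \<le> ennreal (2 / D * N * (X + Y))"
      if lu: "0 \<le> l" "u \<le> 1" and strip: "\<And>t s. l < t \<Longrightarrow> t < u \<Longrightarrow> 0 < s \<Longrightarrow> s < 1 \<Longrightarrow> ?a + t *\<^sub>R ?d + s *\<^sub>R r \<in> \<Omega>"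
        and r: "\<bar>?d $ 1 * r $ 2 - ?d $ 2 * r $ 1\<bar> = D" "(norm r)\<^sup>2 \<le> N" for l u r
    proof -
      have det': "?d $ 1 * r $ 2 - ?d $ 2 * r $ 1 \<noteq> 0" using r(1) D0 by auto
      have "(\<integral>\<^sup>+t\<in>{l<..<u}. ennreal ((?u t)\<^sup>2) \<partial>lborel) = (\<integral>\<^sup>+t\<in>{l<..<u}. ennreal ((z (?a + t *\<^sub>R ?d))\<^sup>2) \<partial>lborel)"
        by (rule nn_integral_cong) (use lu in \<open>auto simp: indicator_def sp_def\<close>)
      also have "\<dots> \<le> ennreal (2 / th * (1 / D) * L2_inner M z z + 2 * (norm r)\<^sup>2 * th * (1 / D) * dform \<Omega> z z)"
        using strip_trace[OF z cont det' strip th] unfolding r(1) by simp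
      also have "\<dots> \<le> ennreal (2 / D * N * (X + Y))"
      proof (rule ennreal_leI)
        have "2 / th * (1 / D) * L2_inner M z z + 2 * (norm r)\<^sup>2 * th * (1 / D) * dform \<Omega> z z = 2 / D * (1 * X + (norm r)\<^sup>2 * Y)"
          by (simp add: X_def Y_def add_divide_distrib distrib_left mult_ac)
        also have "\<dots> \<le> 2 / D * (N * X + N * Y)"
          using D0 XY r(2) by (intro mult_left_mono add_mono mult_right_mono) (auto simp: N_def)
        finally show "2 / th * (1 / D) * L2_inner M z z + 2 * (norm r)\<^sup>2 * th * (1 / D) * dform \<Omega> z z \<le> 2 / D * N * (X + Y)"
          by (simp only: distrib_left mult.assoc)
      qed
      finally show ?thesis .
    qed
    have "(\<integral>\<^sup>+t\<in>{0..1}. ennreal ((z (sp j t))\<^sup>2) \<partial>lborel) \<le> (\<integral>\<^sup>+t. ennreal ((?u t)\<^sup>2) * indicator {0<..<1/2} t + ennreal ((?u t)\<^sup>2) * indicator {1/2<..<1} t \<partial>lborel)"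
    proof (rule nn_integral_mono_AE)
      have "AE t in lborel. t \<noteq> (0::real)" "AE t in lborel. t \<noteq> (1::real)" "AE t in lborel. t \<noteq> (1/2::real)"
        by (rule AE_lborel_singleton)+
      then show "AE t in lborel. ennreal ((z (sp j t))\<^sup>2) * indicator {0..1} t \<le> ennreal ((?u t)\<^sup>2) * indicator {0<..<1/2} t + ennreal ((?u t)\<^sup>2) * indicator {1/2<..<1} t"
        by eventually_elim (auto simp: indicator_def)
    qed
    also have "\<dots> = (\<integral>\<^sup>+t\<in>{0<..<1/2}. ennreal ((?u t)\<^sup>2) \<partial>lborel) + (\<integral>\<^sup>+t\<in>{1/2<..<1}. ennreal ((?u t)\<^sup>2) \<partial>lborel)"
      by (rule nn_integral_add) measurable
    also have "\<dots> \<le> ennreal (2 / D * N * (X + Y)) + ennreal (2 / D * N * (X + Y))"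
      by (intro add_mono half[OF _ _ s1 D1] half[OF _ _ s2 D2]) (auto simp: N_def)
    also have "\<dots> = ennreal (4 / D * N * (X + Y))"
      using D0 XY by (subst ennreal_plus[symmetric]) (auto simp: N_def)
    finally show "(\<integral>\<^sup>+t\<in>{0..1}. ennreal ((z (sp j t))\<^sup>2) \<partial>lborel) \<le> ennreal (4 / D * N * (L2_inner M z z / th + th * dform \<Omega> z z))"
      by (simp add: X_def Y_def)
  qed
qed

theorem trace_inequality:
  obtains C where "C > 0" "\<And>z th. z \<in> H1 \<Omega> \<Longrightarrow> continuous_on (closure \<Omega>) z \<Longrightarrow> 0 < th \<Longrightarrow> th \<le> 1 \<Longrightarrow>
    L2_inner \<Gamma> z z \<le> C * (L2_inner M z z / th + th * dform \<Omega> z z)"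
proof -
  have "\<forall>j\<in>J. \<exists>C\<ge>0. \<forall>z th. z \<in> H1 \<Omega> \<and> continuous_on (closure \<Omega>) z \<and> 0 < th \<and> th \<le> 1 \<longrightarrow>
    (\<integral>\<^sup>+t\<in>{0..1}. ennreal ((z (sp j t))\<^sup>2) \<partial>lborel) \<le> ennreal (C * (L2_inner M z z / th + th * dform \<Omega> z z))"
    using side_trace_inequality by blast
  from bchoice[OF this] obtain C where C: "\<And>j. j \<in> J \<Longrightarrow> C j \<ge> 0"
    "\<And>j z th. j \<in> J \<Longrightarrow> z \<in> H1 \<Omega> \<Longrightarrow> continuous_on (closure \<Omega>) z \<Longrightarrow> 0 < th \<Longrightarrow> th \<le> 1 \<Longrightarrow>
    (\<integral>\<^sup>+t\<in>{0..1}. ennreal ((z (sp j t))\<^sup>2) \<partial>lborel) \<le> ennreal (C j * (L2_inner M z z / th + th * dform \<Omega> z z))" by blast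
  show ?thesis
  proof (rule that[of "1 + (\<Sum>j\<in>J. len j * C j)"])
    have nn: "0 \<le> (\<Sum>j\<in>J. len j * C j)" using C(1) by (intro sum_nonneg mult_nonneg_nonneg) (auto simp: len_def)
    then show "0 < 1 + (\<Sum>j\<in>J. len j * C j)" by simp
    fix z and th :: real assume z: "z \<in> H1 \<Omega>" and cont: "continuous_on (closure \<Omega>) z" and th: "0 < th" "th \<le> 1"
    define X where "X = L2_inner M z z / th + th * dform \<Omega> z z"
    have X: "X \<ge> 0" using th L2.nonneg[OF H1_L2[OF z]] D.nonneg[OF z] by (simp add: X_def)
    have "ennreal (L2_inner \<Gamma> z z) \<le> (\<Sum>j\<in>J. ennreal (len j) * ennreal (C j * X))"
      unfolding nn_integral_\<Gamma>_sq[OF cont] X_def by (intro sum_mono mult_left_mono C z cont th) auto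
    also have "\<dots> = ennreal (\<Sum>j\<in>J. len j * (C j * X))"
      using C(1) X by (subst sum_ennreal[symmetric]) (auto simp: ennreal_mult len_def)
    also have "(\<Sum>j\<in>J. len j * (C j * X)) = (\<Sum>j\<in>J. len j * C j) * X"
      by (simp add: sum_distrib_right mult.assoc)
    finally have "L2_inner \<Gamma> z z \<le> (\<Sum>j\<in>J. len j * C j) * X"
      using nn X by (simp add: ennreal_le_iff)
    also have "\<dots> \<le> (1 + (\<Sum>j\<in>J. len j * C j)) * X" using X by (intro mult_right_mono) auto
    finally show "L2_inner \<Gamma> z z \<le> (1 + (\<Sum>j\<in>J. len j * C j)) * (L2_inner M z z / th + th * dform \<Omega> z z)"
      by (simp add: X_def)
  qed
qed

end

section \<open>The Friedrichs inequality\<close>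

context polygon_domain
begin

text \<open>The squared boundary value at the point of side j at height s, or 0 if the side does not
  reach that height. A horizontal side is met at a single height only; the value infinity there is
  trivially an upper bound and does not affect integrals.\<close>

definition level :: "scal \<Rightarrow> nat \<Rightarrow> real \<Rightarrow> ennreal" where
  "level z j s = (let v = vertex P j $ 2; w = vertex P (nxt P j) $ 2 in
     if w = v then (if s = v then \<infinity> else 0)
     else ennreal ((indicator {0..1} ((s - v) / (w - v)) * z (sp j ((s - v) / (w - v))))\<^sup>2))"

lemma level_measurable:
  assumes "continuous_on (closure \<Omega>) z" "j \<in> J"
  shows "level z j \<in> borel_measurable borel"
proof -
  note [measurable] = side_trace_measurable[OF assms]
  define u where "u t = indicator {0..1} t * z (sp j t)" for t
  have [measurable]: "u \<in> borel_measurable borel" unfolding u_def by measurable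
  have "level z j = (\<lambda>s. let v = vertex P j $ 2; w = vertex P (nxt P j) $ 2 in
     if w = v then (if s = v then \<infinity> else 0) else ennreal ((u ((s - v) / (w - v)))\<^sup>2))"
    by (simp add: level_def u_def fun_eq_iff Let_def)
  then show ?thesis by (cases "vertex P (nxt P j) $ 2 = vertex P j $ 2") (simp_all add: Let_def)
qed

text \<open>The substitution contributes the vertical extent of the side, which is at most its
  length. A horizontal side contributes only a null set of heights.\<close>

lemma nn_integral_level:
  assumes "continuous_on (closure \<Omega>) z" "j \<in> J"
  shows "(\<integral>\<^sup>+s. level z j s \<partial>lborel) \<le> ennreal (len j) * (\<integral>\<^sup>+t\<in>{0..1}. ennreal ((z (sp j t))\<^sup>2) \<partial>lborel)"
proof -
  define v w where "v = vertex P j $ 2" and "w = vertex P (nxt P j) $ 2"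
  show ?thesis
  proof (cases "w = v")
    case True
    have "(\<integral>\<^sup>+s. level z j s \<partial>lborel) = (\<integral>\<^sup>+s. 0 \<partial>(lborel :: real measure))"
    proof (rule nn_integral_cong_AE)
      show "AE s in lborel. level z j s = 0"
        using AE_lborel_singleton[of v] by eventually_elim (use True in \<open>auto simp: level_def v_def w_def\<close>)
    qed
    then show ?thesis by simp
  next
    case False
    define u where "u t = indicator {0..1} t * z (sp j t)" for t
    have [measurable]: "u \<in> borel_measurable borel" unfolding u_def by (rule side_trace_measurable[OF assms])
    have lv: "level z j s = ennreal ((u (- v / (w - v) + 1 / (w - v) * s))\<^sup>2)" for s
      using False by (simp add: level_def u_def v_def[symmetric] w_def[symmetric] diff_divide_distrib)
    have "(\<integral>\<^sup>+s. level z j s \<partial>lborel) = ennreal (1 / \<bar>1 / (w - v)\<bar>) * (\<integral>\<^sup>+t. ennreal ((u t)\<^sup>2) \<partial>lborel)"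
      unfolding lv using False by (subst nn_integral_affine_real[where f="\<lambda>t. ennreal ((u t)\<^sup>2)"]) auto
    also have "(\<integral>\<^sup>+t. ennreal ((u t)\<^sup>2) \<partial>lborel) = (\<integral>\<^sup>+t\<in>{0..1}. ennreal ((z (sp j t))\<^sup>2) \<partial>lborel)"
      by (rule nn_integral_cong) (auto simp: u_def indicator_def)
    also have "1 / \<bar>1 / (w - v)\<bar> \<le> len j"
    proof -
      have "\<bar>(vertex P j - vertex P (nxt P j)) $ 2\<bar> \<le> len j"
        unfolding len_def dist_norm by (rule component_le_norm_cart)
      then show ?thesis by (simp add: v_def w_def abs_minus_commute)
    qed
    finally show ?thesis by (simp add: ennreal_leI mult_right_mono)
  qed
qed

text \<open>From a point of the domain one moves left until the boundary is reached. The value there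
  is controlled by \<open>level\<close> and the increment by the energy on the horizontal line; both
  bounds depend on the height alone, so integration in the first variable costs the width 2
  R.\<close>

theorem Friedrichs_inequality:
  obtains C where "C > 0" "\<And>z. z \<in> H1 \<Omega> \<Longrightarrow> continuous_on (closure \<Omega>) z \<Longrightarrow>
    L2_inner M z z \<le> C * (L2_inner \<Gamma> z z + dform \<Omega> z z)"
proof -
  obtain R where R: "R > 0" "\<And>x. x \<in> \<Omega> \<Longrightarrow> norm x < R"
    using bounded_dom by (meson bounded_pos_less)
  have comp: "\<bar>x $ i\<bar> < R" if "x \<in> \<Omega>" for x i
    using component_le_norm_cart[of x i] R(2)[OF that] by linarith
  \<comment> \<open>The coefficients 2 and 4 R of the boundary and the energy term, each times the
    width 2 R, are added up.\<close>
  show ?thesis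
  proof (rule that[of "4 * R + 8 * R\<^sup>2"])
    show "0 < 4 * R + 8 * R\<^sup>2" using R(1) by (simp add: add_pos_pos)
    fix z assume z: "z \<in> H1 \<Omega>" and cont: "continuous_on (closure \<Omega>) z"
    obtain k where eb: "energy_bound z k" using energy_bound_exists[OF z cont] by blast
    then have km [measurable]: "\<And>n. k n \<in> borel_measurable borel"
      and kint: "\<And>n. (\<integral>\<^sup>+x. k n x \<partial>lborel) \<le> ennreal (dform \<Omega> z z)"
      by (auto simp: energy_bound_def)
    note [measurable] = cut_measurable[OF cont]
    have lm [measurable]: "level z j \<in> borel_measurable borel" if "j \<in> J" for j
      using that by (rule level_measurable[OF cont])
    define H where "H s = liminf (\<lambda>n. \<integral>\<^sup>+t. k n (mkpt t s) \<partial>lborel)" for s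
    have Hm [measurable]: "H \<in> borel_measurable borel" unfolding H_def by measurable
    define L where "L s = (\<Sum>j\<in>J. level z j s)" for s
    have Lm [measurable]: "L \<in> borel_measurable borel" unfolding L_def by (rule borel_measurable_sum) (rule lm)
    have pw: "ennreal ((z x)\<^sup>2) \<le> 2 * L (x $ 2) + ennreal (4 * R) * H (x $ 2)" if x: "x \<in> \<Omega>" for x
    proof -
      define s where "s = x $ 2"
      \<comment> \<open>Its supremum is the last point outside the domain to the left of x on the
        horizontal line; as S is closed, the supremum is attained.\<close>
      define S where "S = {u. u \<le> x $ 1} \<inter> (\<lambda>u. mkpt u s) -` (- \<Omega>)"
      have "closed S" unfolding S_def
        by (intro closed_Int closed_vimage closed_Collect_le continuous_intros continuous_mkpt) (use open_dom in auto)
      moreover have "S \<noteq> {}"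
      proof -
        have "mkpt (- R) s \<notin> \<Omega>" using comp[of "mkpt (- R) s" 1] by auto
        moreover have "- R \<le> x $ 1" using comp[OF x, of 1] by linarith
        ultimately have "- R \<in> S" by (simp add: S_def)
        then show ?thesis by blast
      qed
      moreover have bdd: "bdd_above S" by (auto simp: S_def intro: bdd_aboveI)
      ultimately have y: "Sup S \<in> S" by (intro closed_contains_Sup) auto
      define y where "y = Sup S"
      have yx: "y \<le> x $ 1" "mkpt y s \<notin> \<Omega>" using y by (auto simp: S_def y_def)
      have "mkpt (x $ 1) s = x" by (simp add: s_def)
      then have "y < x $ 1" using yx x by (cases "y = x $ 1") auto
      have line: "mkpt 0 s + u *\<^sub>R mkpt 1 0 = mkpt u s" for u by (rule mkpt_eqI) auto
      have ins: "mkpt 0 s + u *\<^sub>R mkpt 1 0 \<in> \<Omega>" if "y < u" "u \<le> x $ 1" for u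
      proof (rule ccontr)
        assume "\<not> ?thesis"
        then have "u \<in> S" using that by (simp add: S_def line)
        then have "u \<le> y" unfolding y_def using bdd by (rule cSup_upper)
        then show False using that by simp
      qed
      have yR: "- R \<le> y"
      proof -
        have "mkpt (- R) s \<notin> \<Omega>" using comp[of "mkpt (- R) s" 1] by auto
        moreover have "- R \<le> x $ 1" using comp[OF x, of 1] by linarith
        ultimately have "- R \<in> S" by (simp add: S_def)
        then show ?thesis unfolding y_def using bdd by (rule cSup_upper)
      qed
      have "mkpt y s \<in> closure \<Omega>"
        using segment_closure[OF \<open>y < x $ 1\<close> ins, of y] \<open>y < x $ 1\<close> by (simp add: line)
      then have "mkpt y s \<in> bdry P"
        unfolding frontier_eq[symmetric] frontier_def using yx(2) open_dom by (simp add: interior_open)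
      then obtain j where j: "j \<in> J" "mkpt y s \<in> side P j" unfolding bdry_def by blast
      then obtain t where t: "t \<in> {0..1}" "mkpt y s = sp j t" by (auto simp: side_eq)
      have s_eq: "s = vertex P j $ 2 + t * (vertex P (nxt P j) $ 2 - vertex P j $ 2)"
        using arg_cong[OF t(2), of "\<lambda>x. x $ 2"] by (simp add: sp_def)
      have "ennreal ((z (mkpt y s))\<^sup>2) \<le> level z j s"
      proof (cases "vertex P (nxt P j) $ 2 = vertex P j $ 2")
        case True
        then show ?thesis using s_eq by (simp add: level_def)
      next
        case False
        then have "(s - vertex P j $ 2) / (vertex P (nxt P j) $ 2 - vertex P j $ 2) = t" using s_eq by simp
        then show ?thesis using False t by (simp add: level_def)
      qed
      also have "\<dots> \<le> L s" unfolding L_def using j(1) by (intro member_le_sum) auto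
      finally have zy: "ennreal ((z (mkpt y s))\<^sup>2) \<le> L s" .
      have "ennreal ((z (mkpt 0 s + (x $ 1) *\<^sub>R mkpt 1 0) - z (mkpt 0 s + y *\<^sub>R mkpt 1 0))\<^sup>2)
          \<le> ennreal ((norm (mkpt 1 0))\<^sup>2 * (x $ 1 - y)) * liminf (\<lambda>n. \<integral>\<^sup>+t\<in>{y..x $ 1}. k n (mkpt 0 s + t *\<^sub>R mkpt 1 0) \<partial>lborel)"
        by (rule energy_boundD[OF eb \<open>y < x $ 1\<close> ins])
      also have "\<dots> \<le> ennreal (2 * R) * H s"
      proof (rule mult_mono)
        have "(norm (mkpt 1 0))\<^sup>2 = 1" by (simp add: norm_sq_pt)
        then show "ennreal ((norm (mkpt 1 0))\<^sup>2 * (x $ 1 - y)) \<le> ennreal (2 * R)"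
          using comp[OF x, of 1] yR by (intro ennreal_leI) simp
        show "liminf (\<lambda>n. \<integral>\<^sup>+t\<in>{y..x $ 1}. k n (mkpt 0 s + t *\<^sub>R mkpt 1 0) \<partial>lborel) \<le> H s"
          unfolding H_def line by (intro Liminf_mono always_eventually allI nn_integral_mono) (auto simp: indicator_def)
      qed auto
      finally have diff: "ennreal ((z (mkpt y s) - z x)\<^sup>2) \<le> ennreal (2 * R) * H s"
        unfolding line by (simp add: s_def power2_commute)
      have "ennreal ((z x)\<^sup>2) \<le> 2 * ennreal ((z (mkpt y s))\<^sup>2) + 2 * ennreal ((z (mkpt y s) - z x)\<^sup>2)" by (rule ennreal_sq_le)
      also have "\<dots> \<le> 2 * L s + 2 * (ennreal (2 * R) * H s)" by (intro add_mono mult_left_mono zy diff) auto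
      also have "2 * (ennreal (2 * R) * H s) = ennreal (4 * R) * H s"
        using R(1) ennreal_mult[of 2 "2 * R"] by (simp add: mult.assoc[symmetric])
      finally show ?thesis by (simp add: s_def)
    qed
    have "ennreal (L2_inner M z z) = (\<integral>\<^sup>+x. ennreal ((cut z x)\<^sup>2) \<partial>lborel)" by (simp add: nn_integral_cut[OF z cont])
    also have "\<dots> = (\<integral>\<^sup>+s. \<integral>\<^sup>+t. ennreal ((cut z (mkpt t s))\<^sup>2) \<partial>lborel \<partial>lborel)"
      by (rule nn_integral_pt_swap) measurable
    also have "\<dots> \<le> (\<integral>\<^sup>+s. \<integral>\<^sup>+t. (2 * L s + ennreal (4 * R) * H s) * indicator {- R..R} t \<partial>lborel \<partial>lborel)"
    proof (intro nn_integral_mono)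
      fix s t :: real
      show "ennreal ((cut z (mkpt t s))\<^sup>2) \<le> (2 * L s + ennreal (4 * R) * H s) * indicator {- R..R} t"
      proof (cases "mkpt t s \<in> \<Omega>")
        case True
        then show ?thesis using pw[OF True] comp[OF True, of 1] by (simp add: cut_eq indicator_def abs_less_iff)
      qed (simp add: cut_def)
    qed
    also have "\<dots> = (\<integral>\<^sup>+s. (2 * L s + ennreal (4 * R) * H s) * ennreal (2 * R) \<partial>lborel)"
      using R(1) by (subst nn_integral_cmult) auto
    also have "\<dots> = (\<integral>\<^sup>+s. 2 * L s + ennreal (4 * R) * H s \<partial>lborel) * ennreal (2 * R)"
      by (rule nn_integral_multc) measurable
    also have "(\<integral>\<^sup>+s. 2 * L s + ennreal (4 * R) * H s \<partial>lborel) = 2 * (\<integral>\<^sup>+s. L s \<partial>lborel) + ennreal (4 * R) * (\<integral>\<^sup>+s. H s \<partial>lborel)"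
      by (subst nn_integral_add) (auto simp: nn_integral_cmult)
    also have "(\<integral>\<^sup>+s. L s \<partial>lborel) = (\<Sum>j\<in>J. \<integral>\<^sup>+s. level z j s \<partial>lborel)"
      unfolding L_def by (rule nn_integral_sum) (use lm in auto)
    finally have "ennreal (L2_inner M z z) \<le> (2 * (\<Sum>j\<in>J. \<integral>\<^sup>+s. level z j s \<partial>lborel) + ennreal (4 * R) * (\<integral>\<^sup>+s. H s \<partial>lborel)) * ennreal (2 * R)" .
    also have "\<dots> \<le> (2 * ennreal (L2_inner \<Gamma> z z) + ennreal (4 * R) * ennreal (dform \<Omega> z z)) * ennreal (2 * R)"
    proof (intro mult_right_mono add_mono mult_left_mono)
      show "(\<Sum>j\<in>J. \<integral>\<^sup>+s. level z j s \<partial>lborel) \<le> ennreal (L2_inner \<Gamma> z z)"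
        unfolding nn_integral_\<Gamma>_sq[OF cont] by (intro sum_mono nn_integral_level[OF cont])
      have "(\<integral>\<^sup>+s. H s \<partial>lborel) \<le> liminf (\<lambda>n. \<integral>\<^sup>+s. \<integral>\<^sup>+t. k n (mkpt t s) \<partial>lborel \<partial>lborel)"
        unfolding H_def by (rule nn_integral_liminf) measurable
      also have "\<dots> = liminf (\<lambda>n. \<integral>\<^sup>+x. k n x \<partial>lborel)" by (simp add: nn_integral_pt_swap[OF km])
      also have "\<dots> \<le> liminf (\<lambda>n::nat. ennreal (dform \<Omega> z z))"
        by (intro Liminf_mono always_eventually allI kint)
      finally show "(\<integral>\<^sup>+s. H s \<partial>lborel) \<le> ennreal (dform \<Omega> z z)" by (simp add: Liminf_const)
    qed auto
    also have "\<dots> = ennreal ((2 * L2_inner \<Gamma> z z + 4 * R * dform \<Omega> z z) * (2 * R))"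
      using R(1) D.nonneg[OF z] semi_inner.nonneg[OF semi_inner_L2 L2_\<Gamma>_continuous[OF cont]]
      by (simp add: ennreal_mult ennreal_plus)
    finally have "L2_inner M z z \<le> (2 * L2_inner \<Gamma> z z + 4 * R * dform \<Omega> z z) * (2 * R)"
      using R(1) D.nonneg[OF z] semi_inner.nonneg[OF semi_inner_L2 L2_\<Gamma>_continuous[OF cont]]
      by (subst (asm) ennreal_le_iff) auto
    also have "\<dots> \<le> (4 * R + 8 * R\<^sup>2) * (L2_inner \<Gamma> z z + dform \<Omega> z z)"
      using R(1) D.nonneg[OF z] semi_inner.nonneg[OF semi_inner_L2 L2_\<Gamma>_continuous[OF cont]]
      by (simp add: algebra_simps power2_eq_square)
    finally show "L2_inner M z z \<le> (4 * R + 8 * R\<^sup>2) * (L2_inner \<Gamma> z z + dform \<Omega> z z)" .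
  qed
qed

section \<open>The Hardy inequality at a vertex\<close>

lemma sq_weighted:
  fixes a b e :: real
  assumes "e > 0" shows "a\<^sup>2 \<le> (1 + e) * b\<^sup>2 + (1 + 1 / e) * (b - a)\<^sup>2"
proof -
  have "0 \<le> (e * b + (b - a))\<^sup>2 / e" using assms by simp
  also have "\<dots> = (1 + e) * b\<^sup>2 + (1 + 1 / e) * (b - a)\<^sup>2 - a\<^sup>2"
    using assms by (simp add: field_simps power2_eq_square)
  finally show ?thesis by simp
qed

text \<open>The truncated weight keeps the weighted integral finite, so that it can be absorbed after
  comparing the integrals over the sector and over the sector scaled by one half.\<close>

lemma Hardy_truncated:
  fixes g m :: real
  assumes z: "z \<in> H1 \<Omega>" and cont: "continuous_on (closure \<Omega>) z"
    and g: "0 \<le> g" "g < 2" and r: "0 < r" "r \<le> 1" and m: "m \<ge> 0"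
    and cone: "\<And>x l. x \<in> \<Omega> \<Longrightarrow> dist x S < r \<Longrightarrow> l > 0 \<Longrightarrow> l * dist x S < r \<Longrightarrow> S + l *\<^sub>R (x - S) \<in> \<Omega>"
  defines "Q \<equiv> 2 powr g / 4"
  defines "C \<equiv> 2 / (1 - Q) * ((r / 2) powr (- g) + Q * (1 + 2 * Q / (1 - Q)))"
  shows "(\<integral>\<^sup>+x. ennreal (min (dist x S powr (- g)) m * (cut z x)\<^sup>2) * indicator (ball S r) x \<partial>lborel) \<le> ennreal (C * h1form \<Omega> z z)"
proof -
  note [measurable] = cut_measurable[OF cont]
  obtain k where eb: "energy_bound z k" using energy_bound_exists[OF z cont] by blast
  then have km [measurable]: "\<And>n. k n \<in> borel_measurable borel"
    and kint: "\<And>n. (\<integral>\<^sup>+x. k n x \<partial>lborel) \<le> ennreal (dform \<Omega> z z)"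
    by (auto simp: energy_bound_def)
  \<comment> \<open>Halving distances multiplies the weight by at most 2^g and areas by 1/4. Their
    product Q is the contraction factor, below 1 because g < 2.\<close>
  have Q: "0 < Q" "Q < 1"
  proof -
    have "2 powr g < 2 powr 2" using g by (intro powr_less_mono) auto
    then show "0 < Q" "Q < 1" by (auto simp: Q_def)
  qed
  \<comment> \<open>With this weight in \<open>sq_weighted\<close> the factor Q (1 + e) equals (1 +
    Q) / 2, still below 1, which leaves room for absorption.\<close>
  define e where "e = (1 - Q) / (2 * Q)"
  have e: "e > 0" using Q by (simp add: e_def)
  define w where "w x = min (dist x S powr (- g)) m" for x
  have wm [measurable]: "w \<in> borel_measurable borel" unfolding w_def by measurable
  have w0: "w x \<ge> 0" "w x \<le> m" for x using m by (auto simp: w_def)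
  define X where "X = \<Omega> \<inter> ball S r"
  have Xm [measurable]: "X \<in> sets borel" unfolding X_def by measurable
  have [measurable]: "X \<inter> ball S (r / 2) \<in> sets borel" "X - ball S (r / 2) \<in> sets borel" by auto
  define h where "h x = S + (1/2) *\<^sub>R (x - S)" for x
  have h_alt: "h x = (1/2) *\<^sub>R S + (1/2) *\<^sub>R x" for x by (rule mkpt_eqI) (simp_all add: h_def field_simps)
  have hm [measurable]: "h \<in> borel_measurable borel"
    unfolding h_def by (intro borel_measurable_continuous_onI continuous_intros)
  have hd: "dist (h x) S = dist x S / 2" for x by (simp add: h_def dist_norm)
  define I where "I = (\<integral>\<^sup>+x. ennreal (w x * (cut z x)\<^sup>2) * indicator X x \<partial>lborel)"
  define E where "E = (\<integral>\<^sup>+x. ennreal (w x * (cut z x - cut z (h x))\<^sup>2) * indicator X x \<partial>lborel)"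
  define B where "B = (r / 2) powr (- g)"
  have B0: "B \<ge> 0" by (simp add: B_def)
  have L0: "L2_inner M z z \<ge> 0" and D0: "dform \<Omega> z z \<ge> 0" using L2.nonneg[OF H1_L2[OF z]] D.nonneg[OF z] .
  have Ifin: "I \<le> ennreal (m * L2_inner M z z)"
  proof -
    have "I \<le> (\<integral>\<^sup>+x. ennreal m * ennreal ((cut z x)\<^sup>2) \<partial>lborel)"
      unfolding I_def using w0 m
      by (intro nn_integral_mono) (auto simp: indicator_def ennreal_mult[symmetric] intro!: ennreal_leI mult_right_mono)
    also have "\<dots> = ennreal (m * L2_inner M z z)"
      using m L0 by (subst nn_integral_cmult) (auto simp: nn_integral_cut[OF z cont] ennreal_mult)
    finally show ?thesis .
  qed
  define I1 where "I1 = (\<integral>\<^sup>+x. ennreal (w x * (cut z x)\<^sup>2) * indicator (X - ball S (r / 2)) x \<partial>lborel)"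
  define I2 where "I2 = (\<integral>\<^sup>+x. ennreal (w x * (cut z x)\<^sup>2) * indicator (X \<inter> ball S (r / 2)) x \<partial>lborel)"
  have split: "I = I1 + I2"
    unfolding I_def I1_def I2_def
    by (subst nn_integral_add[symmetric]) (auto simp: indicator_def intro!: nn_integral_cong)
  have I1: "I1 \<le> ennreal (B * L2_inner M z z)"
  proof -
    have wB: "w x \<le> B" if "x \<notin> ball S (r / 2)" for x
    proof -
      have "dist x S powr (- g) \<le> (r / 2) powr (- g)"
        using that r g by (intro powr_mono2') (auto simp: dist_commute)
      then show ?thesis by (simp add: w_def B_def)
    qed
    have "I1 \<le> (\<integral>\<^sup>+x. ennreal B * ennreal ((cut z x)\<^sup>2) \<partial>lborel)"
      unfolding I1_def using wB B0
      by (intro nn_integral_mono) (auto simp: indicator_def ennreal_mult[symmetric] intro!: ennreal_leI mult_right_mono)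
    also have "\<dots> = ennreal (B * L2_inner M z z)"
      using B0 L0 by (subst nn_integral_cmult) (auto simp: nn_integral_cut[OF z cont] ennreal_mult)
    finally show ?thesis .
  qed
  \<comment> \<open>The substitution by h expresses the inner half of the sector through the whole
    sector. Replacing the value at h x by the value at x then returns I with factor Q (1 + e), plus
    the difference term E.\<close>
  have I2: "I2 \<le> ennreal Q * (ennreal (1 + e) * I + ennreal (1 + 1 / e) * E)"
  proof -
    let ?f = "\<lambda>x. ennreal (w x * (cut z x)\<^sup>2) * indicator (X \<inter> ball S (r / 2)) x"
    have "(\<integral>\<^sup>+x. ?f ((1/2) *\<^sub>R S + (1/2) *\<^sub>R x) \<partial>lborel) = ennreal (1 / (1/2)\<^sup>2) * I2"
      unfolding I2_def by (rule nn_integral_scale_pt[OF _ half_gt_zero[OF zero_less_one]]) measurable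
    then have "ennreal (1/4) * (\<integral>\<^sup>+x. ?f (h x) \<partial>lborel) = ennreal (1/4) * (ennreal 4 * I2)"
      unfolding h_alt by (simp add: power2_eq_square)
    also have "ennreal (1/4) * (ennreal 4 * I2) = I2"
      unfolding mult.assoc[symmetric] ennreal_mult[symmetric, OF zero_le_divide_1_iff[THEN iffD2, OF zero_le_numeral] zero_le_numeral] by simp
    finally have "I2 = ennreal (1/4) * (\<integral>\<^sup>+x. ?f (h x) \<partial>lborel)" by simp
    also have "\<dots> \<le> ennreal (1/4) * (\<integral>\<^sup>+x. ennreal (2 powr g) * (ennreal (1 + e) * (ennreal (w x * (cut z x)\<^sup>2) * indicator X x)
        + ennreal (1 + 1 / e) * (ennreal (w x * (cut z x - cut z (h x))\<^sup>2) * indicator X x)) \<partial>lborel)"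
    proof (intro mult_left_mono nn_integral_mono)
      fix x
      show "?f (h x) \<le> ennreal (2 powr g) * (ennreal (1 + e) * (ennreal (w x * (cut z x)\<^sup>2) * indicator X x)
        + ennreal (1 + 1 / e) * (ennreal (w x * (cut z x - cut z (h x))\<^sup>2) * indicator X x))"
      proof (cases "h x \<in> X \<inter> ball S (r / 2)")
        case True
        have x: "x \<in> X"
        proof -
          have "S + 2 *\<^sub>R (h x - S) = x" by (simp add: h_def)
          moreover have "S + 2 *\<^sub>R (h x - S) \<in> \<Omega>"
            by (rule cone) (use True in \<open>auto simp: X_def dist_commute\<close>)
          moreover have "dist x S < r" using True hd[of x] by (auto simp: dist_commute)
          ultimately show ?thesis by (simp add: X_def dist_commute)
        qed
        have "w (h x) \<le> 2 powr g * w x"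
        proof -
          have "(dist x S / 2) powr (- g) = 2 powr g * dist x S powr (- g)"
            by (simp add: powr_divide powr_minus divide_simps)
          moreover have "m \<le> 2 powr g * m" using g m by (simp add: ge_one_powr_ge_zero mult_le_cancel_right1)
          moreover have "dist x S powr (- g) \<le> 2 powr g * dist x S powr (- g)"
            using g by (simp add: ge_one_powr_ge_zero mult_le_cancel_right1)
          ultimately show ?thesis unfolding w_def hd by (auto simp: min_def)
        qed
        then have "w (h x) * (cut z (h x))\<^sup>2 \<le> 2 powr g * w x * ((1 + e) * (cut z x)\<^sup>2 + (1 + 1 / e) * (cut z x - cut z (h x))\<^sup>2)"
          using sq_weighted[OF e, of "cut z (h x)" "cut z x"] w0 by (intro mult_mono) auto
        also have "\<dots> = 2 powr g * ((1 + e) * (w x * (cut z x)\<^sup>2) + (1 + 1 / e) * (w x * (cut z x - cut z (h x))\<^sup>2))"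
          by (simp add: algebra_simps)
        finally have "ennreal (w (h x) * (cut z (h x))\<^sup>2) \<le> ennreal (2 powr g * ((1 + e) * (w x * (cut z x)\<^sup>2) + (1 + 1 / e) * (w x * (cut z x - cut z (h x))\<^sup>2)))"
          by (rule ennreal_leI)
        also have "\<dots> = ennreal (2 powr g) * (ennreal (1 + e) * ennreal (w x * (cut z x)\<^sup>2) + ennreal (1 + 1 / e) * ennreal (w x * (cut z x - cut z (h x))\<^sup>2))"
          using e w0 by (simp add: ennreal_mult ennreal_plus del: ennreal_plus[symmetric])
        finally show ?thesis using True x by (simp add: indicator_def)
      qed simp
    qed simp
    also have "\<dots> = ennreal (1/4) * (ennreal (2 powr g) * (ennreal (1 + e) * I + ennreal (1 + 1 / e) * E))"
      unfolding I_def E_def by (simp add: nn_integral_cmult nn_integral_add)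
    also have "\<dots> = ennreal Q * (ennreal (1 + e) * I + ennreal (1 + 1 / e) * E)"
      unfolding mult.assoc[symmetric] Q_def by (subst ennreal_mult[symmetric]) auto
    finally show ?thesis .
  qed
  \<comment> \<open>The squared increment from h x to x is at most |x - S|^2 / 2 times the energy on
    that segment, and the weight times |x - S|^2 is at most 1 since g < 2 and r \<le> 1. After
    exchanging integrals, undoing the dilation by t in [1/2, 1] costs a factor of at most 4.\<close>
  have E: "E \<le> ennreal (dform \<Omega> z z)"
  proof -
    define G where "G x = liminf (\<lambda>n. \<integral>\<^sup>+t\<in>{1/2..1}. k n (S + t *\<^sub>R (x - S)) \<partial>lborel)" for x
    have Gm [measurable]: "G \<in> borel_measurable borel" unfolding G_def by measurable
    have "E \<le> (\<integral>\<^sup>+x. ennreal (1/2) * G x \<partial>lborel)"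
      unfolding E_def
    proof (rule nn_integral_mono)
      fix x
      show "ennreal (w x * (cut z x - cut z (h x))\<^sup>2) * indicator X x \<le> ennreal (1/2) * G x"
      proof (cases "x \<in> X")
        case True
        then have x: "x \<in> \<Omega>" "dist x S < r" by (auto simp: X_def dist_commute)
        have ins: "S + t *\<^sub>R (x - S) \<in> \<Omega>" if "1/2 \<le> t" "t \<le> 1" for t
        proof (rule cone[OF x])
          have "t * dist x S \<le> 1 * dist x S" using that by (intro mult_right_mono) auto
          then show "t * dist x S < r" using x(2) by simp
        qed (use that in auto)
        have hx: "h x \<in> \<Omega>" using ins[of "1/2"] by (simp add: h_def)
        have "ennreal ((z (S + 1 *\<^sub>R (x - S)) - z (S + (1/2) *\<^sub>R (x - S)))\<^sup>2) \<le> ennreal ((norm (x - S))\<^sup>2 * (1 - 1/2)) * G x"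
          unfolding G_def by (rule energy_boundD[OF eb]) (use ins in auto)
        then have d: "ennreal ((cut z x - cut z (h x))\<^sup>2) \<le> ennreal ((dist x S)\<^sup>2 / 2) * G x"
          using x(1) hx by (simp add: cut_eq h_def dist_norm)
        have "w x * (dist x S)\<^sup>2 \<le> 1"
        proof -
          have "w x * (dist x S)\<^sup>2 \<le> dist x S powr (- g) * (dist x S)\<^sup>2" by (intro mult_right_mono) (auto simp: w_def)
          also have "\<dots> \<le> 1"
          proof (cases "dist x S = 0")
            case False
            then have "dist x S powr (- g) * (dist x S)\<^sup>2 = dist x S powr (2 - g)"
              by (simp add: powr_numeral[symmetric] powr_add[symmetric] del: powr_numeral)
            also have "\<dots> \<le> 1" using x(2) r g by (intro powr_le1) auto
            finally show ?thesis .
          qed simp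
          finally show ?thesis .
        qed
        then have "ennreal (w x * ((dist x S)\<^sup>2 / 2)) \<le> ennreal (1/2)"
          by (intro ennreal_leI) simp
        then have c: "ennreal (w x) * ennreal ((dist x S)\<^sup>2 / 2) \<le> ennreal (1/2)"
          by (subst ennreal_mult[symmetric]) (use w0 in auto)
        have "ennreal (w x * (cut z x - cut z (h x))\<^sup>2) = ennreal (w x) * ennreal ((cut z x - cut z (h x))\<^sup>2)"
          using w0 by (simp add: ennreal_mult)
        also have "\<dots> \<le> ennreal (w x) * (ennreal ((dist x S)\<^sup>2 / 2) * G x)" by (intro mult_left_mono d) simp
        also have "\<dots> \<le> ennreal (1/2) * G x" unfolding mult.assoc[symmetric] by (intro mult_right_mono c) simp
        finally show ?thesis using True by simp
      qed simp
    qed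
    also have "\<dots> = ennreal (1/2) * (\<integral>\<^sup>+x. G x \<partial>lborel)" by (rule nn_integral_cmult) measurable
    also have "(\<integral>\<^sup>+x. G x \<partial>lborel) \<le> liminf (\<lambda>n. \<integral>\<^sup>+x. (\<integral>\<^sup>+t\<in>{1/2..1}. k n (S + t *\<^sub>R (x - S)) \<partial>lborel) \<partial>lborel)"
      unfolding G_def by (rule nn_integral_liminf) measurable
    also have "\<dots> \<le> liminf (\<lambda>n::nat. ennreal (2 * dform \<Omega> z z))"
    proof (intro Liminf_mono always_eventually allI)
      fix n
      have "(\<integral>\<^sup>+x. (\<integral>\<^sup>+t\<in>{1/2..1}. k n (S + t *\<^sub>R (x - S)) \<partial>lborel) \<partial>lborel)
          = (\<integral>\<^sup>+t. \<integral>\<^sup>+x. k n (S + t *\<^sub>R (x - S)) * indicator {1/2..1} t \<partial>lborel \<partial>lborel)"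
        by (rule pair_sigma_finite.Fubini'[OF pair_sigma_finite.intro[OF sigma_finite_lborel sigma_finite_lborel]]) measurable
      also have "\<dots> \<le> (\<integral>\<^sup>+t. ennreal (4 * dform \<Omega> z z) * indicator {1/2..1::real} t \<partial>lborel)"
      proof (rule nn_integral_mono)
        fix t :: real
        show "(\<integral>\<^sup>+x. k n (S + t *\<^sub>R (x - S)) * indicator {1/2..1} t \<partial>lborel) \<le> ennreal (4 * dform \<Omega> z z) * indicator {1/2..1} t"
        proof (cases "t \<in> {1/2..1}")
          case True
          then have t: "t > 0" "1 / t\<^sup>2 \<le> 4"
            using power_mono[of "1/2" t 2] by (auto simp: field_simps power2_eq_square)
          have "(\<integral>\<^sup>+x. k n (S + t *\<^sub>R (x - S)) \<partial>lborel) = (\<integral>\<^sup>+x. k n ((S - t *\<^sub>R S) + t *\<^sub>R x) \<partial>lborel)"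
            by (simp add: algebra_simps)
          also have "\<dots> = ennreal (1 / t\<^sup>2) * (\<integral>\<^sup>+x. k n x \<partial>lborel)" by (rule nn_integral_scale_pt[OF km t(1)])
          also have "\<dots> \<le> ennreal 4 * ennreal (dform \<Omega> z z)" by (intro mult_mono ennreal_leI t kint) auto
          finally show ?thesis using True D0 by (simp add: ennreal_mult)
        qed simp
      qed
      also have "\<dots> = ennreal (4 * dform \<Omega> z z) * ennreal (1/2)" by (subst nn_integral_cmult) auto
      also have "\<dots> = ennreal (2 * dform \<Omega> z z)" using D0 by (subst ennreal_mult[symmetric]) auto
      finally show "(\<integral>\<^sup>+x. (\<integral>\<^sup>+t\<in>{1/2..1}. k n (S + t *\<^sub>R (x - S)) \<partial>lborel) \<partial>lborel) \<le> ennreal (2 * dform \<Omega> z z)" .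
    qed
    also have "ennreal (1/2) * liminf (\<lambda>n::nat. ennreal (2 * dform \<Omega> z z)) = ennreal (dform \<Omega> z z)"
      unfolding Liminf_const[OF sequentially_bot] by (subst ennreal_mult[symmetric]) (use D0 in auto)
    finally show ?thesis by (simp add: mult_left_mono)
  qed
  \<comment> \<open>Truncation makes I finite, so the inequality can be rearranged in real
    arithmetic.\<close>
  define i where "i = enn2real I"
  have Ii: "I = ennreal i" "i \<ge> 0"
    using Ifin by (auto simp: i_def ennreal_enn2real_if top_unique)
  have "I \<le> ennreal (B * L2_inner M z z) + ennreal Q * (ennreal (1 + e) * I + ennreal (1 + 1 / e) * ennreal (dform \<Omega> z z))"
    unfolding split[symmetric] using I1 I2 E split
    by (meson add_left_mono add_mono mult_left_mono order_trans zero_le)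
  also have "\<dots> = ennreal (B * L2_inner M z z + Q * ((1 + e) * i + (1 + 1 / e) * dform \<Omega> z z))"
    using B0 L0 D0 Q e Ii(2) by (simp add: Ii(1) ennreal_mult ennreal_plus)
  finally have "i \<le> B * L2_inner M z z + Q * ((1 + e) * i + (1 + 1 / e) * dform \<Omega> z z)"
    using B0 L0 D0 Q e Ii(2) unfolding Ii(1) by (subst (asm) ennreal_le_iff) auto
  then have f1: "i \<le> B * L2_inner M z z + Q * ((1 + e) * i) + Q * (1 + 1 / e) * dform \<Omega> z z"
    by (simp only: distrib_left[of Q "(1 + e) * i"] mult.assoc add.assoc)
  have f2: "Q * ((1 + e) * i) = i - (1 - Q) / 2 * i" using Q by (simp add: e_def field_simps)
  have f3: "1 / e = 2 * Q / (1 - Q)" using Q by (simp add: e_def)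
  have "(1 - Q) / 2 * i \<le> B * L2_inner M z z + Q * (1 + 2 * Q / (1 - Q)) * dform \<Omega> z z"
    using f1[unfolded f3] f2 by linarith
  also have "\<dots> \<le> (B + Q * (1 + 2 * Q / (1 - Q))) * h1form \<Omega> z z"
    using B0 L0 D0 Q unfolding h1form_def distrib_right distrib_left[of _ "L2_inner _ _ _"]
    by (intro add_mono) (auto intro!: mult_nonneg_nonneg add_nonneg_nonneg)
  finally have "2 / (1 - Q) * ((1 - Q) / 2 * i) \<le> 2 / (1 - Q) * ((B + Q * (1 + 2 * Q / (1 - Q))) * h1form \<Omega> z z)"
    using Q by (intro mult_left_mono) auto
  moreover have "2 / (1 - Q) * ((1 - Q) / 2 * i) = i" using Q by simp
  ultimately have "i \<le> C * h1form \<Omega> z z"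
    by (simp only: C_def B_def mult.assoc)
  moreover have "(\<integral>\<^sup>+x. ennreal (min (dist x S powr (- g)) m * (cut z x)\<^sup>2) * indicator (ball S r) x \<partial>lborel) = I"
    unfolding I_def w_def X_def by (rule nn_integral_cong) (auto simp: indicator_def cut_def)
  ultimately show ?thesis by (simp add: Ii(1) ennreal_leI)
qed

text \<open>The constant of \<open>Hardy_truncated\<close> does not involve m, so Fatou's lemma
  removes the truncation.\<close>

theorem Hardy_inequality:
  assumes k: "k \<in> J" and g: "0 \<le> g" "g < 2"
  obtains r C where "r > 0" "r \<le> 1" "C \<ge> 0" "\<And>z. z \<in> H1 \<Omega> \<Longrightarrow> continuous_on (closure \<Omega>) z \<Longrightarrow>
    (\<integral>\<^sup>+x. ennreal (dist x (vertex P k) powr (- g) * (cut z x)\<^sup>2) * indicator (ball (vertex P k) r) x \<partial>lborel) \<le> ennreal (C * h1form \<Omega> z z)"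
proof -
  let ?S = "vertex P k"
  obtain r where r: "0 < r" "r \<le> 1"
    and cone: "\<And>x l. x \<in> \<Omega> \<Longrightarrow> dist x ?S < r \<Longrightarrow> l > 0 \<Longrightarrow> l * dist x ?S < r \<Longrightarrow> ?S + l *\<^sub>R (x - ?S) \<in> \<Omega>"
    using cone_at_vertex[OF k] by blast
  define Q where "Q = 2 powr g / 4"
  define C where "C = 2 / (1 - Q) * ((r / 2) powr (- g) + Q * (1 + 2 * Q / (1 - Q)))"
  have Q: "0 < Q" "Q < 1"
  proof -
    have "2 powr g < 2 powr 2" using g by (intro powr_less_mono) auto
    then show "0 < Q" "Q < 1" by (auto simp: Q_def)
  qed
  show ?thesis
  proof (rule that[OF r, of C])
    show "C \<ge> 0" using Q by (simp add: C_def)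
    fix z assume z: "z \<in> H1 \<Omega>" and cont: "continuous_on (closure \<Omega>) z"
    note [measurable] = cut_measurable[OF cont]
    have [measurable]: "ball ?S r \<in> sets borel" by simp
    let ?f = "\<lambda>n x. ennreal (min (dist x ?S powr (- g)) (real n) * (cut z x)\<^sup>2) * indicator (ball ?S r) x"
    have lim: "(\<lambda>n. ?f n x) \<longlonglongrightarrow> ennreal (dist x ?S powr (- g) * (cut z x)\<^sup>2) * indicator (ball ?S r) x" for x
    proof (rule tendsto_eventually)
      show "\<forall>\<^sub>F n in sequentially. ?f n x = ennreal (dist x ?S powr (- g) * (cut z x)\<^sup>2) * indicator (ball ?S r) x"
        using eventually_ge_at_top[of "nat \<lceil>dist x ?S powr (- g)\<rceil>"]
        by eventually_elim (simp add: min_def nat_ceiling_le_eq)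
    qed
    have "(\<integral>\<^sup>+x. ennreal (dist x ?S powr (- g) * (cut z x)\<^sup>2) * indicator (ball ?S r) x \<partial>lborel)
        = (\<integral>\<^sup>+x. liminf (\<lambda>n. ?f n x) \<partial>lborel)"
      by (rule nn_integral_cong) (rule lim_imp_Liminf[OF sequentially_bot lim, symmetric])
    also have "\<dots> \<le> liminf (\<lambda>n. \<integral>\<^sup>+x. ?f n x \<partial>lborel)" by (rule nn_integral_liminf) measurable
    also have "\<dots> \<le> liminf (\<lambda>n::nat. ennreal (C * h1form \<Omega> z z))"
      unfolding C_def Q_def
      by (intro Liminf_mono always_eventually allI Hardy_truncated z cont g r cone) auto
    finally show "(\<integral>\<^sup>+x. ennreal (dist x ?S powr (- g) * (cut z x)\<^sup>2) * indicator (ball ?S r) x \<partial>lborel) \<le> ennreal (C * h1form \<Omega> z z)"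
      by (simp add: Liminf_const)
  qed
qed

end

section \<open>Traces\<close>

context polygon_domain
begin

sublocale G: semi_inner "L2 \<Gamma>" "L2_inner \<Gamma>" by (rule semi_inner_L2)

lemma G_nrm_eq: "semi_inner.nrm (L2_inner \<Gamma>) u = L2_nrm \<Gamma> u"
  by (rule L2_nrm_eq)

text \<open>Fixed once by choice, this constant is a function of the domain alone, and so is
  \<open>Cf\<close>; neither can vary with the mesh.\<close>

definition Ct :: real where
  "Ct = (SOME C. C > 0 \<and> (\<forall>z th. z \<in> H1 \<Omega> \<longrightarrow> continuous_on (closure \<Omega>) z \<longrightarrow> 0 < th \<longrightarrow> th \<le> 1 \<longrightarrow>
    L2_inner \<Gamma> z z \<le> C * (L2_inner M z z / th + th * dform \<Omega> z z)))"

lemma Ct: "Ct > 0" "z \<in> H1 \<Omega> \<Longrightarrow> continuous_on (closure \<Omega>) z \<Longrightarrow> 0 < th \<Longrightarrow> th \<le> 1 \<Longrightarrow>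
    L2_inner \<Gamma> z z \<le> Ct * (L2_inner M z z / th + th * dform \<Omega> z z)"
proof -
  have "\<exists>C. C > 0 \<and> (\<forall>z th. z \<in> H1 \<Omega> \<longrightarrow> continuous_on (closure \<Omega>) z \<longrightarrow> 0 < th \<longrightarrow> th \<le> 1 \<longrightarrow>
    L2_inner \<Gamma> z z \<le> C * (L2_inner M z z / th + th * dform \<Omega> z z))"
    by (rule trace_inequality) blast
  from someI_ex[OF this] show "Ct > 0" "z \<in> H1 \<Omega> \<Longrightarrow> continuous_on (closure \<Omega>) z \<Longrightarrow> 0 < th \<Longrightarrow> th \<le> 1 \<Longrightarrow>
    L2_inner \<Gamma> z z \<le> Ct * (L2_inner M z z / th + th * dform \<Omega> z z)"
    unfolding Ct_def[symmetric] by blast+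
qed

definition Cf :: real where
  "Cf = (SOME C. C > 0 \<and> (\<forall>z. z \<in> H1 \<Omega> \<longrightarrow> continuous_on (closure \<Omega>) z \<longrightarrow>
    L2_inner M z z \<le> C * (L2_inner \<Gamma> z z + dform \<Omega> z z)))"

lemma Cf: "Cf > 0" "z \<in> H1 \<Omega> \<Longrightarrow> continuous_on (closure \<Omega>) z \<Longrightarrow>
    L2_inner M z z \<le> Cf * (L2_inner \<Gamma> z z + dform \<Omega> z z)"
proof -
  have "\<exists>C. C > 0 \<and> (\<forall>z. z \<in> H1 \<Omega> \<longrightarrow> continuous_on (closure \<Omega>) z \<longrightarrow>
    L2_inner M z z \<le> C * (L2_inner \<Gamma> z z + dform \<Omega> z z))"
    by (rule Friedrichs_inequality) blast
  from someI_ex[OF this] show "Cf > 0" "z \<in> H1 \<Omega> \<Longrightarrow> continuous_on (closure \<Omega>) z \<Longrightarrow>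
    L2_inner M z z \<le> Cf * (L2_inner \<Gamma> z z + dform \<Omega> z z)"
    unfolding Cf_def[symmetric] by blast+
qed

abbreviation "tr \<equiv> has_trace \<Omega> P"

lemma tr_H1: "tr z u \<Longrightarrow> z \<in> H1 \<Omega>"
  by (simp add: has_trace_def)

lemma tr_L2: "tr z u \<Longrightarrow> u \<in> L2 \<Gamma>"
  by (simp add: has_trace_def)

lemma trE:
  assumes "tr z u"
  obtains \<phi> where "\<And>n. \<phi> n \<in> H1 \<Omega>" "\<And>n. continuous_on (closure \<Omega>) (\<phi> n)" "\<And>n. \<phi> n \<in> L2 \<Gamma>"
    "(\<lambda>n. H1_nrm \<Omega> (\<lambda>x. \<phi> n x - z x)) \<longlonglongrightarrow> 0" "(\<lambda>n::nat. L2_nrm \<Gamma> (\<lambda>x. \<phi> n x - u x)) \<longlonglongrightarrow> 0"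
proof -
  obtain \<phi> where "\<forall>n. \<phi> n \<in> H1 \<Omega> \<and> continuous_on (closure \<Omega>) (\<phi> n)"
    "(\<lambda>n. H1_nrm \<Omega> (\<lambda>x. \<phi> n x - z x)) \<longlonglongrightarrow> 0" "(\<lambda>n::nat. L2_nrm \<Gamma> (\<lambda>x. \<phi> n x - u x)) \<longlonglongrightarrow> 0"
    using assms unfolding has_trace_def by blast
  then show ?thesis using L2_\<Gamma>_continuous by (intro that[of \<phi>]) auto
qed

lemma trI:
  assumes "z \<in> H1 \<Omega>" "u \<in> L2 \<Gamma>" "\<And>n. \<phi> n \<in> H1 \<Omega>" "\<And>n. continuous_on (closure \<Omega>) (\<phi> n)"
    "(\<lambda>n. H1_nrm \<Omega> (\<lambda>x. \<phi> n x - z x)) \<longlonglongrightarrow> 0" "(\<lambda>n::nat. L2_nrm \<Gamma> (\<lambda>x. \<phi> n x - u x)) \<longlonglongrightarrow> 0"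
  shows "tr z u"
  using assms unfolding has_trace_def by blast

lemma H1_nrm_zero: "H1_nrm \<Omega> (\<lambda>x. 0) = 0"
  using H.nrm_scale[OF H1_zero, of 0] by (simp add: H_nrm_eq)

lemma L2_nrm_zero: "L2_nrm N (\<lambda>x. 0) = 0"
  by (simp add: L2_nrm_def L2_inner_def)

lemma tr_self:
  assumes "z \<in> H1 \<Omega>" "continuous_on (closure \<Omega>) z" shows "tr z z"
  by (rule trI[where \<phi>="\<lambda>n. z"]) (use assms L2_\<Gamma>_continuous in \<open>auto simp: H1_nrm_zero L2_nrm_zero\<close>)

lemma tr_add:
  assumes "tr z u" "tr w v" shows "tr (\<lambda>x. z x + w x) (\<lambda>x. u x + v x)"
proof -
  obtain \<phi> where \<phi>: "\<And>n. \<phi> n \<in> H1 \<Omega>" "\<And>n. continuous_on (closure \<Omega>) (\<phi> n)" "\<And>n. \<phi> n \<in> L2 \<Gamma>"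
    "(\<lambda>n. H1_nrm \<Omega> (\<lambda>x. \<phi> n x - z x)) \<longlonglongrightarrow> 0" "(\<lambda>n::nat. L2_nrm \<Gamma> (\<lambda>x. \<phi> n x - u x)) \<longlonglongrightarrow> 0"
    by (rule trE[OF assms(1)]) blast
  obtain \<psi> where \<psi>: "\<And>n. \<psi> n \<in> H1 \<Omega>" "\<And>n. continuous_on (closure \<Omega>) (\<psi> n)" "\<And>n. \<psi> n \<in> L2 \<Gamma>"
    "(\<lambda>n. H1_nrm \<Omega> (\<lambda>x. \<psi> n x - w x)) \<longlonglongrightarrow> 0" "(\<lambda>n::nat. L2_nrm \<Gamma> (\<lambda>x. \<psi> n x - v x)) \<longlonglongrightarrow> 0"
    by (rule trE[OF assms(2)]) blast
  note H = tr_H1[OF assms(1)] tr_H1[OF assms(2)] and L = tr_L2[OF assms(1)] tr_L2[OF assms(2)]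
  show ?thesis
  proof (rule trI[where \<phi>="\<lambda>n x. \<phi> n x + \<psi> n x"])
    show "(\<lambda>n. H1_nrm \<Omega> (\<lambda>x. \<phi> n x + \<psi> n x - (z x + w x))) \<longlonglongrightarrow> 0"
    proof (rule Lim_null_comparison[OF always_eventually[OF allI]])
      fix n
      have "H1_nrm \<Omega> (\<lambda>x. (\<phi> n x - z x) + (\<psi> n x - w x)) \<le> H1_nrm \<Omega> (\<lambda>x. \<phi> n x - z x) + H1_nrm \<Omega> (\<lambda>x. \<psi> n x - w x)"
        using H.nrm_add[OF H.diff_mem[OF \<phi>(1) H(1)] H.diff_mem[OF \<psi>(1) H(2)]] by (simp add: H_nrm_eq)
      moreover have "H1_nrm \<Omega> (\<lambda>x. (\<phi> n x - z x) + (\<psi> n x - w x)) \<ge> 0"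
        by (intro H1_nrm_nonneg H.add_mem H.diff_mem \<phi> \<psi> H)
      ultimately show "norm (H1_nrm \<Omega> (\<lambda>x. \<phi> n x + \<psi> n x - (z x + w x))) \<le> H1_nrm \<Omega> (\<lambda>x. \<phi> n x - z x) + H1_nrm \<Omega> (\<lambda>x. \<psi> n x - w x)"
        by (simp add: algebra_simps)
    next
      show "(\<lambda>n. H1_nrm \<Omega> (\<lambda>x. \<phi> n x - z x) + H1_nrm \<Omega> (\<lambda>x. \<psi> n x - w x)) \<longlonglongrightarrow> 0"
        using tendsto_add[OF \<phi>(4) \<psi>(4)] by simp
    qed
    show "(\<lambda>n. L2_nrm \<Gamma> (\<lambda>x. \<phi> n x + \<psi> n x - (u x + v x))) \<longlonglongrightarrow> 0"
    proof (rule Lim_null_comparison[OF always_eventually[OF allI]])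
      fix n
      have "L2_nrm \<Gamma> (\<lambda>x. (\<phi> n x - u x) + (\<psi> n x - v x)) \<le> L2_nrm \<Gamma> (\<lambda>x. \<phi> n x - u x) + L2_nrm \<Gamma> (\<lambda>x. \<psi> n x - v x)"
        using G.nrm_add[OF G.diff_mem[OF \<phi>(3) L(1)] G.diff_mem[OF \<psi>(3) L(2)]] by (simp add: G_nrm_eq)
      moreover have "L2_nrm \<Gamma> (\<lambda>x. (\<phi> n x - u x) + (\<psi> n x - v x)) \<ge> 0"
        unfolding G_nrm_eq[symmetric] by (intro G.nrm_nonneg G.add_mem G.diff_mem \<phi> \<psi> L)
      ultimately show "norm (L2_nrm \<Gamma> (\<lambda>x. \<phi> n x + \<psi> n x - (u x + v x))) \<le> L2_nrm \<Gamma> (\<lambda>x. \<phi> n x - u x) + L2_nrm \<Gamma> (\<lambda>x. \<psi> n x - v x)"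
        by (simp add: algebra_simps)
    next
      show "(\<lambda>n. L2_nrm \<Gamma> (\<lambda>x. \<phi> n x - u x) + L2_nrm \<Gamma> (\<lambda>x. \<psi> n x - v x)) \<longlonglongrightarrow> 0"
        using tendsto_add[OF \<phi>(5) \<psi>(5)] by simp
    qed
  qed (use \<phi> \<psi> H L in \<open>auto intro: H.add_mem G.add_mem continuous_intros\<close>)
qed

lemma tr_scale:
  assumes "tr z u" shows "tr (\<lambda>x. c * z x) (\<lambda>x. c * u x)"
proof -
  obtain \<phi> where \<phi>: "\<And>n. \<phi> n \<in> H1 \<Omega>" "\<And>n. continuous_on (closure \<Omega>) (\<phi> n)" "\<And>n. \<phi> n \<in> L2 \<Gamma>"
    "(\<lambda>n. H1_nrm \<Omega> (\<lambda>x. \<phi> n x - z x)) \<longlonglongrightarrow> 0" "(\<lambda>n::nat. L2_nrm \<Gamma> (\<lambda>x. \<phi> n x - u x)) \<longlonglongrightarrow> 0"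
    by (rule trE[OF assms]) blast
  have "H1_nrm \<Omega> (\<lambda>x. c * \<phi> n x - c * z x) = \<bar>c\<bar> * H1_nrm \<Omega> (\<lambda>x. \<phi> n x - z x)" for n
    using H.nrm_scale[OF H.diff_mem[OF \<phi>(1) tr_H1[OF assms]], of c] by (simp add: H_nrm_eq right_diff_distrib)
  moreover have "L2_nrm \<Gamma> (\<lambda>x. c * \<phi> n x - c * u x) = \<bar>c\<bar> * L2_nrm \<Gamma> (\<lambda>x. \<phi> n x - u x)" for n
    using G.nrm_scale[OF G.diff_mem[OF \<phi>(3) tr_L2[OF assms]], of c] by (simp add: G_nrm_eq right_diff_distrib)
  ultimately show ?thesis
    by (intro trI[where \<phi>="\<lambda>n x. c * \<phi> n x"])
      (use \<phi> tr_H1[OF assms] tr_L2[OF assms] in \<open>auto intro!: H.scale_mem G.scale_mem continuous_intros tendsto_mult_right_zero\<close>)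
qed

lemma tr_diff: "tr z u \<Longrightarrow> tr w v \<Longrightarrow> tr (\<lambda>x. z x - w x) (\<lambda>x. u x - v x)"
  using tr_add[OF _ tr_scale[of w v "-1"], of z u] by simp

lemma tr_AE_cong:
  assumes "tr z u" "AE x in \<Gamma>. u x = v x" "v \<in> L2 \<Gamma>" shows "tr z v"
proof -
  obtain \<phi> where \<phi>: "\<And>n. \<phi> n \<in> H1 \<Omega>" "\<And>n. continuous_on (closure \<Omega>) (\<phi> n)" "\<And>n. \<phi> n \<in> L2 \<Gamma>"
    "(\<lambda>n. H1_nrm \<Omega> (\<lambda>x. \<phi> n x - z x)) \<longlonglongrightarrow> 0" "(\<lambda>n::nat. L2_nrm \<Gamma> (\<lambda>x. \<phi> n x - u x)) \<longlonglongrightarrow> 0"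
    by (rule trE[OF assms(1)]) blast
  note [measurable] = \<phi>(3)[THEN L2_measurable] assms(3)[THEN L2_measurable] tr_L2[OF assms(1), THEN L2_measurable]
  have "L2_nrm \<Gamma> (\<lambda>x. \<phi> n x - u x) = L2_nrm \<Gamma> (\<lambda>x. \<phi> n x - v x)" for n
    unfolding L2_nrm_def L2_inner_def
    by (intro arg_cong[where f=sqrt] integral_cong_AE) (use assms(2) in \<open>auto elim!: eventually_mono\<close>)
  then show ?thesis using \<phi> assms(3) tr_H1[OF assms(1)] by (intro trI[where \<phi>=\<phi>]) auto
qed

lemma H1_lim_dform:
  assumes "\<And>n. \<phi> n \<in> H1 \<Omega>" "z \<in> H1 \<Omega>" "(\<lambda>n. H1_nrm \<Omega> (\<lambda>x. \<phi> n x - z x)) \<longlonglongrightarrow> 0"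
  shows "(\<lambda>n. dform \<Omega> (\<phi> n) (\<phi> n)) \<longlonglongrightarrow> dform \<Omega> z z" "(\<lambda>n. L2_inner M (\<phi> n) (\<phi> n)) \<longlonglongrightarrow> L2_inner M z z"
    "(\<lambda>n. h1form \<Omega> (\<phi> n) (\<phi> n)) \<longlonglongrightarrow> h1form \<Omega> z z"
proof -
  have d: "(\<lambda>x. \<phi> n x - z x) \<in> H1 \<Omega>" for n using assms by (intro H.diff_mem)
  have dn: "D.nrm (\<lambda>x. \<phi> n x - z x) \<le> H1_nrm \<Omega> (\<lambda>x. \<phi> n x - z x)" for n
    using dform_le_h1form[OF d] by (simp add: D.nrm_def H1_nrm_eq)
  show "(\<lambda>n. dform \<Omega> (\<phi> n) (\<phi> n)) \<longlonglongrightarrow> dform \<Omega> z z"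
    by (rule D.tendsto_form[OF assms(1,2)], rule Lim_null_comparison[OF _ assms(3)])
      (use dn D.nrm_nonneg[OF d] in auto)
  show "(\<lambda>n. L2_inner M (\<phi> n) (\<phi> n)) \<longlonglongrightarrow> L2_inner M z z"
    by (rule L2.tendsto_form[OF H1_L2[OF assms(1)] H1_L2[OF assms(2)]], rule Lim_null_comparison[OF _ assms(3)])
      (use L2_nrm_le_H1_nrm[OF d] L2.nrm_nonneg[OF H1_L2[OF d]] in \<open>auto simp: L2_nrm_eq\<close>)
  show "(\<lambda>n. h1form \<Omega> (\<phi> n) (\<phi> n)) \<longlonglongrightarrow> h1form \<Omega> z z"
    by (rule H.tendsto_form[OF assms(1,2)]) (use assms(3) in \<open>simp add: H_nrm_eq\<close>)
qed

text \<open>The approximants in the definition of the trace are continuous up to the boundary, where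
  the inequality holds with th = 1, and both sides pass to the limit under the two
  convergences.\<close>

lemma tr_bound:
  assumes "tr z u" shows "L2_inner \<Gamma> u u \<le> Ct * h1form \<Omega> z z"
proof -
  obtain \<phi> where \<phi>: "\<And>n. \<phi> n \<in> H1 \<Omega>" "\<And>n. continuous_on (closure \<Omega>) (\<phi> n)" "\<And>n. \<phi> n \<in> L2 \<Gamma>"
    "(\<lambda>n. H1_nrm \<Omega> (\<lambda>x. \<phi> n x - z x)) \<longlonglongrightarrow> 0" "(\<lambda>n::nat. L2_nrm \<Gamma> (\<lambda>x. \<phi> n x - u x)) \<longlonglongrightarrow> 0"
    by (rule trE[OF assms]) blast
  have 1: "(\<lambda>n. L2_inner \<Gamma> (\<phi> n) (\<phi> n)) \<longlonglongrightarrow> L2_inner \<Gamma> u u"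
    by (rule G.tendsto_form[OF \<phi>(3) tr_L2[OF assms]]) (use \<phi>(5) in \<open>simp add: G_nrm_eq\<close>)
  have 2: "(\<lambda>n. Ct * h1form \<Omega> (\<phi> n) (\<phi> n)) \<longlonglongrightarrow> Ct * h1form \<Omega> z z"
    by (intro tendsto_mult_left H1_lim_dform(3)[OF \<phi>(1) tr_H1[OF assms] \<phi>(4)])
  show ?thesis
    by (rule LIMSEQ_le[OF 1 2]) (use Ct(2)[OF \<phi>(1,2), of 1] in \<open>auto simp: h1form_def\<close>)
qed

lemma tr_Friedrichs:
  assumes "tr z u" shows "L2_inner M z z \<le> Cf * (L2_inner \<Gamma> u u + dform \<Omega> z z)"
proof -
  obtain \<phi> where \<phi>: "\<And>n. \<phi> n \<in> H1 \<Omega>" "\<And>n. continuous_on (closure \<Omega>) (\<phi> n)" "\<And>n. \<phi> n \<in> L2 \<Gamma>"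
    "(\<lambda>n. H1_nrm \<Omega> (\<lambda>x. \<phi> n x - z x)) \<longlonglongrightarrow> 0" "(\<lambda>n::nat. L2_nrm \<Gamma> (\<lambda>x. \<phi> n x - u x)) \<longlonglongrightarrow> 0"
    by (rule trE[OF assms]) blast
  have 1: "(\<lambda>n. L2_inner \<Gamma> (\<phi> n) (\<phi> n)) \<longlonglongrightarrow> L2_inner \<Gamma> u u"
    by (rule G.tendsto_form[OF \<phi>(3) tr_L2[OF assms]]) (use \<phi>(5) in \<open>simp add: G_nrm_eq\<close>)
  note lim = H1_lim_dform[OF \<phi>(1) tr_H1[OF assms] \<phi>(4)]
  have 2: "(\<lambda>n. Cf * (L2_inner \<Gamma> (\<phi> n) (\<phi> n) + dform \<Omega> (\<phi> n) (\<phi> n))) \<longlonglongrightarrow> Cf * (L2_inner \<Gamma> u u + dform \<Omega> z z)"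
    by (intro tendsto_mult_left tendsto_add 1 lim)
  show ?thesis by (rule LIMSEQ_le[OF lim(2) 2]) (use Cf(2)[OF \<phi>(1,2)] in auto)
qed

text \<open>The difference of two traces of z is a trace of the zero function and is bounded by its
  H1 norm.\<close>

lemma tr_unique:
  assumes "tr z u" "tr z v" shows "AE x in \<Gamma>. u x = v x"
proof -
  have "L2_inner \<Gamma> (\<lambda>x. u x - v x) (\<lambda>x. u x - v x) \<le> Ct * h1form \<Omega> (\<lambda>x. 0) (\<lambda>x. 0)"
    using tr_bound[OF tr_diff[OF assms]] by simp
  also have "\<dots> = 0" using H.zero_left[OF H1_zero] by simp
  finally have "L2_inner \<Gamma> (\<lambda>x. u x - v x) (\<lambda>x. u x - v x) = 0"
    using G.nonneg[OF G.diff_mem[OF tr_L2[OF assms(1)] tr_L2[OF assms(2)]]] by simp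
  then have "AE x in \<Gamma>. u x - v x = 0"
    using L2_null_iff[OF G.diff_mem[OF tr_L2[OF assms(1)] tr_L2[OF assms(2)]]] by simp
  then show ?thesis by simp
qed

section \<open>The kernel of the trace\<close>

abbreviation "Hz \<equiv> H10 \<Omega> P"

lemma Hz_iff: "z \<in> Hz \<longleftrightarrow> tr z (\<lambda>_. 0)"
  using tr_H1 by (auto simp: H10_def)

lemma Hz_H1: "z \<in> Hz \<Longrightarrow> z \<in> H1 \<Omega>"
  by (simp add: H10_def)

lemma semi_inner_Hz: "semi_inner Hz (dform \<Omega>)"
proof (rule D.subspace)
  show "(\<lambda>x. 0) \<in> Hz" using tr_self[OF H1_zero] by (simp add: Hz_iff)
  show "(\<lambda>x. v x + w x) \<in> Hz" if "v \<in> Hz" "w \<in> Hz" for v w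
    using tr_add[of v "\<lambda>_. 0" w "\<lambda>_. 0"] that by (simp add: Hz_iff)
  show "(\<lambda>x. c * v x) \<in> Hz" if "v \<in> Hz" for c v
    using tr_scale[of v "\<lambda>_. 0" c] that by (simp add: Hz_iff)
qed (auto simp: Hz_H1)

sublocale Z: semi_inner Hz "dform \<Omega>" by (rule semi_inner_Hz)

text \<open>A diagonal sequence: each z n is replaced by a continuous function that is within
  1/(n+1) of it in H1 and has boundary norm below 1/(n+1).\<close>

lemma Hz_closed:
  assumes z: "\<And>n. z n \<in> Hz" and w: "w \<in> H1 \<Omega>" "(\<lambda>n::nat. H1_nrm \<Omega> (\<lambda>x. z n x - w x)) \<longlonglongrightarrow> 0"
  shows "w \<in> Hz"
proof -
  have "\<exists>\<phi>. \<phi> \<in> H1 \<Omega> \<and> continuous_on (closure \<Omega>) \<phi> \<and> H1_nrm \<Omega> (\<lambda>x. \<phi> x - z n x) < inverse (Suc n) \<and> L2_nrm \<Gamma> \<phi> < inverse (Suc n)" for n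
  proof -
    obtain \<phi> where \<phi>: "\<And>m. \<phi> m \<in> H1 \<Omega>" "\<And>m. continuous_on (closure \<Omega>) (\<phi> m)"
      "(\<lambda>m. H1_nrm \<Omega> (\<lambda>x. \<phi> m x - z n x)) \<longlonglongrightarrow> 0" "(\<lambda>m::nat. L2_nrm \<Gamma> (\<lambda>x. \<phi> m x - 0)) \<longlonglongrightarrow> 0"
      by (rule trE[OF z[of n, unfolded Hz_iff]]) blast
    have "\<forall>\<^sub>F m in sequentially. H1_nrm \<Omega> (\<lambda>x. \<phi> m x - z n x) < inverse (Suc n)"
      "\<forall>\<^sub>F m in sequentially. L2_nrm \<Gamma> (\<lambda>x. \<phi> m x - 0) < inverse (Suc n)"
      by (rule order_tendstoD(2)[OF \<phi>(3)], simp) (rule order_tendstoD(2)[OF \<phi>(4)], simp)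
    then have "\<forall>\<^sub>F m in sequentially. H1_nrm \<Omega> (\<lambda>x. \<phi> m x - z n x) < inverse (Suc n) \<and> L2_nrm \<Gamma> (\<lambda>x. \<phi> m x - 0) < inverse (Suc n)"
      by (rule eventually_conj)
    from eventually_happens[OF this]
    obtain m where "H1_nrm \<Omega> (\<lambda>x. \<phi> m x - z n x) < inverse (Suc n)" "L2_nrm \<Gamma> (\<lambda>x. \<phi> m x - 0) < inverse (Suc n)"
      by auto
    then show ?thesis using \<phi>(1,2) by (intro exI[of _ "\<phi> m"]) auto
  qed
  then have "\<forall>n. \<exists>\<phi>. \<phi> \<in> H1 \<Omega> \<and> continuous_on (closure \<Omega>) \<phi> \<and> H1_nrm \<Omega> (\<lambda>x. \<phi> x - z n x) < inverse (Suc n) \<and> L2_nrm \<Gamma> \<phi> < inverse (Suc n)" by blast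
  from choice[OF this] obtain \<phi> where \<phi>: "\<And>n. \<phi> n \<in> H1 \<Omega>" "\<And>n. continuous_on (closure \<Omega>) (\<phi> n)"
    "\<And>n. H1_nrm \<Omega> (\<lambda>x. \<phi> n x - z n x) < inverse (Suc n)" "\<And>n. L2_nrm \<Gamma> (\<phi> n) < inverse (Suc n)" by blast
  have inv: "(\<lambda>n. inverse (real (Suc n))) \<longlonglongrightarrow> 0" by (rule LIMSEQ_inverse_real_of_nat)
  show ?thesis unfolding Hz_iff
  proof (rule trI[where \<phi>=\<phi>])
    show "(\<lambda>n. H1_nrm \<Omega> (\<lambda>x. \<phi> n x - w x)) \<longlonglongrightarrow> 0"
    proof (rule Lim_null_comparison[OF always_eventually[OF allI]])
      fix n
      have "H1_nrm \<Omega> (\<lambda>x. \<phi> n x - w x) \<le> H1_nrm \<Omega> (\<lambda>x. \<phi> n x - z n x) + H1_nrm \<Omega> (\<lambda>x. z n x - w x)"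
        using H.nrm_triangle[OF \<phi>(1) Hz_H1[OF z] w(1)] by (simp add: H_nrm_eq)
      moreover have "H1_nrm \<Omega> (\<lambda>x. \<phi> n x - w x) \<ge> 0" by (intro H1_nrm_nonneg H.diff_mem \<phi> w)
      ultimately show "norm (H1_nrm \<Omega> (\<lambda>x. \<phi> n x - w x)) \<le> inverse (Suc n) + H1_nrm \<Omega> (\<lambda>x. z n x - w x)"
        using \<phi>(3)[of n] by simp
    next
      show "(\<lambda>n. inverse (real (Suc n)) + H1_nrm \<Omega> (\<lambda>x. z n x - w x)) \<longlonglongrightarrow> 0"
        using tendsto_add[OF inv w(2)] by simp
    qed
    show "(\<lambda>n. L2_nrm \<Gamma> (\<lambda>x. \<phi> n x - 0)) \<longlonglongrightarrow> 0"
    proof (rule Lim_null_comparison[OF always_eventually[OF allI] inv])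
      fix n
      have "L2_nrm \<Gamma> (\<phi> n) \<ge> 0"
        unfolding G_nrm_eq[symmetric] by (intro G.nrm_nonneg L2_\<Gamma>_continuous \<phi>)
      then show "norm (L2_nrm \<Gamma> (\<lambda>x. \<phi> n x - 0)) \<le> inverse (real (Suc n))" using \<phi>(4)[of n] by simp
    qed
  qed (use \<phi> w G.zero_mem in auto)
qed

lemma Hz_Friedrichs: "z \<in> Hz \<Longrightarrow> h1form \<Omega> z z \<le> (Cf + 1) * dform \<Omega> z z"
  using tr_Friedrichs[of z "\<lambda>_. 0"] G.zero_left[OF G.zero_mem] by (simp add: Hz_iff h1form_def algebra_simps)

text \<open>\<open>Hz_Friedrichs\<close> bounds the H1 norm by the Dirichlet seminorm on this space,
  so a Cauchy sequence of the latter converges in H1, and the limit remains in the closed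
  kernel.\<close>

lemma Hz_complete:
  assumes z: "\<And>n. z n \<in> Hz"
    and cauchy: "\<forall>e>0. \<exists>N. \<forall>m\<ge>N. \<forall>n\<ge>N. Z.nrm (\<lambda>x. z m x - z n x) < e"
  shows "\<exists>w\<in>Hz. (\<lambda>n::nat. Z.nrm (\<lambda>x. z n x - w x)) \<longlonglongrightarrow> 0"
proof -
  let ?s = "sqrt (Cf + 1)"
  have s: "?s > 0" using Cf(1) by simp
  have le: "H1_nrm \<Omega> v \<le> ?s * Z.nrm v" if "v \<in> Hz" for v
    using Hz_Friedrichs[OF that] by (simp add: H1_nrm_eq Z.nrm_def flip: real_sqrt_mult)
  have "\<exists>N. \<forall>m\<ge>N. \<forall>n\<ge>N. H1_nrm \<Omega> (\<lambda>x. z m x - z n x) < e" if "e > 0" for e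
  proof -
    have "e / ?s > 0" using that s by simp
    then obtain N where N: "\<And>m n. m \<ge> N \<Longrightarrow> n \<ge> N \<Longrightarrow> Z.nrm (\<lambda>x. z m x - z n x) < e / ?s" using cauchy by blast
    have "H1_nrm \<Omega> (\<lambda>x. z m x - z n x) < e" if "m \<ge> N" "n \<ge> N" for m n
    proof -
      have "H1_nrm \<Omega> (\<lambda>x. z m x - z n x) \<le> ?s * Z.nrm (\<lambda>x. z m x - z n x)" by (intro le Z.diff_mem z)
      also have "\<dots> < ?s * (e / ?s)" using N[OF that] s by (intro mult_strict_left_mono)
      finally show ?thesis using s by simp
    qed
    then show ?thesis by blast
  qed
  then obtain w where w: "w \<in> H1 \<Omega>" "(\<lambda>n. H1_nrm \<Omega> (\<lambda>x. z n x - w x)) \<longlonglongrightarrow> 0"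
    using H1_complete[of z] Hz_H1[OF z] by blast
  have wz: "w \<in> Hz" by (rule Hz_closed[OF z w])
  have "(\<lambda>n. Z.nrm (\<lambda>x. z n x - w x)) \<longlonglongrightarrow> 0"
  proof (rule Lim_null_comparison[OF always_eventually[OF allI] w(2)])
    fix n
    have d: "(\<lambda>x. z n x - w x) \<in> Hz" using z wz by (rule Z.diff_mem)
    show "norm (Z.nrm (\<lambda>x. z n x - w x)) \<le> H1_nrm \<Omega> (\<lambda>x. z n x - w x)"
      using Z.nrm_nonneg[OF d] dform_le_h1form[OF Hz_H1[OF d]] by (simp add: Z.nrm_def H1_nrm_eq)
  qed
  then show ?thesis using wz by blast
qed

section \<open>Harmonic extension and the space of traces\<close>

abbreviation "Hh \<equiv> Hhalf \<Omega> P"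

text \<open>A relation instead of the chosen function \<open>harm_ext\<close>: it is preserved by
  linear operations, whereas the choice is linear only up to null functions of the Dirichlet
  form.\<close>

definition harm :: "scal \<Rightarrow> scal \<Rightarrow> bool" where
  "harm z u \<longleftrightarrow> z \<in> H1 \<Omega> \<and> (\<forall>\<zeta>\<in>Hz. dform \<Omega> z \<zeta> = 0) \<and> tr z u"

lemma HhI: "tr z u \<Longrightarrow> u \<in> Hh"
  using tr_H1 by (auto simp: Hhalf_def)

lemma HhE: "u \<in> Hh \<Longrightarrow> (\<And>z. z \<in> H1 \<Omega> \<Longrightarrow> tr z u \<Longrightarrow> thesis) \<Longrightarrow> thesis"
  by (auto simp: Hhalf_def)

lemma Hh_L2: "u \<in> Hh \<Longrightarrow> u \<in> L2 \<Gamma>"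
  using tr_L2 by (auto simp: Hhalf_def)

lemma Hh_add: "u \<in> Hh \<Longrightarrow> v \<in> Hh \<Longrightarrow> (\<lambda>x. u x + v x) \<in> Hh"
  by (elim HhE) (rule HhI, rule tr_add)

lemma Hh_scale: "u \<in> Hh \<Longrightarrow> (\<lambda>x. c * u x) \<in> Hh"
  by (elim HhE) (rule HhI, rule tr_scale)

lemma Hh_zero: "(\<lambda>x. 0) \<in> Hh"
  by (rule HhI[OF tr_self]) (auto simp: H1_zero)

text \<open>Dirichlet's principle: from an arbitrary extension its projection to \<open>Hz\<close>,
  orthogonal for the Dirichlet form, is subtracted.\<close>

lemma harm_exists:
  assumes "u \<in> Hh" shows "\<exists>z. harm z u"
proof -
  obtain z where z: "z \<in> H1 \<Omega>" "tr z u" using assms by (rule HhE)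
  have "\<exists>w\<in>Hz. \<forall>v\<in>Hz. dform \<Omega> w v = dform \<Omega> z v"
  proof (rule Z.representation_complete[where C="D.nrm z"])
    show "\<And>f. (\<And>n. f n \<in> Hz) \<Longrightarrow> \<forall>e>0. \<exists>N. \<forall>m\<ge>N. \<forall>n\<ge>N. Z.nrm (\<lambda>x. f m x - f n x) < e \<Longrightarrow>
        \<exists>v\<in>Hz. (\<lambda>n::nat. Z.nrm (\<lambda>x. f n x - v x)) \<longlonglongrightarrow> 0" by (rule Hz_complete)
    show "\<bar>dform \<Omega> z v\<bar> \<le> D.nrm z * Z.nrm v" if "v \<in> Hz" for v
      using D.abs_le_nrm[OF z(1) Hz_H1[OF that]] .
  qed (use z(1) Hz_H1 in \<open>auto simp: D.bilin\<close>)
  then obtain w where w: "w \<in> Hz" "\<And>v. v \<in> Hz \<Longrightarrow> dform \<Omega> w v = dform \<Omega> z v" by blast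
  have "tr (\<lambda>x. z x - w x) (\<lambda>x. u x - 0)" by (rule tr_diff[OF z(2)]) (use w(1) in \<open>simp add: Hz_iff\<close>)
  then have "harm (\<lambda>x. z x - w x) u"
    unfolding harm_def using z(1) w Hz_H1 by (auto simp: D.bilin)
  then show ?thesis by blast
qed

lemma harm_ext: "u \<in> Hh \<Longrightarrow> harm (harm_ext \<Omega> P u) u"
  using someI_ex[OF harm_exists[of u]] unfolding harm_ext_def harm_def dform_def .

lemma harm_H1: "harm z u \<Longrightarrow> z \<in> H1 \<Omega>"
  by (simp add: harm_def)

lemma harm_add: "harm z u \<Longrightarrow> harm w v \<Longrightarrow> harm (\<lambda>x. z x + w x) (\<lambda>x. u x + v x)"
  unfolding harm_def using Hz_H1 by (auto simp: D.bilin intro: tr_add)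

lemma harm_scale: "harm z u \<Longrightarrow> harm (\<lambda>x. c * z x) (\<lambda>x. c * u x)"
  unfolding harm_def using Hz_H1 by (auto simp: D.bilin intro: tr_scale)

lemma tr_diff_Hz:
  assumes "tr z u" "tr w v" "AE x in \<Gamma>. u x = v x" shows "(\<lambda>x. z x - w x) \<in> Hz"
proof -
  have "tr (\<lambda>x. z x - w x) (\<lambda>x. u x - v x)" using assms(1,2) by (rule tr_diff)
  then show ?thesis unfolding Hz_iff
    by (rule tr_AE_cong) (use assms(3) G.zero_mem in \<open>auto elim!: eventually_mono\<close>)
qed

lemma harm_unique:
  assumes "harm z u" "harm w v" "AE x in \<Gamma>. u x = v x" "y \<in> H1 \<Omega>"
  shows "dform \<Omega> z y = dform \<Omega> w y"
proof (rule D.null_diff)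
  show zw: "z \<in> H1 \<Omega>" "w \<in> H1 \<Omega>" using assms harm_H1 by auto
  have d: "(\<lambda>x. z x - w x) \<in> Hz" using assms by (auto simp: harm_def intro: tr_diff_Hz)
  then show "dform \<Omega> (\<lambda>x. z x - w x) (\<lambda>x. z x - w x) = 0"
    using assms(1,2) zw Hz_H1[OF d] by (subst D.diff_left) (auto simp: harm_def)
qed fact

text \<open>Any other extension differs by an element of \<open>Hz\<close>, to which the harmonic
  extension is orthogonal, so Pythagoras applies.\<close>

lemma harm_minimal:
  assumes "harm z u" "tr w u" shows "dform \<Omega> z z \<le> dform \<Omega> w w"
proof -
  have z: "z \<in> H1 \<Omega>" using harm_H1[OF assms(1)] .
  have d: "(\<lambda>x. w x - z x) \<in> Hz" using assms by (auto simp: harm_def intro: tr_diff_Hz)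
  have "dform \<Omega> (\<lambda>x. z x + (w x - z x)) (\<lambda>x. z x + (w x - z x))
      = dform \<Omega> z z + 2 * dform \<Omega> z (\<lambda>x. w x - z x) + dform \<Omega> (\<lambda>x. w x - z x) (\<lambda>x. w x - z x)"
    using z Hz_H1[OF d] by (rule D.expand_add)
  then show ?thesis using assms(1) d D.nonneg[OF Hz_H1[OF d]] by (simp add: harm_def)
qed

section \<open>The boundary form and the trace norm\<close>

abbreviation "pf \<equiv> pform \<Omega> P"

lemma pf_eq: "pf u v = L2_inner \<Gamma> u v + dform \<Omega> (harm_ext \<Omega> P u) (harm_ext \<Omega> P v)"
  by (simp add: pform_def dform_def)

lemma semi_inner_pf: "semi_inner Hh pf"
proof
  show "(\<lambda>x. 0) \<in> Hh" by (rule Hh_zero)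
  fix v w assume vw: "v \<in> Hh" "w \<in> Hh"
  note hv = harm_ext[OF vw(1)] and hw = harm_ext[OF vw(2)]
  show s: "(\<lambda>x. v x + w x) \<in> Hh" using vw by (rule Hh_add)
  show "pf v w = pf w v"
    unfolding pf_eq using G.sym[OF Hh_L2 Hh_L2, OF vw] D.sym[OF harm_H1[OF hv] harm_H1[OF hw]] by simp
  fix z assume z: "z \<in> Hh"
  have "dform \<Omega> (harm_ext \<Omega> P (\<lambda>x. v x + w x)) (harm_ext \<Omega> P z)
      = dform \<Omega> (\<lambda>x. harm_ext \<Omega> P v x + harm_ext \<Omega> P w x) (harm_ext \<Omega> P z)"
    by (rule harm_unique[OF harm_ext[OF s] harm_add[OF hv hw]]) (use harm_H1[OF harm_ext[OF z]] in auto)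
  then show "pf (\<lambda>x. v x + w x) z = pf v z + pf w z"
    unfolding pf_eq using vw z Hh_L2 harm_H1[OF harm_ext] by (simp add: G.bilin D.bilin)
next
  fix v c assume v: "v \<in> Hh"
  note hv = harm_ext[OF v]
  show s: "(\<lambda>x. c * v x) \<in> Hh" using v by (rule Hh_scale)
  show "0 \<le> pf v v" unfolding pf_eq using G.nonneg[OF Hh_L2[OF v]] D.nonneg[OF harm_H1[OF hv]] by simp
  fix z assume z: "z \<in> Hh"
  have "dform \<Omega> (harm_ext \<Omega> P (\<lambda>x. c * v x)) (harm_ext \<Omega> P z)
      = dform \<Omega> (\<lambda>x. c * harm_ext \<Omega> P v x) (harm_ext \<Omega> P z)"
    by (rule harm_unique[OF harm_ext[OF s] harm_scale[OF hv]]) (use harm_H1[OF harm_ext[OF z]] in auto)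
  then show "pf (\<lambda>x. c * v x) z = c * pf v z"
    unfolding pf_eq using v z Hh_L2 harm_H1[OF harm_ext] by (simp add: G.bilin D.bilin algebra_simps)
qed

sublocale PF: semi_inner Hh pf by (rule semi_inner_pf)

lemma pf_null:
  assumes "u \<in> Hh" "pf u u = 0" shows "AE x in \<Gamma>. u x = 0"
proof -
  have "L2_inner \<Gamma> u u = 0"
    using assms(2) G.nonneg[OF Hh_L2[OF assms(1)]] D.nonneg[OF harm_H1[OF harm_ext[OF assms(1)]]]
    unfolding pf_eq by linarith
  then show ?thesis using L2_null_iff[OF Hh_L2[OF assms(1)]] by simp
qed

lemma pf_AE_cong:
  assumes "u \<in> Hh" "v \<in> Hh" "w \<in> Hh" "AE x in \<Gamma>. u x = v x" shows "pf u w = pf v w" "pf w u = pf w v"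
proof -
  have "L2_inner \<Gamma> u w = L2_inner \<Gamma> v w"
    using assms Hh_L2[THEN L2_measurable] by (intro L2_AE_cong) auto
  moreover have "dform \<Omega> (harm_ext \<Omega> P u) (harm_ext \<Omega> P w) = dform \<Omega> (harm_ext \<Omega> P v) (harm_ext \<Omega> P w)"
    by (rule harm_unique[OF harm_ext[OF assms(1)] harm_ext[OF assms(2)] assms(4) harm_H1[OF harm_ext[OF assms(3)]]])
  ultimately show "pf u w = pf v w" by (simp add: pf_eq)
  then show "pf w u = pf w v" using PF.sym assms(1-3) by metis
qed

abbreviation "N \<equiv> Hhalf_nrm \<Omega> P"

lemma N_set:
  assumes "u \<in> Hh"
  shows "{H1_nrm \<Omega> z | z. z \<in> H1 \<Omega> \<and> tr z u} \<noteq> {}" "bdd_below {H1_nrm \<Omega> z | z. z \<in> H1 \<Omega> \<and> tr z u}"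
  using assms H1_nrm_nonneg by (auto elim!: HhE intro!: bdd_belowI[of _ 0])

lemma N_le: "tr z u \<Longrightarrow> N u \<le> H1_nrm \<Omega> z"
  unfolding Hhalf_nrm_def using N_set(2)[OF HhI] tr_H1 by (intro cInf_lower) auto

lemma N_nonneg: "u \<in> Hh \<Longrightarrow> 0 \<le> N u"
  unfolding Hhalf_nrm_def using N_set(1)[of u] H1_nrm_nonneg by (intro cInf_greatest) auto

lemma N_zero: "N (\<lambda>x. 0) = 0"
  using N_le[of "\<lambda>x. 0" "\<lambda>x. 0"] N_nonneg[OF Hh_zero] tr_self[OF H1_zero] by (simp add: H1_nrm_zero)

text \<open>The trace norm is an infimum, so the bound is proved for each extension and carried
  over. The boundary term is controlled by \<open>tr_bound\<close>, the Dirichlet term by minimality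
  of the harmonic extension.\<close>

lemma pf_bound:
  assumes u: "u \<in> Hh" shows "pf u u \<le> (Ct + 1) * (N u)\<^sup>2"
proof -
  let ?s = "sqrt (Ct + 1)"
  have s: "?s > 0" using Ct(1) by simp
  have "PF.nrm u / ?s \<le> N u"
    unfolding Hhalf_nrm_def
  proof (rule cInf_greatest[OF N_set(1)[OF u]])
    fix r assume "r \<in> {H1_nrm \<Omega> z | z. z \<in> H1 \<Omega> \<and> tr z u}"
    then obtain z where z: "r = H1_nrm \<Omega> z" "z \<in> H1 \<Omega>" "tr z u" by auto
    have "pf u u \<le> Ct * h1form \<Omega> z z + h1form \<Omega> z z"
      unfolding pf_eq using tr_bound[OF z(3)] harm_minimal[OF harm_ext[OF u] z(3)] dform_le_h1form[OF z(2)] by linarith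
    then have "pf u u \<le> (Ct + 1) * h1form \<Omega> z z" by (simp add: algebra_simps)
    then have "PF.nrm u \<le> ?s * r" by (simp add: z(1) H1_nrm_eq PF.nrm_def flip: real_sqrt_mult)
    then show "PF.nrm u / ?s \<le> r" using s by (simp add: field_simps)
  qed
  then have "PF.nrm u \<le> ?s * N u" using s by (simp add: field_simps)
  then have "(PF.nrm u)\<^sup>2 \<le> (?s * N u)\<^sup>2" using PF.nrm_nonneg[OF u] by (intro power_mono)
  then show ?thesis using Ct(1) by (simp add: PF.nrm_sq[OF u] power_mult_distrib)
qed

end

section \<open>The bilinear form\<close>

lemma nearI:
  fixes S :: "'a::metric_space" and r c :: real
  assumes "r > 0" "c \<ge> 0" "\<And>x. x \<in> U \<Longrightarrow> dist x S < r \<Longrightarrow> \<bar>f x\<bar> \<le> c * dist x S powr s"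
  shows "\<exists>r>0. \<exists>c\<ge>0. \<forall>x\<in>U. dist x S < r \<longrightarrow> \<bar>f x\<bar> \<le> c * dist x S powr s"
  using assms by blast

lemma continuous_off_vertices:
  assumes "smooth_off_vertices \<Omega> P f D" shows "continuous_on (closure \<Omega> - vertices P) f"
  using assms unfolding smooth_off_vertices_def
  by (metis (mono_tags, lifting) continuous_on_cong)

context polygon_domain
begin

lemma vertices_disjoint: "vertices P \<inter> \<Omega> = {}"
proof -
  have "vertex P j \<in> bdry P" if "j \<in> J" for j
    using sp_mem[OF that, of 0] by (simp add: sp_def)
  then show ?thesis using bdry_disjoint by (auto simp: vertices_def)
qed

lemma dom_off_vertices: "\<Omega> \<subseteq> closure \<Omega> - vertices P"
  using vertices_disjoint closure_subset by blast

lemma dist_vertex_pos: "k \<in> J \<Longrightarrow> x \<in> \<Omega> \<Longrightarrow> 0 < dist x (vertex P k)"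
  using vertices_disjoint unfolding vertices_def by (metis disjoint_iff imageI zero_less_dist_iff)

lemma vertex_boundD:
  assumes "vertex_bound \<Omega> P k s f"
  shows "\<exists>r>0. \<exists>c\<ge>0. \<forall>x\<in>\<Omega>. dist x (vertex P k) < r \<longrightarrow> \<bar>f x\<bar> \<le> c * dist x (vertex P k) powr s"
proof -
  obtain D r where D: "smooth_off_vertices \<Omega> P f D" and r: "r > 0"
    and b: "\<And>i j. \<exists>c. \<forall>x\<in>closure \<Omega> - vertices P. dist x (vertex P k) < r \<longrightarrow>
       \<bar>D i j x\<bar> \<le> c * dist x (vertex P k) powr (s - real (i + j))"
    using assms unfolding vertex_bound_def by blast
  obtain c where c: "\<And>x. x \<in> closure \<Omega> - vertices P \<Longrightarrow> dist x (vertex P k) < r \<Longrightarrow>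
       \<bar>D 0 0 x\<bar> \<le> c * dist x (vertex P k) powr (s - real (0 + 0))"
    using b[of 0 0] by blast
  have "\<bar>f x\<bar> \<le> \<bar>c\<bar> * dist x (vertex P k) powr s" if "x \<in> \<Omega>" "dist x (vertex P k) < r" for x
  proof -
    have x: "x \<in> closure \<Omega> - vertices P" using that(1) dom_off_vertices by blast
    have "\<bar>f x\<bar> \<le> c * dist x (vertex P k) powr s"
      using c[OF x that(2)] D x unfolding smooth_off_vertices_def by simp
    also have "\<dots> \<le> \<bar>c\<bar> * dist x (vertex P k) powr s" by (intro mult_right_mono) auto
    finally show ?thesis .
  qed
  then show ?thesis using r by (intro nearI[of r "\<bar>c\<bar>"]) auto
qed

text \<open>Outside small balls around the vertices f is continuous on a compact set and hence
  bounded; inside a ball one singular term alone dominates it. The radii R are prescribed in advance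
  because the Hardy inequality holds only on its own balls.\<close>

lemma singular_bound:
  fixes f :: scal
  assumes cont: "continuous_on (closure \<Omega> - vertices P) f"
    and near: "\<And>k. k \<in> J \<Longrightarrow> \<exists>r>0. \<exists>c\<ge>0. \<forall>x\<in>\<Omega>. dist x (vertex P k) < r \<longrightarrow> \<bar>f x\<bar> \<le> c * dist x (vertex P k) powr (- g)"
    and R: "\<And>k. k \<in> J \<Longrightarrow> R k > 0"
  shows "\<exists>B\<ge>0. \<exists>c. (\<forall>k\<in>J. c k \<ge> 0) \<and> (\<forall>x\<in>\<Omega>. \<bar>f x\<bar> \<le> B +
    (\<Sum>k\<in>J. c k * (dist x (vertex P k) powr (- g) * indicator (ball (vertex P k) (R k)) x)))"
proof -
  have "\<forall>k\<in>J. \<exists>q. fst q > 0 \<and> snd q \<ge> 0 \<and> (\<forall>x\<in>\<Omega>. dist x (vertex P k) < fst q \<longrightarrow> \<bar>f x\<bar> \<le> snd q * dist x (vertex P k) powr (- g))"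
    using near by (metis fst_conv snd_conv)
  from bchoice[OF this] obtain q where q: "\<And>k. k \<in> J \<Longrightarrow> fst (q k) > 0" "\<And>k. k \<in> J \<Longrightarrow> snd (q k) \<ge> 0"
    "\<And>k x. k \<in> J \<Longrightarrow> x \<in> \<Omega> \<Longrightarrow> dist x (vertex P k) < fst (q k) \<Longrightarrow> \<bar>f x\<bar> \<le> snd (q k) * dist x (vertex P k) powr (- g)" by blast
  define s where "s k = min (fst (q k)) (R k)" for k
  have s: "s k > 0" if "k \<in> J" for k using q(1) R that by (simp add: s_def)
  define F where "F = closure \<Omega> - (\<Union>k\<in>J. ball (vertex P k) (s k))"
  have "compact F" unfolding F_def using compact_closure by (intro compact_diff open_UN) auto
  moreover have "F \<subseteq> closure \<Omega> - vertices P" using s by (auto simp: F_def vertices_def)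
  ultimately have "bounded (f ` F)"
    using cont by (intro compact_imp_bounded compact_continuous_image) (auto intro: continuous_on_subset)
  then obtain B where B: "\<And>x. x \<in> F \<Longrightarrow> \<bar>f x\<bar> \<le> B" unfolding bounded_iff by force
  have pos: "0 \<le> snd (q k) * (dist x (vertex P k) powr (- g) * indicator (ball (vertex P k) (R k)) x)" if "k \<in> J" for k x
    using q(2)[OF that] by (simp add: indicator_def)
  show ?thesis
  proof (intro exI[of _ "\<bar>B\<bar>"] conjI exI[of _ "\<lambda>k. snd (q k)"] ballI)
    show "0 \<le> \<bar>B\<bar>" by simp
    show "0 \<le> snd (q k)" if "k \<in> J" for k using q(2)[OF that] .
    fix x assume x: "x \<in> \<Omega>"
    show "\<bar>f x\<bar> \<le> \<bar>B\<bar> + (\<Sum>k\<in>J. snd (q k) * (dist x (vertex P k) powr (- g) * indicator (ball (vertex P k) (R k)) x))"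
    proof (cases "x \<in> F")
      case True
      then have "\<bar>f x\<bar> \<le> \<bar>B\<bar>" using B[of x] by simp
      moreover have "0 \<le> (\<Sum>k\<in>J. snd (q k) * (dist x (vertex P k) powr (- g) * indicator (ball (vertex P k) (R k)) x))"
        by (rule sum_nonneg) (rule pos)
      ultimately show ?thesis by simp
    next
      case False
      then obtain k where k: "k \<in> J" "dist x (vertex P k) < s k"
        using x closure_subset[of \<Omega>] by (auto simp: F_def dist_commute)
      have "\<bar>f x\<bar> \<le> snd (q k) * (dist x (vertex P k) powr (- g) * indicator (ball (vertex P k) (R k)) x)"
        using q(3)[OF k(1) x] k(2) by (simp add: s_def dist_commute)
      also have "\<dots> \<le> (\<Sum>k\<in>J. snd (q k) * (dist x (vertex P k) powr (- g) * indicator (ball (vertex P k) (R k)) x))"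
        by (rule member_le_sum[OF k(1)]) (use pos in auto)
      finally show ?thesis by simp
    qed
  qed
qed

text \<open>The majorant of \<open>singular_bound\<close> is integrated against z^2 term by term:
  the bounded part by the L2 norm, each singular term by the Hardy inequality.\<close>

lemma weighted_bound:
  fixes f :: scal
  assumes cont: "continuous_on (closure \<Omega> - vertices P) f" and g: "0 \<le> g" "g < 2"
    and near: "\<And>k. k \<in> J \<Longrightarrow> \<exists>r>0. \<exists>c\<ge>0. \<forall>x\<in>\<Omega>. dist x (vertex P k) < r \<longrightarrow> \<bar>f x\<bar> \<le> c * dist x (vertex P k) powr (- g)"
  shows "\<exists>W\<ge>0. \<forall>z. z \<in> H1 \<Omega> \<and> continuous_on (closure \<Omega>) z \<longrightarrow>
    (\<integral>\<^sup>+x. ennreal (\<bar>f x\<bar> * (z x)\<^sup>2) \<partial>M) \<le> ennreal (W * h1form \<Omega> z z)"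
proof -
  have "\<forall>k\<in>J. \<exists>q. fst q > 0 \<and> snd q \<ge> 0 \<and> (\<forall>z. z \<in> H1 \<Omega> \<longrightarrow> continuous_on (closure \<Omega>) z \<longrightarrow>
    (\<integral>\<^sup>+x. ennreal (dist x (vertex P k) powr (- g) * (cut z x)\<^sup>2) * indicator (ball (vertex P k) (fst q)) x \<partial>lborel) \<le> ennreal (snd q * h1form \<Omega> z z))"
  proof
    fix k assume k: "k \<in> J"
    obtain r C where "r > 0" "C \<ge> 0" "\<And>z. z \<in> H1 \<Omega> \<Longrightarrow> continuous_on (closure \<Omega>) z \<Longrightarrow>
    (\<integral>\<^sup>+x. ennreal (dist x (vertex P k) powr (- g) * (cut z x)\<^sup>2) * indicator (ball (vertex P k) r) x \<partial>lborel) \<le> ennreal (C * h1form \<Omega> z z)"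
      by (rule Hardy_inequality[OF k g]) blast
    then show "\<exists>q. fst q > 0 \<and> snd q \<ge> 0 \<and> (\<forall>z. z \<in> H1 \<Omega> \<longrightarrow> continuous_on (closure \<Omega>) z \<longrightarrow>
    (\<integral>\<^sup>+x. ennreal (dist x (vertex P k) powr (- g) * (cut z x)\<^sup>2) * indicator (ball (vertex P k) (fst q)) x \<partial>lborel) \<le> ennreal (snd q * h1form \<Omega> z z))"
      by (intro exI[of _ "(r, C)"]) simp
  qed
  from bchoice[OF this] obtain q where q: "\<And>k. k \<in> J \<Longrightarrow> fst (q k) > 0" "\<And>k. k \<in> J \<Longrightarrow> snd (q k) \<ge> 0"
    "\<And>k z. k \<in> J \<Longrightarrow> z \<in> H1 \<Omega> \<Longrightarrow> continuous_on (closure \<Omega>) z \<Longrightarrow>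
    (\<integral>\<^sup>+x. ennreal (dist x (vertex P k) powr (- g) * (cut z x)\<^sup>2) * indicator (ball (vertex P k) (fst (q k))) x \<partial>lborel) \<le> ennreal (snd (q k) * h1form \<Omega> z z)"
    by blast
  obtain B c where B: "B \<ge> 0" and c: "\<And>k. k \<in> J \<Longrightarrow> c k \<ge> 0"
    and bnd: "\<And>x. x \<in> \<Omega> \<Longrightarrow> \<bar>f x\<bar> \<le> B + (\<Sum>k\<in>J. c k * (dist x (vertex P k) powr (- g) * indicator (ball (vertex P k) (fst (q k))) x))"
    using singular_bound[OF cont near, of "\<lambda>k. fst (q k)"] q(1) by blast
  show ?thesis
  proof (intro exI[of _ "B + (\<Sum>k\<in>J. c k * snd (q k))"] conjI allI impI)
    have S0: "0 \<le> (\<Sum>k\<in>J. c k * snd (q k))" using c q(2) by (intro sum_nonneg) auto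
    show "0 \<le> B + (\<Sum>k\<in>J. c k * snd (q k))" using B S0 by simp
    fix z assume "z \<in> H1 \<Omega> \<and> continuous_on (closure \<Omega>) z"
    then have z: "z \<in> H1 \<Omega>" and zc: "continuous_on (closure \<Omega>) z" by auto
    note [measurable] = cut_measurable[OF zc]
    have [measurable]: "ball y r \<in> sets borel" for y :: pt and r by simp
    have h0: "h1form \<Omega> z z \<ge> 0" by (rule H.nonneg[OF z])
    have L0: "L2_inner M z z \<ge> 0" by (rule L2.nonneg[OF H1_L2[OF z]])
    let ?t = "\<lambda>k x. ennreal (dist x (vertex P k) powr (- g) * (cut z x)\<^sup>2) * indicator (ball (vertex P k) (fst (q k))) x"
    let ?F = "\<lambda>x. ennreal B * ennreal ((cut z x)\<^sup>2) + (\<Sum>k\<in>J. ennreal (c k) * ?t k x)"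
    have "(\<integral>\<^sup>+x. ennreal (\<bar>f x\<bar> * (z x)\<^sup>2) \<partial>M) \<le> (\<integral>\<^sup>+x. ?F x \<partial>M)"
    proof (rule nn_integral_mono)
      fix x assume "x \<in> space M"
      then have x: "x \<in> \<Omega>" by simp
      have "\<bar>f x\<bar> * (z x)\<^sup>2 \<le> (B + (\<Sum>k\<in>J. c k * (dist x (vertex P k) powr (- g) * indicator (ball (vertex P k) (fst (q k))) x))) * (cut z x)\<^sup>2"
        using mult_right_mono[OF bnd[OF x], of "(z x)\<^sup>2"] by (simp add: cut_eq[OF x])
      also have "\<dots> = B * (cut z x)\<^sup>2 + (\<Sum>k\<in>J. c k * (dist x (vertex P k) powr (- g) * (cut z x)\<^sup>2 * indicator (ball (vertex P k) (fst (q k))) x))"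
        unfolding distrib_right sum_distrib_right
        by (intro arg_cong2[where f="(+)"] sum.cong refl) (simp_all add: mult_ac)
      finally have "ennreal (\<bar>f x\<bar> * (z x)\<^sup>2) \<le> ennreal (B * (cut z x)\<^sup>2 + (\<Sum>k\<in>J. c k * (dist x (vertex P k) powr (- g) * (cut z x)\<^sup>2 * indicator (ball (vertex P k) (fst (q k))) x)))"
        by (rule ennreal_leI)
      also have "\<dots> = ennreal (B * (cut z x)\<^sup>2) + (\<Sum>k\<in>J. ennreal (c k * (dist x (vertex P k) powr (- g) * (cut z x)\<^sup>2 * indicator (ball (vertex P k) (fst (q k))) x)))"
      proof -
        have nn: "0 \<le> c k * (dist x (vertex P k) powr (- g) * (cut z x)\<^sup>2 * indicator (ball (vertex P k) (fst (q k))) x)" if "k \<in> J" for k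
          using c[OF that] by (simp add: indicator_def)
        then have "0 \<le> (\<Sum>k\<in>J. c k * (dist x (vertex P k) powr (- g) * (cut z x)\<^sup>2 * indicator (ball (vertex P k) (fst (q k))) x))"
          by (rule sum_nonneg)
        then show ?thesis using B nn by (subst sum_ennreal) (auto simp: ennreal_plus)
      qed
      also have "\<dots> = ?F x"
      proof -
        have "ennreal (c k * (dist x (vertex P k) powr (- g) * (cut z x)\<^sup>2 * indicator (ball (vertex P k) (fst (q k))) x)) = ennreal (c k) * ?t k x" if "k \<in> J" for k
          using c[OF that] by (simp add: indicator_def ennreal_mult)
        then have "(\<Sum>k\<in>J. ennreal (c k * (dist x (vertex P k) powr (- g) * (cut z x)\<^sup>2 * indicator (ball (vertex P k) (fst (q k))) x)))
            = (\<Sum>k\<in>J. ennreal (c k) * ?t k x)" by (rule sum.cong[OF refl])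
        moreover have "ennreal (B * (cut z x)\<^sup>2) = ennreal B * ennreal ((cut z x)\<^sup>2)"
          using B by (simp add: ennreal_mult)
        ultimately show ?thesis by (simp only:)
      qed
      finally show "ennreal (\<bar>f x\<bar> * (z x)\<^sup>2) \<le> ?F x" .
    qed
    also have "\<dots> \<le> (\<integral>\<^sup>+x. ?F x \<partial>lborel)"
    proof -
      have "?F \<in> borel_measurable borel" by measurable
      from nn_integral_M_borel[OF this] show ?thesis
        by (simp only:) (rule nn_integral_mono, auto simp: indicator_def)
    qed
    also have "\<dots> = ennreal B * (\<integral>\<^sup>+x. ennreal ((cut z x)\<^sup>2) \<partial>lborel) + (\<Sum>k\<in>J. ennreal (c k) * (\<integral>\<^sup>+x. ?t k x \<partial>lborel))"
      by (subst nn_integral_add) (auto simp: nn_integral_sum nn_integral_cmult)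
    also have "\<dots> \<le> ennreal B * ennreal (h1form \<Omega> z z) + (\<Sum>k\<in>J. ennreal (c k) * ennreal (snd (q k) * h1form \<Omega> z z))"
      unfolding nn_integral_cut[OF z zc]
      by (intro add_mono mult_left_mono sum_mono q z zc ennreal_leI L2_le_h1form) auto
    also have "\<dots> = ennreal ((B + (\<Sum>k\<in>J. c k * snd (q k))) * h1form \<Omega> z z)"
    proof -
      have "(\<Sum>k\<in>J. ennreal (c k) * ennreal (snd (q k) * h1form \<Omega> z z)) = (\<Sum>k\<in>J. ennreal (c k * snd (q k) * h1form \<Omega> z z))"
        using c q(2) h0 by (intro sum.cong) (auto simp: ennreal_mult mult.assoc)
      also have "\<dots> = ennreal (\<Sum>k\<in>J. c k * snd (q k) * h1form \<Omega> z z)"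
        using c q(2) h0 by (intro sum_ennreal) auto
      also have "\<dots> = ennreal ((\<Sum>k\<in>J. c k * snd (q k)) * h1form \<Omega> z z)" by (simp add: sum_distrib_right)
      finally show ?thesis
        using B S0 h0 by (simp add: distrib_right ennreal_plus ennreal_mult)
    qed
    finally show "(\<integral>\<^sup>+x. ennreal (\<bar>f x\<bar> * (z x)\<^sup>2) \<partial>M) \<le> ennreal ((B + (\<Sum>k\<in>J. c k * snd (q k))) * h1form \<Omega> z z)" .
  qed
qed

lemma L2_nrm_grad: "z \<in> H1 \<Omega> \<Longrightarrow> L2_nrm M (\<lambda>x. grad \<Omega> z x $ i) \<le> H1_nrm \<Omega> z"
proof -
  assume z: "z \<in> H1 \<Omega>"
  have "L2_inner M (\<lambda>x. grad \<Omega> z x $ i) (\<lambda>x. grad \<Omega> z x $ i) \<le> dform \<Omega> z z"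
    using exhaust_2[of i] L2.nonneg[OF grad_L2[OF z]] by (auto simp: dform_components z)
  then show ?thesis using dform_le_h1form[OF z] by (simp add: L2_nrm_def H1_nrm_eq)
qed

end

lemma near_weaken:
  fixes s s' :: real and S :: "'a::metric_space"
  assumes "\<exists>r>0. \<exists>c\<ge>0. \<forall>x\<in>U. dist x S < r \<longrightarrow> \<bar>f x\<bar> \<le> c * dist x S powr s" "s' \<le> s"
  shows "\<exists>r>0. \<exists>c\<ge>0. \<forall>x\<in>U. dist x S < r \<longrightarrow> \<bar>f x\<bar> \<le> c * dist x S powr s'"
proof -
  obtain r c where rc: "r > 0" "c \<ge> 0" "\<And>x. x \<in> U \<Longrightarrow> dist x S < r \<Longrightarrow> \<bar>f x\<bar> \<le> c * dist x S powr s"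
    using assms(1) by blast
  show ?thesis
  proof (rule nearI[of "min r 1" c])
    fix x assume x: "x \<in> U" "dist x S < min r 1"
    then have "\<bar>f x\<bar> \<le> c * dist x S powr s" using rc(3) by simp
    also have "\<dots> \<le> c * dist x S powr s'"
      using assms(2) x(2) rc(2) by (intro mult_left_mono powr_mono') auto
    finally show "\<bar>f x\<bar> \<le> c * dist x S powr s'" .
  qed (use rc in auto)
qed

locale coefficients = polygon_domain +
  fixes A :: "pt \<Rightarrow> real^2^2" and b :: "pt \<Rightarrow> pt" and a0 :: scal
  assumes adm: "admissible_coefficients \<Omega> P A b a0"
begin

lemma coefficient_continuity:
  "continuous_on (closure \<Omega> - vertices P) (\<lambda>x. A x $ p $ q)"
  "continuous_on (closure \<Omega> - vertices P) (\<lambda>x. b x $ p)"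
  "continuous_on (closure \<Omega> - vertices P) a0"
  using adm unfolding admissible_coefficients_def by (meson continuous_off_vertices)+

lemma coefficient_measurable:
  "(\<lambda>x. A x $ p $ q) \<in> borel_measurable M" "(\<lambda>x. b x $ p) \<in> borel_measurable M" "a0 \<in> borel_measurable M"
  by (rule measurable_M_continuous[OF continuous_on_subset[OF _ dom_off_vertices]], rule coefficient_continuity)+

lemma coefficient_decay:
  obtains \<delta> where "\<delta> > 0"
    "\<And>k p q. k \<in> J \<Longrightarrow> vertex_bound \<Omega> P k \<delta> (\<lambda>x. A x $ p $ q - A (vertex P k) $ p $ q)"
    "\<And>k p. k \<in> J \<Longrightarrow> vertex_bound \<Omega> P k (\<delta> - 1) (\<lambda>x. b x $ p)"
    "\<And>k. k \<in> J \<Longrightarrow> vertex_bound \<Omega> P k (\<delta> - 2) a0"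
  using adm unfolding admissible_coefficients_def by blast

text \<open>Near a vertex the entries differ from their vertex values by at most a multiple of a
  positive power of the distance, so \<open>singular_bound\<close> applies with exponent 0.\<close>

lemma A_bounded: "\<exists>C\<ge>0. \<forall>x\<in>\<Omega>. \<forall>p q. \<bar>A x $ p $ q\<bar> \<le> C"
proof -
  obtain \<delta> where \<delta>: "\<delta> > 0" "\<And>k p q. k \<in> J \<Longrightarrow> vertex_bound \<Omega> P k \<delta> (\<lambda>x. A x $ p $ q - A (vertex P k) $ p $ q)"
    by (rule coefficient_decay) blast
  have one: "\<exists>C\<ge>0. \<forall>x\<in>\<Omega>. \<bar>A x $ p $ q\<bar> \<le> C" for p q
  proof -
    have near: "\<exists>r>0. \<exists>c\<ge>0. \<forall>x\<in>\<Omega>. dist x (vertex P k) < r \<longrightarrow> \<bar>A x $ p $ q\<bar> \<le> c * dist x (vertex P k) powr (- 0)"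
      if k: "k \<in> J" for k
    proof -
      have "\<exists>r>0. \<exists>c\<ge>0. \<forall>x\<in>\<Omega>. dist x (vertex P k) < r \<longrightarrow> \<bar>A x $ p $ q - A (vertex P k) $ p $ q\<bar> \<le> c * dist x (vertex P k) powr 0"
        by (rule near_weaken[OF vertex_boundD[OF \<delta>(2)[OF k]]]) (use \<delta>(1) in simp)
      then obtain r c where rc: "r > 0" "c \<ge> 0" "\<And>x. x \<in> \<Omega> \<Longrightarrow> dist x (vertex P k) < r \<Longrightarrow> \<bar>A x $ p $ q - A (vertex P k) $ p $ q\<bar> \<le> c * dist x (vertex P k) powr 0"
        by blast
      have "\<bar>A x $ p $ q\<bar> \<le> (c + \<bar>A (vertex P k) $ p $ q\<bar>) * dist x (vertex P k) powr (- 0)"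
        if "x \<in> \<Omega>" "dist x (vertex P k) < r" for x
      proof -
        have "dist x (vertex P k) powr (- 0) = 1" "dist x (vertex P k) powr 0 = 1"
          using dist_vertex_pos[OF k that(1)] by auto
        then show ?thesis using rc(3)[OF that] by (simp only: mult_1_right)
      qed
      then show ?thesis using rc(1,2) by (intro nearI[of r "c + \<bar>A (vertex P k) $ p $ q\<bar>"]) auto
    qed
    obtain B c where B: "B \<ge> 0" "\<And>k. k \<in> J \<Longrightarrow> c k \<ge> 0"
      "\<And>x. x \<in> \<Omega> \<Longrightarrow> \<bar>A x $ p $ q\<bar> \<le> B + (\<Sum>k\<in>J. c k * (dist x (vertex P k) powr (- 0) * indicator (ball (vertex P k) 1) x))"
      using singular_bound[OF coefficient_continuity(1) near, of "\<lambda>k. 1", OF _ zero_less_one] by blast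
    have "\<bar>A x $ p $ q\<bar> \<le> B + (\<Sum>k\<in>J. c k)" if "x \<in> \<Omega>" for x
    proof -
      have "(\<Sum>k\<in>J. c k * (dist x (vertex P k) powr (- 0) * indicator (ball (vertex P k) 1) x)) \<le> (\<Sum>k\<in>J. c k)"
        using B(2) by (intro sum_mono mult_left_le) (auto simp: indicator_def)
      then show ?thesis using B(3)[OF that] by linarith
    qed
    moreover have "0 \<le> B + (\<Sum>k\<in>J. c k)" by (intro add_nonneg_nonneg sum_nonneg B)
    ultimately show ?thesis by blast
  qed
  obtain C where C: "\<And>p q. C p q \<ge> 0" "\<And>p q x. x \<in> \<Omega> \<Longrightarrow> \<bar>A x $ p $ q\<bar> \<le> C p q"
    using one by metis
  show ?thesis
  proof (intro exI[of _ "\<Sum>p\<in>UNIV. \<Sum>q\<in>UNIV. C p q"] conjI ballI allI)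
    show "0 \<le> (\<Sum>p\<in>UNIV. \<Sum>q\<in>UNIV. C p q)" by (intro sum_nonneg C)
    fix x p q assume "x \<in> \<Omega>"
    then have "\<bar>A x $ p $ q\<bar> \<le> C p q" by (rule C)
    also have "\<dots> \<le> (\<Sum>q\<in>UNIV. C p q)" by (rule member_le_sum) (auto simp: C)
    also have "\<dots> \<le> (\<Sum>p\<in>UNIV. \<Sum>q\<in>UNIV. C p q)" by (rule member_le_sum) (auto simp: C sum_nonneg)
    finally show "\<bar>A x $ p $ q\<bar> \<le> (\<Sum>p\<in>UNIV. \<Sum>q\<in>UNIV. C p q)" .
  qed
qed

text \<open>The square of b is of order r^(2 \<delta> - 2) and a0 of order r^(\<delta> - 2), both
  milder than r^(-2), so both are admissible weights. The square of b appears because b z has to be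
  in L2.\<close>

lemma lower_order_weights:
  "\<exists>W\<ge>0. \<forall>z. z \<in> H1 \<Omega> \<and> continuous_on (closure \<Omega>) z \<longrightarrow>
    (\<forall>p. (\<integral>\<^sup>+x. ennreal ((b x $ p * z x)\<^sup>2) \<partial>M) \<le> ennreal (W * h1form \<Omega> z z)) \<and>
    (\<integral>\<^sup>+x. ennreal (\<bar>a0 x\<bar> * (z x)\<^sup>2) \<partial>M) \<le> ennreal (W * h1form \<Omega> z z)"
proof -
  obtain \<delta> where \<delta>: "\<delta> > 0"
    "\<And>k p. k \<in> J \<Longrightarrow> vertex_bound \<Omega> P k (\<delta> - 1) (\<lambda>x. b x $ p)"
    "\<And>k. k \<in> J \<Longrightarrow> vertex_bound \<Omega> P k (\<delta> - 2) a0"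
    by (rule coefficient_decay) blast
  \<comment> \<open>An exponent below 2 that dominates both singularities; the minimum with 1 keeps
    it nonnegative.\<close>
  define g where "g = 2 - min \<delta> 1"
  have g: "0 \<le> g" "g < 2" "- g \<le> 2 * (\<delta> - 1)" "- g \<le> \<delta> - 2" using \<delta>(1) by (auto simp: g_def min_def)
  have "\<exists>W\<ge>0. \<forall>z. z \<in> H1 \<Omega> \<and> continuous_on (closure \<Omega>) z \<longrightarrow>
    (\<integral>\<^sup>+x. ennreal (\<bar>a0 x\<bar> * (z x)\<^sup>2) \<partial>M) \<le> ennreal (W * h1form \<Omega> z z)"
    by (rule weighted_bound[OF coefficient_continuity(3) g(1,2)]) (rule near_weaken[OF vertex_boundD[OF \<delta>(3)] g(4)])
  then obtain W0 where W0: "W0 \<ge> 0" "\<And>z. z \<in> H1 \<Omega> \<Longrightarrow> continuous_on (closure \<Omega>) z \<Longrightarrow>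
    (\<integral>\<^sup>+x. ennreal (\<bar>a0 x\<bar> * (z x)\<^sup>2) \<partial>M) \<le> ennreal (W0 * h1form \<Omega> z z)" by blast
  have "\<exists>W\<ge>0. \<forall>z. z \<in> H1 \<Omega> \<and> continuous_on (closure \<Omega>) z \<longrightarrow>
    (\<integral>\<^sup>+x. ennreal (\<bar>(b x $ p)\<^sup>2\<bar> * (z x)\<^sup>2) \<partial>M) \<le> ennreal (W * h1form \<Omega> z z)" for p
  proof (rule weighted_bound[OF continuous_on_power[OF coefficient_continuity(2)] g(1,2)])
    fix k assume k: "k \<in> J"
    obtain r c where rc: "r > 0" "c \<ge> 0" "\<And>x. x \<in> \<Omega> \<Longrightarrow> dist x (vertex P k) < r \<Longrightarrow> \<bar>b x $ p\<bar> \<le> c * dist x (vertex P k) powr (\<delta> - 1)"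
      using vertex_boundD[OF \<delta>(2)[OF k]] by blast
    have "\<exists>r>0. \<exists>c\<ge>0. \<forall>x\<in>\<Omega>. dist x (vertex P k) < r \<longrightarrow> \<bar>(b x $ p)\<^sup>2\<bar> \<le> c * dist x (vertex P k) powr (2 * (\<delta> - 1))"
    proof (rule nearI[of r "c\<^sup>2"])
      fix x assume "x \<in> \<Omega>" "dist x (vertex P k) < r"
      then have "\<bar>b x $ p\<bar>\<^sup>2 \<le> (c * dist x (vertex P k) powr (\<delta> - 1))\<^sup>2" by (intro power_mono rc) auto
      also have "\<dots> = c\<^sup>2 * dist x (vertex P k) powr (2 * (\<delta> - 1))"
        by (simp add: power_mult_distrib power2_eq_square powr_add[symmetric])
      finally show "\<bar>(b x $ p)\<^sup>2\<bar> \<le> c\<^sup>2 * dist x (vertex P k) powr (2 * (\<delta> - 1))" by simp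
    qed (use rc in auto)
    then show "\<exists>r>0. \<exists>c\<ge>0. \<forall>x\<in>\<Omega>. dist x (vertex P k) < r \<longrightarrow> \<bar>(b x $ p)\<^sup>2\<bar> \<le> c * dist x (vertex P k) powr (- g)"
      by (rule near_weaken) (rule g)
  qed
  then have "\<forall>p. \<exists>W\<ge>0. \<forall>z. z \<in> H1 \<Omega> \<and> continuous_on (closure \<Omega>) z \<longrightarrow>
    (\<integral>\<^sup>+x. ennreal (\<bar>(b x $ p)\<^sup>2\<bar> * (z x)\<^sup>2) \<partial>M) \<le> ennreal (W * h1form \<Omega> z z)" by blast
  from choice[OF this] obtain W where W: "\<And>p. W p \<ge> 0" "\<And>p z. z \<in> H1 \<Omega> \<Longrightarrow> continuous_on (closure \<Omega>) z \<Longrightarrow>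
    (\<integral>\<^sup>+x. ennreal (\<bar>(b x $ p)\<^sup>2\<bar> * (z x)\<^sup>2) \<partial>M) \<le> ennreal (W p * h1form \<Omega> z z)" by blast
  show ?thesis
  proof (intro exI[of _ "W0 + W 1 + W 2"] conjI allI impI)
    show "0 \<le> W0 + W 1 + W 2" using W0 W by simp
    fix z assume "z \<in> H1 \<Omega> \<and> continuous_on (closure \<Omega>) z"
    then have z: "z \<in> H1 \<Omega>" "continuous_on (closure \<Omega>) z" by auto
    note h0 = H.nonneg[OF z(1)]
    show "(\<integral>\<^sup>+x. ennreal (\<bar>a0 x\<bar> * (z x)\<^sup>2) \<partial>M) \<le> ennreal ((W0 + W 1 + W 2) * h1form \<Omega> z z)"
      by (rule order_trans[OF W0(2)[OF z]]) (use h0 W0(1) W(1) in \<open>auto intro!: ennreal_leI mult_right_mono simp: add.assoc\<close>)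
    fix p :: 2
    have "W p \<le> W0 + W 1 + W 2" using exhaust_2[of p] W0(1) W(1)[of 1] W(1)[of 2] by auto
    then have "ennreal (W p * h1form \<Omega> z z) \<le> ennreal ((W0 + W 1 + W 2) * h1form \<Omega> z z)"
      using h0 by (intro ennreal_leI mult_right_mono)
    then show "(\<integral>\<^sup>+x. ennreal ((b x $ p * z x)\<^sup>2) \<partial>M) \<le> ennreal ((W0 + W 1 + W 2) * h1form \<Omega> z z)"
      using W(2)[OF z, of p] by (simp add: power_mult_distrib)
  qed
qed

text \<open>The Hardy inequality is available for functions continuous up to the boundary, so on
  this space the integrals of the bilinear form are under control. All discrete functions belong to
  it.\<close>

definition V :: "scal set" where
  "V = {z \<in> H1 \<Omega>. continuous_on (closure \<Omega>) z}"

lemma V_H1: "z \<in> V \<Longrightarrow> z \<in> H1 \<Omega>" and V_cont: "z \<in> V \<Longrightarrow> continuous_on (closure \<Omega>) z"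
  by (auto simp: V_def)

lemma V_add: "y \<in> V \<Longrightarrow> z \<in> V \<Longrightarrow> (\<lambda>x. y x + z x) \<in> V"
  and V_scale: "z \<in> V \<Longrightarrow> (\<lambda>x. c * z x) \<in> V"
  by (auto simp: V_def H.bilin intro!: continuous_intros)

text \<open>Each term of the bilinear form is split into two L2 factors: A grad y against grad z,
  grad y against b z, and the square root of |a0| on either side. Products of these are integrable
  and bounded by Cauchy-Schwarz.\<close>

lemma form_factors:
  "\<exists>W\<ge>0. \<forall>z\<in>V. (\<forall>p. (\<lambda>x. b x $ p * z x) \<in> L2 M \<and> L2_nrm M (\<lambda>x. b x $ p * z x) \<le> W * H1_nrm \<Omega> z) \<and>
    (\<lambda>x. sqrt \<bar>a0 x\<bar> * z x) \<in> L2 M \<and> L2_nrm M (\<lambda>x. sqrt \<bar>a0 x\<bar> * z x) \<le> W * H1_nrm \<Omega> z \<and>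
    (\<forall>p q. (\<lambda>x. A x $ p $ q * grad \<Omega> z x $ q) \<in> L2 M \<and> L2_nrm M (\<lambda>x. A x $ p $ q * grad \<Omega> z x $ q) \<le> W * H1_nrm \<Omega> z)"
proof -
  obtain W where W: "W \<ge> 0" "\<And>z p. z \<in> V \<Longrightarrow> (\<integral>\<^sup>+x. ennreal ((b x $ p * z x)\<^sup>2) \<partial>M) \<le> ennreal (W * h1form \<Omega> z z)"
    "\<And>z. z \<in> V \<Longrightarrow> (\<integral>\<^sup>+x. ennreal (\<bar>a0 x\<bar> * (z x)\<^sup>2) \<partial>M) \<le> ennreal (W * h1form \<Omega> z z)"
    using lower_order_weights unfolding V_def by blast
  obtain C where C: "C \<ge> 0" "\<And>x p q. x \<in> \<Omega> \<Longrightarrow> \<bar>A x $ p $ q\<bar> \<le> C" using A_bounded by blast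
  note [measurable] = coefficient_measurable
  have gen: "f \<in> L2 M \<and> L2_nrm M f \<le> sqrt K * H1_nrm \<Omega> z"
    if "z \<in> V" "f \<in> borel_measurable M" "(\<integral>\<^sup>+x. ennreal ((f x)\<^sup>2) \<partial>M) \<le> ennreal (K * h1form \<Omega> z z)" "K \<ge> 0" for f z K
  proof -
    have f: "f \<in> L2 M" using that(2,3) by (rule L2_I)
    have "L2_inner M f f \<le> K * h1form \<Omega> z z"
      using that(3,4) H.nonneg[OF V_H1[OF that(1)]] unfolding nn_integral_L2[OF f] by (simp add: ennreal_le_iff)
    then show ?thesis using f by (simp add: L2_nrm_def H1_nrm_eq flip: real_sqrt_mult)
  qed
  define K where "K = W + C\<^sup>2"
  have K: "K \<ge> 0" "W \<le> K" "C\<^sup>2 \<le> K" using W(1) by (auto simp: K_def)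
  show ?thesis
  proof (intro exI[of _ "sqrt K"] conjI ballI)
    show "0 \<le> sqrt K" using K by simp
    fix z assume z: "z \<in> V"
    have h0: "0 \<le> h1form \<Omega> z z" by (rule H.nonneg[OF V_H1[OF z]])
    have up: "ennreal (W * h1form \<Omega> z z) \<le> ennreal (K * h1form \<Omega> z z)"
      using K h0 by (intro ennreal_leI mult_right_mono)
    have [measurable]: "z \<in> borel_measurable M" using z V_H1 H1_L2 L2_measurable by blast
    have [measurable]: "(\<lambda>x. grad \<Omega> z x $ q) \<in> borel_measurable M" for q
      using grad_L2[OF V_H1[OF z]] by (rule L2_measurable)
    show "\<forall>p. (\<lambda>x. b x $ p * z x) \<in> L2 M \<and> L2_nrm M (\<lambda>x. b x $ p * z x) \<le> sqrt K * H1_nrm \<Omega> z"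
      by (intro allI gen[OF z _ order_trans[OF W(2)[OF z] up] K(1)]) measurable
    have "(\<integral>\<^sup>+x. ennreal ((sqrt \<bar>a0 x\<bar> * z x)\<^sup>2) \<partial>M) \<le> ennreal (K * h1form \<Omega> z z)"
      using order_trans[OF W(3)[OF z] up] by (simp add: power_mult_distrib)
    then have "(\<lambda>x. sqrt \<bar>a0 x\<bar> * z x) \<in> L2 M \<and> L2_nrm M (\<lambda>x. sqrt \<bar>a0 x\<bar> * z x) \<le> sqrt K * H1_nrm \<Omega> z"
      by (intro gen[OF z _ _ K(1)]) measurable
    then show "(\<lambda>x. sqrt \<bar>a0 x\<bar> * z x) \<in> L2 M" "L2_nrm M (\<lambda>x. sqrt \<bar>a0 x\<bar> * z x) \<le> sqrt K * H1_nrm \<Omega> z" by auto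
    show "\<forall>p q. (\<lambda>x. A x $ p $ q * grad \<Omega> z x $ q) \<in> L2 M \<and> L2_nrm M (\<lambda>x. A x $ p $ q * grad \<Omega> z x $ q) \<le> sqrt K * H1_nrm \<Omega> z"
    proof (intro allI gen[OF z _ _ K(1)])
      fix p q :: 2
      let ?g = "\<lambda>x. grad \<Omega> z x $ q"
      show "(\<lambda>x. A x $ p $ q * ?g x) \<in> borel_measurable M" by measurable
      have "(\<integral>\<^sup>+x. ennreal ((A x $ p $ q * ?g x)\<^sup>2) \<partial>M) \<le> (\<integral>\<^sup>+x. ennreal (C\<^sup>2) * ennreal ((?g x)\<^sup>2) \<partial>M)"
      proof (rule nn_integral_mono)
        fix x assume "x \<in> space M"
        then have "(A x $ p $ q)\<^sup>2 \<le> C\<^sup>2" using C by (auto simp: abs_le_square_iff[symmetric] intro: order_trans[OF _ abs_ge_self])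
        then have "(A x $ p $ q * ?g x)\<^sup>2 \<le> C\<^sup>2 * (?g x)\<^sup>2" by (simp add: power_mult_distrib mult_right_mono)
        then show "ennreal ((A x $ p $ q * ?g x)\<^sup>2) \<le> ennreal (C\<^sup>2) * ennreal ((?g x)\<^sup>2)"
          by (simp add: ennreal_mult[symmetric] ennreal_leI)
      qed
      also have "\<dots> = ennreal (C\<^sup>2) * ennreal (L2_inner M ?g ?g)"
        by (subst nn_integral_cmult) (auto simp: nn_integral_L2[OF grad_L2[OF V_H1[OF z]]])
      also have "\<dots> = ennreal (C\<^sup>2 * L2_inner M ?g ?g)"
        using L2.nonneg[OF grad_L2[OF V_H1[OF z]]] by (simp add: ennreal_mult)
      also have "\<dots> \<le> ennreal (K * h1form \<Omega> z z)"
      proof (intro ennreal_leI mult_mono K)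
        have "(L2_nrm M ?g)\<^sup>2 \<le> (H1_nrm \<Omega> z)\<^sup>2"
          using L2_nrm_grad[OF V_H1[OF z]] L2.nrm_nonneg[OF grad_L2[OF V_H1[OF z]]]
          by (intro power_mono) (auto simp: L2_nrm_eq)
        then show "L2_inner M ?g ?g \<le> h1form \<Omega> z z" by (simp add: L2_nrm_sq H1_nrm_sq[OF V_H1[OF z]])
      qed (use K L2.nonneg[OF grad_L2[OF V_H1[OF z]]] in auto)
      finally show "(\<integral>\<^sup>+x. ennreal ((A x $ p $ q * ?g x)\<^sup>2) \<partial>M) \<le> ennreal (K * h1form \<Omega> z z)" .
    qed
  qed
qed

lemma form_integrands:
  "(A x *v grad \<Omega> y x) \<bullet> grad \<Omega> z x = (\<Sum>p\<in>UNIV. \<Sum>q\<in>UNIV. (A x $ p $ q * grad \<Omega> y x $ q) * grad \<Omega> z x $ p)"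
  "(b x \<bullet> grad \<Omega> y x) * z x = (\<Sum>p\<in>UNIV. grad \<Omega> y x $ p * (b x $ p * z x))"
  "a0 x * y x * z x = sgn (a0 x) * ((sqrt \<bar>a0 x\<bar> * y x) * (sqrt \<bar>a0 x\<bar> * z x))"
proof -
  show "(A x *v grad \<Omega> y x) \<bullet> grad \<Omega> z x = (\<Sum>p\<in>UNIV. \<Sum>q\<in>UNIV. (A x $ p $ q * grad \<Omega> y x $ q) * grad \<Omega> z x $ p)"
    by (simp add: inner_vec_def matrix_vector_mult_def sum_distrib_right)
  show "(b x \<bullet> grad \<Omega> y x) * z x = (\<Sum>p\<in>UNIV. grad \<Omega> y x $ p * (b x $ p * z x))"
    unfolding inner_vec_def sum_distrib_right by (rule sum.cong) (simp_all add: mult_ac)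
  have "sgn (a0 x) * ((sqrt \<bar>a0 x\<bar> * y x) * (sqrt \<bar>a0 x\<bar> * z x)) = sgn (a0 x) * (sqrt \<bar>a0 x\<bar> * sqrt \<bar>a0 x\<bar>) * (y x * z x)"
    by (simp only: mult_ac)
  also have "\<dots> = a0 x * (y x * z x)" by (simp add: sgn_mult_abs)
  finally show "a0 x * y x * z x = sgn (a0 x) * ((sqrt \<bar>a0 x\<bar> * y x) * (sqrt \<bar>a0 x\<bar> * z x))"
    by (simp only: mult.assoc[of "a0 x"])
qed

lemma form_integrable:
  assumes "y \<in> V" "z \<in> V"
  shows "integrable M (\<lambda>x. (A x *v grad \<Omega> y x) \<bullet> grad \<Omega> z x)"
    "integrable M (\<lambda>x. (b x \<bullet> grad \<Omega> y x) * z x)" "integrable M (\<lambda>x. a0 x * y x * z x)"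
proof -
  note [measurable] = coefficient_measurable
  have m: "(\<lambda>x. b x $ p * z x) \<in> L2 M" "(\<lambda>x. sqrt \<bar>a0 x\<bar> * y x) \<in> L2 M" "(\<lambda>x. sqrt \<bar>a0 x\<bar> * z x) \<in> L2 M"
    "(\<lambda>x. A x $ p $ q * grad \<Omega> y x $ q) \<in> L2 M" for p q
    using form_factors assms by auto
  have g: "(\<lambda>x. grad \<Omega> y x $ p) \<in> L2 M" "(\<lambda>x. grad \<Omega> z x $ p) \<in> L2 M" for p
    using assms V_H1 grad_L2 by auto
  show "integrable M (\<lambda>x. (A x *v grad \<Omega> y x) \<bullet> grad \<Omega> z x)"
    unfolding form_integrands by (intro Bochner_Integration.integrable_sum L2_integrable_mult m g)
  show "integrable M (\<lambda>x. (b x \<bullet> grad \<Omega> y x) * z x)"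
    unfolding form_integrands by (intro Bochner_Integration.integrable_sum L2_integrable_mult m g)
  have "integrable M (\<lambda>x. (sqrt \<bar>a0 x\<bar> * y x) * (sqrt \<bar>a0 x\<bar> * z x))" by (intro L2_integrable_mult m)
  then show "integrable M (\<lambda>x. a0 x * y x * z x)"
    by (rule Bochner_Integration.integrable_bound)
      (use assms V_H1 H1_L2 L2_measurable in \<open>auto simp: form_integrands(3) abs_mult abs_sgn_eq\<close>)
qed

abbreviation "af \<equiv> aform \<Omega> A b a0"

lemma Av_measurable:
  assumes [measurable]: "g \<in> borel_measurable M" "h \<in> borel_measurable M"
  shows "(\<lambda>x. (A x *v g x) \<bullet> h x) \<in> borel_measurable M" "(\<lambda>x. b x \<bullet> g x) \<in> borel_measurable M"
proof -
  note [measurable] = coefficient_measurable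
  have [measurable]: "(\<lambda>x. g x $ p) \<in> borel_measurable M" "(\<lambda>x. h x $ p) \<in> borel_measurable M" for p by measurable
  show "(\<lambda>x. (A x *v g x) \<bullet> h x) \<in> borel_measurable M" "(\<lambda>x. b x \<bullet> g x) \<in> borel_measurable M"
    unfolding inner_vec_def matrix_vector_mult_def by simp_all
qed

lemma af_add_left:
  assumes "y \<in> V" "y' \<in> V" "z \<in> V" shows "af (\<lambda>x. y x + y' x) z = af y z + af y' z"
proof -
  note i = form_integrable[OF assms(1,3)] form_integrable[OF assms(2,3)]
  note [measurable] = Av_measurable assms(1-3)[THEN V_H1, THEN H1_L2, THEN L2_measurable]
    assms(1-3)[THEN V_H1, THEN grad_measurable] grad_measurable[OF V_H1[OF V_add[OF assms(1,2)]]]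
  have ae: "AE x in M. grad \<Omega> (\<lambda>x. y x + y' x) x = grad \<Omega> y x + grad \<Omega> y' x"
    using assms V_H1 by (intro grad_add) auto
  have "(LINT x|M. (A x *v grad \<Omega> (\<lambda>x. y x + y' x) x) \<bullet> grad \<Omega> z x)
      = (LINT x|M. (A x *v grad \<Omega> y x) \<bullet> grad \<Omega> z x + (A x *v grad \<Omega> y' x) \<bullet> grad \<Omega> z x)"
    by (rule integral_cong_AE) (use ae in \<open>auto elim!: eventually_mono simp: matrix_vector_right_distrib inner_add_left\<close>)
  moreover have "(LINT x|M. (b x \<bullet> grad \<Omega> (\<lambda>x. y x + y' x) x) * z x)
      = (LINT x|M. (b x \<bullet> grad \<Omega> y x) * z x + (b x \<bullet> grad \<Omega> y' x) * z x)"
    by (rule integral_cong_AE) (use ae in \<open>auto elim!: eventually_mono simp: inner_add_right distrib_right\<close>)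
  moreover have "(LINT x|M. a0 x * (y x + y' x) * z x) = (LINT x|M. a0 x * y x * z x + a0 x * y' x * z x)"
    by (simp add: algebra_simps)
  ultimately show ?thesis unfolding aform_def using i by simp
qed

lemma af_add_right:
  assumes "y \<in> V" "y' \<in> V" "z \<in> V" shows "af z (\<lambda>x. y x + y' x) = af z y + af z y'"
proof -
  note i = form_integrable[OF assms(3,1)] form_integrable[OF assms(3,2)]
  note [measurable] = Av_measurable assms(1-3)[THEN V_H1, THEN H1_L2, THEN L2_measurable]
    assms(1-3)[THEN V_H1, THEN grad_measurable] grad_measurable[OF V_H1[OF V_add[OF assms(1,2)]]]
  have ae: "AE x in M. grad \<Omega> (\<lambda>x. y x + y' x) x = grad \<Omega> y x + grad \<Omega> y' x"
    using assms V_H1 by (intro grad_add) auto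
  have "(LINT x|M. (A x *v grad \<Omega> z x) \<bullet> grad \<Omega> (\<lambda>x. y x + y' x) x)
      = (LINT x|M. (A x *v grad \<Omega> z x) \<bullet> grad \<Omega> y x + (A x *v grad \<Omega> z x) \<bullet> grad \<Omega> y' x)"
    by (rule integral_cong_AE) (use ae in \<open>auto elim!: eventually_mono simp: inner_add_right\<close>)
  moreover have "(LINT x|M. (b x \<bullet> grad \<Omega> z x) * (y x + y' x))
      = (LINT x|M. (b x \<bullet> grad \<Omega> z x) * y x + (b x \<bullet> grad \<Omega> z x) * y' x)"
    by (simp add: distrib_left)
  moreover have "(LINT x|M. a0 x * z x * (y x + y' x)) = (LINT x|M. a0 x * z x * y x + a0 x * z x * y' x)"
    by (simp add: algebra_simps)
  ultimately show ?thesis unfolding aform_def using i by simp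
qed

lemma af_scale_left:
  assumes "y \<in> V" "z \<in> V" shows "af (\<lambda>x. c * y x) z = c * af y z"
proof -
  note [measurable] = Av_measurable assms[THEN V_H1, THEN H1_L2, THEN L2_measurable]
    assms[THEN V_H1, THEN grad_measurable] grad_measurable[OF V_H1[OF V_scale[OF assms(1)]]]
  have ae: "AE x in M. grad \<Omega> (\<lambda>x. c * y x) x = c *\<^sub>R grad \<Omega> y x"
    using assms V_H1 by (intro grad_scale) auto
  have "(LINT x|M. (A x *v grad \<Omega> (\<lambda>x. c * y x) x) \<bullet> grad \<Omega> z x) = (LINT x|M. c * ((A x *v grad \<Omega> y x) \<bullet> grad \<Omega> z x))"
    by (rule integral_cong_AE) (use ae in \<open>auto elim!: eventually_mono simp: matrix_vector_mult_scaleR\<close>)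
  moreover have "(LINT x|M. (b x \<bullet> grad \<Omega> (\<lambda>x. c * y x) x) * z x) = (LINT x|M. c * ((b x \<bullet> grad \<Omega> y x) * z x))"
    by (rule integral_cong_AE) (use ae in \<open>auto elim!: eventually_mono\<close>)
  moreover have "(LINT x|M. a0 x * (c * y x) * z x) = (LINT x|M. c * (a0 x * y x * z x))"
    by (simp add: algebra_simps)
  ultimately show ?thesis unfolding aform_def by (simp add: distrib_left)
qed

lemma af_scale_right:
  assumes "y \<in> V" "z \<in> V" shows "af z (\<lambda>x. c * y x) = c * af z y"
proof -
  note [measurable] = Av_measurable assms[THEN V_H1, THEN H1_L2, THEN L2_measurable]
    assms[THEN V_H1, THEN grad_measurable] grad_measurable[OF V_H1[OF V_scale[OF assms(1)]]]
  have ae: "AE x in M. grad \<Omega> (\<lambda>x. c * y x) x = c *\<^sub>R grad \<Omega> y x"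
    using assms V_H1 by (intro grad_scale) auto
  have "(LINT x|M. (A x *v grad \<Omega> z x) \<bullet> grad \<Omega> (\<lambda>x. c * y x) x) = (LINT x|M. c * ((A x *v grad \<Omega> z x) \<bullet> grad \<Omega> y x))"
    by (rule integral_cong_AE) (use ae in \<open>auto elim!: eventually_mono\<close>)
  moreover have "(LINT x|M. (b x \<bullet> grad \<Omega> z x) * (c * y x)) = (LINT x|M. c * ((b x \<bullet> grad \<Omega> z x) * y x))"
    by (simp add: algebra_simps)
  moreover have "(LINT x|M. a0 x * z x * (c * y x)) = (LINT x|M. c * (a0 x * z x * y x))"
    by (simp add: algebra_simps)
  ultimately show ?thesis unfolding aform_def by (simp add: distrib_left)
qed

text \<open>Cauchy-Schwarz on each of the factorisations in \<open>form_integrands\<close>, with the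
  factor norms from \<open>form_factors\<close>.\<close>

lemma af_bounded: "\<exists>C\<ge>0. \<forall>y\<in>V. \<forall>z\<in>V. \<bar>af y z\<bar> \<le> C * H1_nrm \<Omega> y * H1_nrm \<Omega> z"
proof -
  obtain W where W0: "W \<ge> 0" and Wall:
    "\<forall>z\<in>V. (\<forall>p. (\<lambda>x. b x $ p * z x) \<in> L2 M \<and> L2_nrm M (\<lambda>x. b x $ p * z x) \<le> W * H1_nrm \<Omega> z) \<and>
    (\<lambda>x. sqrt \<bar>a0 x\<bar> * z x) \<in> L2 M \<and> L2_nrm M (\<lambda>x. sqrt \<bar>a0 x\<bar> * z x) \<le> W * H1_nrm \<Omega> z \<and>
    (\<forall>p q. (\<lambda>x. A x $ p $ q * grad \<Omega> z x $ q) \<in> L2 M \<and> L2_nrm M (\<lambda>x. A x $ p $ q * grad \<Omega> z x $ q) \<le> W * H1_nrm \<Omega> z)"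
    using form_factors by (elim exE conjE) (rule that)
  have Wz: "(\<lambda>x. b x $ p * z x) \<in> L2 M" "L2_nrm M (\<lambda>x. b x $ p * z x) \<le> W * H1_nrm \<Omega> z"
    "(\<lambda>x. sqrt \<bar>a0 x\<bar> * z x) \<in> L2 M" "L2_nrm M (\<lambda>x. sqrt \<bar>a0 x\<bar> * z x) \<le> W * H1_nrm \<Omega> z"
    "(\<lambda>x. A x $ p $ q * grad \<Omega> z x $ q) \<in> L2 M"
    "L2_nrm M (\<lambda>x. A x $ p $ q * grad \<Omega> z x $ q) \<le> W * H1_nrm \<Omega> z" if "z \<in> V" for z p q
    using bspec[OF Wall that] by simp_all
  note W = W0 Wz
  have cs: "\<bar>L2_inner M f g\<bar> \<le> K * L * (H1_nrm \<Omega> y * H1_nrm \<Omega> z)"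
    if "f \<in> L2 M" "g \<in> L2 M" "L2_nrm M f \<le> K * H1_nrm \<Omega> y" "L2_nrm M g \<le> L * H1_nrm \<Omega> z" "K \<ge> 0" "y \<in> V" for f g y z K L
  proof -
    have "\<bar>L2_inner M f g\<bar> \<le> L2_nrm M f * L2_nrm M g" using L2.abs_le_nrm[OF that(1,2)] by (simp add: L2_nrm_eq)
    also have "\<dots> \<le> (K * H1_nrm \<Omega> y) * (L * H1_nrm \<Omega> z)"
      using that L2.nrm_nonneg[OF that(2)] H1_nrm_nonneg[OF V_H1[OF that(6)]]
      by (intro mult_mono) (auto simp: L2_nrm_eq)
    finally show ?thesis by (simp add: mult_ac)
  qed
  note [measurable] = coefficient_measurable
  have "\<bar>af y z\<bar> \<le> (6 * W + W * W) * H1_nrm \<Omega> y * H1_nrm \<Omega> z" if yz: "y \<in> V" "z \<in> V" for y z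
  proof -
    let ?h = "H1_nrm \<Omega> y * H1_nrm \<Omega> z"
    have g: "(\<lambda>x. grad \<Omega> w x $ p) \<in> L2 M" "L2_nrm M (\<lambda>x. grad \<Omega> w x $ p) \<le> 1 * H1_nrm \<Omega> w" if "w \<in> V" for w p
      using that V_H1 grad_L2 L2_nrm_grad by auto
    have i: "integrable M (\<lambda>x. (A x $ p $ q * grad \<Omega> y x $ q) * grad \<Omega> z x $ p)" "integrable M (\<lambda>x. grad \<Omega> y x $ p * (b x $ p * z x))" for p q
      using W g yz by (auto intro: L2_integrable_mult)
    have t1: "(LINT x|M. (A x *v grad \<Omega> y x) \<bullet> grad \<Omega> z x) = (\<Sum>p\<in>UNIV. \<Sum>q\<in>UNIV. L2_inner M (\<lambda>x. A x $ p $ q * grad \<Omega> y x $ q) (\<lambda>x. grad \<Omega> z x $ p))"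
      unfolding form_integrands L2_inner_def using i by (simp add: Bochner_Integration.integral_sum)
    have t2: "(LINT x|M. (b x \<bullet> grad \<Omega> y x) * z x) = (\<Sum>p\<in>UNIV. L2_inner M (\<lambda>x. grad \<Omega> y x $ p) (\<lambda>x. b x $ p * z x))"
      unfolding form_integrands L2_inner_def using i by (simp add: Bochner_Integration.integral_sum)
    have c1: "\<bar>L2_inner M (\<lambda>x. A x $ p $ q * grad \<Omega> y x $ q) (\<lambda>x. grad \<Omega> z x $ p)\<bar> \<le> W * ?h" for p q
      using cs[OF W(6)[OF yz(1)] g(1)[OF yz(2)] W(7)[OF yz(1)] g(2)[OF yz(2)] W(1) yz(1)] by simp
    have c2: "\<bar>L2_inner M (\<lambda>x. grad \<Omega> y x $ p) (\<lambda>x. b x $ p * z x)\<bar> \<le> W * ?h" for p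
      using cs[OF g(1)[OF yz(1)] W(2)[OF yz(2)] g(2)[OF yz(1)] W(3)[OF yz(2)] _ yz(1)] by simp
    \<comment> \<open>The sign is attached to one factor to turn the zero-order term into an L2
      pairing. The norm does not change, since the square root vanishes wherever the sign
      does.\<close>
    let ?f = "\<lambda>x. sgn (a0 x) * (sqrt \<bar>a0 x\<bar> * y x)"
    have f: "?f \<in> L2 M" "L2_nrm M ?f \<le> W * H1_nrm \<Omega> y"
    proof -
      have fm: "?f \<in> borel_measurable M" using L2_measurable[OF W(4)[OF yz(1)]] by measurable
      have sq: "(?f x)\<^sup>2 = (sqrt \<bar>a0 x\<bar> * y x)\<^sup>2" for x
        by (cases "a0 x = 0") (auto simp: power_mult_distrib sgn_real_def)
      show "?f \<in> L2 M" using W(4)[OF yz(1)] fm unfolding L2_def by (simp add: sq)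
      have "L2_nrm M ?f = L2_nrm M (\<lambda>x. sqrt \<bar>a0 x\<bar> * y x)"
        unfolding L2_nrm_def L2_inner_def power2_eq_square[symmetric] sq ..
      then show "L2_nrm M ?f \<le> W * H1_nrm \<Omega> y" using W(5)[OF yz(1)] by simp
    qed
    have t3: "(LINT x|M. a0 x * y x * z x) = L2_inner M ?f (\<lambda>x. sqrt \<bar>a0 x\<bar> * z x)"
      unfolding form_integrands L2_inner_def by (simp add: mult.assoc)
    have c3: "\<bar>L2_inner M ?f (\<lambda>x. sqrt \<bar>a0 x\<bar> * z x)\<bar> \<le> W * W * ?h"
      by (rule cs[OF f(1) W(4)[OF yz(2)] f(2) W(5)[OF yz(2)] W(1) yz(1)])
    \<comment> \<open>Four entries of A and two components of b contribute W each, the zero-order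
      term W times W.\<close>
    have "\<bar>af y z\<bar> \<le> 6 * (W * ?h) + W * W * ?h"
      unfolding aform_def t1 t2 t3 sum_2
      using c1[of 1 1] c1[of 1 2] c1[of 2 1] c1[of 2 2] c2[of 1] c2[of 2] c3 by linarith
    then show ?thesis by (simp add: algebra_simps)
  qed
  then show ?thesis using W(1) by (intro exI[of _ "6 * W + W * W"]) auto
qed

end

section \<open>Discrete spaces and operators\<close>

context plane_domain
begin

lemma L2_inner_cong: "(\<And>x. x \<in> \<Omega> \<Longrightarrow> f x = f' x) \<Longrightarrow> (\<And>x. x \<in> \<Omega> \<Longrightarrow> g x = g' x) \<Longrightarrow> L2_inner M f g = L2_inner M f' g'"
  unfolding L2_inner_def by (rule Bochner_Integration.integral_cong) auto

lemma h1form_cong: "(\<And>x. x \<in> \<Omega> \<Longrightarrow> y x = y' x) \<Longrightarrow> h1form \<Omega> y y = h1form \<Omega> y' y'"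
  unfolding h1form_def dform_def using grad_cong[of y y'] L2_inner_cong[of y y' y y'] by simp

lemma h1form_zero_on: "(\<And>x. x \<in> \<Omega> \<Longrightarrow> y x = 0) \<Longrightarrow> h1form \<Omega> y y = 0"
  using h1form_cong[of y "\<lambda>x. 0"] H.zero_left[OF H1_zero] by simp

end

context coefficients
begin

definition Ca :: real where
  "Ca = (SOME C. C \<ge> 0 \<and> (\<forall>y\<in>V. \<forall>z\<in>V. \<bar>af y z\<bar> \<le> C * H1_nrm \<Omega> y * H1_nrm \<Omega> z))"

lemma Ca: "Ca \<ge> 0" "y \<in> V \<Longrightarrow> z \<in> V \<Longrightarrow> \<bar>af y z\<bar> \<le> Ca * H1_nrm \<Omega> y * H1_nrm \<Omega> z"
proof -
  have "\<exists>C. C \<ge> 0 \<and> (\<forall>y\<in>V. \<forall>z\<in>V. \<bar>af y z\<bar> \<le> C * H1_nrm \<Omega> y * H1_nrm \<Omega> z)" using af_bounded by blast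
  from someI_ex[OF this] show "Ca \<ge> 0" "y \<in> V \<Longrightarrow> z \<in> V \<Longrightarrow> \<bar>af y z\<bar> \<le> Ca * H1_nrm \<Omega> y * H1_nrm \<Omega> z"
    unfolding Ca_def[symmetric] by blast+
qed

text \<open>A discrete state is a discrete function z with the same trace plus a correction of norm
  at most |cA| Ca times that of z. The absolute value makes the constant positive whatever the sign
  of cA.\<close>

definition ext_const :: "real \<Rightarrow> real" where
  "ext_const cA = 1 + \<bar>cA\<bar> * Ca"

text \<open>The averaging width of the trace inequality, chosen so that the coefficient of the term
  to be absorbed, Cf Ct c^2 theta with c the extension constant, is at most 1/2.\<close>

definition theta :: "real \<Rightarrow> real" where
  "theta cA = min 1 (1 / (2 * Cf * Ct * (ext_const cA)\<^sup>2))"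

text \<open>The reciprocal of the factor by which the second derivative bounds the squared H1 norm
  of the discrete harmonic extension. No quantity of the mesh enters.\<close>

definition nu :: "real \<Rightarrow> real \<Rightarrow> real" where
  "nu cA \<kappa> = 1 / (2 * Cf * Ct / theta cA + 2 * (Cf + 1) / \<kappa>)"

lemma ext_const_pos: "ext_const cA > 0"
proof -
  have "0 \<le> \<bar>cA\<bar> * Ca" using Ca(1) by (intro mult_nonneg_nonneg) auto
  then show ?thesis unfolding ext_const_def by linarith
qed

lemma theta_pos: "theta cA > 0" "theta cA \<le> 1" "2 * Cf * Ct * (ext_const cA)\<^sup>2 * theta cA \<le> 1"
proof -
  define r where "r = 2 * Cf * Ct * (ext_const cA)\<^sup>2"
  have r: "r > 0" using Cf(1) Ct(1) ext_const_pos[of cA] by (simp add: r_def)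
  have th: "theta cA = min 1 (1 / r)" by (simp add: theta_def r_def)
  show "theta cA > 0" "theta cA \<le> 1" using r by (auto simp: th)
  have "r * theta cA \<le> r * (1 / r)" using r unfolding th by (intro mult_left_mono) auto
  then show "2 * Cf * Ct * (ext_const cA)\<^sup>2 * theta cA \<le> 1" using r unfolding r_def[symmetric] by simp
qed

lemma nu_pos: "\<kappa> > 0 \<Longrightarrow> nu cA \<kappa> > 0"
  using Cf(1) Ct(1) theta_pos[of cA] by (auto simp: nu_def intro!: divide_pos_pos add_pos_pos)

end

text \<open>One mesh is fixed here, but cA is a parameter common to all meshes, so constants built
  from it agree across instances.\<close>

locale discrete = coefficients +
  fixes K :: "pt set set" and cA \<kappa> :: real and yd ud :: scal
  assumes tri: "triangulates \<Omega> K"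
    and solv: "\<forall>f\<in>Hm1 \<Omega> P. \<exists>\<eta>\<in>Y0h \<Omega> P K.
          (\<forall>\<zeta>\<in>Y0h \<Omega> P K. aform \<Omega> A b a0 \<eta> \<zeta> = f \<zeta>) \<and>
          (\<forall>\<eta>'\<in>Y0h \<Omega> P K. (\<forall>\<zeta>\<in>Y0h \<Omega> P K. aform \<Omega> A b a0 \<eta>' \<zeta> = f \<zeta>) \<longrightarrow>
             (\<forall>x\<in>closure \<Omega>. \<eta>' x = \<eta> x)) \<and>
          H1_nrm \<Omega> \<eta> \<le> cA * Hm1_nrm \<Omega> P f"
    and yd: "yd \<in> L2 (lebesgue_on \<Omega>)" and ud: "ud \<in> Hhalf \<Omega> P" and \<kappa>: "\<kappa> > 0"
begin

abbreviation "Y \<equiv> Yh \<Omega> K"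
abbreviation "Y0 \<equiv> Y0h \<Omega> P K"
abbreviation "U \<equiv> Uh \<Omega> P K"

lemma Y_V: "y \<in> Y \<Longrightarrow> y \<in> V"
  by (simp add: Yh_def V_def)

lemma Y_H1: "y \<in> Y \<Longrightarrow> y \<in> H1 \<Omega>"
  by (simp add: Yh_def)

lemma Y_tr: "y \<in> Y \<Longrightarrow> tr y y"
  by (rule tr_self) (simp_all add: Yh_def)

lemma Y_Hh: "y \<in> Y \<Longrightarrow> y \<in> Hh"
  using Y_tr by (rule HhI)

lemma Y_zero: "(\<lambda>x. 0) \<in> Y"
proof -
  have "\<exists>g c. \<forall>x\<in>T. (0::real) = g \<bullet> x + c" for T :: "pt set"
    by (intro exI[of _ 0]) auto
  then show ?thesis by (simp add: Yh_def H1_zero)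
qed

lemma Y_add:
  assumes "y \<in> Y" "z \<in> Y" shows "(\<lambda>x. y x + z x) \<in> Y"
proof -
  have "\<exists>g c. \<forall>x\<in>T. y x + z x = g \<bullet> x + c" if T: "T \<in> K" for T
  proof -
    obtain g c where "\<And>x. x \<in> T \<Longrightarrow> y x = g \<bullet> x + c" using assms(1) T unfolding Yh_def by blast
    moreover obtain g' c' where "\<And>x. x \<in> T \<Longrightarrow> z x = g' \<bullet> x + c'" using assms(2) T unfolding Yh_def by blast
    ultimately show ?thesis by (intro exI[of _ "g + g'"] exI[of _ "c + c'"]) (simp add: inner_add_left)
  qed
  then show ?thesis
    using Y_H1[OF assms(1)] Y_H1[OF assms(2)] V_cont[OF Y_V[OF assms(1)]] V_cont[OF Y_V[OF assms(2)]]
    unfolding Yh_def by (intro CollectI conjI ballI H1_add continuous_on_add) blast+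
qed

lemma Y_scale:
  assumes "y \<in> Y" shows "(\<lambda>x. a * y x) \<in> Y"
proof -
  have "\<exists>g c. \<forall>x\<in>T. a * y x = g \<bullet> x + c" if T: "T \<in> K" for T
  proof -
    obtain g c where "\<And>x. x \<in> T \<Longrightarrow> y x = g \<bullet> x + c" using assms(1) T unfolding Yh_def by blast
    then show ?thesis by (intro exI[of _ "a *\<^sub>R g"] exI[of _ "a * c"]) (simp add: distrib_left)
  qed
  then show ?thesis
    using Y_H1[OF assms] V_cont[OF Y_V[OF assms]]
    unfolding Yh_def by (intro CollectI conjI ballI H1_scale continuous_on_mult continuous_on_const) blast+
qed

lemma Y_diff: "y \<in> Y \<Longrightarrow> z \<in> Y \<Longrightarrow> (\<lambda>x. y x - z x) \<in> Y"
  using Y_add[OF _ Y_scale[of z "-1"], of y] by simp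

text \<open>An affine function vanishing at the corners of a triangle vanishes on their convex hull.
  The finitely many corners form the point set that the finite-dimensional arguments
  require.\<close>

lemma Y_nodes: "\<exists>X. finite X \<and> (\<forall>y\<in>Y. (\<forall>x\<in>X. y x = 0) \<longrightarrow> (\<forall>x\<in>closure \<Omega>. y x = 0))"
proof -
  have "\<forall>T\<in>K. \<exists>C. finite C \<and> T = convex hull C"
  proof
    fix T assume "T \<in> K"
    then have "2 simplex T" using tri by (simp add: triangulates_def)
    then obtain C where "\<not> affine_dependent C" "T = convex hull C" unfolding simplex_def by blast
    then show "\<exists>C. finite C \<and> T = convex hull C" using aff_independent_finite by blast
  qed
  from bchoice[OF this] obtain C where C: "\<And>T. T \<in> K \<Longrightarrow> finite (C T)" "\<And>T. T \<in> K \<Longrightarrow> T = convex hull (C T)" by blast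
  have "finite K" "\<Union>K = closure \<Omega>" using tri by (auto simp: triangulates_def triangulation_def)
  show ?thesis
  proof (intro exI[of _ "\<Union>T\<in>K. C T"] conjI ballI impI)
    show "finite (\<Union>T\<in>K. C T)" using \<open>finite K\<close> C(1) by blast
    fix y x assume y: "y \<in> Y" and z: "\<forall>x\<in>\<Union>T\<in>K. C T. y x = 0" and "x \<in> closure \<Omega>"
    then obtain T where T: "T \<in> K" "x \<in> T" using \<open>\<Union>K = closure \<Omega>\<close> by blast
    obtain g c where g: "\<And>x. x \<in> T \<Longrightarrow> y x = g \<bullet> x + c" using y T(1) unfolding Yh_def by blast
    have "C T \<subseteq> T" using hull_subset[of "C T" convex] C(2)[OF T(1)] by simp
    then have "g \<bullet> x = - c" if "x \<in> C T" for x using g[of x] z T(1) that by force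
    then have "C T \<subseteq> {x. g \<bullet> x = - c}" by auto
    then have "convex hull (C T) \<subseteq> {x. g \<bullet> x = - c}" by (rule hull_minimal) (rule convex_hyperplane)
    then have "x \<in> {x. g \<bullet> x = - c}" using C(2)[OF T(1)] T(2) by blast
    then show "y x = 0" using g[OF T(2)] by simp
  qed
qed

lemma Y0_iff: "y \<in> Y0 \<longleftrightarrow> y \<in> Y \<and> y \<in> Hz"
  by (simp add: Y0h_def)

lemma Y0_zero: "(\<lambda>x. 0) \<in> Y0"
  using Y_zero Z.zero_mem by (simp add: Y0_iff)

lemma Y0_add: "y \<in> Y0 \<Longrightarrow> z \<in> Y0 \<Longrightarrow> (\<lambda>x. y x + z x) \<in> Y0"
  by (simp add: Y0_iff Y_add Z.add_mem)

lemma Y0_scale: "y \<in> Y0 \<Longrightarrow> (\<lambda>x. a * y x) \<in> Y0"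
  by (simp add: Y0_iff Y_scale Z.scale_mem)

lemma Y0_V: "y \<in> Y0 \<Longrightarrow> y \<in> V" and Y0_H1: "y \<in> Y0 \<Longrightarrow> y \<in> H1 \<Omega>"
  using Y_V Y_H1 by (auto simp: Y0_iff)

lemma semi_inner_Y0: "semi_inner Y0 (h1form \<Omega>)" "semi_inner Y0 (dform \<Omega>)"
  by (rule H.subspace D.subspace; use Y0_H1 Y0_zero Y0_add Y0_scale in auto)+

lemma semi_inner_Y: "semi_inner Y pf"
  by (rule PF.subspace) (use Y_Hh Y_zero Y_add Y_scale in auto)

lemma pf_zero_on:
  assumes "y \<in> Y" "\<And>x. x \<in> closure \<Omega> \<Longrightarrow> y x = 0" shows "pf y y = 0"
proof -
  have "AE x in \<Gamma>. y x = 0" using assms(2) bdry_closure by (intro AE_I2) (auto simp: space_\<Gamma>)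
  then have "pf y y = pf (\<lambda>x. 0) y" by (intro pf_AE_cong Y_Hh[OF assms(1)] Hh_zero)
  then show ?thesis using PF.zero_left[OF Y_Hh[OF assms(1)]] by simp
qed

lemma representation_Y0:
  assumes "p = h1form \<Omega> \<or> p = dform \<Omega>"
    and "\<And>v w. v \<in> Y0 \<Longrightarrow> w \<in> Y0 \<Longrightarrow> l (\<lambda>x. v x + w x) = l v + l w"
    and "\<And>c v. v \<in> Y0 \<Longrightarrow> l (\<lambda>x. c * v x) = c * l v"
    and "\<And>v. v \<in> Y0 \<Longrightarrow> p v v = 0 \<Longrightarrow> l v = (0::real)"
  shows "\<exists>w\<in>Y0. \<forall>v\<in>Y0. p w v = l v"
proof -
  obtain X where X: "finite X" "\<And>y. y \<in> Y \<Longrightarrow> \<forall>x\<in>X. y x = 0 \<Longrightarrow> \<forall>x\<in>closure \<Omega>. y x = 0" using Y_nodes by blast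
  have p: "semi_inner Y0 p" using semi_inner_Y0 assms(1) by blast
  show ?thesis
  proof (rule representation_finite[OF X(1) p _ assms(2,3,4)])
    fix v assume v: "v \<in> Y0" "\<forall>x\<in>X. v x = 0"
    then have "\<And>x. x \<in> \<Omega> \<Longrightarrow> v x = 0" using X(2)[of v] closure_subset[of \<Omega>] by (auto simp: Y0_iff)
    then have "h1form \<Omega> v v = 0" by (rule h1form_zero_on)
    moreover from this have "dform \<Omega> v v = 0"
      using dform_le_h1form[OF Y0_H1[OF v(1)]] D.nonneg[OF Y0_H1[OF v(1)]] by simp
    ultimately show "p v v = 0" using assms(1) by auto
  qed
qed

text \<open>Solvability is assumed for functionals on all of H10, whereas the residual of the
  bilinear form is controlled on continuous functions. Representing the residual on
  \<open>Y0\<close> by the H1 inner product with some w yields a functional that makes sense on H10,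
  with norm at most that of w.\<close>

lemma riesz_functional:
  assumes w: "w \<in> Hz"
  shows "h1form \<Omega> w \<in> Hm1 \<Omega> P" "Hm1_nrm \<Omega> P (h1form \<Omega> w) \<le> H1_nrm \<Omega> w"
proof -
  note w1 = Hz_H1[OF w]
  have b: "\<bar>h1form \<Omega> w v\<bar> \<le> H1_nrm \<Omega> w * H1_nrm \<Omega> v" if "v \<in> Hz" for v
    using H.abs_le_nrm[OF w1 Hz_H1[OF that]] by (simp add: H_nrm_eq)
  then show "h1form \<Omega> w \<in> Hm1 \<Omega> P"
    unfolding Hm1_def dual_def using w1 Hz_H1 by (auto simp: H.bilin)
  show "Hm1_nrm \<Omega> P (h1form \<Omega> w) \<le> H1_nrm \<Omega> w"
    unfolding Hm1_nrm_def dual_nrm_def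
  proof (rule cSup_least)
    show "{\<bar>h1form \<Omega> w v\<bar> |v. v \<in> Hz \<and> H1_nrm \<Omega> v \<le> 1} \<noteq> {}"
      using Z.zero_mem H1_nrm_zero by (auto intro!: exI[of _ "\<lambda>x. 0"])
    fix r assume "r \<in> {\<bar>h1form \<Omega> w v\<bar> |v. v \<in> Hz \<and> H1_nrm \<Omega> v \<le> 1}"
    then obtain v where v: "r = \<bar>h1form \<Omega> w v\<bar>" "v \<in> Hz" "H1_nrm \<Omega> v \<le> 1" by blast
    then have "r \<le> H1_nrm \<Omega> w * H1_nrm \<Omega> v" using b by simp
    also have "\<dots> \<le> H1_nrm \<Omega> w * 1" using v(3) H1_nrm_nonneg[OF w1] by (intro mult_left_mono)
    finally show "r \<le> H1_nrm \<Omega> w" by simp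
  qed
qed

text \<open>On \<open>Y0\<close> the negative residual of z is the H1 inner product with some w;
  testing with w itself gives norm at most Ca times that of z. The discrete problem is then solved
  for this functional.\<close>

lemma correction:
  assumes z: "z \<in> Y"
  shows "\<exists>\<eta>\<in>Y0. (\<forall>\<zeta>\<in>Y0. af \<eta> \<zeta> = - af z \<zeta>) \<and> H1_nrm \<Omega> \<eta> \<le> \<bar>cA\<bar> * Ca * H1_nrm \<Omega> z"
proof -
  note zV = Y_V[OF z]
  have "\<exists>w\<in>Y0. \<forall>v\<in>Y0. h1form \<Omega> w v = - af z v"
  proof (rule representation_Y0)
    fix v assume v: "v \<in> Y0" "h1form \<Omega> v v = 0"
    then have "\<bar>af z v\<bar> \<le> 0" using Ca(2)[OF zV Y0_V[OF v(1)]] by (simp add: H1_nrm_eq)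
    then show "- af z v = 0" by simp
  qed (use zV Y0_V in \<open>auto simp: af_add_right af_scale_right\<close>)
  then obtain w where w: "w \<in> Y0" "\<And>v. v \<in> Y0 \<Longrightarrow> h1form \<Omega> w v = - af z v" by blast
  have wz: "w \<in> Hz" using w(1) by (simp add: Y0_iff)
  obtain \<eta> where \<eta>: "\<eta> \<in> Y0" "\<And>\<zeta>. \<zeta> \<in> Y0 \<Longrightarrow> af \<eta> \<zeta> = h1form \<Omega> w \<zeta>" "H1_nrm \<Omega> \<eta> \<le> cA * Hm1_nrm \<Omega> P (h1form \<Omega> w)"
    using bspec[OF solv riesz_functional(1)[OF wz]] by blast
  have wn: "H1_nrm \<Omega> w \<ge> 0" using H1_nrm_nonneg[OF Y0_H1[OF w(1)]] .
  have "(H1_nrm \<Omega> w)\<^sup>2 = - af z w" using w(2)[OF w(1)] H1_nrm_sq[OF Y0_H1[OF w(1)]] by simp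
  also have "\<dots> \<le> (Ca * H1_nrm \<Omega> z) * H1_nrm \<Omega> w" using Ca(2)[OF zV Y0_V[OF w(1)]] by simp
  finally have wle: "H1_nrm \<Omega> w \<le> Ca * H1_nrm \<Omega> z"
    using wn Ca(1) H1_nrm_nonneg[OF Y_H1[OF z]] by (cases "H1_nrm \<Omega> w = 0") (auto simp: power2_eq_square)
  \<comment> \<open>Nonnegativity of the dual norm justifies replacing cA by its absolute
    value.\<close>
  have n0: "0 \<le> Hm1_nrm \<Omega> P (h1form \<Omega> w)"
    unfolding Hm1_nrm_def dual_nrm_def
  proof (rule cSup_upper2[of 0])
    show "0 \<in> {\<bar>h1form \<Omega> w v\<bar> |v. v \<in> Hz \<and> H1_nrm \<Omega> v \<le> 1}"
      using Z.zero_mem H1_nrm_zero H.scale_right[OF H1_zero Hz_H1[OF wz], of 0] by (auto intro!: exI[of _ "\<lambda>x. 0"])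
    show "bdd_above {\<bar>h1form \<Omega> w v\<bar> |v. v \<in> Hz \<and> H1_nrm \<Omega> v \<le> 1}"
    proof (rule bdd_aboveI[of _ "H1_nrm \<Omega> w"])
      fix r assume "r \<in> {\<bar>h1form \<Omega> w v\<bar> |v. v \<in> Hz \<and> H1_nrm \<Omega> v \<le> 1}"
      then obtain v where v: "r = \<bar>h1form \<Omega> w v\<bar>" "v \<in> Hz" "H1_nrm \<Omega> v \<le> 1" by blast
      then have "r \<le> H1_nrm \<Omega> w * H1_nrm \<Omega> v"
        using H.abs_le_nrm[OF Hz_H1[OF wz] Hz_H1[OF v(2)]] by (simp add: H_nrm_eq)
      also have "\<dots> \<le> H1_nrm \<Omega> w * 1" using v(3) wn by (intro mult_left_mono)
      finally show "r \<le> H1_nrm \<Omega> w" by simp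
    qed
  qed simp
  have "H1_nrm \<Omega> \<eta> \<le> \<bar>cA\<bar> * Hm1_nrm \<Omega> P (h1form \<Omega> w)"
    using \<eta>(3) mult_right_mono[OF abs_ge_self[of cA] n0] by linarith
  also have "\<dots> \<le> \<bar>cA\<bar> * (Ca * H1_nrm \<Omega> z)"
    using riesz_functional(2)[OF wz] wle by (intro mult_left_mono) auto
  finally show ?thesis using \<eta>(1,2) w(2) by (intro bexI[of _ \<eta>]) (auto simp: mult.assoc)
qed

text \<open>Both y and 0 solve the problem with zero right-hand side, and uniqueness is assumed on
  the closed domain.\<close>

lemma homogeneous_unique:
  assumes y: "y \<in> Y0" "\<And>\<zeta>. \<zeta> \<in> Y0 \<Longrightarrow> af y \<zeta> = 0" and x: "x \<in> closure \<Omega>"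
  shows "y x = 0"
proof -
  have "(\<lambda>_. 0) \<in> Hm1 \<Omega> P" unfolding Hm1_def dual_def by (auto intro: exI[of _ 0])
  from bspec[OF solv this] obtain \<eta> where
    \<eta>: "\<And>\<eta>'. \<eta>' \<in> Y0 \<Longrightarrow> (\<And>\<zeta>. \<zeta> \<in> Y0 \<Longrightarrow> af \<eta>' \<zeta> = 0) \<Longrightarrow> \<forall>x\<in>closure \<Omega>. \<eta>' x = \<eta> x" by blast
  have "af (\<lambda>x. 0) \<zeta> = 0" if "\<zeta> \<in> Y0" for \<zeta>
    using af_scale_left[OF Y0_V[OF Y0_zero] Y0_V[OF that], of 0] by simp
  then show ?thesis using \<eta>[OF Y0_zero] \<eta>[OF y] x by simp
qed

text \<open>States are specified by their trace instead of the control. The relation is linear in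
  the pair, while \<open>disc_state\<close> and \<open>Qh\<close> are choices and so linear only up
  to irrelevant values. \<open>DH\<close> does the same for the discrete harmonic extension.\<close>

definition DS :: "scal \<Rightarrow> scal \<Rightarrow> bool" where
  "DS y q \<longleftrightarrow> y \<in> Y \<and> (\<forall>\<zeta>\<in>Y0. af y \<zeta> = 0) \<and> tr y q"

definition DH :: "scal \<Rightarrow> scal \<Rightarrow> bool" where
  "DH y q \<longleftrightarrow> y \<in> Y \<and> (\<forall>\<zeta>\<in>Y0. dform \<Omega> y \<zeta> = 0) \<and> tr y q"

lemma DS_Y: "DS y q \<Longrightarrow> y \<in> Y" and DH_Y: "DH y q \<Longrightarrow> y \<in> Y"
  by (auto simp: DS_def DH_def)

lemma DS_tr: "DS y q \<Longrightarrow> tr y q" and DH_tr: "DH y q \<Longrightarrow> tr y q"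
  by (auto simp: DS_def DH_def)

lemma Y_tr_diff:
  assumes "y \<in> Y" "z \<in> Y" "tr y q" "tr z r" "AE x in \<Gamma>. q x = r x"
  shows "(\<lambda>x. y x - z x) \<in> Y0"
  using Y_diff[OF assms(1,2)] tr_diff_Hz[OF assms(3-5)] by (simp add: Y0_iff)

text \<open>The state is z plus its correction. The bound compares it with any discrete function of
  the same trace; for coercivity this will be the discrete harmonic extension.\<close>

lemma DS_exists:
  assumes "z \<in> Y" "tr z q" shows "\<exists>y. DS y q \<and> H1_nrm \<Omega> y \<le> ext_const cA * H1_nrm \<Omega> z"
proof -
  obtain \<eta> where \<eta>: "\<eta> \<in> Y0" "\<And>\<zeta>. \<zeta> \<in> Y0 \<Longrightarrow> af \<eta> \<zeta> = - af z \<zeta>" "H1_nrm \<Omega> \<eta> \<le> \<bar>cA\<bar> * Ca * H1_nrm \<Omega> z"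
    using correction[OF assms(1)] by blast
  have Y: "\<eta> \<in> Y" and "tr \<eta> (\<lambda>_. 0)" using \<eta>(1) by (auto simp: Y0_iff Hz_iff)
  then have "tr (\<lambda>x. z x + \<eta> x) (\<lambda>x. q x + 0)" using assms(2) by (intro tr_add)
  moreover have "af (\<lambda>x. z x + \<eta> x) \<zeta> = 0" if "\<zeta> \<in> Y0" for \<zeta>
    using af_add_left[OF Y_V[OF assms(1)] Y_V[OF Y] Y0_V[OF that]] \<eta>(2)[OF that] by simp
  ultimately have "DS (\<lambda>x. z x + \<eta> x) q" using Y_add[OF assms(1) Y] by (simp add: DS_def)
  moreover have "H1_nrm \<Omega> (\<lambda>x. z x + \<eta> x) \<le> ext_const cA * H1_nrm \<Omega> z"
    using H.nrm_add[OF Y_H1[OF assms(1)] Y_H1[OF Y]] \<eta>(3) by (simp add: H_nrm_eq ext_const_def distrib_right)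
  ultimately show ?thesis by blast
qed

lemma DS_unique:
  assumes "DS y q" "DS z r" "AE x in \<Gamma>. q x = r x" "x \<in> closure \<Omega>" shows "y x = z x"
proof -
  have yz: "y \<in> Y" "z \<in> Y" using assms DS_Y by auto
  have d: "(\<lambda>x. y x - z x) \<in> Y0" using yz assms by (intro Y_tr_diff) (auto intro: DS_tr)
  have "af (\<lambda>x. y x - z x) \<zeta> = 0" if "\<zeta> \<in> Y0" for \<zeta>
    using af_add_left[OF Y_V[OF yz(1)] V_scale[OF Y_V[OF yz(2)], of "-1"] Y0_V[OF that]]
      af_scale_left[OF Y_V[OF yz(2)] Y0_V[OF that], of "-1"] assms(1,2) that
    by (simp add: DS_def)
  then show ?thesis using homogeneous_unique[OF d _ assms(4)] by simp
qed

lemma DS_add: "DS y q \<Longrightarrow> DS z r \<Longrightarrow> DS (\<lambda>x. y x + z x) (\<lambda>x. q x + r x)"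
  unfolding DS_def using af_add_left Y_V Y0_V by (auto intro: Y_add tr_add)

lemma DS_scale: "DS y q \<Longrightarrow> DS (\<lambda>x. c * y x) (\<lambda>x. c * q x)"
  unfolding DS_def using af_scale_left Y_V Y0_V by (auto intro: Y_scale tr_scale)

lemma DH_exists:
  assumes "z \<in> Y" "tr z q" shows "\<exists>y. DH y q"
proof -
  have "\<exists>w\<in>Y0. \<forall>v\<in>Y0. dform \<Omega> w v = dform \<Omega> z v"
    by (rule representation_Y0) (use Y_H1[OF assms(1)] Y0_H1 in \<open>auto simp: D.bilin D.null_right\<close>)
  then obtain w where w: "w \<in> Y0" "\<And>v. v \<in> Y0 \<Longrightarrow> dform \<Omega> w v = dform \<Omega> z v" by blast
  have Y: "w \<in> Y" and "tr w (\<lambda>_. 0)" using w(1) by (auto simp: Y0_iff Hz_iff)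
  then have "tr (\<lambda>x. z x - w x) (\<lambda>x. q x - 0)" using assms(2) by (intro tr_diff)
  then have "DH (\<lambda>x. z x - w x) q"
    using w(2) Y_diff[OF assms(1) Y] Y_H1[OF Y] Y_H1[OF assms(1)] Y0_H1 by (simp add: DH_def D.bilin)
  then show ?thesis by blast
qed

text \<open>The difference lies in \<open>Y0\<close> and is orthogonal to it, hence to itself.
  Equality of Dirichlet pairings is what the functional needs, as it involves only the gradient of
  the extension.\<close>

lemma DH_unique:
  assumes "DH y q" "DH z r" "AE x in \<Gamma>. q x = r x" "w \<in> H1 \<Omega>"
  shows "dform \<Omega> y w = dform \<Omega> z w"
proof (rule D.null_diff)
  show yz: "y \<in> H1 \<Omega>" "z \<in> H1 \<Omega>" using assms DH_Y Y_H1 by auto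
  have d: "(\<lambda>x. y x - z x) \<in> Y0" using assms by (intro Y_tr_diff) (auto intro: DH_tr DH_Y)
  then show "dform \<Omega> (\<lambda>x. y x - z x) (\<lambda>x. y x - z x) = 0"
    using assms(1,2) yz Y0_H1[OF d] by (subst D.diff_left) (auto simp: DH_def)
qed fact

lemma DH_add: "DH y q \<Longrightarrow> DH z r \<Longrightarrow> DH (\<lambda>x. y x + z x) (\<lambda>x. q x + r x)"
  unfolding DH_def using Y_H1 Y0_H1 by (auto simp: D.bilin intro: Y_add tr_add)

lemma DH_scale: "DH y q \<Longrightarrow> DH (\<lambda>x. c * y x) (\<lambda>x. c * q x)"
  unfolding DH_def using Y_H1 Y0_H1 by (auto simp: D.bilin intro: Y_scale tr_scale)

section \<open>Discrete traces and the projection onto them\<close>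

lemma U_iff: "u \<in> U \<longleftrightarrow> (\<exists>y\<in>Y. tr y u)"
  by (simp add: Uh_def)

lemma U_Hh: "u \<in> U \<Longrightarrow> u \<in> Hh"
  using HhI by (auto simp: U_iff)

lemma Y_U: "y \<in> Y \<Longrightarrow> y \<in> U"
  using Y_tr by (auto simp: U_iff)

lemma U_add: "u \<in> U \<Longrightarrow> v \<in> U \<Longrightarrow> (\<lambda>x. u x + v x) \<in> U"
  unfolding U_iff by (blast intro: Y_add tr_add)

lemma U_scale: "u \<in> U \<Longrightarrow> (\<lambda>x. c * u x) \<in> U"
  unfolding U_iff by (blast intro: Y_scale tr_scale)

lemma U_diff: "u \<in> U \<Longrightarrow> v \<in> U \<Longrightarrow> (\<lambda>x. u x - v x) \<in> U"
  using U_add[OF _ U_scale[of v "-1"], of u] by simp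

lemma U_representative: "u \<in> U \<Longrightarrow> \<exists>y\<in>Y. tr y u \<and> (AE x in \<Gamma>. u x = y x)"
  unfolding U_iff using tr_unique[OF _ Y_tr] by blast

abbreviation "q \<equiv> Qh \<Omega> P K"

text \<open>The Riesz argument takes place in \<open>Y\<close>, where finitely many point values
  determine a function, and not in \<open>U\<close>, whose elements are fixed only almost
  everywhere. Discrete functions with equal traces differ by a null vector of \<open>pf\<close>,
  which is harmless.\<close>

lemma q_exists:
  assumes u: "u \<in> Hh" shows "\<exists>r. r \<in> U \<and> (\<forall>v\<in>U. pf r v = pf u v)"
proof -
  obtain X where X: "finite X" "\<And>y. y \<in> Y \<Longrightarrow> \<forall>x\<in>X. y x = 0 \<Longrightarrow> \<forall>x\<in>closure \<Omega>. y x = 0" using Y_nodes by blast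
  have "\<exists>w\<in>Y. \<forall>v\<in>Y. pf w v = pf u v"
  proof (rule representation_finite[OF X(1) semi_inner_Y])
    show "pf v v = 0" if "v \<in> Y" "\<forall>x\<in>X. v x = 0" for v
      using X(2)[OF that] by (intro pf_zero_on that) auto
  qed (use u Y_Hh in \<open>auto simp: PF.bilin PF.null_right\<close>)
  then obtain w where w: "w \<in> Y" "\<And>v. v \<in> Y \<Longrightarrow> pf w v = pf u v" by blast
  have "pf w v = pf u v" if v: "v \<in> U" for v
  proof -
    obtain y where y: "y \<in> Y" "AE x in \<Gamma>. v x = y x" using U_representative[OF v] by blast
    have "pf w v = pf w y" "pf u v = pf u y"
      by (rule pf_AE_cong(2); use u U_Hh[OF v] Y_Hh w(1) y in auto)+
    then show ?thesis using w(2)[OF y(1)] by simp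
  qed
  then show ?thesis using Y_U[OF w(1)] by blast
qed

lemma q_spec: "u \<in> Hh \<Longrightarrow> q u \<in> U" "u \<in> Hh \<Longrightarrow> v \<in> U \<Longrightarrow> pf (q u) v = pf u v"
  using someI_ex[OF q_exists[of u]] unfolding Qh_def by blast+

lemma q_unique:
  assumes "r \<in> U" "s \<in> U" "\<And>v. v \<in> U \<Longrightarrow> pf r v = pf s v" shows "AE x in \<Gamma>. r x = s x"
proof -
  have d: "(\<lambda>x. r x - s x) \<in> U" using assms(1,2) by (rule U_diff)
  have "pf (\<lambda>x. r x - s x) (\<lambda>x. r x - s x) = 0"
    using assms(3)[OF d] by (simp add: PF.diff_left U_Hh assms(1,2) U_Hh[OF d])
  then have "AE x in \<Gamma>. r x - s x = 0" using pf_null[OF U_Hh[OF d]] by simp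
  then show ?thesis by simp
qed

lemma q_add:
  assumes "u \<in> Hh" "v \<in> Hh" shows "AE x in \<Gamma>. q (\<lambda>x. u x + v x) x = q u x + q v x"
proof (rule q_unique)
  note s = Hh_add[OF assms]
  show "q (\<lambda>x. u x + v x) \<in> U" using s by (rule q_spec)
  show "(\<lambda>x. q u x + q v x) \<in> U" using assms by (intro U_add q_spec)
  fix z assume z: "z \<in> U"
  show "pf (q (\<lambda>x. u x + v x)) z = pf (\<lambda>x. q u x + q v x) z"
    using assms z q_spec(1)[THEN U_Hh] U_Hh by (simp add: q_spec s PF.add_left)
qed

lemma q_scale:
  assumes "u \<in> Hh" shows "AE x in \<Gamma>. q (\<lambda>x. c * u x) x = c * q u x"
proof (rule q_unique)
  note s = Hh_scale[OF assms, of c]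
  show "q (\<lambda>x. c * u x) \<in> U" using s by (rule q_spec)
  show "(\<lambda>x. c * q u x) \<in> U" using assms by (intro U_scale q_spec)
  fix z assume z: "z \<in> U"
  show "pf (q (\<lambda>x. c * u x)) z = pf (\<lambda>x. c * q u x) z"
    using assms z q_spec(1)[THEN U_Hh] U_Hh by (simp add: q_spec s PF.scale_left)
qed

text \<open>A discrete trace satisfies the equations that define its own projection, so for discrete
  data the state and the extension have trace u itself.\<close>

lemma q_id: "u \<in> U \<Longrightarrow> AE x in \<Gamma>. q u x = u x"
  by (rule q_unique) (auto simp: q_spec U_Hh)

lemma q_bound:
  assumes "u \<in> Hh" shows "pf (q u) (q u) \<le> pf u u"
proof -
  have qh: "q u \<in> Hh" using q_spec(1)[OF assms] U_Hh by blast
  have "0 \<le> pf (\<lambda>x. u x - q u x) (\<lambda>x. u x - q u x)" using PF.diff_mem[OF assms qh] by (rule PF.nonneg)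
  also have "\<dots> = pf u u - 2 * pf u (q u) + pf (q u) (q u)" by (rule PF.expand_diff[OF assms qh])
  finally show ?thesis using q_spec(2)[OF assms q_spec(1)[OF assms]] by simp
qed

abbreviation "S \<equiv> disc_state \<Omega> P A b a0 K"
abbreviation "E \<equiv> disc_harm_ext \<Omega> P K"

lemma S_DS: "u \<in> Hh \<Longrightarrow> DS (S u) (q u)"
proof -
  assume "u \<in> Hh"
  then obtain z where "z \<in> Y" "tr z (q u)" using q_spec(1) U_iff by blast
  then have "\<exists>y. DS y (q u)" using DS_exists by blast
  from someI_ex[OF this] show ?thesis unfolding disc_state_def DS_def .
qed

lemma E_DH: "u \<in> Hh \<Longrightarrow> DH (E u) (q u)"
proof -
  assume "u \<in> Hh"
  then obtain z where "z \<in> Y" "tr z (q u)" using q_spec(1) U_iff by blast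
  then have "\<exists>y. DH y (q u)" by (rule DH_exists)
  from someI_ex[OF this] show ?thesis unfolding disc_harm_ext_def DH_def dform_def .
qed

lemma S_L2: "u \<in> Hh \<Longrightarrow> S u \<in> L2 M" and S_H1: "u \<in> Hh \<Longrightarrow> S u \<in> H1 \<Omega>" and E_H1: "u \<in> Hh \<Longrightarrow> E u \<in> H1 \<Omega>"
  using S_DS DS_Y E_DH DH_Y Y_H1 H1_L2 by blast+

lemma S_add: "u \<in> Hh \<Longrightarrow> v \<in> Hh \<Longrightarrow> x \<in> \<Omega> \<Longrightarrow> S (\<lambda>x. u x + v x) x = S u x + S v x"
  using DS_unique[OF S_DS[OF Hh_add] DS_add[OF S_DS S_DS] q_add] closure_subset by blast

lemma S_scale: "u \<in> Hh \<Longrightarrow> x \<in> \<Omega> \<Longrightarrow> S (\<lambda>x. c * u x) x = c * S u x"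
  using DS_unique[OF S_DS[OF Hh_scale] DS_scale[OF S_DS] q_scale] closure_subset by blast

lemma E_add: "u \<in> Hh \<Longrightarrow> v \<in> Hh \<Longrightarrow> w \<in> H1 \<Omega> \<Longrightarrow> dform \<Omega> (E (\<lambda>x. u x + v x)) w = dform \<Omega> (E u) w + dform \<Omega> (E v) w"
  using DH_unique[OF E_DH[OF Hh_add] DH_add[OF E_DH E_DH] q_add] by (simp add: D.add_left E_H1)

lemma E_scale: "u \<in> Hh \<Longrightarrow> w \<in> H1 \<Omega> \<Longrightarrow> dform \<Omega> (E (\<lambda>x. c * u x)) w = c * dform \<Omega> (E u) w"
  using DH_unique[OF E_DH[OF Hh_scale] DH_scale[OF E_DH] q_scale] by (simp add: D.scale_left E_H1)

section \<open>The quadratic form of the functional\<close>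

definition sS :: "scal \<Rightarrow> scal \<Rightarrow> real" where
  "sS u v = L2_inner M (S u) (S v)"

definition eE :: "scal \<Rightarrow> scal \<Rightarrow> real" where
  "eE u v = dform \<Omega> (E u) (E v)"

lemma semi_inner_sS: "semi_inner Hh sS"
proof
  fix v w assume vw: "v \<in> Hh" "w \<in> Hh"
  show "sS v w = sS w v" unfolding sS_def using vw S_L2 by (intro L2.sym)
  fix z assume z: "z \<in> Hh"
  have "L2_inner M (S (\<lambda>x. v x + w x)) (S z) = L2_inner M (\<lambda>x. S v x + S w x) (S z)"
    by (rule L2_inner_cong) (simp_all add: S_add vw)
  then show "sS (\<lambda>x. v x + w x) z = sS v z + sS w z"
    unfolding sS_def by (simp add: L2.add_left S_L2 vw z)
next
  fix v c z assume vz: "v \<in> Hh" "z \<in> Hh"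
  have "L2_inner M (S (\<lambda>x. c * v x)) (S z) = L2_inner M (\<lambda>x. c * S v x) (S z)"
    by (rule L2_inner_cong) (simp_all add: S_scale vz)
  then show "sS (\<lambda>x. c * v x) z = c * sS v z"
    unfolding sS_def by (simp add: L2.scale_left S_L2 vz)
qed (auto simp: Hh_zero Hh_add Hh_scale sS_def S_L2 L2.nonneg)

lemma semi_inner_eE: "semi_inner Hh eE"
  by unfold_locales (auto simp: Hh_zero Hh_add Hh_scale eE_def E_H1 D.nonneg E_add E_scale intro: D.sym)

definition Bf :: "scal \<Rightarrow> scal \<Rightarrow> real" where
  "Bf u v = sS u v + \<kappa> * eE u v"

sublocale SS: semi_inner Hh sS by (rule semi_inner_sS)
sublocale EE: semi_inner Hh eE by (rule semi_inner_eE)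

lemma semi_inner_Bf: "semi_inner Hh Bf"
proof
  fix v w assume vw: "v \<in> Hh" "w \<in> Hh"
  show "Bf v w = Bf w v" unfolding Bf_def using SS.sym[OF vw] EE.sym[OF vw] by simp
next
  fix v assume v: "v \<in> Hh"
  show "0 \<le> Bf v v" unfolding Bf_def using SS.nonneg[OF v] EE.nonneg[OF v] \<kappa> by simp
qed (simp_all add: Hh_zero Hh_add Hh_scale Bf_def SS.add_left SS.scale_left EE.add_left EE.scale_left algebra_simps)

sublocale BB: semi_inner Hh Bf by (rule semi_inner_Bf)

lemma Bf_cong:
  assumes "u \<in> Hh" "v \<in> Hh" "AE x in \<Gamma>. q u x = q v x" shows "Bf u u = Bf v v"
proof -
  have "sS u u = sS v v" unfolding sS_def
    by (rule L2_inner_cong; rule DS_unique[OF S_DS[OF assms(1)] S_DS[OF assms(2)] assms(3)]; use closure_subset in blast)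
  moreover have "eE u u = eE v v"
  proof -
    note u = DH_unique[OF E_DH[OF assms(1)] E_DH[OF assms(2)] assms(3)]
    have "eE u u = dform \<Omega> (E v) (E u)" unfolding eE_def by (rule u) (rule E_H1[OF assms(1)])
    also have "\<dots> = dform \<Omega> (E u) (E v)" by (rule D.sym) (use E_H1 assms in auto)
    also have "\<dots> = eE v v" unfolding eE_def by (rule u) (rule E_H1[OF assms(2)])
    finally show ?thesis .
  qed
  ultimately show ?thesis by (simp add: Bf_def)
qed

text \<open>The constant depends on the mesh and only certifies boundedness in the trace norm, as
  differentiability demands. The projection reduces the claim to \<open>Y\<close>, where
  \<open>form_bound_finite\<close> compares with \<open>pf\<close>: a null vector of
  \<open>pf\<close> has zero trace, so the form vanishes on it.\<close>

lemma Bf_bound: "\<exists>C\<ge>0. \<forall>v\<in>Hh. Bf v v \<le> C * (N v)\<^sup>2"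
proof -
  obtain X where X: "finite X" "\<And>y. y \<in> Y \<Longrightarrow> \<forall>x\<in>X. y x = 0 \<Longrightarrow> \<forall>x\<in>closure \<Omega>. y x = 0" using Y_nodes by blast
  have BY: "semi_inner Y Bf" by (rule BB.subspace) (use Y_Hh Y_zero Y_add Y_scale in auto)
  have null: "Bf y y = 0" if y: "y \<in> Y" "pf y y = 0" for y
  proof -
    have ae: "AE x in \<Gamma>. y x = 0" by (rule pf_null[OF Y_Hh[OF y(1)] y(2)])
    have "AE x in \<Gamma>. q y x = q (\<lambda>x. 0) x"
      using ae q_id[OF Y_U[OF y(1)]] q_id[OF Y_U[OF Y_zero]] by eventually_elim simp
    then have "Bf y y = Bf (\<lambda>x. 0) (\<lambda>x. 0)" by (rule Bf_cong[OF Y_Hh[OF y(1)] Hh_zero])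
    then show ?thesis using BB.zero_left[OF Hh_zero] by simp
  qed
  have "\<exists>C\<ge>0. \<forall>v\<in>Y. Bf v v \<le> C * pf v v"
    by (rule form_bound_finite[OF X(1) semi_inner_Y BY]) (use X(2) pf_zero_on null in auto)
  then obtain C where C: "C \<ge> 0" "\<And>v. v \<in> Y \<Longrightarrow> Bf v v \<le> C * pf v v" by blast
  show ?thesis
  proof (intro exI[of _ "C * (Ct + 1)"] conjI ballI)
    show "0 \<le> C * (Ct + 1)" using C(1) Ct(1) by simp
    fix v assume v: "v \<in> Hh"
    obtain y where y: "y \<in> Y" "AE x in \<Gamma>. q v x = y x" using U_representative[OF q_spec(1)[OF v]] by blast
    note qh = U_Hh[OF q_spec(1)[OF v]]
    have "AE x in \<Gamma>. q v x = q y x" using y(2) q_id[OF Y_U[OF y(1)]] by eventually_elim simp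
    then have "Bf v v = Bf y y" by (rule Bf_cong[OF v Y_Hh[OF y(1)]])
    also have "\<dots> \<le> C * pf y y" by (rule C(2)[OF y(1)])
    also have "pf y y = pf (q v) (q v)"
      using pf_AE_cong[OF qh Y_Hh[OF y(1)] qh y(2)] pf_AE_cong[OF qh Y_Hh[OF y(1)] Y_Hh[OF y(1)] y(2)] by simp
    also have "C * pf (q v) (q v) \<le> C * ((Ct + 1) * (N v)\<^sup>2)"
      using q_bound[OF v] pf_bound[OF v] C(1) by (intro mult_left_mono) auto
    finally show "Bf v v \<le> C * (Ct + 1) * (N v)\<^sup>2" by (simp add: mult.assoc)
  qed
qed

section \<open>The second derivative\<close>

abbreviation "Jf \<equiv> Jh \<Omega> P A b a0 yd ud \<kappa> K"

definition dJ :: "scal \<Rightarrow> scal \<Rightarrow> real" where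
  "dJ u w = L2_inner M (\<lambda>x. S u x - yd x) (S w) + \<kappa> * eE (\<lambda>x. u x - ud x) w"

lemma Hh_diff: "u \<in> Hh \<Longrightarrow> v \<in> Hh \<Longrightarrow> (\<lambda>x. u x - v x) \<in> Hh"
  by (rule PF.diff_mem)

lemma Jf_eq: "Jf u = 1 / 2 * L2_inner M (\<lambda>x. S u x - yd x) (\<lambda>x. S u x - yd x)
    + \<kappa> / 2 * eE (\<lambda>x. u x - ud x) (\<lambda>x. u x - ud x)"
  by (simp add: Jh_def L2_nrm_sq dform_self eE_def)

lemma Jf_expand:
  assumes u: "u \<in> Hh" and w: "w \<in> Hh"
  shows "Jf (\<lambda>x. u x + w x) = Jf u + dJ u w + 1 / 2 * Bf w w"
proof -
  have r: "(\<lambda>x. S u x - yd x) \<in> L2 M" using S_L2[OF u] yd by (rule L2.diff_mem)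
  have "L2_inner M (\<lambda>x. S (\<lambda>x. u x + w x) x - yd x) (\<lambda>x. S (\<lambda>x. u x + w x) x - yd x)
      = L2_inner M (\<lambda>x. (S u x - yd x) + S w x) (\<lambda>x. (S u x - yd x) + S w x)"
    by (rule L2_inner_cong) (simp_all add: S_add u w)
  also have "\<dots> = L2_inner M (\<lambda>x. S u x - yd x) (\<lambda>x. S u x - yd x) + 2 * L2_inner M (\<lambda>x. S u x - yd x) (S w) + sS w w"
    unfolding sS_def by (rule L2.expand_add[OF r S_L2[OF w]])
  finally have 1: "L2_inner M (\<lambda>x. S (\<lambda>x. u x + w x) x - yd x) (\<lambda>x. S (\<lambda>x. u x + w x) x - yd x)
      = L2_inner M (\<lambda>x. S u x - yd x) (\<lambda>x. S u x - yd x) + 2 * L2_inner M (\<lambda>x. S u x - yd x) (S w) + sS w w" .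
  have eq: "(\<lambda>x. u x + w x - ud x) = (\<lambda>x. (u x - ud x) + w x)" by (simp add: algebra_simps)
  have 2: "eE (\<lambda>x. u x + w x - ud x) (\<lambda>x. u x + w x - ud x)
      = eE (\<lambda>x. u x - ud x) (\<lambda>x. u x - ud x) + 2 * eE (\<lambda>x. u x - ud x) w + eE w w"
    unfolding eq by (rule EE.expand_add[OF Hh_diff[OF u ud] w])
  show ?thesis unfolding Jf_eq 1 2 dJ_def Bf_def by (simp add: algebra_simps)
qed

lemma dJ_add_right: "u \<in> Hh \<Longrightarrow> v \<in> Hh \<Longrightarrow> w \<in> Hh \<Longrightarrow> dJ u (\<lambda>x. v x + w x) = dJ u v + dJ u w"
proof -
  assume uvw: "u \<in> Hh" "v \<in> Hh" "w \<in> Hh"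
  have r: "(\<lambda>x. S u x - yd x) \<in> L2 M" using S_L2[OF uvw(1)] yd by (rule L2.diff_mem)
  have "L2_inner M (\<lambda>x. S u x - yd x) (S (\<lambda>x. v x + w x)) = L2_inner M (\<lambda>x. S u x - yd x) (\<lambda>x. S v x + S w x)"
    by (rule L2_inner_cong) (simp_all add: S_add uvw)
  also have "\<dots> = L2_inner M (\<lambda>x. S u x - yd x) (S v) + L2_inner M (\<lambda>x. S u x - yd x) (S w)"
    by (rule L2.add_right) (use r S_L2 uvw in auto)
  finally show ?thesis unfolding dJ_def using EE.add_right[OF uvw(2,3) Hh_diff[OF uvw(1) ud]] by (simp add: algebra_simps)
qed

lemma dJ_scale_right: "u \<in> Hh \<Longrightarrow> v \<in> Hh \<Longrightarrow> dJ u (\<lambda>x. c * v x) = c * dJ u v"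
proof -
  assume uv: "u \<in> Hh" "v \<in> Hh"
  have r: "(\<lambda>x. S u x - yd x) \<in> L2 M" using S_L2[OF uv(1)] yd by (rule L2.diff_mem)
  have "L2_inner M (\<lambda>x. S u x - yd x) (S (\<lambda>x. c * v x)) = L2_inner M (\<lambda>x. S u x - yd x) (\<lambda>x. c * S v x)"
    by (rule L2_inner_cong) (simp_all add: S_scale uv)
  also have "\<dots> = c * L2_inner M (\<lambda>x. S u x - yd x) (S v)"
    by (rule L2.scale_right) (use r S_L2 uv in auto)
  finally show ?thesis unfolding dJ_def using EE.scale_right[OF uv(2) Hh_diff[OF uv(1) ud]] by (simp add: algebra_simps)
qed

lemma dJ_add_left: "u \<in> Hh \<Longrightarrow> w \<in> Hh \<Longrightarrow> v \<in> Hh \<Longrightarrow> dJ (\<lambda>x. u x + w x) v = dJ u v + Bf w v"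
proof -
  assume uwv: "u \<in> Hh" "w \<in> Hh" "v \<in> Hh"
  have r: "(\<lambda>x. S u x - yd x) \<in> L2 M" using S_L2[OF uwv(1)] yd by (rule L2.diff_mem)
  have "L2_inner M (\<lambda>x. S (\<lambda>x. u x + w x) x - yd x) (S v) = L2_inner M (\<lambda>x. (S u x - yd x) + S w x) (S v)"
    by (rule L2_inner_cong) (simp_all add: S_add uwv)
  also have "\<dots> = L2_inner M (\<lambda>x. S u x - yd x) (S v) + sS w v"
    unfolding sS_def by (rule L2.add_left) (use r S_L2 uwv in auto)
  finally have 1: "L2_inner M (\<lambda>x. S (\<lambda>x. u x + w x) x - yd x) (S v) = L2_inner M (\<lambda>x. S u x - yd x) (S v) + sS w v" .
  have eq: "(\<lambda>x. u x + w x - ud x) = (\<lambda>x. (u x - ud x) + w x)" by (simp add: algebra_simps)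
  have 2: "eE (\<lambda>x. u x + w x - ud x) v = eE (\<lambda>x. u x - ud x) v + eE w v"
    unfolding eq by (rule EE.add_left[OF Hh_diff[OF uwv(1) ud] uwv(2,3)])
  show ?thesis unfolding dJ_def 1 2 Bf_def by (simp add: algebra_simps)
qed

lemma dualI:
  assumes "\<And>v w. v \<in> Hh \<Longrightarrow> w \<in> Hh \<Longrightarrow> f (\<lambda>x. v x + w x) = f v + f w"
    "\<And>c v. v \<in> Hh \<Longrightarrow> f (\<lambda>x. c * v x) = c * f v" "\<And>v. v \<in> Hh \<Longrightarrow> \<bar>f v\<bar> \<le> C * N v"
  shows "f \<in> dual Hh N"
  unfolding dual_def using assms by blast

text \<open>The first derivative is affine in u with linear part \<open>Bf\<close>, so the remainder
  at second order is identically zero. The remainder at first order is half of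
  \<open>Bf w w\<close>, which \<open>Bf_bound\<close> makes quadratic in the norm.\<close>

lemma second_derivative:
  assumes u: "u \<in> Hh" shows "second_frechet_deriv Hh N Jf u Bf"
proof -
  obtain C where C: "C \<ge> 0" "\<And>v. v \<in> Hh \<Longrightarrow> Bf v v \<le> C * (N v)\<^sup>2" using Bf_bound by blast
  have nrm: "BB.nrm v \<le> sqrt C * N v" if "v \<in> Hh" for v
    using real_sqrt_le_mono[OF C(2)[OF that]] N_nonneg[OF that] by (simp add: BB.nrm_def real_sqrt_mult)
  have Bb: "\<bar>Bf v w\<bar> \<le> C * N v * N w" if "v \<in> Hh" "w \<in> Hh" for v w
  proof -
    have "\<bar>Bf v w\<bar> \<le> BB.nrm v * BB.nrm w" by (rule BB.abs_le_nrm[OF that])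
    also have "\<dots> \<le> (sqrt C * N v) * (sqrt C * N w)"
      using nrm that BB.nrm_nonneg N_nonneg C(1) by (intro mult_mono) auto
    also have "\<dots> = (sqrt C * sqrt C) * N v * N w" by (simp only: mult_ac)
    also have "sqrt C * sqrt C = C" using C(1) by simp
    finally show ?thesis .
  qed
  have dJ_bound: "\<exists>c. \<forall>w\<in>Hh. \<bar>dJ v w\<bar> \<le> c * N w" if v: "v \<in> Hh" for v
  proof (intro exI ballI)
    fix w assume w: "w \<in> Hh"
    have r: "(\<lambda>x. S v x - yd x) \<in> L2 M" using S_L2[OF v] yd by (rule L2.diff_mem)
    note d = Hh_diff[OF v ud]
    have s: "SS.nrm w \<le> sqrt C * N w"
    proof -
      have "sS w w \<le> Bf w w" unfolding Bf_def using EE.nonneg[OF w] \<kappa> by simp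
      then have "SS.nrm w \<le> BB.nrm w" by (simp add: SS.nrm_def BB.nrm_def)
      then show ?thesis using nrm[OF w] by simp
    qed
    have e: "\<kappa> * EE.nrm w \<le> sqrt \<kappa> * (sqrt C * N w)"
    proof -
      have "\<kappa> * eE w w \<le> Bf w w" unfolding Bf_def using SS.nonneg[OF w] by simp
      then have "sqrt \<kappa> * EE.nrm w \<le> BB.nrm w" by (simp add: EE.nrm_def BB.nrm_def flip: real_sqrt_mult)
      then have "sqrt \<kappa> * EE.nrm w \<le> sqrt C * N w" using nrm[OF w] by simp
      then have "sqrt \<kappa> * (sqrt \<kappa> * EE.nrm w) \<le> sqrt \<kappa> * (sqrt C * N w)" using \<kappa> by (intro mult_left_mono) auto
      then show ?thesis using \<kappa> by (simp flip: mult.assoc)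
    qed
    have "\<bar>L2_inner M (\<lambda>x. S v x - yd x) (S w)\<bar> \<le> L2.nrm (\<lambda>x. S v x - yd x) * L2.nrm (S w)"
      by (rule L2.abs_le_nrm[OF r S_L2[OF w]])
    also have "L2.nrm (S w) = SS.nrm w" by (simp add: L2.nrm_def SS.nrm_def sS_def)
    also have "L2.nrm (\<lambda>x. S v x - yd x) * SS.nrm w \<le> L2.nrm (\<lambda>x. S v x - yd x) * (sqrt C * N w)"
      using s L2.nrm_nonneg[OF r] by (intro mult_left_mono)
    finally have 1: "\<bar>L2_inner M (\<lambda>x. S v x - yd x) (S w)\<bar> \<le> L2.nrm (\<lambda>x. S v x - yd x) * (sqrt C * N w)" .
    have "\<bar>\<kappa> * eE (\<lambda>x. v x - ud x) w\<bar> = \<kappa> * \<bar>eE (\<lambda>x. v x - ud x) w\<bar>" using \<kappa> by (simp add: abs_mult)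
    also have "\<dots> \<le> \<kappa> * (EE.nrm (\<lambda>x. v x - ud x) * EE.nrm w)"
      using EE.abs_le_nrm[OF d w] \<kappa> by (intro mult_left_mono) auto
    also have "\<dots> = EE.nrm (\<lambda>x. v x - ud x) * (\<kappa> * EE.nrm w)" by (simp only: mult_ac)
    also have "\<dots> \<le> EE.nrm (\<lambda>x. v x - ud x) * (sqrt \<kappa> * (sqrt C * N w))"
      using e EE.nrm_nonneg[OF d] by (intro mult_left_mono)
    finally show "\<bar>dJ v w\<bar> \<le> (L2.nrm (\<lambda>x. S v x - yd x) * sqrt C + EE.nrm (\<lambda>x. v x - ud x) * sqrt \<kappa> * sqrt C) * N w"
      using 1 unfolding dJ_def by (simp add: distrib_right mult.assoc)
  qed
  have frechet: "frechet_deriv Hh N Jf v (dJ v)" if v: "v \<in> Hh" for v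
    unfolding frechet_deriv_def
  proof (intro conjI allI impI)
    obtain c where c: "\<And>w. w \<in> Hh \<Longrightarrow> \<bar>dJ v w\<bar> \<le> c * N w" using dJ_bound[OF v] by blast
    show "dJ v \<in> dual Hh N" by (rule dualI[OF dJ_add_right[OF v] dJ_scale_right[OF v] c])
    fix \<epsilon> :: real assume \<epsilon>: "0 < \<epsilon>"
    show "\<exists>d>0. \<forall>w\<in>Hh. N w < d \<longrightarrow> \<bar>Jf (\<lambda>x. v x + w x) - Jf v - dJ v w\<bar> \<le> \<epsilon> * N w"
    \<comment> \<open>The summand 1 covers the case C = 0.\<close>
    proof (intro exI[of _ "\<epsilon> / (C + 1)"] conjI ballI impI)
      show "0 < \<epsilon> / (C + 1)" using \<epsilon> C(1) by simp
      fix w assume w: "w \<in> Hh" "N w < \<epsilon> / (C + 1)"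
      have "\<bar>Jf (\<lambda>x. v x + w x) - Jf v - dJ v w\<bar> = 1 / 2 * Bf w w"
        using Jf_expand[OF v w(1)] BB.nonneg[OF w(1)] by simp
      also have "\<dots> \<le> C * (N w)\<^sup>2" using C(2)[OF w(1)] BB.nonneg[OF w(1)] by simp
      also have "\<dots> = (C * N w) * N w" by (simp add: power2_eq_square)
      also have "\<dots> \<le> \<epsilon> * N w"
      proof (rule mult_right_mono)
        have "C * N w \<le> (C + 1) * N w" using N_nonneg[OF w(1)] by (simp add: distrib_right)
        also have "\<dots> \<le> \<epsilon>" using w(2) C(1) by (simp add: field_simps)
        finally show "C * N w \<le> \<epsilon>" .
      qed (rule N_nonneg[OF w(1)])
      finally show "\<bar>Jf (\<lambda>x. v x + w x) - Jf v - dJ v w\<bar> \<le> \<epsilon> * N w" .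
    qed
  qed
  show ?thesis
    unfolding second_frechet_deriv_def
  proof (intro conjI ballI)
    show "(\<lambda>w. Bf v w) \<in> dual Hh N" if v: "v \<in> Hh" for v
      by (rule dualI[where C="C * N v"]) (use v Bb in \<open>auto simp: BB.bilin\<close>)
    show "(\<lambda>v. Bf v w) \<in> dual Hh N" if w: "w \<in> Hh" for w
      by (rule dualI[where C="C * N w"]) (use w Bb in \<open>auto simp: BB.bilin mult_ac\<close>)
    show "\<exists>C. \<forall>v\<in>Hh. \<forall>w\<in>Hh. \<bar>Bf v w\<bar> \<le> C * N v * N w" using Bb by blast
    show "\<exists>J'. (\<forall>v\<in>Hh. frechet_deriv Hh N Jf v (J' v)) \<and>
        (\<forall>\<epsilon>>0. \<exists>d>0. \<forall>w\<in>Hh. N w < d \<longrightarrow>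
           dual_nrm Hh N (\<lambda>v. J' (\<lambda>x. u x + w x) v - J' u v - Bf w v) \<le> \<epsilon> * N w)"
    proof (intro exI[of _ dJ] conjI ballI allI impI frechet)
      fix \<epsilon> :: real assume \<epsilon>: "0 < \<epsilon>"
      have "dual_nrm Hh N (\<lambda>v. dJ (\<lambda>x. u x + w x) v - dJ u v - Bf w v) \<le> \<epsilon> * N w" if w: "w \<in> Hh" for w
      proof -
        \<comment> \<open>The zero function makes the set nonempty, so it is exactly {0} and its
          supremum is 0.\<close>
        have "{\<bar>dJ (\<lambda>x. u x + w x) v - dJ u v - Bf w v\<bar> |v. v \<in> Hh \<and> N v \<le> 1} = {0}"
          using dJ_add_left[OF u w] Hh_zero N_zero by (auto intro!: exI[of _ "\<lambda>x. 0"])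
        then show ?thesis unfolding dual_nrm_def using \<epsilon> N_nonneg[OF w] by simp
      qed
      then show "\<exists>d>0. \<forall>w\<in>Hh. N w < d \<longrightarrow>
           dual_nrm Hh N (\<lambda>v. dJ (\<lambda>x. u x + w x) v - dJ u v - Bf w v) \<le> \<epsilon> * N w"
        by (intro exI[of _ 1]) auto
    qed
  qed
qed

lemma coercivity:
  assumes v: "v \<in> U" shows "Bf v v \<ge> nu cA \<kappa> * (N v)\<^sup>2"
proof -
  note vh = U_Hh[OF v]
  define z where "z = E v"
  define y where "y = S v"
  \<comment> \<open>The quantity to be absorbed is m and not \<open>N v\<close>: it belongs to a
    discrete extension with which the state can be compared, and it dominates
    \<open>N v\<close>.\<close>
  define m where "m = H1_nrm \<Omega> z"
  define th where "th = theta cA"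
  define c where "c = ext_const cA"
  define l where "l = L2_inner M y y"
  define e where "e = dform \<Omega> z z"
  define g where "g = L2_inner \<Gamma> v v"
  note th = theta_pos[of cA, folded th_def]
  have z: "DH z (q v)" and y: "DS y (q v)" unfolding z_def y_def using E_DH S_DS vh by auto
  note zY = DH_Y[OF z] and yY = DS_Y[OF y]
  \<comment> \<open>As v is discrete, its projection agrees with it almost everywhere, so z extends
    v itself.\<close>
  have trz: "tr z v" by (rule tr_AE_cong[OF DH_tr[OF z] q_id[OF v] Hh_L2[OF vh]])
  \<comment> \<open>The state has the same trace, so the boundary norm of v can be read off from
    y.\<close>
  have "AE x in \<Gamma>. v x = y x"
    using tr_unique[OF DS_tr[OF y] Y_tr[OF yY]] q_id[OF v] by eventually_elim simp
  then have g: "g = L2_inner \<Gamma> y y"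
    unfolding g_def L2_inner_def
    using Hh_L2[OF vh, THEN L2_measurable] Hh_L2[OF Y_Hh[OF yY], THEN L2_measurable]
    by (intro integral_cong_AE) (auto elim!: eventually_mono)
  have m0: "m \<ge> 0" unfolding m_def by (rule H1_nrm_nonneg[OF Y_H1[OF zY]])
  have l0: "l \<ge> 0" unfolding l_def by (rule L2.nonneg[OF H1_L2[OF Y_H1[OF yY]]])
  have e0: "e \<ge> 0" unfolding e_def by (rule D.nonneg[OF Y_H1[OF zY]])
  have Nm: "N v \<le> m" unfolding m_def by (rule N_le[OF trz])
  have Bv: "Bf v v = l + \<kappa> * e" by (simp add: Bf_def sS_def eE_def l_def e_def y_def z_def)
  \<comment> \<open>The chosen state agrees on the closed domain with the one that
    \<open>DS_exists\<close> constructs from z, and so inherits its bound.\<close>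
  have ym: "H1_nrm \<Omega> y \<le> c * m"
  proof -
    obtain y' where y': "DS y' (q v)" "H1_nrm \<Omega> y' \<le> c * m"
      using DS_exists[OF zY DH_tr[OF z]] unfolding c_def m_def by blast
    have "h1form \<Omega> y y = h1form \<Omega> y' y'"
      by (rule h1form_cong, rule DS_unique[OF y y'(1)]) (use closure_subset in auto)
    then show ?thesis using y'(2) by (simp add: H1_nrm_eq)
  qed
  have "dform \<Omega> y y \<le> (c * m)\<^sup>2"
  proof -
    have "dform \<Omega> y y \<le> (H1_nrm \<Omega> y)\<^sup>2"
      using dform_le_h1form[OF Y_H1[OF yY]] by (simp add: H1_nrm_sq[OF Y_H1[OF yY]])
    also have "\<dots> \<le> (c * m)\<^sup>2" using ym H1_nrm_nonneg[OF Y_H1[OF yY]] by (rule power_mono)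
    finally show ?thesis .
  qed
  then have "Ct * (l / th + th * dform \<Omega> y y) \<le> Ct * (l / th + th * (c * m)\<^sup>2)"
    using Ct(1) th by (intro mult_left_mono add_left_mono) auto
  moreover have "g \<le> Ct * (l / th + th * dform \<Omega> y y)"
    unfolding g l_def using Ct(2)[OF Y_H1[OF yY] V_cont[OF Y_V[OF yY]] th(1,2)] .
  ultimately have gb: "g \<le> Ct * (l / th + th * (c * m)\<^sup>2)" by simp
  have "m\<^sup>2 = L2_inner M z z + e" unfolding m_def e_def by (simp add: H1_nrm_sq[OF Y_H1[OF zY]] h1form_def)
  \<comment> \<open>Friedrichs is applied to z, whose gradient the functional controls, while g was
    bounded by the trace inequality for y, whose L2 norm it controls. The common trace v links the
    two.\<close>
  also have "\<dots> \<le> Cf * (g + e) + e" unfolding g_def e_def using tr_Friedrichs[OF trz] by simp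
  also have "\<dots> \<le> Cf * (Ct * (l / th + th * (c * m)\<^sup>2) + e) + e"
    using gb Cf(1) by (intro add_right_mono mult_left_mono) auto
  also have "\<dots> = Cf * Ct / th * l + (Cf * Ct * c\<^sup>2 * th) * m\<^sup>2 + (Cf + 1) * e"
    by (simp add: algebra_simps power_mult_distrib)
  also have "\<dots> \<le> Cf * Ct / th * l + 1 / 2 * m\<^sup>2 + (Cf + 1) * e"
  proof -
    have "Cf * Ct * c\<^sup>2 * th \<le> 1 / 2" using th(3) by (simp add: c_def)
    then have "(Cf * Ct * c\<^sup>2 * th) * m\<^sup>2 \<le> 1 / 2 * m\<^sup>2" by (rule mult_right_mono) simp
    then show ?thesis by linarith
  qed
  finally have "m\<^sup>2 \<le> 2 * (Cf * Ct / th * l) + 2 * ((Cf + 1) * e)" by simp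
  \<comment> \<open>The gradient term is rewritten with the weight \<kappa> that it carries in
    \<open>Bf v v\<close>.\<close>
  also have "\<dots> = (2 * Cf * Ct / th) * l + (2 * (Cf + 1) / \<kappa>) * (\<kappa> * e)"
  proof -
    have "2 * (Cf + 1) / \<kappa> * (\<kappa> * e) = 2 * ((Cf + 1) * e)" using \<kappa> by simp
    then show ?thesis by (simp add: mult.assoc)
  qed
  also have "\<dots> \<le> (2 * Cf * Ct / th + 2 * (Cf + 1) / \<kappa>) * l + (2 * Cf * Ct / th + 2 * (Cf + 1) / \<kappa>) * (\<kappa> * e)"
    using Cf(1) Ct(1) th \<kappa> l0 e0 by (intro add_mono mult_right_mono) auto
  also have "\<dots> = (2 * Cf * Ct / th + 2 * (Cf + 1) / \<kappa>) * Bf v v" by (simp add: Bv distrib_left)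
  finally have mB: "m\<^sup>2 \<le> (2 * Cf * Ct / th + 2 * (Cf + 1) / \<kappa>) * Bf v v" .
  have pos: "2 * Cf * Ct / th + 2 * (Cf + 1) / \<kappa> > 0"
    using Cf(1) Ct(1) th \<kappa> by (intro add_pos_pos divide_pos_pos) auto
  have "(N v)\<^sup>2 \<le> m\<^sup>2" using Nm N_nonneg[OF vh] by (rule power_mono)
  then have "(N v)\<^sup>2 \<le> (2 * Cf * Ct / th + 2 * (Cf + 1) / \<kappa>) * Bf v v" using mB by simp
  then have "(N v)\<^sup>2 / (2 * Cf * Ct / th + 2 * (Cf + 1) / \<kappa>) \<le> Bf v v"
    using pos by (simp add: pos_divide_le_eq mult.commute)
  then show ?thesis by (simp add: nu_def th_def)
qed

end

theorem theorem6p3: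
  fixes \<Omega> :: "(real^2) set" and P :: polygon
    and A :: "real^2 \<Rightarrow> real^2^2" and b :: "real^2 \<Rightarrow> real^2" and a0 :: "real^2 \<Rightarrow> real"
    and \<mu> :: "nat \<Rightarrow> real" and Hs :: "real set" and K :: "real \<Rightarrow> (real^2) set set"
    and hA cA \<kappa> :: real and yd ud :: "real^2 \<Rightarrow> real"
  assumes "polygonal_domain \<Omega> P"
    and "admissible_coefficients \<Omega> P A b a0"
    and "graded_mesh_family \<Omega> P \<mu> Hs K"
    and "hA > 0"
    and "discrete_solvability \<Omega> P A b a0 Hs K hA cA"
    and "yd \<in> L2 (lebesgue_on \<Omega>)"
    and "ud \<in> Hhalf \<Omega> P"
    and "\<kappa> > 0"
  shows "\<exists>\<nu>>0. \<forall>h\<in>Hs. 0 < h \<and> h < hA \<longrightarrow> (\<forall>u\<in>Hhalf \<Omega> P.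
           \<exists>B. second_frechet_deriv (Hhalf \<Omega> P) (Hhalf_nrm \<Omega> P)
                 (Jh \<Omega> P A b a0 yd ud \<kappa> (K h)) u B \<and>
               (\<forall>vh\<in>Uh \<Omega> P (K h). B vh vh \<ge> \<nu> * (Hhalf_nrm \<Omega> P vh)\<^sup>2))"
proof -
  interpret coefficients \<Omega> P A b a0 by unfold_locales fact+
  have D: "discrete \<Omega> P A b a0 (K h) cA \<kappa> yd ud" if h: "h \<in> Hs" "0 < h" "h < hA" for h
  proof unfold_locales
    show "triangulates \<Omega> (K h)" using assms(3) h(1) unfolding graded_mesh_family_def by blast
  qed (use assms(5) h in \<open>simp add: discrete_solvability_def\<close>, fact+)
  show ?thesis
  \<comment> \<open>The witness is fixed before h is introduced; all its ingredients come from the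
    domain, the coefficients, cA and \<kappa>.\<close>
  proof (intro exI[of _ "nu cA \<kappa>"] conjI ballI impI)
    show "nu cA \<kappa> > 0" using assms(8) by (rule nu_pos)
    fix h u assume h: "h \<in> Hs" "0 < h \<and> h < hA" and u: "u \<in> Hhalf \<Omega> P"
    interpret discrete \<Omega> P A b a0 "K h" cA \<kappa> yd ud using D h by blast
    show "\<exists>B. second_frechet_deriv (Hhalf \<Omega> P) (Hhalf_nrm \<Omega> P) (Jh \<Omega> P A b a0 yd ud \<kappa> (K h)) u B \<and>
        (\<forall>vh\<in>Uh \<Omega> P (K h). B vh vh \<ge> nu cA \<kappa> * (Hhalf_nrm \<Omega> P vh)\<^sup>2)"
      using second_derivative[OF u] coercivity by blast
  qed
qed

end
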